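(* Let $N\ge1$, let $\mathcal T_1,\mathcal T_2,\mathcal Y,U_i,U_o,Y$ be as in the context, let $\gamma>\|Y\|_\infty$, and let $Y_o$, $R$, $\hat R(V)$, $\hat R_1(V)$, $A_R,B_R,C_R(V)$ be as in the context. Put $$\alpha:=\inf\{\|\mathcal T_1-\mathcal T_2V-z^{-N}\mathcal T_2D\|_\infty : D\in\mathcal{RH}_\infty,\ V\in\mathcal Y\}.$$ Then $V\mapsto C_R(V)$ is affine in the coefficients $V_0,\dots,V_{N-1}$ of $V$, and the following are equivalent: (i) there exist $V\in\mathcal Y$, real symmetric matrices $P,Q\ge0$ and a scalar $\lambda\ge0$ such that $$\begin{bmatrix}A_R^\top QA_R-Q & C_R(V)^\top\\ C_R(V)&-\lambda I\end{bmatrix}\le0,\quad \begin{bmatrix}-P&PB_R&PA_R\\ B_R^\top P&-I&0\\ A_R^\top P&0&-P\end{bmatrix}\le0,\quad P-Q\ge0,\quad \lambda<1;$$ (ii) there exists $V\in\mathcal Y$ such that $\|\tilde\Gamma_{\hat R_1(V)}\|<1$; (iii) $\alpha<\gamma$. Moreover, any $V$ occurring in a solution of (i) satisfies $\|\tilde\Gamma_{\hat R_1(V)}\|<1$.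
   Context: Discrete time. $\mathcal{RL}_\infty$ is the set of real-rational transfer matrices (of whatever size is required) that are bounded on the unit circle, with norm $\|G\|_\infty=\sup_{|z|=1}\|G(z)\|$ (largest singular value). $\mathcal{RH}_\infty\subset\mathcal{RL}_\infty$ is the set of proper stable ones (all poles in $|z|<1$). $G^\sim(z):=G(z^{-1})^\top$. $\mathcal H_2$ is the Hardy space of square-summable series $\sum_{i\ge0}H_iz^{-i}$, $\mathcal H_2^\perp$ its orthogonal complement in $L_2$ of the unit circle (series $\sum_{k\ge1}H_kz^k$). For $F\in\mathcal{RH}_\infty$, $\tilde\Gamma_F:\mathcal H_2^\perp\to\mathcal H_2$ is the Hankel operator $g\mapsto \Pi_{\mathcal H_2}(Fg)$, with operator norm $\|\tilde\Gamma_F\|$. Matrix inequalities are in the semidefinite order. Plant data: $A$ is a real matrix with spectral radius $<1$, $\mathcal{T}_1=C_1(zI-A)^{-1}B_1$ (with $p_1$ columns) and $\mathcal{T}_2=C_1(zI-A)^{-1}B_2+D_{12}$ (with $p_2$ columns), with real matrices such that $D_{12}^\top D_{12}>0$ and $C_1^\top D_{12}=0$. Definitions: - $\mathcal T_2=U_iU_o$ with $U_i,U_o,U_o^{-1}\in\mathcal{RH}_\infty$, $U_i^\sim U_i=I$; $Y:=(I-U_iU_i^\sim)\mathcal T_1$. - For $\gamma>\|Y\|_\infty$: $Y_o,Y_o^{-1}\in\mathcal{RH}_\infty$ with $Y_o^\sim Y_o=\gamma^2I-Y^\sim Y$; $R:=U_i^\sim\mathcal T_1Y_o^{-1}$. -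 $\mathcal{Y}$ is the set of all $V=\sum_{i=0}^{N-1}z^{-i}V_i$ with $V_i\in\mathcal Y_i$, each $\mathcal{Y}_i\subset\mathbb{R}^{p_2\times p_1}$ a given linear subspace. - $\hat R(V):=z^NR-U_o(z^NV)Y_o^{-1}$. - An anti-stable/stable decomposition of $F\in\mathcal{RL}_\infty$ is a pair $(F_1,F_2)$ with $F_1,F_2\in\mathcal{RH}_\infty$, $F_1$ strictly proper, $F=F_1^\sim+F_2$. Let $(R_1,R_2)$ be such a decomposition of $z^NR$, and $(\hat R_1(V),\hat R_2(V))$ one of $\hat R(V)$. - $G(V):=U_oVY_o^{-1}=\sum_{i\ge0}z^{-i}G_i(V)\in\mathcal{RH}_\infty$. - $(A_r,B_r,C_r,0)$ is a minimal (stable) real realization of $R_1$, i.e. $R_1=C_r(zI-A_r)^{-1}B_r$. $A_q$ is the $N\times N$ block down-shift matrix with blocks of size $p_2\times p_2$ (identity blocks on the first block sub-diagonal, zeros elsewhere), $B_q=[I,0,\dots,0]^\top$, $C_q(V)=[G_{N-1}(V)^\top,\dots,G_0(V)^\top]$. - $A_R=\begin{bmatrix}A_r&0\\ 0&A_q\end{bmatrix}$, $B_R=\begin{bmatrix}B_r\\ B_q\end{bmatrix}$, $C_R(V)=[\,C_r\ \ -C_q(V)\,]$. *)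

theory Defs
  imports
    "HOL-Analysis.Analysis"
    "HOL-Computational_Algebra.Computational_Algebra"
    "HOL-Computational_Algebra.Field_as_Ring"
    "Jordan_Normal_Form.Spectral_Radius"
    "Jordan_Normal_Form.Schur_Decomposition"
    "Jordan_Normal_Form.Gauss_Jordan_Elimination"
begin

section \<open>Real-rational transfer matrices\<close>

type_synonym tf = "real poly fract mat"

definition const :: "real \<Rightarrow> real poly fract" where
  "const c = to_fract [:c:]"

definition zvar :: "real poly fract" where
  "zvar = to_fract [:0, 1:]"

text \<open>Substitution of \<open>x\<close> for \<open>z\<close> in a rational function; \<open>h\<close> embeds the reals into the target field
  (\<open>of_real\<close> for point evaluation in the complex plane, \<open>const\<close> for substitution of a rational
  function). The fraction is reduced, so at a pole the value is \<open>_ / 0 = 0\<close>.\<close>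
definition rat_subst :: "(real \<Rightarrow> 'b) \<Rightarrow> 'b :: field \<Rightarrow> real poly fract \<Rightarrow> 'b" where
  "rat_subst h x f =
     poly (map_poly h (fst (quot_of_fract f))) x / poly (map_poly h (snd (quot_of_fract f))) x"

abbreviation rat_eval :: "real poly fract \<Rightarrow> complex \<Rightarrow> complex" where
  "rat_eval f z \<equiv> rat_subst of_real z f"

definition poles :: "real poly fract \<Rightarrow> complex set" where
  "poles f = {z. poly (map_poly of_real (snd (quot_of_fract f))) z = 0}"

definition proper :: "real poly fract \<Rightarrow> bool" where
  "proper f \<longleftrightarrow> degree (fst (quot_of_fract f)) \<le> degree (snd (quot_of_fract f))"

definition strictly_proper :: "real poly fract \<Rightarrow> bool" where
  "strictly_proper f \<longleftrightarrow>
     f = 0 \<or> degree (fst (quot_of_fract f)) < degree (snd (quot_of_fract f))"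

definition RL_inf :: "nat \<Rightarrow> nat \<Rightarrow> tf set" where
  "RL_inf m p = {F \<in> carrier_mat m p.
     \<forall>i<m. \<forall>j<p. bounded (rat_eval (F $$ (i,j)) ` (sphere 0 1 - poles (F $$ (i,j))))}"

definition RH_inf :: "nat \<Rightarrow> nat \<Rightarrow> tf set" where
  "RH_inf m p = {F \<in> carrier_mat m p.
     \<forall>i<m. \<forall>j<p. proper (F $$ (i,j)) \<and> (\<forall>z \<in> poles (F $$ (i,j)). cmod z < 1)}"

definition largest_singular_value :: "complex mat \<Rightarrow> real" where
  "largest_singular_value M = sqrt (spectral_radius (mat_adjoint M * M))"

definition Linf_norm :: "tf \<Rightarrow> real" where
  "Linf_norm F = (SUP z \<in> sphere 0 1. largest_singular_value (map_mat (\<lambda>f. rat_eval f z) F))"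

definition para_conj :: "tf \<Rightarrow> tf" where
  "para_conj F = transpose_mat (map_mat (rat_subst const (inverse zvar)) F)"

definition minv :: "'a :: field mat \<Rightarrow> 'a mat" where
  "minv M = the (mat_inverse M)"

definition RH_inf_units :: "nat \<Rightarrow> tf set" where
  "RH_inf_units p = {F \<in> RH_inf p p. invertible_mat F \<and> minv F \<in> RH_inf p p}"

definition antistable_stable_decomp :: "nat \<Rightarrow> nat \<Rightarrow> tf \<Rightarrow> tf \<Rightarrow> tf \<Rightarrow> bool" where
  "antistable_stable_decomp m p F F1 F2 \<longleftrightarrow>
     F \<in> RL_inf m p \<and> F1 \<in> RH_inf p m \<and> F2 \<in> RH_inf m p \<and>
     (\<forall>i<p. \<forall>j<m. strictly_proper (F1 $$ (i,j))) \<and>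
     F = para_conj F1 + F2"

text \<open>The coefficients of the expansion of \<open>f\<close> in powers of \<open>1/z\<close>; intended for proper stable \<open>f\<close>,
  for which they exist and are unique.\<close>
definition impulse :: "real poly fract \<Rightarrow> nat \<Rightarrow> real" where
  "impulse f = (THE h. \<forall>z. cmod z \<ge> 1 \<longrightarrow> (\<lambda>i. of_real (h i) / z ^ i) sums rat_eval f z)"

definition impulse_mat :: "tf \<Rightarrow> nat \<Rightarrow> real mat" where
  "impulse_mat F i = map_mat (\<lambda>f. impulse f i) F"


section \<open>Hankel operator\<close>

text \<open>An element of \<open>L\<^sub>2\<close> of the unit circle is represented by its square-summable sequence of
  Fourier coefficients: \<open>g k\<close> is the coefficient of \<open>z\<close> to the power \<open>k\<close>.\<close>

definition sq_norm :: "complex vec \<Rightarrow> real" where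
  "sq_norm v = (\<Sum>i<dim_vec v. (cmod (v $ i))\<^sup>2)"

definition L2 :: "nat \<Rightarrow> (int \<Rightarrow> complex vec) set" where
  "L2 m = {g. (\<forall>k. g k \<in> carrier_vec m) \<and> (\<lambda>k. sq_norm (g k)) summable_on UNIV}"

definition L2_norm :: "(int \<Rightarrow> complex vec) \<Rightarrow> real" where
  "L2_norm g = sqrt (\<Sum>\<^sub>\<infinity>k. sq_norm (g k))"

definition H2 :: "nat \<Rightarrow> (int \<Rightarrow> complex vec) set" where
  "H2 m = {g \<in> L2 m. \<forall>k>0. g k = 0\<^sub>v m}"

definition H2_perp :: "nat \<Rightarrow> (int \<Rightarrow> complex vec) set" where
  "H2_perp m = {g \<in> L2 m. \<forall>k\<le>0. g k = 0\<^sub>v m}"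

text \<open>Orthogonal projection of \<open>L\<^sub>2\<close> onto \<open>H\<^sub>2\<close>.\<close>
definition proj_H2 :: "(int \<Rightarrow> complex vec) \<Rightarrow> int \<Rightarrow> complex vec" where
  "proj_H2 g = (\<lambda>k. if k \<le> 0 then g k else 0\<^sub>v (dim_vec (g k)))"

text \<open>The product \<open>F g\<close> for stable \<open>F\<close>: the coefficient of \<open>z\<close> to the power \<open>k\<close> collects the products
  of the coefficient of \<open>F\<close> at exponent \<open>-i\<close> with that of \<open>g\<close> at exponent \<open>k + i\<close>.\<close>
definition mult_L2 :: "tf \<Rightarrow> (int \<Rightarrow> complex vec) \<Rightarrow> int \<Rightarrow> complex vec" where
  "mult_L2 F g = (\<lambda>k. vec (dim_row F) (\<lambda>a.
     \<Sum>\<^sub>\<infinity>i. (map_mat of_real (impulse_mat F i) *\<^sub>v g (k + int i)) $ a))"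

definition Hankel :: "tf \<Rightarrow> (int \<Rightarrow> complex vec) \<Rightarrow> int \<Rightarrow> complex vec" where
  "Hankel F g = proj_H2 (mult_L2 F g)"

definition Hankel_norm :: "tf \<Rightarrow> real" where
  "Hankel_norm F = (SUP g \<in> {g \<in> H2_perp (dim_col F). L2_norm g \<le> 1}. L2_norm (Hankel F g))"


section \<open>Real matrices and state-space realizations\<close>

definition psd :: "real mat \<Rightarrow> bool" where
  "psd M \<longleftrightarrow> square_mat M \<and> transpose_mat M = M \<and>
     (\<forall>v \<in> carrier_vec (dim_row M). v \<bullet> (M *\<^sub>v v) \<ge> 0)"

definition pos_def :: "real mat \<Rightarrow> bool" where
  "pos_def M \<longleftrightarrow> square_mat M \<and> transpose_mat M = M \<and>
     (\<forall>v \<in> carrier_vec (dim_row M). v \<noteq> 0\<^sub>v (dim_row M) \<longrightarrow> v \<bullet> (M *\<^sub>v v) > 0)"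

text \<open>The disjunct for the empty matrix is needed since \<open>spectral_radius\<close> is then a \<open>Max\<close> over the
  empty set.\<close>
definition stable :: "real mat \<Rightarrow> bool" where
  "stable A \<longleftrightarrow> dim_row A = 0 \<or> spectral_radius (map_mat complex_of_real A) < 1"

definition append_columns :: "'a :: zero mat \<Rightarrow> 'a mat \<Rightarrow> 'a mat" (infixr "@\<^sub>c" 66) where
  "A @\<^sub>c B = four_block_mat A B (0\<^sub>m 0 (dim_col A)) (0\<^sub>m 0 (dim_col B))"

text \<open>The transfer matrix of \<open>(A, B, C, D)\<close>, i.e. \<open>D + C (z I - A)\<^bsup>-1\<^esup> B\<close>.\<close>
definition state_space :: "real mat \<Rightarrow> real mat \<Rightarrow> real mat \<Rightarrow> real mat \<Rightarrow> tf" where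
  "state_space A B C D =
     map_mat const C * minv (zvar \<cdot>\<^sub>m 1\<^sub>m (dim_row A) - map_mat const A) * map_mat const B
     + map_mat const D"

text \<open>Realization \<open>(A, B, C, 0)\<close> of order \<open>n\<close>.\<close>
definition realization :: "nat \<Rightarrow> real mat \<Rightarrow> real mat \<Rightarrow> real mat \<Rightarrow> tf \<Rightarrow> bool" where
  "realization n A B C F \<longleftrightarrow>
     A \<in> carrier_mat n n \<and> B \<in> carrier_mat n (dim_col F) \<and> C \<in> carrier_mat (dim_row F) n \<and>
     F = state_space A B C (0\<^sub>m (dim_row F) (dim_col F))"

definition minimal_realization :: "nat \<Rightarrow> real mat \<Rightarrow> real mat \<Rightarrow> real mat \<Rightarrow> tf \<Rightarrow> bool" where
  "minimal_realization n A B C F \<longleftrightarrow>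
     realization n A B C F \<and> (\<forall>n' A' B' C'. realization n' A' B' C' F \<longrightarrow> n \<le> n')"


section \<open>The constraint set and the matrix inequalities\<close>

definition mat_subspace :: "nat \<Rightarrow> nat \<Rightarrow> real mat set \<Rightarrow> bool" where
  "mat_subspace m p S \<longleftrightarrow> S \<subseteq> carrier_mat m p \<and> 0\<^sub>m m p \<in> S \<and>
     (\<forall>X\<in>S. \<forall>Y\<in>S. X + Y \<in> S) \<and> (\<forall>c. \<forall>X\<in>S. c \<cdot>\<^sub>m X \<in> S)"

text \<open>The transfer matrix with impulse response \<open>V 0, \<dots>, V (N - 1)\<close>.\<close>
definition fir :: "nat \<Rightarrow> nat \<Rightarrow> nat \<Rightarrow> (nat \<Rightarrow> real mat) \<Rightarrow> tf" where
  "fir m p N V = mat m p (\<lambda>(a,b). \<Sum>i<N. inverse zvar ^ i * const (V i $$ (a,b)))"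

definition fir_set :: "nat \<Rightarrow> nat \<Rightarrow> nat \<Rightarrow> (nat \<Rightarrow> real mat set) \<Rightarrow> tf set" where
  "fir_set m p N S = {fir m p N V | V. \<forall>i<N. V i \<in> S i}"

definition affine_in_coeffs ::
  "nat \<Rightarrow> nat \<Rightarrow> nat \<Rightarrow> ((nat \<Rightarrow> real mat) \<Rightarrow> real mat) \<Rightarrow> bool" where
  "affine_in_coeffs m p N f \<longleftrightarrow>
     (\<forall>V W t. (\<forall>i<N. V i \<in> carrier_mat m p \<and> W i \<in> carrier_mat m p) \<longrightarrow>
        f (\<lambda>i. (1 - t) \<cdot>\<^sub>m V i + t \<cdot>\<^sub>m W i) = (1 - t) \<cdot>\<^sub>m f V + t \<cdot>\<^sub>m f W)"

definition Aq :: "nat \<Rightarrow> nat \<Rightarrow> real mat" where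
  "Aq N p = mat (N * p) (N * p) (\<lambda>(i,j). if i = j + p then 1 else 0)"

definition Bq :: "nat \<Rightarrow> nat \<Rightarrow> real mat" where
  "Bq N p = mat (N * p) p (\<lambda>(i,j). if i = j then 1 else 0)"

text \<open>\<open>[G\<^bsub>N-1\<^esub>\<^sup>T, \<dots>, G\<^sub>0\<^sup>T]\<close>; column \<open>j\<close> is column \<open>j mod dim_row G\<close> of block number \<open>j div dim_row G\<close>.\<close>
definition Cq :: "nat \<Rightarrow> tf \<Rightarrow> real mat" where
  "Cq N G = mat (dim_col G) (N * dim_row G)
     (\<lambda>(i,j). transpose_mat (impulse_mat G (N - 1 - j div dim_row G)) $$ (i, j mod dim_row G))"

definition LMI ::
  "real mat \<Rightarrow> real mat \<Rightarrow> real mat \<Rightarrow> real mat \<Rightarrow> real mat \<Rightarrow> real \<Rightarrow> bool" where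
  "LMI A B C P Q lam \<longleftrightarrow>
     (let n = dim_row A; k = dim_col B; l = dim_row C in
      P \<in> carrier_mat n n \<and> Q \<in> carrier_mat n n \<and> psd P \<and> psd Q \<and> lam \<ge> 0 \<and>
      psd (- four_block_mat
               (transpose_mat A * Q * A - Q) (transpose_mat C)
               C (- (lam \<cdot>\<^sub>m 1\<^sub>m l))) \<and>
      psd (- ((- P @\<^sub>c P * B @\<^sub>c P * A) @\<^sub>r
              (transpose_mat B * P @\<^sub>c - 1\<^sub>m k @\<^sub>c 0\<^sub>m k n) @\<^sub>r
              (transpose_mat A * P @\<^sub>c 0\<^sub>m n k @\<^sub>c - P))) \<and>
      psd (P - Q) \<and> lam < 1)"

end

theory Submission
  imports Defs "HOL-Complex_Analysis.Complex_Analysis"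
begin

text \<open>Set \<open>M = T1 - T2 V - z\<^bsup>-N\<^esup> T2 D\<close>. On the unit circle \<open>M\<close> splits orthogonally into \<open>Y\<close> and the part in the range
  of \<open>Ui\<close>, and the spectral factor \<open>Yo\<close> turns \<open>\<parallel>M\<parallel>\<^sub>\<infinity> < \<gamma>\<close> into \<open>\<parallel>Rhat V - Uo D Yo\<^bsup>-1\<^esup>\<parallel>\<^sub>\<infinity> < 1\<close>. As \<open>D\<close> ranges over
  all stable matrices this is Nehari's problem for \<open>Rhat1 V\<close>, whose Hankel norm is the supremum of the norms of
  the finite block Hankel sections. A strictly contractive family of sections is extended, one
  diagonal at a time, to a large contractive Toeplitz matrix by Parrott's lemma; the Fejer mean of
  its symbol is an approximate, rational (FIR) Nehari extension, and the strictness absorbs the error. On the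
  state-space side the sections of \<open>C (z I - A)\<^bsup>-1\<^esup> B\<close> are uniformly strictly contractive iff
  the controllability Gramian (inverse of \<open>P\<close>) and the observability Gramian (\<open>lam Q\<close>) satisfy the
  matrix inequalities, up to a small perturbation that makes \<open>P\<close> exist without controllability.
  Multiplying by \<open>z\<^sup>N\<close> adds the shift part \<open>(Aq, Bq, Cq)\<close> to the realization of \<open>R1\<close>.\<close>

text \<open>What passes through all the equivalences is a constant \<rho> < 1, uniform over the
  finite sections or over the circle. The bound \<open>Hankel_norm F < 1\<close>, the condition
  \<open>lam < 1\<close> and the gap below \<gamma> are each converted into such a constant and
  back. No extremal object is constructed: no exact Nehari extension, no infinite Gramian, no
  attained infimum. Every step therefore concerns finite matrices with a margin to spend. The margin
  pays for the Fejer error of order 1/n and for the weight \<epsilon> added to both Gramians;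
  \<epsilon> in turn pays for cutting the Gramians off at a finite horizon.

  Two devices keep this elementary. Contractivity is a bound on a bilinear form over arbitrary
  finite index sets, so that Parrott's lemma shrinks to one unknown scalar. Fourier coefficients are
  limits of averages over roots of unity, which take the place of integrals over the circle.

  The operator side and the state-space side meet only in the numbers \<open>C A^k B\<close>: the
  sections of \<open>Rhat1 V\<close> and of the augmented triple have the same entries.\<close>

section \<open>Bounded bilinear forms\<close>

definition bdd_form ::
  "'i set \<Rightarrow> 'j set \<Rightarrow> ('i \<Rightarrow> 'j \<Rightarrow> 'a :: real_normed_field) \<Rightarrow> real \<Rightarrow> bool" where
  "bdd_form I J M \<rho> \<longleftrightarrow> (\<forall>w u. 2 * norm (\<Sum>i\<in>I. \<Sum>j\<in>J. w i * M i j * u j)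
     \<le> \<rho> * ((\<Sum>i\<in>I. (norm (w i))\<^sup>2) + (\<Sum>j\<in>J. (norm (u j))\<^sup>2)))"

lemma bdd_formD:
  "bdd_form I J M \<rho> \<Longrightarrow> 2 * norm (\<Sum>i\<in>I. \<Sum>j\<in>J. w i * M i j * u j)
     \<le> \<rho> * ((\<Sum>i\<in>I. (norm (w i))\<^sup>2) + (\<Sum>j\<in>J. (norm (u j))\<^sup>2))"
  unfolding bdd_form_def by blast

lemma bdd_form_cong:
  assumes "\<And>i j. i \<in> I \<Longrightarrow> j \<in> J \<Longrightarrow> M i j = M' i j"
  shows "bdd_form I J M \<rho> \<longleftrightarrow> bdd_form I J M' \<rho>"
  unfolding bdd_form_def using assms by simp

lemma bdd_form_subset:
  assumes b: "bdd_form I J M \<rho>" and "I' \<subseteq> I" "J' \<subseteq> J" "finite I" "finite J"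
  shows "bdd_form I' J' M \<rho>"
  unfolding bdd_form_def
proof (intro allI)
  fix w :: "'a \<Rightarrow> 'c" and u :: "'b \<Rightarrow> 'c"
  let ?w = "\<lambda>i. if i \<in> I' then w i else 0" and ?u = "\<lambda>j. if j \<in> J' then u j else 0"
  have "(\<Sum>i\<in>I. \<Sum>j\<in>J. ?w i * M i j * ?u j) = (\<Sum>i\<in>I'. \<Sum>j\<in>J'. w i * M i j * u j)"
  proof -
    have "(\<Sum>i\<in>I. \<Sum>j\<in>J. ?w i * M i j * ?u j) = (\<Sum>i\<in>I'. \<Sum>j\<in>J. ?w i * M i j * ?u j)"
      using assms by (intro sum.mono_neutral_right) auto
    also have "\<dots> = (\<Sum>i\<in>I'. \<Sum>j\<in>J'. ?w i * M i j * ?u j)"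
      using assms by (intro sum.cong sum.mono_neutral_right) auto
    finally show ?thesis by simp
  qed
  moreover have "(\<Sum>i\<in>I. (norm (?w i))\<^sup>2) = (\<Sum>i\<in>I'. (norm (w i))\<^sup>2)"
    using assms by (intro sum.mono_neutral_cong_right) auto
  moreover have "(\<Sum>i\<in>J. (norm (?u i))\<^sup>2) = (\<Sum>i\<in>J'. (norm (u i))\<^sup>2)"
    using assms by (intro sum.mono_neutral_cong_right) auto
  ultimately show "2 * norm (\<Sum>i\<in>I'. \<Sum>j\<in>J'. w i * M i j * u j)
      \<le> \<rho> * ((\<Sum>i\<in>I'. (norm (w i))\<^sup>2) + (\<Sum>j\<in>J'. (norm (u j))\<^sup>2))"
    using bdd_formD[OF b, of ?w ?u] by metis
qed

lemma bdd_form_image: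
  assumes "inj_on f I" "inj_on g J" "bdd_form I J (\<lambda>i j. M (f i) (g j)) \<rho>"
  shows "bdd_form (f ` I) (g ` J) M \<rho>"
  using assms unfolding bdd_form_def by (simp add: sum.reindex)

lemma bdd_form_swap:
  assumes "bdd_form I J M \<rho>"
  shows "bdd_form J I (\<lambda>j i. M i j) \<rho>"
  unfolding bdd_form_def
proof (intro allI)
  fix w :: "'b \<Rightarrow> 'c" and u :: "'a \<Rightarrow> 'c"
  have "(\<Sum>i\<in>J. \<Sum>j\<in>I. w i * M j i * u j) = (\<Sum>i\<in>I. \<Sum>j\<in>J. u i * M i j * w j)"
    by (subst sum.swap) (simp add: mult_ac)
  then show "2 * norm (\<Sum>i\<in>J. \<Sum>j\<in>I. w i * M j i * u j)
      \<le> \<rho> * ((\<Sum>i\<in>J. (norm (w i))\<^sup>2) + (\<Sum>j\<in>I. (norm (u j))\<^sup>2))"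
    using bdd_formD[OF assms, of u w] by (simp add: add.commute)
qed

lemma bdd_form_add:
  fixes M :: "'i \<Rightarrow> 'j \<Rightarrow> 'a :: real_normed_field"
  assumes "bdd_form I J M \<rho>" "bdd_form I J M' \<rho>'"
  shows "bdd_form I J (\<lambda>i j. M i j + M' i j) (\<rho> + \<rho>')"
  unfolding bdd_form_def
proof (intro allI)
  fix w :: "'i \<Rightarrow> 'a" and u :: "'j \<Rightarrow> 'a"
  have "(\<Sum>i\<in>I. \<Sum>j\<in>J. w i * (M i j + M' i j) * u j)
      = (\<Sum>i\<in>I. \<Sum>j\<in>J. w i * M i j * u j) + (\<Sum>i\<in>I. \<Sum>j\<in>J. w i * M' i j * u j)"
    by (simp add: algebra_simps sum.distrib)
  then have "2 * norm (\<Sum>i\<in>I. \<Sum>j\<in>J. w i * (M i j + M' i j) * u j)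
     \<le> 2 * norm (\<Sum>i\<in>I. \<Sum>j\<in>J. w i * M i j * u j) + 2 * norm (\<Sum>i\<in>I. \<Sum>j\<in>J. w i * M' i j * u j)"
    using norm_triangle_ineq[of "\<Sum>i\<in>I. \<Sum>j\<in>J. w i * M i j * u j" "\<Sum>i\<in>I. \<Sum>j\<in>J. w i * M' i j * u j"]
    by (simp only: distrib_left[symmetric] mult_le_cancel_left_pos zero_less_numeral)
  then show "2 * norm (\<Sum>i\<in>I. \<Sum>j\<in>J. w i * (M i j + M' i j) * u j)
     \<le> (\<rho> + \<rho>') * ((\<Sum>i\<in>I. (norm (w i))\<^sup>2) + (\<Sum>j\<in>J. (norm (u j))\<^sup>2))"
    using bdd_formD[OF assms(1), of w u] bdd_formD[OF assms(2), of w u]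
    by (simp add: distrib_right)
qed

text \<open>Cauchy-Schwarz for the dominating rank-one matrix \<open>\<alpha> i * \<beta> j\<close>.
  All crude norm bounds come from here: for sections with geometrically decaying blocks, and for
  matrices with uniformly small entries.\<close>

lemma bdd_form_rank_one:
  fixes M :: "'i \<Rightarrow> 'j \<Rightarrow> 'a :: real_normed_field"
  assumes M: "\<And>i j. i \<in> I \<Longrightarrow> j \<in> J \<Longrightarrow> norm (M i j) \<le> \<alpha> i * \<beta> j"
    and \<alpha>: "(\<Sum>i\<in>I. (\<alpha> i)\<^sup>2) \<le> \<rho>" and \<beta>: "(\<Sum>j\<in>J. (\<beta> j)\<^sup>2) \<le> \<rho>"
  shows "bdd_form I J M \<rho>"
  unfolding bdd_form_def
proof (intro allI)
  fix w :: "'i \<Rightarrow> 'a" and u :: "'j \<Rightarrow> 'a"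
  let ?X = "\<Sum>i\<in>I. \<alpha> i * norm (w i)" and ?Y = "\<Sum>j\<in>J. \<beta> j * norm (u j)"
  have "norm (\<Sum>i\<in>I. \<Sum>j\<in>J. w i * M i j * u j) \<le> (\<Sum>i\<in>I. \<Sum>j\<in>J. (\<alpha> i * norm (w i)) * (\<beta> j * norm (u j)))"
  proof (intro order_trans[OF norm_sum] sum_mono)
    fix i j assume "i \<in> I" "j \<in> J"
    then have "norm (M i j) * (norm (w i) * norm (u j)) \<le> (\<alpha> i * \<beta> j) * (norm (w i) * norm (u j))"
      using M by (intro mult_right_mono) auto
    then show "norm (w i * M i j * u j) \<le> \<alpha> i * norm (w i) * (\<beta> j * norm (u j))"
      by (simp add: norm_mult mult_ac)
  qed
  also have "\<dots> = ?X * ?Y" by (simp add: sum_product)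
  finally have 1: "2 * norm (\<Sum>i\<in>I. \<Sum>j\<in>J. w i * M i j * u j) \<le> ?X\<^sup>2 + ?Y\<^sup>2"
    using sum_squares_bound[of ?X ?Y] by linarith
  have "?X\<^sup>2 \<le> (\<Sum>i\<in>I. (\<alpha> i)\<^sup>2) * (\<Sum>i\<in>I. (norm (w i))\<^sup>2)" by (rule Cauchy_Schwarz_ineq_sum)
  also have "\<dots> \<le> \<rho> * (\<Sum>i\<in>I. (norm (w i))\<^sup>2)" by (intro mult_right_mono \<alpha> sum_nonneg) auto
  finally have 2: "?X\<^sup>2 \<le> \<rho> * (\<Sum>i\<in>I. (norm (w i))\<^sup>2)" .
  have "?Y\<^sup>2 \<le> (\<Sum>i\<in>J. (\<beta> i)\<^sup>2) * (\<Sum>i\<in>J. (norm (u i))\<^sup>2)" by (rule Cauchy_Schwarz_ineq_sum)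
  also have "\<dots> \<le> \<rho> * (\<Sum>i\<in>J. (norm (u i))\<^sup>2)" by (intro mult_right_mono \<beta> sum_nonneg) auto
  finally show "2 * norm (\<Sum>i\<in>I. \<Sum>j\<in>J. w i * M i j * u j)
      \<le> \<rho> * ((\<Sum>i\<in>I. (norm (w i))\<^sup>2) + (\<Sum>j\<in>J. (norm (u j))\<^sup>2))"
    using 1 2 by (simp add: distrib_left)
qed

text \<open>To pass from the form to the operator bound, \<open>w\<close> is taken as a multiple of
  the conjugate of \<open>M u\<close>, with the multiple chosen to balance the arithmetic
  mean.\<close>

lemma bdd_form_iff_quad:
  fixes M :: "'i \<Rightarrow> 'j \<Rightarrow> 'a :: real_normed_field"
  assumes "\<rho> \<ge> 0"
  shows "bdd_form I J M \<rho> \<longleftrightarrow>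
    (\<forall>u. (\<Sum>i\<in>I. (norm (\<Sum>j\<in>J. M i j * u j))\<^sup>2) \<le> \<rho>\<^sup>2 * (\<Sum>j\<in>J. (norm (u j))\<^sup>2))" (is "?L \<longleftrightarrow> ?R")
proof
  assume L: ?L
  show ?R
  proof
    fix u :: "'j \<Rightarrow> 'a"
    define v where "v i = (\<Sum>j\<in>J. M i j * u j)" for i
    let ?S = "\<Sum>i\<in>I. (norm (v i))\<^sup>2" and ?U = "\<Sum>j\<in>J. (norm (u j))\<^sup>2"
    have key: "2 * \<bar>t\<bar> * ?S \<le> \<rho> * (t\<^sup>2 * ?S + ?U)" for t :: real
    proof -
      \<comment> \<open>A general normed field has no conjugation. The quotient of the squared norm
        by \<open>v i\<close> does the same service: it has the modulus of \<open>v i\<close>, and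
        its product with \<open>v i\<close> is real and nonnegative.\<close>
      define w where "w i = of_real t * (if v i = 0 then 0 else of_real ((norm (v i))\<^sup>2) / v i)" for i
      have nw: "norm (w i) = \<bar>t\<bar> * norm (v i)" for i
        by (simp add: w_def norm_mult norm_divide power2_eq_square)
      have wv: "w i * v i = of_real (t * (norm (v i))\<^sup>2)" for i by (simp add: w_def)
      have "(\<Sum>i\<in>I. \<Sum>j\<in>J. w i * M i j * u j) = (\<Sum>i\<in>I. w i * v i)"
        by (simp add: v_def sum_distrib_left mult.assoc)
      also have "\<dots> = of_real (t * ?S)" by (simp only: wv of_real_sum sum_distrib_left)
      finally have "(\<Sum>i\<in>I. \<Sum>j\<in>J. w i * M i j * u j) = of_real (t * ?S)" .
      moreover have "?S \<ge> 0" by (intro sum_nonneg) auto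
      ultimately have "norm (\<Sum>i\<in>I. \<Sum>j\<in>J. w i * M i j * u j) = \<bar>t\<bar> * ?S"
        by (simp only: norm_of_real abs_mult abs_of_nonneg)
      moreover have "(\<Sum>i\<in>I. (norm (w i))\<^sup>2) = t\<^sup>2 * ?S"
        by (simp add: nw power_mult_distrib sum_distrib_left)
      ultimately show ?thesis using bdd_formD[OF L, of w u] by (simp add: mult.assoc)
    qed
    show "?S \<le> \<rho>\<^sup>2 * ?U"
    proof (cases "\<rho> = 0")
      case True
      then show ?thesis using key[of 1] by simp
    next
      case False
      with assms have r: "\<rho> > 0" by simp
      \<comment> \<open>The choice \<open>t = 1/\<rho>\<close> maximises
        \<open>2 * t - \<rho> * t^2\<close> and so gives the best bound on
        \<open>?S\<close>.\<close>
      have "2 * (1/\<rho>) * ?S \<le> \<rho> * ((1/\<rho>)\<^sup>2 * ?S + ?U)" using key[of "1/\<rho>"] r by simp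
      then have "\<rho> * (2 * (1/\<rho>) * ?S) \<le> \<rho> * (\<rho> * ((1/\<rho>)\<^sup>2 * ?S + ?U))"
        using r by (intro mult_left_mono) auto
      moreover have "\<rho> * (2 * (1/\<rho>) * ?S) = 2 * ?S" using r by simp
      moreover have "\<rho> * (\<rho> * ((1/\<rho>)\<^sup>2 * ?S + ?U)) = ?S + \<rho>\<^sup>2 * ?U"
        using r by (simp add: field_simps power2_eq_square)
      ultimately show ?thesis by linarith
    qed
  qed
next
  assume R: ?R
  show ?L unfolding bdd_form_def
  proof (intro allI)
    fix w :: "'i \<Rightarrow> 'a" and u :: "'j \<Rightarrow> 'a"
    define v where "v i = (\<Sum>j\<in>J. M i j * u j)" for i
    let ?S = "\<Sum>i\<in>I. (norm (v i))\<^sup>2" and ?U = "\<Sum>j\<in>J. (norm (u j))\<^sup>2"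
      and ?W = "\<Sum>i\<in>I. (norm (w i))\<^sup>2"
    have S: "?S \<le> \<rho>\<^sup>2 * ?U" using R by (simp add: v_def)
    have U: "?U \<ge> 0" and W: "?W \<ge> 0" by (intro sum_nonneg; simp)+
    have "(\<Sum>i\<in>I. \<Sum>j\<in>J. w i * M i j * u j) = (\<Sum>i\<in>I. w i * v i)"
      by (simp add: v_def sum_distrib_left mult.assoc)
    then have "norm (\<Sum>i\<in>I. \<Sum>j\<in>J. w i * M i j * u j) \<le> (\<Sum>i\<in>I. norm (w i) * norm (v i))"
      by (simp add: norm_mult[symmetric] norm_sum)
    then have "(norm (\<Sum>i\<in>I. \<Sum>j\<in>J. w i * M i j * u j))\<^sup>2 \<le> (\<Sum>i\<in>I. norm (w i) * norm (v i))\<^sup>2"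
      by (intro power_mono) auto
    also have "\<dots> \<le> ?W * ?S" by (rule Cauchy_Schwarz_ineq_sum)
    also have "\<dots> \<le> ?W * (\<rho>\<^sup>2 * ?U)" by (intro mult_left_mono S W)
    also have "\<dots> \<le> (\<rho> * ((?W + ?U) / 2))\<^sup>2"
    proof -
      have "?W * ?U \<le> ((?W + ?U) / 2)\<^sup>2"
        using sum_squares_bound[of ?W ?U] by (simp add: power2_eq_square field_simps)
      then have "\<rho>\<^sup>2 * (?W * ?U) \<le> \<rho>\<^sup>2 * ((?W + ?U) / 2)\<^sup>2" by (intro mult_left_mono) auto
      then show ?thesis by (simp only: power_mult_distrib mult_ac)
    qed
    finally have "norm (\<Sum>i\<in>I. \<Sum>j\<in>J. w i * M i j * u j) \<le> \<rho> * ((?W + ?U) / 2)"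
    proof (rule power2_le_imp_le)
      show "0 \<le> \<rho> * ((?W + ?U) / 2)"
        by (intro mult_nonneg_nonneg divide_nonneg_nonneg add_nonneg_nonneg assms U W) simp
    qed
    then show "2 * norm (\<Sum>i\<in>I. \<Sum>j\<in>J. w i * M i j * u j) \<le> \<rho> * (?W + ?U)" by simp
  qed
qed

text \<open>A real matrix does not gain norm over the complex numbers. Once \<open>w\<close> is
  rotated by a unimodular \<open>c\<close> that makes the value of the form nonnegative, its real
  part splits into the form at the real parts and the form at the imaginary parts, and the squared
  lengths add up.\<close>

lemma bdd_form_complex:
  assumes b: "bdd_form I J M \<rho>"
  shows "bdd_form I J (\<lambda>i j. complex_of_real (M i j)) \<rho>"
  unfolding bdd_form_def
proof (intro allI)
  fix w u :: "_ \<Rightarrow> complex"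
  define z where "z = (\<Sum>i\<in>I. \<Sum>j\<in>J. w i * complex_of_real (M i j) * u j)"
  define c where "c = (if z = 0 then 1 else cnj (sgn z))"
  have nc: "norm c = 1" by (simp add: c_def norm_sgn)
  have cz: "c * z = of_real (norm z)"
  proof (cases "z = 0")
    case False
    have "cnj z * z = of_real (norm z) * of_real (norm z)"
      using complex_norm_square[of z] by (simp add: power2_eq_square mult.commute)
    then show ?thesis using False by (simp add: c_def sgn_eq)
  qed (simp add: c_def)
  define w' where "w' i = c * w i" for i
  have nw': "norm (w' i) = norm (w i)" for i by (simp add: w'_def norm_mult nc)
  have "of_real (norm z) = (\<Sum>i\<in>I. \<Sum>j\<in>J. w' i * complex_of_real (M i j) * u j)"
    unfolding cz[symmetric] unfolding z_def w'_def by (simp add: sum_distrib_left mult.assoc)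
  then have "norm z = Re (\<Sum>i\<in>I. \<Sum>j\<in>J. w' i * complex_of_real (M i j) * u j)"
    by (metis Re_complex_of_real)
  also have "\<dots> = (\<Sum>i\<in>I. \<Sum>j\<in>J. Re (w' i) * M i j * Re (u j))
      + (\<Sum>i\<in>I. \<Sum>j\<in>J. (- Im (w' i)) * M i j * Im (u j))"
    by (simp add: algebra_simps sum.distrib sum_subtractf sum_negf)
  finally have "2 * norm z \<le> 2 * norm (\<Sum>i\<in>I. \<Sum>j\<in>J. Re (w' i) * M i j * Re (u j))
      + 2 * norm (\<Sum>i\<in>I. \<Sum>j\<in>J. (- Im (w' i)) * M i j * Im (u j))"
    unfolding real_norm_def by linarith
  also have "\<dots> \<le> \<rho> * ((\<Sum>i\<in>I. (norm (Re (w' i)))\<^sup>2) + (\<Sum>j\<in>J. (norm (Re (u j)))\<^sup>2))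
      + \<rho> * ((\<Sum>i\<in>I. (norm (- Im (w' i)))\<^sup>2) + (\<Sum>j\<in>J. (norm (Im (u j)))\<^sup>2))"
    by (intro add_mono bdd_formD[OF b])
  also have "\<dots> = \<rho> * ((\<Sum>i\<in>I. (norm (w' i))\<^sup>2) + (\<Sum>j\<in>J. (norm (u j))\<^sup>2))"
    by (simp add: cmod_power2 sum.distrib algebra_simps)
  finally show "2 * norm (\<Sum>i\<in>I. \<Sum>j\<in>J. w i * complex_of_real (M i j) * u j)
      \<le> \<rho> * ((\<Sum>i\<in>I. (norm (w i))\<^sup>2) + (\<Sum>j\<in>J. (norm (u j))\<^sup>2))"
    by (simp add: nw' z_def)
qed

section \<open>Parrott's extension\<close>

text \<open>The unknown entry enters the form only through \<open>w i0 * u j0\<close>, so each pair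
  of vectors bounds the correction \<delta> from one side by the quotient \<open>h w u\<close>: from
  above where the product is positive, from below where it is negative. That no lower bound exceeds
  an upper bound is an instance of Finsler's lemma, since the hypotheses settle all pairs with
  \<open>w i0 * u j0 = 0\<close>.\<close>

lemma parrott_entry:
  fixes M :: "'i \<Rightarrow> 'j \<Rightarrow> real"
  assumes fin: "finite I" "finite J" and i0: "i0 \<notin> I" and j0: "j0 \<notin> J"
    and row: "bdd_form I (insert j0 J) M \<rho>" and col: "bdd_form (insert i0 I) J M \<rho>"
  shows "\<exists>x. bdd_form (insert i0 I) (insert j0 J) (\<lambda>i j. if i = i0 \<and> j = j0 then x else M i j) \<rho>"
proof -
  define F where "F w u = (\<Sum>i\<in>insert i0 I. \<Sum>j\<in>insert j0 J. w i * M i j * u j)" for w u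
  define n where "n w u = \<rho> * ((\<Sum>i\<in>insert i0 I. (w i)\<^sup>2) + (\<Sum>j\<in>insert j0 J. (u j)\<^sup>2))"
    for w :: "'i \<Rightarrow> real" and u :: "'j \<Rightarrow> real"
  have Fu0: "2 * F w u \<le> n w u" if "u j0 = 0" for w u
  proof -
    have "F w u = (\<Sum>i\<in>insert i0 I. \<Sum>j\<in>J. w i * M i j * u j)"
      using fin j0 that by (simp add: F_def)
    then have "2 * F w u \<le> 2 * norm (\<Sum>i\<in>insert i0 I. \<Sum>j\<in>J. w i * M i j * u j)" by simp
    also have "\<dots> \<le> n w u" using bdd_formD[OF col, of w u] fin j0 that by (simp add: n_def)
    finally show ?thesis .
  qed
  have Fw0: "2 * F w u \<le> n w u" if "w i0 = 0" for w u
  proof -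
    have "F w u = (\<Sum>i\<in>I. \<Sum>j\<in>insert j0 J. w i * M i j * u j)"
      using fin i0 that by (simp add: F_def)
    then have "2 * F w u \<le> 2 * norm (\<Sum>i\<in>I. \<Sum>j\<in>insert j0 J. w i * M i j * u j)" by simp
    also have "\<dots> \<le> n w u" using bdd_formD[OF row, of w u] fin i0 that by (simp add: n_def)
    finally show ?thesis .
  qed
  have Flin: "F (\<lambda>i. a * w i + b * w' i) (\<lambda>j. c * u j + d * u' j)
      = a*c * F w u + a*d * F w u' + b*c * F w' u + b*d * F w' u'" for a b c d w w' u u'
    unfolding F_def by (simp only: sum_distrib_left sum.distrib[symmetric] algebra_simps)
  \<comment> \<open>The sum of the values of a quadratic form at two vectors is invariant under
    rotation of the pair, up to the factor \<open>p^2 + q^2\<close>.\<close>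
  have nlin: "n (\<lambda>i. p * w i + - q * w' i) (\<lambda>j. p * u j + - q * u' j)
      + n (\<lambda>i. q * w i + p * w' i) (\<lambda>j. q * u j + p * u' j) = (p\<^sup>2 + q\<^sup>2) * (n w u + n w' u')"
    for p q w w' u u'
  proof -
    have "(\<Sum>i\<in>A. (p * f i + - q * f' i)\<^sup>2) + (\<Sum>i\<in>A. (q * f i + p * f' i)\<^sup>2)
        = (p\<^sup>2 + q\<^sup>2) * ((\<Sum>i\<in>A. (f i)\<^sup>2) + (\<Sum>i\<in>A. (f' i)\<^sup>2))" for f f' :: "'z \<Rightarrow> real" and A
      by (simp only: sum_distrib_left sum.distrib[symmetric])
        (intro sum.cong refl, simp add: power2_eq_square algebra_simps)
    note s = this[of w w'] this[of u u']
    have gen: "\<rho> * (a1 + b1) + \<rho> * (a2 + b2) = k * (\<rho> * (x1 + y1) + \<rho> * (x2 + y2))"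
      if "a1 + a2 = k * (x1 + x2)" "b1 + b2 = k * (y1 + y2)" for a1 a2 b1 b2 k x1 x2 y1 y2
    proof -
      have "\<rho> * (a1 + b1) + \<rho> * (a2 + b2) = \<rho> * ((a1 + a2) + (b1 + b2))" by (simp add: algebra_simps)
      also have "\<dots> = k * (\<rho> * (x1 + y1) + \<rho> * (x2 + y2))" unfolding that by (simp add: algebra_simps)
      finally show ?thesis .
    qed
    show ?thesis unfolding n_def by (rule gen[OF s(1)[of "insert i0 I"] s(2)[of "insert j0 J"]])
  qed
  \<comment> \<open>Rotating the pair of vectors so that the first loses its \<open>j0\<close>-component also removes the
    \<open>i0\<close>-component of the second.\<close>
  have rot: "2 * (F w u + F w' u') \<le> n w u + n w' u'"
    if h: "w i0 * u j0 + w' i0 * u' j0 = 0" "u j0 \<noteq> 0" for w w' u u'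
  proof -
    let ?p = "u' j0" and ?q = "u j0"
    have pos: "?p\<^sup>2 + ?q\<^sup>2 > 0" using h(2) by (simp add: add_nonneg_pos)
    have 1: "2 * F (\<lambda>i. ?p * w i + - ?q * w' i) (\<lambda>j. ?p * u j + - ?q * u' j)
        \<le> n (\<lambda>i. ?p * w i + - ?q * w' i) (\<lambda>j. ?p * u j + - ?q * u' j)"
      by (rule Fu0) simp
    have 2: "2 * F (\<lambda>i. ?q * w i + ?p * w' i) (\<lambda>j. ?q * u j + ?p * u' j)
        \<le> n (\<lambda>i. ?q * w i + ?p * w' i) (\<lambda>j. ?q * u j + ?p * u' j)"
      by (rule Fw0) (use h(1) in \<open>simp add: mult.commute\<close>)
    have "F (\<lambda>i. ?p * w i + - ?q * w' i) (\<lambda>j. ?p * u j + - ?q * u' j)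
        + F (\<lambda>i. ?q * w i + ?p * w' i) (\<lambda>j. ?q * u j + ?p * u' j)
        = (?p\<^sup>2 + ?q\<^sup>2) * (F w u + F w' u')"
      unfolding Flin by (simp add: power2_eq_square algebra_simps)
    then have "(?p\<^sup>2 + ?q\<^sup>2) * (2 * (F w u + F w' u')) \<le> (?p\<^sup>2 + ?q\<^sup>2) * (n w u + n w' u')"
      using 1 2 nlin[of ?p w ?q w' u u'] by linarith
    then show ?thesis using pos by simp
  qed
  have sc: "F (\<lambda>i. a * w i) (\<lambda>j. a * u j) = a\<^sup>2 * F w u"
       "n (\<lambda>i. a * w i) (\<lambda>j. a * u j) = a\<^sup>2 * n w u" for a w u
    unfolding F_def n_def
    by (simp_all only: power_mult_distrib sum_distrib_left distrib_left power2_eq_square mult_ac)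
  define h where "h w u = (n w u - 2 * F w u) / (2 * (w i0 * u j0))" for w u
  have key: "h w' u' \<le> h w u" if "w i0 * u j0 > 0" "w' i0 * u' j0 < 0" for w u w' u'
  proof -
    define s where "s = w i0 * u j0"
    define s' where "s' = - (w' i0 * u' j0)"
    have s: "s > 0" "s' > 0" "u j0 \<noteq> 0" using that by (auto simp: s_def s'_def)
    \<comment> \<open>Scaling by \<open>sqrt s'\<close> and \<open>sqrt s\<close> makes the two
      products of components at \<open>i0\<close> and \<open>j0\<close> opposite to each other, as
      \<open>rot\<close> requires.\<close>
    have "2 * (F (\<lambda>i. sqrt s' * w i) (\<lambda>j. sqrt s' * u j) + F (\<lambda>i. sqrt s * w' i) (\<lambda>j. sqrt s * u' j))
       \<le> n (\<lambda>i. sqrt s' * w i) (\<lambda>j. sqrt s' * u j) + n (\<lambda>i. sqrt s * w' i) (\<lambda>j. sqrt s * u' j)"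
    proof (rule rot)
      have "sqrt s' * w i0 * (sqrt s' * u j0) + sqrt s * w' i0 * (sqrt s * u' j0)
          = (sqrt s')\<^sup>2 * s - (sqrt s)\<^sup>2 * s'" by (simp add: s_def s'_def power2_eq_square algebra_simps)
      then show "sqrt s' * w i0 * (sqrt s' * u j0) + sqrt s * w' i0 * (sqrt s * u' j0) = 0" using s by simp
      show "sqrt s' * u j0 \<noteq> 0" using s by simp
    qed
    then have "0 \<le> s' * (n w u - 2 * F w u) + s * (n w' u' - 2 * F w' u')"
      unfolding sc using s by (simp add: algebra_simps)
    then have "- (n w' u' - 2 * F w' u') / (2 * s') \<le> (n w u - 2 * F w u) / (2 * s)"
      using s by (simp add: field_simps)
    moreover have "h w u = (n w u - 2 * F w u) / (2 * s)" by (simp add: h_def s_def)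
    moreover have "h w' u' = - (n w' u' - 2 * F w' u') / (2 * s')"
      by (simp add: h_def s'_def minus_divide_left)
    ultimately show ?thesis by simp
  qed
  define L where "L = {h w u | w u. w i0 * u j0 < 0}"
  have Lne: "L \<noteq> {}"
  proof -
    have "h (\<lambda>_. 1) (\<lambda>_. -1) \<in> L" unfolding L_def by force
    then show ?thesis by auto
  qed
  have Lb: "bdd_above L" unfolding L_def
    by (rule bdd_aboveI[of _ "h (\<lambda>_. 1) (\<lambda>_. 1)"]) (use key[of "\<lambda>_. 1" "\<lambda>_. 1"] in auto)
  define \<delta> where "\<delta> = Sup L"
  have main: "2 * \<delta> * (w i0 * u j0) + 2 * F w u \<le> n w u" for w u
  proof -
    consider "w i0 = 0" | "u j0 = 0" | "w i0 * u j0 > 0" | "w i0 * u j0 < 0"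
      using linorder_less_linear[of "w i0 * u j0" 0] by auto
    then show ?thesis
    proof cases
      case 3
      have "\<delta> \<le> h w u" unfolding \<delta>_def using Lne key[of w u] 3 by (intro cSup_least) (auto simp: L_def)
      then show ?thesis using 3 by (simp add: h_def field_simps)
    next
      case 4
      have "h w u \<le> \<delta>" unfolding \<delta>_def using Lb 4 by (intro cSup_upper) (auto simp: L_def)
      then show ?thesis using 4 by (simp add: h_def field_simps)
    qed (use Fu0 Fw0 in auto)
  qed
  let ?M = "\<lambda>i j. if i = i0 \<and> j = j0 then M i0 j0 + \<delta> else M i j"
  have eq: "(\<Sum>i\<in>insert i0 I. \<Sum>j\<in>insert j0 J. w i * ?M i j * u j) = \<delta> * (w i0 * u j0) + F w u" for w u
  proof -
    have "(\<Sum>j\<in>insert j0 J. w i * ?M i j * u j) = (\<Sum>j\<in>insert j0 J. w i * M i j * u j)" if "i \<in> I" for i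
      using that i0 by (intro sum.cong) auto
    moreover have "(\<Sum>j\<in>insert j0 J. w i0 * ?M i0 j * u j)
        = \<delta> * (w i0 * u j0) + (\<Sum>j\<in>insert j0 J. w i0 * M i0 j * u j)"
    proof -
      have "(\<Sum>j\<in>J. w i0 * ?M i0 j * u j) = (\<Sum>j\<in>J. w i0 * M i0 j * u j)"
        using j0 by (intro sum.cong) auto
      then show ?thesis using fin j0 by (simp add: algebra_simps)
    qed
    ultimately show ?thesis unfolding F_def using fin i0 by simp
  qed
  have "bdd_form (insert i0 I) (insert j0 J) ?M \<rho>"
    unfolding bdd_form_def
  proof (intro allI)
    fix w u
    \<comment> \<open>The form is odd and the bound is even in \<open>w\<close>, so the one-sided
      inequality already controls the absolute value.\<close>
    have neg: "F (\<lambda>i. - w i) u = - F w u" "n (\<lambda>i. - w i) u = n w u"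
      unfolding F_def n_def by (simp_all add: sum_negf)
    have "2 * \<delta> * (w i0 * u j0) + 2 * F w u \<le> n w u"
         "- (2 * \<delta> * (w i0 * u j0) + 2 * F w u) \<le> n w u"
      using main[of w u] main[of "\<lambda>i. - w i" u] by (simp_all add: neg)
    then have "\<bar>2 * \<delta> * (w i0 * u j0) + 2 * F w u\<bar> \<le> n w u" by linarith
    moreover have "2 * \<bar>\<delta> * (w i0 * u j0) + F w u\<bar> = \<bar>2 * \<delta> * (w i0 * u j0) + 2 * F w u\<bar>"
      by (simp add: abs_if algebra_simps)
    ultimately have "2 * \<bar>\<delta> * (w i0 * u j0) + F w u\<bar> \<le> n w u" by simp
    then show "2 * norm (\<Sum>i\<in>insert i0 I. \<Sum>j\<in>insert j0 J. w i * ?M i j * u j)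
        \<le> \<rho> * ((\<Sum>i\<in>insert i0 I. (norm (w i))\<^sup>2) + (\<Sum>j\<in>insert j0 J. (norm (u j))\<^sup>2))"
      unfolding eq by (simp add: n_def)
  qed
  then show ?thesis by blast
qed

text \<open>Induction over the unknown columns of row \<open>i0\<close>: the rows in
  \<open>I\<close> are complete from the start, and the columns filled so far belong to the known
  column strip of the next step.\<close>

lemma parrott_row:
  fixes M :: "'i \<Rightarrow> 'j \<Rightarrow> real"
  assumes "finite J0" "finite I" "finite J" "i0 \<notin> I" "J0 \<inter> J = {}"
    "bdd_form I (J0 \<union> J) M \<rho>" "bdd_form (insert i0 I) J M \<rho>"
  shows "\<exists>M'. (\<forall>i j. \<not> (i = i0 \<and> j \<in> J0) \<longrightarrow> M' i j = M i j) \<and> bdd_form (insert i0 I) (J0 \<union> J) M' \<rho>"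
  using assms
proof (induction J0 rule: finite_induct)
  case empty
  then show ?case by auto
next
  case (insert j0 J0)
  have "bdd_form I (J0 \<union> J) M \<rho>"
    by (rule bdd_form_subset[OF insert.prems(5)]) (use insert in auto)
  then obtain M' where M': "\<And>i j. \<not> (i = i0 \<and> j \<in> J0) \<Longrightarrow> M' i j = M i j"
    and b: "bdd_form (insert i0 I) (J0 \<union> J) M' \<rho>"
    using insert.IH[OF insert.prems(1-3)] insert.prems by auto
  have "bdd_form I (insert j0 (J0 \<union> J)) M' \<rho> \<longleftrightarrow> bdd_form I (insert j0 (J0 \<union> J)) M \<rho>"
    using insert.prems by (intro bdd_form_cong M') auto
  with insert.prems have "bdd_form I (insert j0 (J0 \<union> J)) M' \<rho>" by simp
  from parrott_entry[OF _ _ _ _ this b] insert obtain x where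
    "bdd_form (insert i0 I) (insert j0 (J0 \<union> J)) (\<lambda>i j. if i = i0 \<and> j = j0 then x else M' i j) \<rho>"
    by auto
  then show ?case using M'
    by (intro exI[of _ "\<lambda>i j. if i = i0 \<and> j = j0 then x else M' i j"]) auto
qed

text \<open>Parrott's theorem in the real case, by induction over the unknown rows: each completed
  row joins the known row strip of the next step.\<close>

lemma parrott_block:
  fixes M :: "'i \<Rightarrow> 'j \<Rightarrow> real"
  assumes "finite I0" "finite J0" "finite I" "finite J" "I0 \<inter> I = {}" "J0 \<inter> J = {}"
    "bdd_form I (J0 \<union> J) M \<rho>" "bdd_form (I0 \<union> I) J M \<rho>"
  shows "\<exists>M'. (\<forall>i j. \<not> (i \<in> I0 \<and> j \<in> J0) \<longrightarrow> M' i j = M i j) \<and> bdd_form (I0 \<union> I) (J0 \<union> J) M' \<rho>"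
  using assms
proof (induction I0 rule: finite_induct)
  case empty
  then show ?case by auto
next
  case (insert i0 I0)
  have "bdd_form (I0 \<union> I) J M \<rho>"
    by (rule bdd_form_subset[OF insert.prems(7)]) (use insert in auto)
  then obtain M' where M': "\<And>i j. \<not> (i \<in> I0 \<and> j \<in> J0) \<Longrightarrow> M' i j = M i j"
    and b: "bdd_form (I0 \<union> I) (J0 \<union> J) M' \<rho>"
    using insert.IH[OF insert.prems(1-3)] insert.prems by auto
  have "bdd_form (insert i0 (I0 \<union> I)) J M' \<rho> \<longleftrightarrow> bdd_form (insert i0 (I0 \<union> I)) J M \<rho>"
    using insert.prems by (intro bdd_form_cong M') auto
  with insert.prems have "bdd_form (insert i0 (I0 \<union> I)) J M' \<rho>" by simp
  from parrott_row[OF _ _ _ _ _ b this] insert obtain M'' where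
    "\<forall>i j. \<not> (i = i0 \<and> j \<in> J0) \<longrightarrow> M'' i j = M' i j" "bdd_form (insert i0 I0 \<union> I) (J0 \<union> J) M'' \<rho>"
    by auto
  then show ?case using M' by (intro exI[of _ M'']) auto
qed

text \<open>The sequence is indexed by integers so that the offset \<open>s\<close> can become
  negative. At \<open>s = 1\<close> this is a section of the Hankel operator; at
  \<open>s = 1 - L\<close> it is a block Toeplitz matrix with its block columns in reverse
  order.\<close>

definition hankel_section ::
  "nat \<Rightarrow> nat \<Rightarrow> (int \<Rightarrow> nat \<Rightarrow> nat \<Rightarrow> real) \<Rightarrow> int \<Rightarrow> real \<Rightarrow> nat \<Rightarrow> bool" where
  "hankel_section l m h s \<rho> L \<longleftrightarrow> bdd_form ({..<L} \<times> {..<l}) ({..<L} \<times> {..<m})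
     (\<lambda>i j. h (int (fst i) + int (fst j) + s) (snd i) (snd j)) \<rho>"

text \<open>At offset \<open>s - 1\<close> the coefficient \<open>h (s - 1)\<close> occurs in the
  corner block only. Without the first block row, or without the first block column, what remains is
  a submatrix of the section at offset \<open>s\<close>. Parrott's theorem thus fills in exactly the
  missing coefficient, and the Hankel structure survives.\<close>

lemma hankel_section_step:
  assumes h: "hankel_section l m h s \<rho> L" and L: "L > 0"
  shows "\<exists>h'. (\<forall>k\<ge>s. h' k = h k) \<and> hankel_section l m h' (s - 1) \<rho> L"
proof -
  obtain L' where L': "L = Suc L'" using L by (cases L) auto
  let ?M = "\<lambda>i j. h (int (fst i) + int (fst j) + (s - 1)) (snd i) (snd j)"
  let ?A = "\<lambda>p. {0::nat} \<times> {..<p::nat}" and ?B = "\<lambda>p. {1..<L} \<times> {..<p::nat}"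
  have un: "?A p \<union> ?B p = {..<L} \<times> {..<p}" for p using L by force
  have im: "?B p = map_prod Suc id ` ({..<L'} \<times> {..<p})" for p
    by (force simp: L' image_iff less_Suc_eq_0_disj)
  have inj: "inj_on (map_prod Suc id) X" for X :: "(nat \<times> nat) set" by (auto simp: inj_on_def)
  note h' = h[unfolded hankel_section_def]
  have "bdd_form (map_prod Suc id ` ({..<L'} \<times> {..<l})) (id ` ({..<L} \<times> {..<m})) ?M \<rho>"
  proof (rule bdd_form_image[OF inj])
    show "bdd_form ({..<L'} \<times> {..<l}) ({..<L} \<times> {..<m}) (\<lambda>i j. ?M (map_prod Suc id i) (id j)) \<rho>"
      using bdd_form_subset[OF h', of "{..<L'} \<times> {..<l}" "{..<L} \<times> {..<m}"]
      by (simp add: L' algebra_simps lessThan_Suc Sigma_mono subset_insertI)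
  qed auto
  then have 1: "bdd_form (?B l) (?A m \<union> ?B m) ?M \<rho>" unfolding im[symmetric] un by simp
  have "bdd_form (id ` ({..<L} \<times> {..<l})) (map_prod Suc id ` ({..<L'} \<times> {..<m})) ?M \<rho>"
  proof (rule bdd_form_image[OF _ inj])
    show "bdd_form ({..<L} \<times> {..<l}) ({..<L'} \<times> {..<m}) (\<lambda>i j. ?M (id i) (map_prod Suc id j)) \<rho>"
      using bdd_form_subset[OF h', of "{..<L} \<times> {..<l}" "{..<L'} \<times> {..<m}"]
      by (simp add: L' algebra_simps lessThan_Suc Sigma_mono subset_insertI)
  qed auto
  then have 2: "bdd_form (?A l \<union> ?B l) (?B m) ?M \<rho>" unfolding im[symmetric] un by simp
  have "\<exists>M'. (\<forall>i j. \<not> (i \<in> ?A l \<and> j \<in> ?A m) \<longrightarrow> M' i j = ?M i j) \<and>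
      bdd_form (?A l \<union> ?B l) (?A m \<union> ?B m) M' \<rho>"
    by (rule parrott_block[OF _ _ _ _ _ _ 1 2]) auto
  then obtain M' where
    M': "\<And>i j. \<not> (i \<in> ?A l \<and> j \<in> ?A m) \<Longrightarrow> M' i j = ?M i j"
    and b: "bdd_form (?A l \<union> ?B l) (?A m \<union> ?B m) M' \<rho>" by blast
  let ?h = "h(s - 1 := \<lambda>a c. M' (0,a) (0,c))"
  have "hankel_section l m ?h (s - 1) \<rho> L"
    unfolding hankel_section_def
  proof (rule iffD2[OF bdd_form_cong b[unfolded un]])
    fix i j :: "nat \<times> nat" assume ij: "i \<in> {..<L} \<times> {..<l}" "j \<in> {..<L} \<times> {..<m}"
    obtain i1 i2 j1 j2 where [simp]: "i = (i1,i2)" "j = (j1,j2)" by (cases i, cases j) auto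
    show "?h (int (fst i) + int (fst j) + (s - 1)) (snd i) (snd j) = M' i j"
      using ij M'[of i j] by (cases "i1 = 0 \<and> j1 = 0") auto
  qed
  then show ?thesis by (intro exI[of _ ?h]) auto
qed

lemma hankel_section_extend:
  assumes "hankel_section l m h s \<rho> L" "L > 0"
  shows "\<exists>h'. (\<forall>k\<ge>s. h' k = h k) \<and> hankel_section l m h' (s - int t) \<rho> L"
proof (induction t)
  case 0
  then show ?case using assms by auto
next
  case (Suc t)
  then obtain h' where h': "\<forall>k\<ge>s. h' k = h k" "hankel_section l m h' (s - int t) \<rho> L" by auto
  from hankel_section_step[OF h'(2) assms(2)] obtain h'' where
    "\<forall>k\<ge>s - int t. h'' k = h' k" "hankel_section l m h'' (s - int t - 1) \<rho> L" by auto
  then show ?case using h'(1) by (intro exI[of _ h'']) (auto simp: algebra_simps)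
qed

section \<open>Evaluation of rational functions\<close>

definition evp :: "(real \<Rightarrow> 'b) \<Rightarrow> 'b :: field \<Rightarrow> real poly \<Rightarrow> 'b" where
  "evp h x p = poly (map_poly h p) x"

text \<open>Read off the reduced denominator, this is the condition under which
  \<open>rat_subst\<close> gives a true value and not the default 0 at a pole; hence it is the
  hypothesis of the homomorphism rules. The parameter \<open>h\<close> covers two uses: evaluation
  at complex points and the substitution of 1/z.\<close>

definition reg :: "(real \<Rightarrow> 'b) \<Rightarrow> 'b :: field \<Rightarrow> real poly fract \<Rightarrow> bool" where
  "reg h x f \<longleftrightarrow> evp h x (snd (quot_of_fract f)) \<noteq> 0"

lemma rat_subst_evp: "rat_subst h x f = evp h x (fst (quot_of_fract f)) / evp h x (snd (quot_of_fract f))"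
  by (simp add: rat_subst_def evp_def)

lemma not_pole_iff_reg: "z \<notin> poles f \<longleftrightarrow> reg of_real z f"
  by (simp add: poles_def reg_def evp_def)

lemma fract_cases: "\<exists>p q. f = to_fract p / to_fract q \<and> q \<noteq> (0 :: real poly) \<and>
    p = fst (quot_of_fract f) \<and> q = snd (quot_of_fract f)"
  using Fract_quot_of_fract[of f] snd_quot_of_fract_nonzero[of f]
  by (intro exI[of _ "fst (quot_of_fract f)"] exI[of _ "snd (quot_of_fract f)"])
    (simp add: Fract_conv_to_fract[symmetric])

lemma fract_reduce:
  fixes p q :: "real poly"
  assumes "f = to_fract p / to_fract q" "q \<noteq> 0"
  obtains g where "p = g * fst (quot_of_fract f)" "q = g * snd (quot_of_fract f)" "g \<noteq> 0"
proof -
  let ?p = "fst (quot_of_fract f)" and ?q = "snd (quot_of_fract f)"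
  have nz: "?q \<noteq> 0" by simp
  have "f = to_fract ?p / to_fract ?q" using fract_cases[of f] by auto
  with assms have "to_fract (p * ?q) = to_fract (?p * q)"
    using nz by (simp add: frac_eq_eq)
  then have eq: "p * ?q = ?p * q" by (simp only: to_fract_eq_iff)
  then have "?q dvd ?p * q" by (metis dvd_triv_right)
  then have "?q dvd q" using coprime_quot_of_fract[of f]
    by (simp add: coprime_dvd_mult_right_iff coprime_commute)
  then obtain g where g: "q = ?q * g" by (elim dvdE)
  with eq have "p * ?q = (g * ?p) * ?q" by (simp add: mult_ac)
  then have "p = g * ?p" using nz by simp
  with g that[of g] \<open>q \<noteq> 0\<close> show ?thesis by (auto simp: mult_ac)
qed

context
  fixes h :: "real \<Rightarrow> 'b :: field" and x :: 'b
  assumes h: "field_hom h"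
begin

interpretation h: field_hom h by (rule h)
interpretation hp: map_poly_comm_ring_hom h ..

lemma evp_add: "evp h x (p + q) = evp h x p + evp h x q"
  and evp_mult: "evp h x (p * q) = evp h x p * evp h x q"
  and evp_0: "evp h x 0 = 0"
  and evp_1: "evp h x 1 = 1"
  and evp_minus: "evp h x (- q) = - evp h x q"
  and evp_const: "evp h x [:c:] = h c"
  and evp_X: "evp h x [:0, 1:] = x"
  and evp_pCons: "evp h x (pCons c p) = h c + x * evp h x p"
proof -
  have pC: "map_poly h (pCons c p) = pCons (h c) (map_poly h p)" for c p
    by (rule h.map_poly_pCons_hom)
  show "evp h x (p + q) = evp h x p + evp h x q" "evp h x (p * q) = evp h x p * evp h x q"
    "evp h x 0 = 0" "evp h x 1 = 1" "evp h x (- q) = - evp h x q"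
    by (simp_all add: evp_def hp.hom_add hp.hom_mult hp.hom_uminus)
  show "evp h x [:c:] = h c" "evp h x [:0, 1:] = x" "evp h x (pCons c p) = h c + x * evp h x p"
    unfolding evp_def pC by simp_all
qed

text \<open>Sums and products lead to fractions that are not reduced. A nonvanishing denominator is
  enough, because the common factor is then nonzero at \<open>x\<close> and cancels. The arithmetic
  rules for \<open>reg\<close> rest on this.\<close>

lemma rat_subst_frac:
  assumes f: "f = to_fract p / to_fract q" and q: "evp h x q \<noteq> 0"
  shows "reg h x f" "rat_subst h x f = evp h x p / evp h x q"
proof -
  have "q \<noteq> 0" using q evp_0 by auto
  from fract_reduce[OF f this] obtain g where
    g: "p = g * fst (quot_of_fract f)" "q = g * snd (quot_of_fract f)" .
  have q': "evp h x g * evp h x (snd (quot_of_fract f)) \<noteq> 0"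
    using q g(2) by (metis evp_mult)
  then show "reg h x f" by (simp add: reg_def)
  have "evp h x p = evp h x g * evp h x (fst (quot_of_fract f))"
       "evp h x q = evp h x g * evp h x (snd (quot_of_fract f))"
    using g by (metis evp_mult)+
  with q' show "rat_subst h x f = evp h x p / evp h x q" by (simp add: rat_subst_evp)
qed

lemma reg_cases:
  assumes "reg h x f"
  obtains p q where "f = to_fract p / to_fract q" "evp h x q \<noteq> 0"
    "rat_subst h x f = evp h x p / evp h x q" "q \<noteq> 0"
  using assms fract_cases[of f] by (auto simp: reg_def rat_subst_evp)

lemma reg_to_fract: "reg h x (to_fract p)" "rat_subst h x (to_fract p) = evp h x p"
  using rat_subst_frac[of "to_fract p" p 1] by (simp_all add: evp_1)

lemma reg_const: "reg h x (const c)" "rat_subst h x (const c) = h c"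
  using reg_to_fract[of "[:c:]"] by (simp_all add: const_def evp_const)

lemma reg_zvar: "reg h x zvar" "rat_subst h x zvar = x"
  using reg_to_fract[of "[:0,1:]"] by (simp_all add: zvar_def evp_X)

lemma reg_0: "reg h x 0" "rat_subst h x 0 = 0"
  using reg_to_fract[of 0] by (simp_all add: evp_0)

lemma reg_1: "reg h x 1" "rat_subst h x 1 = 1"
  using reg_to_fract[of 1] by (simp_all add: evp_1)

lemma reg_add:
  assumes "reg h x f" "reg h x g"
  shows "reg h x (f + g)" "rat_subst h x (f + g) = rat_subst h x f + rat_subst h x g"
proof -
  obtain p q where f: "f = to_fract p / to_fract q" "evp h x q \<noteq> 0"
    "rat_subst h x f = evp h x p / evp h x q" "q \<noteq> 0" using reg_cases[OF assms(1)] .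
  obtain p' q' where g: "g = to_fract p' / to_fract q'" "evp h x q' \<noteq> 0"
    "rat_subst h x g = evp h x p' / evp h x q'" "q' \<noteq> 0" using reg_cases[OF assms(2)] .
  have 1: "f + g = to_fract (p * q' + p' * q) / to_fract (q * q')"
    using f g by (simp add: field_simps)
  have 2: "evp h x (q * q') \<noteq> 0" using f g by (simp add: evp_mult)
  note r = rat_subst_frac[OF 1 2]
  show "reg h x (f + g)" by (rule r)
  show "rat_subst h x (f + g) = rat_subst h x f + rat_subst h x g"
    unfolding r f(3) g(3) using f g by (simp add: evp_add evp_mult field_simps)
qed

lemma reg_mult:
  assumes "reg h x f" "reg h x g"
  shows "reg h x (f * g)" "rat_subst h x (f * g) = rat_subst h x f * rat_subst h x g"
proof -
  obtain p q where f: "f = to_fract p / to_fract q" "evp h x q \<noteq> 0"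
    "rat_subst h x f = evp h x p / evp h x q" "q \<noteq> 0" using reg_cases[OF assms(1)] .
  obtain p' q' where g: "g = to_fract p' / to_fract q'" "evp h x q' \<noteq> 0"
    "rat_subst h x g = evp h x p' / evp h x q'" "q' \<noteq> 0" using reg_cases[OF assms(2)] .
  have 1: "f * g = to_fract (p * p') / to_fract (q * q')"
    using f g by simp
  have 2: "evp h x (q * q') \<noteq> 0" using f g by (simp add: evp_mult)
  note r = rat_subst_frac[OF 1 2]
  show "reg h x (f * g)" by (rule r)
  show "rat_subst h x (f * g) = rat_subst h x f * rat_subst h x g"
    unfolding r f(3) g(3) using f g by (simp add: evp_mult)
qed

lemma reg_uminus:
  assumes "reg h x f"
  shows "reg h x (- f)" "rat_subst h x (- f) = - rat_subst h x f"
proof -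
  have "const (-1) = - 1" unfolding const_def
    by (metis minus_pCons minus_zero one_pCons to_fract_1 to_fract_uminus)
  then have c: "const (-1) * f = - f" by simp
  show "reg h x (- f)" "rat_subst h x (- f) = - rat_subst h x f"
    using reg_mult[OF reg_const(1)[of "-1"] assms] unfolding c reg_const by (simp_all add: h.hom_uminus)
qed

lemma reg_diff:
  assumes "reg h x f" "reg h x g"
  shows "reg h x (f - g)" "rat_subst h x (f - g) = rat_subst h x f - rat_subst h x g"
  using reg_add[OF assms(1) reg_uminus(1)[OF assms(2)]] reg_uminus(2)[OF assms(2)] by simp_all

lemma reg_inverse:
  assumes "reg h x f" "rat_subst h x f \<noteq> 0"
  shows "reg h x (inverse f)" "rat_subst h x (inverse f) = inverse (rat_subst h x f)"
proof -
  obtain p q where f: "f = to_fract p / to_fract q" "evp h x q \<noteq> 0"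
    "rat_subst h x f = evp h x p / evp h x q" "q \<noteq> 0" using reg_cases[OF assms(1)] .
  have 1: "inverse f = to_fract q / to_fract p" using f by simp
  have 2: "evp h x p \<noteq> 0" using assms(2) f(3) by auto
  show "reg h x (inverse f)" "rat_subst h x (inverse f) = inverse (rat_subst h x f)"
    using rat_subst_frac[OF 1 2] f(3) by simp_all
qed

lemma reg_divide:
  assumes "reg h x f" "reg h x g" "rat_subst h x g \<noteq> 0"
  shows "reg h x (f / g)" "rat_subst h x (f / g) = rat_subst h x f / rat_subst h x g"
  using reg_mult[OF assms(1) reg_inverse(1)[OF assms(2,3)]] reg_inverse(2)[OF assms(2,3)]
  by (simp_all add: divide_inverse)

lemma reg_power:
  assumes "reg h x f"
  shows "reg h x (f ^ n) \<and> rat_subst h x (f ^ n) = rat_subst h x f ^ n"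
  by (induction n) (auto simp: reg_1 reg_mult assms)

lemma reg_sum:
  assumes "\<And>i. i \<in> I \<Longrightarrow> reg h x (f i)"
  shows "reg h x (sum f I) \<and> rat_subst h x (sum f I) = (\<Sum>i\<in>I. rat_subst h x (f i))"
  using assms by (induction I rule: infinite_finite_induct) (auto simp: reg_0 reg_add)

end

lemma field_hom_of_real: "field_hom (of_real :: real \<Rightarrow> complex)"
  by (rule of_real_hom.field_hom_axioms)

lemma const_simps: "const 0 = 0" "const 1 = 1" "const (a + b) = const a + const b"
  "const (a * b) = const a * const b" "const (a - b) = const a - const b" "const (- a) = - const a"
  by (simp_all add: const_def flip: one_pCons to_fract_add to_fract_mult to_fract_diff to_fract_uminus)

lemma field_hom_const: "field_hom const"
  by (unfold_locales) (simp_all add: const_simps)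

lemmas evp_simps = evp_0 evp_1 evp_add evp_mult evp_minus evp_const evp_X evp_pCons
lemmas cevp = evp_simps[OF field_hom_of_real]

lemmas creg_0 = reg_0[OF field_hom_of_real]
lemmas creg_1 = reg_1[OF field_hom_of_real]
lemmas creg_const = reg_const[OF field_hom_of_real]
lemmas creg_zvar = reg_zvar[OF field_hom_of_real]
lemmas creg_add = reg_add[OF field_hom_of_real]
lemmas creg_mult = reg_mult[OF field_hom_of_real]
lemmas creg_diff = reg_diff[OF field_hom_of_real]
lemmas creg_inverse = reg_inverse[OF field_hom_of_real]
lemmas creg_divide = reg_divide[OF field_hom_of_real]
lemmas creg_sum = reg_sum[OF field_hom_of_real]
lemmas creg_power = reg_power[OF field_hom_of_real]

lemma evp_cnj: "evp of_real (cnj z) p = cnj (evp of_real z p)"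
  by (induction p) (simp_all add: cevp)

lemma rat_eval_cnj: "rat_eval f (cnj z) = cnj (rat_eval f z)" "reg of_real (cnj z) f = reg of_real z f"
  by (simp_all add: rat_subst_evp evp_cnj reg_def)

section \<open>The substitution \<open>z \<mapsto> 1/z\<close>\<close>

definition rsub :: "real poly fract \<Rightarrow> real poly fract" where
  "rsub = rat_subst const (inverse zvar)"

lemma zvar_nz: "zvar \<noteq> 0" by (simp add: zvar_def)

lemma evp_const_zvar: "evp const zvar p = to_fract p"
proof (induction p)
  case (pCons a p)
  have "to_fract (pCons a p) = to_fract ([:a:] + [:0, 1:] * p)" by simp
  also have "\<dots> = const a + zvar * to_fract p" by (simp only: const_def zvar_def to_fract_add to_fract_mult)
  finally show ?case using pCons by (simp add: evp_simps[OF field_hom_const])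
qed (simp add: evp_simps[OF field_hom_const])

text \<open>Up to the factor \<open>zvar ^ degree q\<close>, the polynomial with 1/z inserted is the
  reflected polynomial, which is nonzero. Hence the substitution meets no poles, and
  \<open>rsub\<close> is a homomorphism defined on the whole field.\<close>

lemma evp_const_inverse_zvar_nz:
  assumes "q \<noteq> 0" shows "evp const (inverse zvar) q \<noteq> 0"
proof -
  have "map_poly const (reflect_poly q) = reflect_poly (map_poly const q)"
  proof -
    interpret field_hom const by (rule field_hom_const)
    show ?thesis by (intro poly_eqI) (simp add: coeff_map_poly coeff_reflect_poly const_simps)
  qed
  then have "to_fract (reflect_poly q) = zvar ^ degree q * evp const (inverse zvar) q"
    unfolding evp_const_zvar[symmetric] evp_def
    using poly_reflect_poly_nz[OF zvar_nz, of "map_poly const q"]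
    by (simp add: const_def zvar_nz degree_map_poly)
  moreover have "to_fract (reflect_poly q) \<noteq> 0" using assms by simp
  ultimately show ?thesis by auto
qed

lemma rsub_reg: "reg const (inverse zvar) f"
  unfolding reg_def by (intro evp_const_inverse_zvar_nz) simp

lemma rsub_simps:
  "rsub (f + g) = rsub f + rsub g" "rsub (f * g) = rsub f * rsub g" "rsub 0 = 0" "rsub 1 = 1"
  "rsub (- f) = - rsub f" "rsub (f - g) = rsub f - rsub g" "rsub (const c) = const c"
  "rsub zvar = inverse zvar"
  unfolding rsub_def
  by (simp_all add: reg_add[OF field_hom_const rsub_reg rsub_reg] reg_mult[OF field_hom_const rsub_reg rsub_reg]
    reg_0[OF field_hom_const] reg_1[OF field_hom_const] reg_uminus[OF field_hom_const rsub_reg]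
    reg_diff[OF field_hom_const rsub_reg rsub_reg] reg_const[OF field_hom_const] reg_zvar[OF field_hom_const])

lemma rsub_sum: "rsub (sum f I) = (\<Sum>i\<in>I. rsub (f i))"
  by (induction I rule: infinite_finite_induct) (auto simp: rsub_simps)

lemma rsub_inverse: "rsub (inverse f) = inverse (rsub f)"
proof (cases "f = 0")
  case False
  have "rsub (inverse f) * rsub f = rsub (inverse f * f)" by (simp only: rsub_simps)
  also have "\<dots> = 1" using False by (simp add: rsub_simps)
  finally have "rsub (inverse f) * rsub f = 1" .
  then show ?thesis by (metis inverse_unique mult.commute)
qed (simp add: rsub_simps)

lemma rsub_evp: "rsub (to_fract p) = evp const (inverse zvar) p"
  unfolding rsub_def by (rule reg_to_fract[OF field_hom_const])

lemma rsub_rsub: "rsub (rsub f) = f"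
proof -
  have p: "rsub (rsub (to_fract p)) = to_fract p" for p
  proof (induction p)
    case (pCons a p)
    have "to_fract (pCons a p) = to_fract ([:a:] + [:0, 1:] * p)" by simp
    also have "\<dots> = const a + zvar * to_fract p" by (simp only: const_def zvar_def to_fract_add to_fract_mult)
    finally have "to_fract (pCons a p) = const a + zvar * to_fract p" .
    then show ?case using pCons by (simp add: rsub_simps rsub_inverse)
  qed (simp add: rsub_simps)
  obtain p q where "f = to_fract p / to_fract q" using fract_cases by blast
  then show ?thesis by (simp add: divide_inverse rsub_simps rsub_inverse p)
qed

lemma rat_eval_rsub:
  assumes z: "z \<noteq> 0" and f: "reg of_real (inverse z) f"
  shows "reg of_real z (rsub f)" "rat_eval (rsub f) z = rat_eval f (inverse z)"
proof -
  have iz: "reg of_real z (inverse zvar)" "rat_eval (inverse zvar) z = inverse z"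
    using creg_inverse[OF creg_zvar(1)[of z]] z by (simp_all add: creg_zvar)
  have p: "reg of_real z (rsub (to_fract p)) \<and> rat_eval (rsub (to_fract p)) z = evp of_real (inverse z) p" for p
    unfolding rsub_evp
    by (induction p) (simp_all add: evp_simps[OF field_hom_const] cevp creg_0 creg_add creg_mult creg_const iz)
  obtain p q where f: "f = to_fract p / to_fract q" "evp of_real (inverse z) q \<noteq> 0"
    "rat_eval f (inverse z) = evp of_real (inverse z) p / evp of_real (inverse z) q"
    using reg_cases[OF field_hom_of_real f] by metis
  have "rsub f = rsub (to_fract p) / rsub (to_fract q)"
    unfolding f by (simp add: divide_inverse rsub_simps rsub_inverse)
  then show "reg of_real z (rsub f)" "rat_eval (rsub f) z = rat_eval f (inverse z)"
    using creg_divide[of z "rsub (to_fract p)" "rsub (to_fract q)"] p[of p] p[of q] f(2,3) by auto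
qed

section \<open>Proper stable rational functions\<close>

definition rh :: "real poly fract \<Rightarrow> bool" where
  "rh f \<longleftrightarrow> proper f \<and> (\<forall>z \<in> poles f. cmod z < 1)"

lemma RH_inf_iff: "F \<in> RH_inf m p \<longleftrightarrow> F \<in> carrier_mat m p \<and> (\<forall>i<m. \<forall>j<p. rh (F $$ (i,j)))"
  unfolding RH_inf_def rh_def by auto

lemma rh_reg: "rh f \<Longrightarrow> cmod z \<ge> 1 \<Longrightarrow> reg of_real z f"
  unfolding rh_def not_pole_iff_reg[symmetric] by force

text \<open>The fraction need not be reduced: cancelling a common factor lowers both degrees alike
  and can only remove roots of the denominator.\<close>

lemma rhI:
  assumes f: "f = to_fract p / to_fract q" and q: "q \<noteq> 0" and deg: "degree p \<le> degree q"
    and roots: "\<And>z. cmod z \<ge> 1 \<Longrightarrow> evp of_real z q \<noteq> 0"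
  shows "rh f"
proof -
  from fract_reduce[OF f q] obtain g where
    g: "p = g * fst (quot_of_fract f)" "q = g * snd (quot_of_fract f)" "g \<noteq> 0" .
  have "proper f"
  proof (cases "fst (quot_of_fract f) = 0")
    case False
    then show ?thesis using deg g q unfolding proper_def
      by (metis add_le_cancel_left degree_mult_eq snd_quot_of_fract_nonzero)
  qed (simp add: proper_def)
  moreover have "cmod z < 1" if "z \<in> poles f" for z
  proof (rule ccontr)
    assume "\<not> cmod z < 1"
    then show False using that rat_subst_frac(1)[OF field_hom_of_real f roots, of z] not_pole_iff_reg by auto
  qed
  ultimately show ?thesis by (simp add: rh_def)
qed

lemma rh_fract:
  assumes "rh f"
  shows "\<exists>p q. f = to_fract p / to_fract q \<and> q \<noteq> 0 \<and> degree p \<le> degree q \<and>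
    (\<forall>z. cmod z \<ge> 1 \<longrightarrow> evp of_real z q \<noteq> 0)"
proof -
  obtain p q where pq: "f = to_fract p / to_fract q" "q \<noteq> 0" "p = fst (quot_of_fract f)"
    "q = snd (quot_of_fract f)" using fract_cases[of f] by auto
  have roots: "evp of_real z q \<noteq> 0" if "cmod z \<ge> 1" for z
    using rh_reg[OF assms that] by (simp add: reg_def pq(4))
  have deg: "degree p \<le> degree q" using assms by (simp add: rh_def proper_def pq(3,4))
  show ?thesis using pq(1,2) deg roots by blast
qed

lemma rh_add: assumes "rh f" "rh g" shows "rh (f + g)"
proof -
  obtain p q where f: "f = to_fract p / to_fract q" "q \<noteq> 0"
    "degree p \<le> degree q" "\<And>z. cmod z \<ge> 1 \<Longrightarrow> evp of_real z q \<noteq> 0"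
    using rh_fract[OF assms(1)] by blast
  obtain p' q' where g: "g = to_fract p' / to_fract q'" "q' \<noteq> 0"
    "degree p' \<le> degree q'" "\<And>z. cmod z \<ge> 1 \<Longrightarrow> evp of_real z q' \<noteq> 0"
    using rh_fract[OF assms(2)] by blast
  show ?thesis
  proof (rule rhI)
    show "f + g = to_fract (p * q' + p' * q) / to_fract (q * q')" using f g by (simp add: field_simps)
    have "degree (p * q') \<le> degree (q * q')" "degree (p' * q) \<le> degree (q * q')"
      using f g degree_mult_le[of p q'] degree_mult_le[of p' q] by (simp_all add: degree_mult_eq)
    then show "degree (p * q' + p' * q) \<le> degree (q * q')" by (rule degree_add_le)
  qed (use f g in \<open>auto simp: cevp\<close>)
qed

lemma rh_mult: assumes "rh f" "rh g" shows "rh (f * g)"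
proof -
  obtain p q where f: "f = to_fract p / to_fract q" "q \<noteq> 0"
    "degree p \<le> degree q" "\<And>z. cmod z \<ge> 1 \<Longrightarrow> evp of_real z q \<noteq> 0"
    using rh_fract[OF assms(1)] by blast
  obtain p' q' where g: "g = to_fract p' / to_fract q'" "q' \<noteq> 0"
    "degree p' \<le> degree q'" "\<And>z. cmod z \<ge> 1 \<Longrightarrow> evp of_real z q' \<noteq> 0"
    using rh_fract[OF assms(2)] by blast
  show ?thesis
  proof (rule rhI)
    show "f * g = to_fract (p * p') / to_fract (q * q')" using f g by simp
    show "degree (p * p') \<le> degree (q * q')"
      using f g degree_mult_le[of p p'] by (simp add: degree_mult_eq)
  qed (use f g in \<open>auto simp: cevp\<close>)
qed

lemma rh_const: "rh (const c)"
  by (rule rhI[of _ "[:c:]" 1]) (auto simp: const_def cevp)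

lemma rh_0: "rh 0" and rh_1: "rh 1"
  using rh_const[of 0] rh_const[of 1] by (simp_all add: const_simps)

lemma rh_uminus: "rh f \<Longrightarrow> rh (- f)"
  using rh_mult[OF rh_const[of "-1"], of f] by (simp add: const_simps)

lemma rh_diff: "rh f \<Longrightarrow> rh g \<Longrightarrow> rh (f - g)"
  using rh_add[OF _ rh_uminus, of f g] by simp

lemma rh_inverse_zvar: "rh (inverse zvar)"
  by (rule rhI[of _ 1 "[:0,1:]"]) (auto simp: zvar_def cevp divide_inverse)

lemma rh_power: "rh f \<Longrightarrow> rh (f ^ n)"
  by (induction n) (auto simp: rh_1 rh_mult)

lemma rh_sum: "(\<And>i. i \<in> I \<Longrightarrow> rh (f i)) \<Longrightarrow> rh (sum f I)"
  by (induction I rule: infinite_finite_induct) (auto simp: rh_0 rh_add)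

section \<open>Expansion of proper stable functions in powers of 1/z\<close>

text \<open>The point \<open>w = 0\<close> is excluded because it stands for z at infinity, where
  the expansions say nothing. The constant term is recovered as a limit; then the isolation of zeros
  of power series settles the other coefficients.\<close>

lemma powser_unique:
  fixes a b :: "nat \<Rightarrow> complex"
  assumes a: "\<And>w. w \<noteq> 0 \<Longrightarrow> cmod w < 1 \<Longrightarrow> (\<lambda>i. a i * w ^ i) sums f w"
    and b: "\<And>w. w \<noteq> 0 \<Longrightarrow> cmod w < 1 \<Longrightarrow> (\<lambda>i. b i * w ^ i) sums f w"
  shows "a = b"
proof -
  define d where "d i = a i - b i" for i
  have d: "(\<lambda>i. d i * w ^ i) sums 0" if "w \<noteq> 0" "cmod w < 1" for w
    using sums_diff[OF a[OF that] b[OF that]] by (simp add: d_def algebra_simps)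
  have "((\<lambda>_. 0) \<longlongrightarrow> d 0) (at (0::complex))"
    by (rule powser_limit_0_strong[of 1]) (use d in auto)
  then have d0: "d 0 = 0"
    using tendsto_unique[of "at (0::complex)" "\<lambda>_. 0" "d 0" 0] by (simp add: trivial_limit_at)
  have d': "(\<lambda>i. d i * (w - 0) ^ i) sums 0" if "norm (w - 0) < 1" for w
  proof (cases "w = 0")
    case True
    have "(\<lambda>i. d i * 0 ^ i) sums d 0" by (rule powser_sums_zero)
    then show ?thesis using True d0 by simp
  qed (use d that in auto)
  have "d m = 0" for m
  proof (rule ccontr)
    assume dm: "d m \<noteq> 0"
    then have "m > 0" using d0 by (cases m) auto
    obtain s where s: "s > 0" "\<And>z. z \<in> cball (0::complex) s - {0} \<Longrightarrow> (0::complex) \<noteq> 0"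
      by (rule powser_0_nonzero[of 1 0 d "\<lambda>_. 0" m]) (use d' dm \<open>m > 0\<close> in auto)
    have "of_real s \<in> cball (0::complex) s - {0}" using s(1) by simp
    with s(2) show False by blast
  qed
  then show ?thesis by (auto simp: d_def)
qed

lemma poly_roots_gap:
  fixes q :: "complex poly"
  assumes "\<And>w. cmod w \<le> 1 \<Longrightarrow> poly q w \<noteq> 0"
  shows "\<exists>R>1. \<forall>w. cmod w < R \<longrightarrow> poly q w \<noteq> 0"
proof -
  have q0: "q \<noteq> 0" using assms[of 0] by auto
  let ?S = "cmod ` {w. poly q w = 0}"
  have fin: "finite ?S" using poly_roots_finite[OF q0] by simp
  define R where "R = Min (insert 2 ?S)"
  have "\<forall>y\<in>insert 2 ?S. 1 < y" using assms by (auto simp: not_le[symmetric])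
  then have "R > 1" unfolding R_def using fin by (subst Min_gr_iff) auto
  moreover have "poly q w \<noteq> 0" if "cmod w < R" for w
    using that fin unfolding R_def by (subst (asm) Min_gr_iff) auto
  ultimately show ?thesis by blast
qed

text \<open>In the variable w = 1/z the function becomes \<open>P/Q\<close>, where \<open>Q\<close>
  is the reflected denominator: its constant term is the leading coefficient of \<open>q\<close>,
  and its zeros are reciprocals of roots of \<open>q\<close>. So the quotient is analytic on a disc
  of radius greater than 1, and its Taylor coefficients decay geometrically.\<close>

lemma rh_expansion:
  assumes "rh f"
  shows "\<exists>h c r. 0 < r \<and> r < 1 \<and> (\<forall>i. \<bar>h i\<bar> \<le> c * r ^ i) \<and>
    (\<forall>z. cmod z \<ge> 1 \<longrightarrow> (\<lambda>i. of_real (h i) / z ^ i) sums rat_eval f z)"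
proof -
  obtain p q where f: "f = to_fract p / to_fract q" "q \<noteq> 0"
    "degree p \<le> degree q" and q: "\<And>z. cmod z \<ge> 1 \<Longrightarrow> evp of_real z q \<noteq> 0"
    using rh_fract[OF assms] by blast
  \<comment> \<open>By properness the exponent is a true difference, so that \<open>P\<close> at
    \<open>w\<close> is \<open>w ^ degree q\<close> times \<open>p\<close> at 1/w, with the same
    power of \<open>w\<close> as for \<open>Q\<close>.\<close>
  define P where "P = monom 1 (degree q - degree p) * reflect_poly p"
  define Q where "Q = reflect_poly q"
  let ?c = "map_poly complex_of_real"
  have crefl: "?c (reflect_poly r) = reflect_poly (?c r)" for r
    by (intro poly_eqI) (simp add: coeff_map_poly coeff_reflect_poly)
  have cmult: "poly (?c (r * s)) w = poly (?c r) w * poly (?c s) w" for r s w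
    using evp_mult[OF field_hom_of_real] unfolding evp_def .
  have refl: "poly (?c (reflect_poly r)) w = w ^ degree r * evp of_real (inverse w) r" if "w \<noteq> 0" for r w
    using poly_reflect_poly_nz[OF that, of "?c r"] by (simp add: crefl evp_def)
  have Pw: "poly (?c P) w = w ^ degree q * evp of_real (inverse w) p" if "w \<noteq> 0" for w
    using f(3) by (simp add: P_def cmult refl[OF that] map_poly_monom poly_monom flip: power_add)
  have Qw: "poly (?c Q) w = w ^ degree q * evp of_real (inverse w) q" if "w \<noteq> 0" for w
    by (simp add: Q_def refl[OF that])
  have Q0: "coeff Q 0 \<noteq> 0" using f(2) by (simp add: Q_def)
  have Qnz: "poly (?c Q) w \<noteq> 0" if "cmod w \<le> 1" for w
  proof (cases "w = 0")
    case True
    then show ?thesis using Q0 by (simp add: poly_0_coeff_0 coeff_map_poly)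
  next
    case False
    then have "cmod (inverse w) \<ge> 1" using that by (simp add: norm_inverse one_le_inverse)
    then show ?thesis using Qw[OF False] q False by simp
  qed
  obtain R where R: "R > 1" "\<And>w. cmod w < R \<Longrightarrow> poly (?c Q) w \<noteq> 0"
    using poly_roots_gap[OF Qnz] by blast
  \<comment> \<open>The coefficients must be real, so the quotient is formed over the reals as
    \<open>H\<close>, while convergence is studied for the complex series \<open>Hc\<close>. The two
    agree because the inverse of a power series is unique.\<close>
  define H where "H = fps_of_poly P * inverse (fps_of_poly Q)"
  define Hc where "Hc = fps_of_poly (?c P) * inverse (fps_of_poly (?c Q))"
  have Hc: "fps_nth Hc i = of_real (fps_nth H i)" for i
  proof -
    let ?m = "\<lambda>F. Abs_fps (\<lambda>n. complex_of_real (fps_nth F n))"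
    have mult: "?m (F * G) = ?m F * ?m G" for F G
      by (intro fps_ext) (simp add: fps_mult_nth)
    have pol: "?m (fps_of_poly r) = fps_of_poly (?c r)" for r
      by (intro fps_ext) (simp add: coeff_map_poly)
    have "inverse (fps_of_poly Q) * fps_of_poly Q = 1"
      by (rule inverse_mult_eq_1) (simp add: Q0)
    then have "?m (inverse (fps_of_poly Q)) * fps_of_poly (?c Q) = ?m 1"
      by (simp only: mult[symmetric] pol[symmetric])
    also have "?m 1 = 1" by (intro fps_ext) simp
    finally have "inverse (fps_of_poly (?c Q)) = ?m (inverse (fps_of_poly Q))"
      by (intro fps_inverse_unique) (simp only: mult.commute)
    then have "Hc = ?m H" unfolding Hc_def H_def mult pol by simp
    then show ?thesis by simp
  qed
  have rad: "fps_conv_radius (inverse (fps_of_poly (?c Q))) \<ge> R"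
    using fps_conv_radius_inverse[of R "fps_of_poly (?c Q)"] R(2) by simp
  have radH: "fps_conv_radius Hc \<ge> R"
    using fps_conv_radius_mult[of "fps_of_poly (?c P)" "inverse (fps_of_poly (?c Q))"] rad
    by (simp add: Hc_def)
  have evalH: "eval_fps Hc w = poly (?c P) w / poly (?c Q) w" if "cmod w < R" for w
  proof -
    have "ereal (norm w) < R" using that by simp
    moreover have "eval_fps (inverse (fps_of_poly (?c Q))) w = inverse (eval_fps (fps_of_poly (?c Q)) w)"
      by (rule eval_fps_inverse[of R]) (use R(2) that in auto)
    ultimately show ?thesis unfolding Hc_def
      using less_le_trans[OF \<open>ereal (norm w) < R\<close> rad] by (subst eval_fps_mult) (auto simp: divide_inverse)
  qed
  \<comment> \<open>At a radius \<open>s\<close> strictly between 1 and \<open>R\<close> the terms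
    of the convergent series are bounded, which gives decay with ratio \<open>1/s\<close>.\<close>
  define s where "s = (1 + R) / 2"
  have s: "1 < s" "s < R" using R(1) by (auto simp: s_def)
  have "(\<lambda>n. fps_nth Hc n * of_real s ^ n) sums eval_fps Hc (of_real s)"
    by (rule sums_eval_fps, rule less_le_trans[OF _ radH]) (use s in simp)
  then have "Bseq (\<lambda>n. fps_nth Hc n * of_real s ^ n)"
    by (intro convergent_imp_Bseq convergentI[OF summable_LIMSEQ_zero] sums_summable)
  then obtain c where c: "\<And>n. norm (fps_nth Hc n * of_real s ^ n) \<le> c"
    unfolding Bseq_def by blast
  have "\<bar>fps_nth H n\<bar> \<le> c * (1 / s) ^ n" for n
  proof -
    have "\<bar>fps_nth H n\<bar> * s ^ n \<le> c" using c[of n] s by (simp add: Hc norm_mult norm_power)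
    then show ?thesis using s by (simp add: field_simps power_one_over)
  qed
  moreover have "(\<lambda>i. of_real (fps_nth H i) / z ^ i) sums rat_eval f z" if z: "cmod z \<ge> 1" for z
  proof -
    have z0: "z \<noteq> 0" "inverse z \<noteq> 0" using z by auto
    have "cmod (inverse z) \<le> 1" using z by (simp add: norm_inverse inverse_le_1_iff)
    then have w: "cmod (inverse z) < R" using R(1) by linarith
    have "(\<lambda>n. fps_nth Hc n * inverse z ^ n) sums eval_fps Hc (inverse z)"
      by (rule sums_eval_fps, rule less_le_trans[OF _ radH]) (use w in simp)
    moreover have "eval_fps Hc (inverse z) = rat_eval f z"
      unfolding evalH[OF w] Pw[OF z0(2)] Qw[OF z0(2)]
      using rat_subst_frac(2)[OF field_hom_of_real f(1) q[OF z]] z0 by simp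
    ultimately show ?thesis by (simp add: Hc divide_inverse power_inverse)
  qed
  ultimately show ?thesis using s
    by (intro exI[of _ "fps_nth H"] exI[of _ c] exI[of _ "1/s"]) auto
qed

text \<open>This justifies the definite description in \<open>impulse\<close>: an expansion exists,
  and its values on the closed exterior of the disc determine it.\<close>

lemma impulse_props:
  assumes "rh f"
  shows "\<exists>c r. 0 < r \<and> r < 1 \<and> (\<forall>i. \<bar>impulse f i\<bar> \<le> c * r ^ i)"
    "cmod z \<ge> 1 \<Longrightarrow> (\<lambda>i. of_real (impulse f i) / z ^ i) sums rat_eval f z"
proof -
  from rh_expansion[OF assms] obtain h c r where
    h: "0 < r" "r < 1" "\<And>i. \<bar>h i\<bar> \<le> c * r ^ i"
      "\<And>z. cmod z \<ge> 1 \<Longrightarrow> (\<lambda>i. of_real (h i) / z ^ i) sums rat_eval f z" by blast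
  have "impulse f = h" unfolding impulse_def
  proof (rule the_equality)
    fix h' assume h': "\<forall>z. cmod z \<ge> 1 \<longrightarrow> (\<lambda>i. of_real (h' i) / z ^ i) sums rat_eval f z"
    have "(\<lambda>i. complex_of_real (h' i)) = (\<lambda>i. complex_of_real (h i))"
    proof (rule powser_unique)
      fix w :: complex assume w: "w \<noteq> 0" "cmod w < 1"
      then have z: "cmod (inverse w) \<ge> 1" by (simp add: norm_inverse one_le_inverse)
      show "(\<lambda>i. complex_of_real (h' i) * w ^ i) sums rat_eval f (inverse w)"
        using h'[rule_format, OF z] by (simp add: divide_inverse power_inverse)
      show "(\<lambda>i. complex_of_real (h i) * w ^ i) sums rat_eval f (inverse w)"
        using h(4)[OF z] by (simp add: divide_inverse power_inverse)
    qed
    then show "h' = h" by (auto simp: fun_eq_iff)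
  qed (use h in auto)
  with h show "\<exists>c r. 0 < r \<and> r < 1 \<and> (\<forall>i. \<bar>impulse f i\<bar> \<le> c * r ^ i)"
    "cmod z \<ge> 1 \<Longrightarrow> (\<lambda>i. of_real (impulse f i) / z ^ i) sums rat_eval f z" by auto
qed

lemma impulse_unique:
  assumes "\<And>z. cmod z \<ge> 1 \<Longrightarrow> (\<lambda>i. of_real (h i) / z ^ i) sums rat_eval f z" "rh f"
  shows "impulse f = h"
proof -
  have "(\<lambda>i. complex_of_real (impulse f i)) = (\<lambda>i. complex_of_real (h i))"
  proof (rule powser_unique)
    fix w :: complex assume w: "w \<noteq> 0" "cmod w < 1"
    then have z: "cmod (inverse w) \<ge> 1" by (simp add: norm_inverse one_le_inverse)
    show "(\<lambda>i. complex_of_real (impulse f i) * w ^ i) sums rat_eval f (inverse w)"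
      using impulse_props(2)[OF assms(2) z] by (simp add: divide_inverse power_inverse)
    show "(\<lambda>i. complex_of_real (h i) * w ^ i) sums rat_eval f (inverse w)"
      using assms(1)[OF z] by (simp add: divide_inverse power_inverse)
  qed
  then show ?thesis by (auto simp: fun_eq_iff)
qed

lemma impulse_add:
  assumes "rh f" "rh g"
  shows "impulse (f + g) = (\<lambda>i. impulse f i + impulse g i)"
proof (rule impulse_unique)
  fix z assume z: "cmod z \<ge> 1"
  show "(\<lambda>i. of_real (impulse f i + impulse g i) / z ^ i) sums rat_eval (f + g) z"
    using sums_add[OF impulse_props(2)[OF assms(1) z] impulse_props(2)[OF assms(2) z]]
    by (simp add: creg_add rh_reg[OF _ z] assms add_divide_distrib)
qed (rule rh_add[OF assms])

lemma impulse_cmult: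
  assumes "rh f"
  shows "impulse (const c * f) = (\<lambda>i. c * impulse f i)"
proof (rule impulse_unique)
  fix z assume z: "cmod z \<ge> 1"
  show "(\<lambda>i. of_real (c * impulse f i) / z ^ i) sums rat_eval (const c * f) z"
    using sums_mult[OF impulse_props(2)[OF assms z], of "of_real c"]
    by (simp add: creg_mult creg_const rh_reg[OF _ z] assms)
qed (intro rh_mult rh_const assms)

section \<open>Laurent expansions on the unit circle\<close>

text \<open>The Wiener algebra of the circle; the function is constrained at points of modulus 1
  only. Stable and anti-stable parts both fit in, so that matching the coefficients of a
  decomposition becomes a matter of uniqueness.\<close>

definition laurent :: "(int \<Rightarrow> complex) \<Rightarrow> (complex \<Rightarrow> complex) \<Rightarrow> bool" where
  "laurent a \<phi> \<longleftrightarrow> (\<lambda>k. norm (a k)) summable_on UNIV \<and>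
     (\<forall>z. cmod z = 1 \<longrightarrow> ((\<lambda>k. a k * z powi k) has_sum \<phi> z) UNIV)"

lemma laurent_cong:
  assumes "laurent a \<phi>" "\<And>k. a k = b k" "\<And>z. cmod z = 1 \<Longrightarrow> \<phi> z = \<psi> z"
  shows "laurent b \<psi>"
proof -
  have "a = b" using assms(2) by auto
  then show ?thesis using assms(1) unfolding laurent_def by (auto simp: assms(3)[symmetric])
qed

lemma laurent_add:
  assumes "laurent a \<phi>" "laurent b \<psi>"
  shows "laurent (\<lambda>k. a k + b k) (\<lambda>z. \<phi> z + \<psi> z)"
  unfolding laurent_def
proof (intro conjI allI impI)
  have "(\<lambda>k. norm (a k) + norm (b k)) summable_on UNIV"
    using assms by (intro summable_on_add) (auto simp: laurent_def)
  then show "(\<lambda>k. norm (a k + b k)) summable_on UNIV"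
    by (rule summable_on_comparison_test) (auto intro: norm_triangle_ineq)
  show "((\<lambda>k. (a k + b k) * z powi k) has_sum \<phi> z + \<psi> z) UNIV" if "cmod z = 1" for z
    using has_sum_add[of "\<lambda>k. a k * z powi k" UNIV "\<phi> z" "\<lambda>k. b k * z powi k" "\<psi> z"] assms that
    by (simp add: laurent_def distrib_right)
qed

lemma laurent_cmult:
  assumes "laurent a \<phi>"
  shows "laurent (\<lambda>k. c * a k) (\<lambda>z. c * \<phi> z)"
  unfolding laurent_def
proof (intro conjI allI impI)
  show "(\<lambda>k. norm (c * a k)) summable_on UNIV"
    using assms unfolding norm_mult laurent_def by (intro summable_on_cmult_right) auto
  show "((\<lambda>k. (c * a k) * z powi k) has_sum c * \<phi> z) UNIV" if "cmod z = 1" for z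
    using has_sum_cmult_right[of "\<lambda>k. a k * z powi k" UNIV "\<phi> z" c] assms that
    by (simp add: laurent_def mult.assoc)
qed

lemma laurent_0: "laurent (\<lambda>_. 0) (\<lambda>_. 0)"
  by (simp add: laurent_def)

lemma laurent_diff:
  assumes "laurent a \<phi>" "laurent b \<psi>"
  shows "laurent (\<lambda>k. a k - b k) (\<lambda>z. \<phi> z - \<psi> z)"
  using laurent_add[OF assms(1) laurent_cmult[OF assms(2), of "-1"]] by simp

lemma laurent_sum:
  assumes "\<And>i. i \<in> I \<Longrightarrow> laurent (a i) (\<phi> i)"
  shows "laurent (\<lambda>k. \<Sum>i\<in>I. a i k) (\<lambda>z. \<Sum>i\<in>I. \<phi> i z)"
  using assms by (induction I rule: infinite_finite_induct) (auto intro: laurent_0 laurent_add)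

lemma laurent_const: "laurent (\<lambda>k. if k = 0 then c else 0) (\<lambda>_. c)"
  unfolding laurent_def
proof (intro conjI allI impI)
  have "((\<lambda>k::int. norm (if k = 0 then c else 0)) has_sum norm c) UNIV"
    by (rule has_sum_finite_neutralI[of "{0}"]) auto
  then show "(\<lambda>k::int. norm (if k = 0 then c else 0)) summable_on UNIV"
    by (rule has_sum_imp_summable)
  show "((\<lambda>k. (if k = 0 then c else 0) * z powi k) has_sum c) UNIV" for z
    by (rule has_sum_finite_neutralI[of "{0}"]) auto
qed

lemma laurent_shift:
  assumes "laurent a \<phi>"
  shows "laurent (\<lambda>k. a (k - n)) (\<lambda>z. z powi n * \<phi> z)"
  unfolding laurent_def
proof (intro conjI allI impI)
  have bij: "bij_betw (\<lambda>k::int. k - n) UNIV UNIV"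
    by (rule bij_betwI[of _ _ _ "\<lambda>k. k + n"]) auto
  show "(\<lambda>k. norm (a (k - n))) summable_on UNIV"
    using summable_on_reindex_bij_betw[OF bij, of "\<lambda>k. norm (a k)"] assms by (simp add: laurent_def)
  show "((\<lambda>k. a (k - n) * z powi k) has_sum z powi n * \<phi> z) UNIV" if z: "cmod z = 1" for z
  proof -
    have "z \<noteq> 0" using z by auto
    then have e: "z powi k = z powi n * z powi (k - n)" for k
      by (simp flip: power_int_add)
    have "((\<lambda>k. z powi n * (a k * z powi k)) has_sum z powi n * \<phi> z) UNIV"
      using assms z by (intro has_sum_cmult_right) (simp add: laurent_def)
    then have "((\<lambda>k. z powi n * (a (k - n) * z powi (k - n))) has_sum z powi n * \<phi> z) UNIV"
      using has_sum_reindex_bij_betw[OF bij, of "\<lambda>k. z powi n * (a k * z powi k)" "z powi n * \<phi> z"] by simp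
    moreover have "z powi n * (a (k - n) * z powi (k - n)) = a (k - n) * z powi k" for k
      unfolding e[of k] by simp
    ultimately show ?thesis by (simp only:)
  qed
qed

lemma laurent_reflect:
  assumes "laurent a \<phi>"
  shows "laurent (\<lambda>k. a (- k)) (\<lambda>z. \<phi> (inverse z))"
  unfolding laurent_def
proof (intro conjI allI impI)
  have bij: "bij_betw (\<lambda>k::int. - k) UNIV UNIV"
    by (rule bij_betwI[of _ _ _ "\<lambda>k. - k"]) auto
  show "(\<lambda>k. norm (a (- k))) summable_on UNIV"
    using summable_on_reindex_bij_betw[OF bij, of "\<lambda>k. norm (a k)"] assms by (simp add: laurent_def)
  show "((\<lambda>k. a (- k) * z powi k) has_sum \<phi> (inverse z)) UNIV" if z: "cmod z = 1" for z
  proof -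
    have "((\<lambda>k. a k * inverse z powi k) has_sum \<phi> (inverse z)) UNIV"
      using assms z by (simp add: laurent_def norm_inverse)
    then show ?thesis
      using has_sum_reindex_bij_betw[OF bij, of "\<lambda>k. a k * inverse z powi k" "\<phi> (inverse z)"]
      by (simp add: power_int_inverse power_int_minus)
  qed
qed

lemma laurent_powi: "laurent (\<lambda>k. if k = n then c else 0) (\<lambda>z. c * z powi n)"
  using laurent_shift[OF laurent_const[of c], of n]
  by (rule laurent_cong) (auto simp: mult.commute)

section \<open>Fourier coefficients by averages over roots of unity\<close>

text \<open>The average over the roots of unity of order \<open>M + 1\<close> stands in for the
  normalised integral over the circle. Being a finite sum, it commutes with the algebra and raises
  no question of integrability.\<close>

definition circle_mean :: "(complex \<Rightarrow> complex) \<Rightarrow> nat \<Rightarrow> complex" where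
  "circle_mean \<phi> M = (\<Sum>j<Suc M. \<phi> (cis (2 * pi * real j / real (Suc M)))) / of_nat (Suc M)"

lemma circle_mean_add: "circle_mean (\<lambda>z. \<phi> z + \<psi> z) M = circle_mean \<phi> M + circle_mean \<psi> M"
  unfolding circle_mean_def by (simp only: sum.distrib add_divide_distrib)

lemma circle_mean_cmult: "circle_mean (\<lambda>z. c * \<phi> z) M = c * circle_mean \<phi> M"
  unfolding circle_mean_def by (simp only: sum_distrib_left[symmetric] times_divide_eq_right)

lemma circle_mean_sum: "circle_mean (\<lambda>z. \<Sum>i\<in>I. \<phi> i z) M = (\<Sum>i\<in>I. circle_mean (\<phi> i) M)"
  unfolding circle_mean_def by (subst sum.swap) (simp only: sum_divide_distrib)

lemma circle_mean_bound:
  assumes "\<And>z. cmod z = 1 \<Longrightarrow> norm (\<phi> z) \<le> B"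
  shows "norm (circle_mean \<phi> M) \<le> B"
proof -
  have "norm (\<Sum>j<Suc M. \<phi> (cis (2 * pi * real j / real (Suc M)))) \<le> (\<Sum>j<Suc M. B)"
    by (intro sum_norm_le assms) simp
  then have "norm (\<Sum>j<Suc M. \<phi> (cis (2 * pi * real j / real (Suc M)))) / real (Suc M) \<le> B"
    by (simp add: divide_le_eq mult.commute del: of_nat_Suc sum.lessThan_Suc)
  then show ?thesis unfolding circle_mean_def norm_divide norm_of_nat .
qed

lemma circle_mean_norm_le:
  assumes "\<And>z. cmod z = 1 \<Longrightarrow> norm (\<phi> z) \<le> Re (\<psi> z)"
  shows "norm (circle_mean \<phi> M) \<le> Re (circle_mean \<psi> M)"
proof -
  have "norm (\<Sum>j<Suc M. \<phi> (cis (2 * pi * real j / real (Suc M))))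
      \<le> (\<Sum>j<Suc M. Re (\<psi> (cis (2 * pi * real j / real (Suc M)))))"
    by (intro sum_norm_le assms) simp
  then show ?thesis
    unfolding circle_mean_def norm_divide norm_of_nat Re_divide_of_nat Re_sum
    by (intro divide_right_mono) auto
qed

text \<open>The geometric sum over the roots of unity vanishes unless \<open>k\<close> is a multiple
  of \<open>M + 1\<close>; in the stated range 0 is the only such multiple.\<close>

lemma circle_mean_powi:
  assumes "\<bar>k\<bar> \<le> int M"
  shows "circle_mean (\<lambda>z. z powi k) M = (if k = 0 then 1 else 0)"
proof (cases "k = 0")
  case True
  then show ?thesis by (simp add: circle_mean_def del: of_nat_Suc)
next
  case False
  define n where "n = Suc M"
  define \<omega> where "\<omega> = cis (2 * pi * real_of_int k / real n)"
  have n: "real n > 0" by (simp add: n_def)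
  have pw: "cis (2 * pi * real j / real n) powi k = \<omega> ^ j" for j
    by (simp add: \<omega>_def cis_power_int Complex.DeMoivre mult_ac)
  have "\<omega> \<noteq> 1"
  proof
    assume "\<omega> = 1"
    then have "cos (2 * pi * real_of_int k / real n) = 1" by (simp add: \<omega>_def complex_eq_iff)
    then obtain m :: int where "2 * pi * real_of_int k / real n = real_of_int m * 2 * pi"
      using cos_one_2pi_int by blast
    then have "real_of_int k = real_of_int m * real n" using n by (simp add: field_simps)
    then have "k = m * int n" by (metis of_int_eq_iff of_int_mult of_int_of_nat_eq)
    then have "int n dvd k" by simp
    then have "int n \<le> \<bar>k\<bar>" using False by (intro zdvd_imp_le) auto
    with assms show False unfolding n_def by simp
  qed
  moreover have "\<omega> ^ n = 1"
    using n by (simp add: \<omega>_def Complex.DeMoivre)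
  ultimately have "(\<Sum>j<n. \<omega> ^ j) = 0" by (simp add: geometric_sum)
  then show ?thesis using False unfolding circle_mean_def n_def[symmetric] by (simp add: pw)
qed

lemma has_sum_norm_le:
  fixes f :: "'i \<Rightarrow> complex"
  assumes "(f has_sum x) A" "(g has_sum y) A" "\<And>k. k \<in> A \<Longrightarrow> norm (f k) \<le> g k"
  shows "norm x \<le> y"
proof (rule tendsto_le[OF _ _ tendsto_norm])
  show "(sum g \<longlongrightarrow> y) (finite_subsets_at_top A)" "(sum f \<longlongrightarrow> x) (finite_subsets_at_top A)"
    using assms by (simp_all add: has_sum_def)
  show "\<forall>\<^sub>F F in finite_subsets_at_top A. norm (sum f F) \<le> sum g F"
    by (rule eventually_finite_subsets_at_top_weakI) (use assms(3) in \<open>auto intro!: sum_norm_le\<close>)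
qed simp

text \<open>The series is cut to a finite set of exponents that contains 0 and leaves a tail of norm
  below \<open>e\<close>. Once \<open>M\<close> dominates the exponents kept, the mean of the finite
  part is exactly \<open>a 0\<close>, and the tail is bounded uniformly on the circle.\<close>

lemma circle_mean_laurent:
  assumes "laurent a \<phi>"
  shows "circle_mean \<phi> \<longlonglongrightarrow> a 0"
proof (rule LIMSEQ_I)
  fix e :: real assume e: "e > 0"
  let ?n = "\<lambda>k. norm (a k)"
  have sm: "?n summable_on UNIV" using assms by (simp add: laurent_def)
  then have n: "(?n has_sum infsum ?n UNIV) UNIV" by simp
  then have "\<forall>\<^sub>F F in finite_subsets_at_top UNIV. dist (sum ?n F) (infsum ?n UNIV) < e"
    using e unfolding has_sum_def by (rule tendstoD)
  then have "\<exists>F0. finite F0 \<and> F0 \<subseteq> UNIV \<and>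
      (\<forall>F. finite F \<and> F0 \<subseteq> F \<and> F \<subseteq> UNIV \<longrightarrow> dist (sum ?n F) (infsum ?n UNIV) < e)"
    unfolding eventually_finite_subsets_at_top .
  then obtain F0 where F0: "finite F0"
    "\<And>F. finite F \<Longrightarrow> F0 \<subseteq> F \<Longrightarrow> dist (sum ?n F) (infsum ?n UNIV) < e"
    by (meson subset_UNIV)
  define F where "F = insert 0 F0"
  have F: "finite F" "0 \<in> F" "dist (sum ?n F) (infsum ?n UNIV) < e"
    using F0(1) F0(2)[of "insert 0 F0"] by (simp_all add: F_def subset_insertI)
  define p where "p z = (\<Sum>k\<in>F. a k * z powi k)" for z
  have err: "norm (\<phi> z - p z) \<le> infsum ?n UNIV - sum ?n F" if z: "cmod z = 1" for z
  proof (rule has_sum_norm_le)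
    have hs: "((\<lambda>k. a k * z powi k) has_sum \<phi> z) UNIV" using assms z by (simp add: laurent_def)
    have "((\<lambda>k. a k * z powi k) has_sum p z) F" unfolding p_def by (rule has_sum_finite[OF F(1)])
    then show "((\<lambda>k. a k * z powi k) has_sum (\<phi> z - p z)) (UNIV - F)"
      by (rule has_sum_Diff[OF hs]) simp
    show "(?n has_sum (infsum ?n UNIV - sum ?n F)) (UNIV - F)"
      by (rule has_sum_Diff[OF n has_sum_finite[OF F(1)]]) simp
  qed (use z in \<open>auto simp: norm_mult norm_power_int\<close>)
  obtain K where K: "\<And>k. k \<in> F \<Longrightarrow> \<bar>k\<bar> \<le> int K"
  proof
    fix k assume "k \<in> F"
    then have "nat \<bar>k\<bar> \<le> Max ((\<lambda>k. nat \<bar>k\<bar>) ` F)" using F(1) by (intro Max_ge) auto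
    then show "\<bar>k\<bar> \<le> int (Max ((\<lambda>k. nat \<bar>k\<bar>) ` F))" by linarith
  qed
  have "norm (circle_mean \<phi> M - a 0) < e" if M: "M \<ge> K" for M
  proof -
    have "circle_mean p M = (\<Sum>k\<in>F. a k * (if k = 0 then 1 else 0))"
      unfolding p_def circle_mean_sum circle_mean_cmult
    proof (intro sum.cong refl)
      fix k assume "k \<in> F"
      then have "\<bar>k\<bar> \<le> int M" using K[of k] M by linarith
      then show "a k * circle_mean (\<lambda>z. z powi k) M = a k * (if k = 0 then 1 else 0)"
        by (simp add: circle_mean_powi)
    qed
    also have "\<dots> = (\<Sum>k\<in>F. if k = 0 then a k else 0)" by (intro sum.cong) auto
    also have "\<dots> = a 0" using F by simp
    finally have pm: "circle_mean p M = a 0" .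
    have "norm (circle_mean (\<lambda>z. \<phi> z + (-1) * p z) M) \<le> infsum ?n UNIV - sum ?n F"
      by (rule circle_mean_bound) (use err in simp)
    also have "\<dots> < e" using F(3) by (simp add: dist_real_def)
    finally show ?thesis unfolding circle_mean_add circle_mean_cmult pm by simp
  qed
  then show "\<exists>N. \<forall>M\<ge>N. norm (circle_mean \<phi> M - a 0) < e" by blast
qed

lemma laurent_unique:
  assumes "laurent a \<phi>" "laurent b \<phi>"
  shows "a = b"
proof
  fix k
  have "circle_mean (\<lambda>z. z powi (- k) * \<phi> z) \<longlonglongrightarrow> a (0 - - k)"
       "circle_mean (\<lambda>z. z powi (- k) * \<phi> z) \<longlonglongrightarrow> b (0 - - k)"
    using circle_mean_laurent[OF laurent_shift] assms by blast+
  then show "a k = b k" using LIMSEQ_unique by simp blast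
qed

lemma laurent_causal:
  fixes h :: "nat \<Rightarrow> real"
  assumes h: "\<And>i. \<bar>h i\<bar> \<le> c * r ^ i" and r: "0 < r" "r < 1"
    and s: "\<And>z. cmod z = 1 \<Longrightarrow> (\<lambda>i. of_real (h i) / z ^ i) sums \<phi> z"
  shows "laurent (\<lambda>k. if k \<le> 0 then of_real (h (nat (- k))) else 0) \<phi>"
  unfolding laurent_def
proof (intro conjI allI impI)
  have sm: "summable (\<lambda>i. \<bar>h i\<bar>)"
    by (rule summable_comparison_test'[of "\<lambda>i. c * r ^ i" 0])
      (use h r in \<open>auto intro: summable_mult\<close>)
  have bij: "bij_betw (\<lambda>i. - int i) UNIV {..0}"
    by (rule bij_betwI[of _ _ _ "\<lambda>k. nat (- k)"]) auto
  have "(\<lambda>i. \<bar>h i\<bar>) summable_on UNIV"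
    using sm by (intro norm_summable_imp_summable_on) simp
  then have "(\<lambda>k. norm (if k \<le> 0 then complex_of_real (h (nat (- k))) else 0)) summable_on {..0}"
    using summable_on_reindex_bij_betw[OF bij,
        of "\<lambda>k. norm (if k \<le> 0 then complex_of_real (h (nat (- k))) else 0)"] by simp
  then show "(\<lambda>k. norm (if k \<le> 0 then complex_of_real (h (nat (- k))) else 0)) summable_on UNIV"
    by (rule summable_on_cong_neutral[THEN iffD1, rotated -1]) auto
  fix z :: complex assume z: "cmod z = 1"
  have "((\<lambda>i. of_real (h i) / z ^ i) has_sum \<phi> z) UNIV"
    using s[OF z] sm z by (intro norm_summable_imp_has_sum) (auto simp: norm_divide norm_power)
  then have "((\<lambda>k. (if k \<le> 0 then complex_of_real (h (nat (- k))) else 0) * z powi k) has_sum \<phi> z) {..0}"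
    using has_sum_reindex_bij_betw[OF bij,
        of "\<lambda>k. (if k \<le> 0 then complex_of_real (h (nat (- k))) else 0) * z powi k" "\<phi> z"]
    by (simp add: power_int_minus divide_inverse)
  then show "((\<lambda>k. (if k \<le> 0 then complex_of_real (h (nat (- k))) else 0) * z powi k) has_sum \<phi> z) UNIV"
    by (rule has_sum_cong_neutral[THEN iffD1, rotated -1]) auto
qed

lemma laurent_rh:
  assumes "rh f"
  shows "laurent (\<lambda>k. if k \<le> 0 then of_real (impulse f (nat (- k))) else 0) (rat_eval f)"
proof -
  obtain c r where "0 < r" "r < 1" "\<And>i. \<bar>impulse f i\<bar> \<le> c * r ^ i"
    using impulse_props(1)[OF assms] by blast
  then show ?thesis
    by (intro laurent_causal[of "impulse f" c r] impulse_props(2)[OF assms]) auto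
qed

lemma laurent_rsub:
  assumes "rh f"
  shows "laurent (\<lambda>k. if k \<ge> 0 then of_real (impulse f (nat k)) else 0) (rat_eval (rsub f))"
proof (rule laurent_cong[OF laurent_reflect[OF laurent_rh[OF assms]]])
  fix z :: complex assume z: "cmod z = 1"
  then have "z \<noteq> 0" "cmod (inverse z) \<ge> 1" by (auto simp: norm_inverse)
  then show "rat_eval f (inverse z) = rat_eval (rsub f) z"
    using rat_eval_rsub(2) rh_reg[OF assms] by metis
qed auto

section \<open>Evaluation of transfer matrices\<close>

definition ev :: "complex \<Rightarrow> tf \<Rightarrow> complex mat" where
  "ev z F = map_mat (\<lambda>f. rat_eval f z) F"

definition regm :: "complex \<Rightarrow> tf \<Rightarrow> bool" where
  "regm z F \<longleftrightarrow> (\<forall>i<dim_row F. \<forall>j<dim_col F. reg of_real z (F $$ (i,j)))"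

lemma ev_dim [simp]: "dim_row (ev z F) = dim_row F" "dim_col (ev z F) = dim_col F"
  and ev_index: "i < dim_row F \<Longrightarrow> j < dim_col F \<Longrightarrow> ev z F $$ (i,j) = rat_eval (F $$ (i,j)) z"
  and ev_carrier: "F \<in> carrier_mat m p \<Longrightarrow> ev z F \<in> carrier_mat m p"
  by (auto simp: ev_def)

lemma times_index: "i < dim_row A \<Longrightarrow> j < dim_col B \<Longrightarrow> dim_col A = dim_row B \<Longrightarrow>
    (A * B) $$ (i,j) = (\<Sum>k<dim_row B. A $$ (i,k) * B $$ (k,j))"
  by (simp add: scalar_prod_def atLeast0LessThan)

lemma ev_mult:
  assumes "regm z A" "regm z B" "dim_col A = dim_row B"
  shows "regm z (A * B)" "ev z (A * B) = ev z A * ev z B"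
proof -
  have r: "reg of_real z (A $$ (i,k) * B $$ (k,j)) \<and>
      rat_eval (A $$ (i,k) * B $$ (k,j)) z = rat_eval (A $$ (i,k)) z * rat_eval (B $$ (k,j)) z"
    if "i < dim_row A" "j < dim_col B" "k < dim_row B" for i j k
    using assms that by (auto simp: regm_def creg_mult)
  show "regm z (A * B)" unfolding regm_def
    using assms r by (auto simp: times_index simp del: index_mult_mat(1) intro!: creg_sum[THEN conjunct1])
  show "ev z (A * B) = ev z A * ev z B"
  proof (rule eq_matI)
    fix i j assume "i < dim_row (ev z A * ev z B)" "j < dim_col (ev z A * ev z B)"
    then have ij: "i < dim_row A" "j < dim_col B" by simp_all
    have "rat_eval (\<Sum>k<dim_row B. A $$ (i,k) * B $$ (k,j)) z
        = (\<Sum>k<dim_row B. rat_eval (A $$ (i,k)) z * rat_eval (B $$ (k,j)) z)"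
      using r[OF ij] by (subst creg_sum[THEN conjunct2]) auto
    then show "ev z (A * B) $$ (i,j) = (ev z A * ev z B) $$ (i,j)"
      using ij assms(3) by (simp add: ev_index times_index del: index_mult_mat(1))
  qed (use assms in auto)
qed

lemma ev_add:
  assumes "regm z A" "regm z B" "dim_row A = dim_row B" "dim_col A = dim_col B"
  shows "regm z (A + B)" "ev z (A + B) = ev z A + ev z B"
  using assms by (auto simp: regm_def creg_add ev_index intro!: eq_matI)

lemma ev_diff:
  assumes "regm z A" "regm z B" "dim_row A = dim_row B" "dim_col A = dim_col B"
  shows "regm z (A - B)" "ev z (A - B) = ev z A - ev z B"
  using assms by (auto simp: regm_def creg_diff ev_index intro!: eq_matI)

lemma ev_smult:
  assumes "reg of_real z c" "regm z A"
  shows "regm z (c \<cdot>\<^sub>m A)" "ev z (c \<cdot>\<^sub>m A) = rat_eval c z \<cdot>\<^sub>m ev z A"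
  using assms by (auto simp: regm_def creg_mult ev_index intro!: eq_matI)

lemma ev_one: "regm z (1\<^sub>m n)" "ev z (1\<^sub>m n) = 1\<^sub>m n"
  by (auto simp: regm_def creg_0 creg_1 ev_index intro!: eq_matI)

lemma ev_map_const: "regm z (map_mat const A)" "ev z (map_mat const A) = map_mat of_real A"
  by (auto simp: regm_def creg_const ev_index intro!: eq_matI)

lemma mat_adjoint_altdef: "mat_adjoint A = transpose_mat (map_mat cnj A)"
  by (rule eq_matI) (auto simp: mat_adjoint_def mat_of_rows_def)

lemma para_conj_altdef: "para_conj F = transpose_mat (map_mat rsub F)"
  by (simp add: para_conj_def rsub_def)

lemma para_conj_dim [simp]: "dim_row (para_conj F) = dim_col F" "dim_col (para_conj F) = dim_row F"
  by (simp_all add: para_conj_altdef)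

lemma para_conj_index [simp]:
  "i < dim_col F \<Longrightarrow> j < dim_row F \<Longrightarrow> para_conj F $$ (i,j) = rsub (F $$ (j,i))"
  by (simp add: para_conj_altdef)

lemma para_conj_carrier: "F \<in> carrier_mat m p \<Longrightarrow> para_conj F \<in> carrier_mat p m"
  by (simp add: para_conj_altdef)

lemma para_conj_mult:
  assumes "dim_col A = dim_row B"
  shows "para_conj (A * B) = para_conj B * para_conj A"
  using assms by (intro eq_matI) (auto simp: times_index rsub_sum rsub_simps mult.commute simp del: index_mult_mat(1))

lemma para_conj_one: "para_conj (1\<^sub>m n) = 1\<^sub>m n"
  by (intro eq_matI) (auto simp: rsub_simps)

lemma para_conj_smult: "para_conj (c \<cdot>\<^sub>m A) = rsub c \<cdot>\<^sub>m para_conj A"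
  by (intro eq_matI) (auto simp: rsub_simps)

lemma para_conj_para_conj: "para_conj (para_conj A) = A"
  by (intro eq_matI) (auto simp: rsub_rsub)

text \<open>On the unit circle the inverse of \<open>z\<close> is its conjugate, and functions with
  real coefficients commute with conjugation.\<close>

lemma ev_para_conj:
  assumes "regm z F" "cmod z = 1"
  shows "regm z (para_conj F)" "ev z (para_conj F) = mat_adjoint (ev z F)"
proof -
  have z: "z \<noteq> 0" "inverse z = cnj z"
    using assms(2) complex_norm_square[of z] by (auto intro!: inverse_unique)
  have r: "reg of_real z (rsub (F $$ (j,i))) \<and> rat_eval (rsub (F $$ (j,i))) z = cnj (rat_eval (F $$ (j,i)) z)"
    if "j < dim_row F" "i < dim_col F" for i j
    using rat_eval_rsub[OF z(1), of "F $$ (j,i)"] that assms(1) unfolding z(2) rat_eval_cnj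
    by (simp add: regm_def)
  show "regm z (para_conj F)" using r by (auto simp: regm_def)
  show "ev z (para_conj F) = mat_adjoint (ev z F)"
    using r by (intro eq_matI) (auto simp: mat_adjoint_altdef ev_index)
qed

lemma RH_inf_regm:
  assumes "F \<in> RH_inf m p" "cmod z \<ge> 1"
  shows "regm z F"
  using assms rh_reg by (auto simp: RH_inf_iff regm_def)

lemma RH_inf_carrier: "F \<in> RH_inf m p \<Longrightarrow> F \<in> carrier_mat m p"
  by (simp add: RH_inf_iff)

lemma RH_inf_mult:
  assumes "F \<in> RH_inf m n" "G \<in> RH_inf n p"
  shows "F * G \<in> RH_inf m p"
  using assms unfolding RH_inf_iff by (auto simp: times_index simp del: index_mult_mat(1) intro!: rh_sum rh_mult)

lemma RH_inf_add: "F \<in> RH_inf m p \<Longrightarrow> G \<in> RH_inf m p \<Longrightarrow> F + G \<in> RH_inf m p"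
  unfolding RH_inf_iff by (auto simp: rh_add)

lemma RH_inf_diff: "F \<in> RH_inf m p \<Longrightarrow> G \<in> RH_inf m p \<Longrightarrow> F - G \<in> RH_inf m p"
  unfolding RH_inf_iff by (auto simp: rh_diff)

lemma RH_inf_fir: "fir m p N V \<in> RH_inf m p"
  unfolding RH_inf_iff fir_def by (auto intro!: rh_sum rh_mult rh_power rh_inverse_zvar rh_const)

lemma minv_inverse:
  assumes A: "A \<in> carrier_mat n n" and B: "B \<in> carrier_mat n n" "A * B = 1\<^sub>m n" "B * A = 1\<^sub>m n"
  shows "minv A = B"
proof -
  have "A \<in> Units (ring_mat TYPE('a) n undefined)"
    using A B unfolding Units_def ring_mat_def by auto
  then obtain B' where B': "mat_inverse A = Some B'"
    using mat_inverse(1)[OF A, of undefined] by (cases "mat_inverse A") auto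
  from mat_inverse(2)[OF A B'] have b: "A * B' = 1\<^sub>m n" "B' * A = 1\<^sub>m n" "B' \<in> carrier_mat n n" by auto
  have "B' = B' * (A * B)" using b B by simp
  also have "\<dots> = (B' * A) * B" by (rule assoc_mult_mat[OF b(3) A B(1), symmetric])
  also have "\<dots> = B" unfolding b(2) using B by simp
  finally have "B' = B" .
  then show ?thesis by (simp add: minv_def B')
qed

lemma minv_invertible:
  assumes A: "A \<in> carrier_mat n n" "invertible_mat A"
  shows "A * minv A = 1\<^sub>m n" "minv A * A = 1\<^sub>m n" "minv A \<in> carrier_mat n n"
proof -
  obtain B where B: "inverts_mat A B" "inverts_mat B A" using A(2) unfolding invertible_mat_def by auto
  then have "A * B = 1\<^sub>m n" "B * A = 1\<^sub>m (dim_row B)" using A(1) by (auto simp: inverts_mat_def)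
  moreover from this have "dim_col B = n" "dim_row B = n"
    using A(1) by (metis carrier_matD index_mult_mat(3) index_one_mat(3))+
  ultimately have B': "B \<in> carrier_mat n n" "A * B = 1\<^sub>m n" "B * A = 1\<^sub>m n" by auto
  from minv_inverse[OF A(1) this] B'
  show "A * minv A = 1\<^sub>m n" "minv A * A = 1\<^sub>m n" "minv A \<in> carrier_mat n n" by auto
qed

lemma RH_inf_units:
  assumes "U \<in> RH_inf_units p"
  shows "U \<in> RH_inf p p" "minv U \<in> RH_inf p p" "U * minv U = 1\<^sub>m p" "minv U * U = 1\<^sub>m p"
    "U \<in> carrier_mat p p" "minv U \<in> carrier_mat p p"
  using assms minv_invertible[of U p] by (auto simp: RH_inf_units_def RH_inf_carrier)

section \<open>State-space realizations\<close>

text \<open>A root of the characteristic polynomial is an eigenvalue, so its modulus is at most the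
  spectral radius. Its existence also excludes the empty matrix, for which \<open>stable\<close>
  gives no information on the spectral radius.\<close>

lemma stable_char_poly:
  assumes A: "A \<in> carrier_mat n n" and st: "stable A" and z: "cmod z \<ge> 1"
  shows "evp of_real z (char_poly A) \<noteq> 0"
proof -
  let ?A = "map_mat complex_of_real A"
  have cA: "?A \<in> carrier_mat n n" using A by simp
  have cp: "map_poly of_real (char_poly A) = char_poly ?A"
    using of_real_hom.char_poly_hom[OF A, where ?'a = complex] by simp
  show ?thesis
  proof
    assume "evp of_real z (char_poly A) = 0"
    then have "poly (char_poly ?A) z = 0" by (simp add: evp_def cp)
    then have z': "z \<in> spectrum ?A" using spectrum_root_char_poly[OF cA] by simp
    then have "n > 0" using card_finite_spectrum[OF cA] by (cases n) auto
    then have "spectral_radius ?A < 1" using st A by (auto simp: stable_def)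
    moreover have "norm z \<le> spectral_radius ?A"
      by (rule spectral_radius_mem_max(2)[OF cA \<open>n > 0\<close>]) (use z' in auto)
    ultimately show False using z by simp
  qed
qed

definition resolvent :: "real mat \<Rightarrow> tf" where
  "resolvent A = minv (zvar \<cdot>\<^sub>m 1\<^sub>m (dim_row A) - map_mat const A)"

text \<open>The inverse is given by Cramer's rule, as the adjugate of the characteristic matrix
  divided by the characteristic polynomial. The only denominator is therefore
  \<open>char_poly A\<close>, which has no root of modulus 1 or more.\<close>

lemma resolvent:
  assumes A: "A \<in> carrier_mat n n" and st: "stable A" and z: "cmod z \<ge> 1"
  shows "resolvent A \<in> carrier_mat n n" "regm z (resolvent A)"
    "(z \<cdot>\<^sub>m 1\<^sub>m n - map_mat of_real A) * ev z (resolvent A) = 1\<^sub>m n"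
proof -
  let ?P = "char_poly_matrix A"
  define M where "M = zvar \<cdot>\<^sub>m 1\<^sub>m n - map_mat const A"
  have M: "M \<in> carrier_mat n n" unfolding M_def by (rule minus_carrier_mat) (use A in simp)
  have P: "?P \<in> carrier_mat n n" using A by simp
  have "comm_ring_hom (to_fract :: real poly \<Rightarrow> _)" by unfold_locales simp_all
  then interpret tf: comm_ring_hom "to_fract :: real poly \<Rightarrow> real poly fract" .
  have MP: "map_mat to_fract ?P = M"
  proof (rule eq_matI)
    fix i j assume "i < dim_row M" "j < dim_col M"
    then have "i < n" "j < n" using M by auto
    then show "map_mat to_fract ?P $$ (i,j) = M $$ (i,j)"
      using A by (auto simp: M_def char_poly_matrix_def zvar_def const_def simp flip: to_fract_diff to_fract_uminus)
  qed (use M P in auto)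
  define d where "d = to_fract (char_poly A)"
  define W where "W = inverse d \<cdot>\<^sub>m map_mat to_fract (adj_mat ?P)"
  have W: "W \<in> carrier_mat n n" using adj_mat(1)[OF P] by (simp add: W_def)
  have "char_poly A \<noteq> 0" using stable_char_poly[OF A st, of 1] by (auto simp: evp_def)
  then have d0: "d \<noteq> 0" by (simp add: d_def)
  have one: "inverse d \<cdot>\<^sub>m (map_mat to_fract (det ?P \<cdot>\<^sub>m 1\<^sub>m n)) = 1\<^sub>m n"
    using d0 by (intro eq_matI) (auto simp: d_def char_poly_def)
  have adj: "map_mat to_fract (adj_mat ?P) \<in> carrier_mat n n" using adj_mat(1)[OF P] by simp
  have "M * W = inverse d \<cdot>\<^sub>m (M * map_mat to_fract (adj_mat ?P))"
    unfolding W_def by (rule mult_smult_distrib[OF M adj])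
  also have "M * map_mat to_fract (adj_mat ?P) = map_mat to_fract (?P * adj_mat ?P)"
    unfolding MP[symmetric] by (rule tf.mat_hom_mult[OF P adj_mat(1)[OF P], symmetric])
  finally have MW: "M * W = 1\<^sub>m n" unfolding adj_mat(2)[OF P] one .
  have "W * M = inverse d \<cdot>\<^sub>m (map_mat to_fract (adj_mat ?P) * M)"
    unfolding W_def by (rule mult_smult_assoc_mat[OF adj M])
  also have "map_mat to_fract (adj_mat ?P) * M = map_mat to_fract (adj_mat ?P * ?P)"
    unfolding MP[symmetric] by (rule tf.mat_hom_mult[OF adj_mat(1)[OF P] P, symmetric])
  finally have WM: "W * M = 1\<^sub>m n" unfolding adj_mat(3)[OF P] one .
  have res: "resolvent A = W"
    using minv_inverse[OF M W MW WM] A by (simp add: resolvent_def M_def)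
  have "evp of_real z (char_poly A) \<noteq> 0" by (rule stable_char_poly[OF A st z])
  then have rd: "reg of_real z (inverse d)"
    unfolding d_def using reg_to_fract[OF field_hom_of_real] by (intro creg_inverse) auto
  have rW: "regm z W"
    unfolding W_def by (rule ev_smult(1)[OF rd]) (simp add: regm_def reg_to_fract[OF field_hom_of_real])
  show "resolvent A \<in> carrier_mat n n" "regm z (resolvent A)" unfolding res by (rule W, rule rW)
  have z1: "regm z (zvar \<cdot>\<^sub>m 1\<^sub>m n)" "ev z (zvar \<cdot>\<^sub>m 1\<^sub>m n) = z \<cdot>\<^sub>m 1\<^sub>m n"
    using ev_smult[OF creg_zvar(1) ev_one(1), of z n] by (simp_all add: creg_zvar ev_one)
  have rM: "regm z M" "ev z M = z \<cdot>\<^sub>m 1\<^sub>m n - map_mat of_real A"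
    unfolding M_def using ev_diff[OF z1(1) ev_map_const(1)[of z A]] A by (simp_all add: z1 ev_map_const)
  have "ev z (M * W) = ev z M * ev z W" by (rule ev_mult[OF rM(1) rW]) (use M W in auto)
  then show "(z \<cdot>\<^sub>m 1\<^sub>m n - map_mat of_real A) * ev z (resolvent A) = 1\<^sub>m n"
    unfolding MW rM(2) res ev_one by simp
qed

lemma state_space_regm:
  assumes A: "A \<in> carrier_mat n n" "stable A" and B: "B \<in> carrier_mat n m"
    and C: "C \<in> carrier_mat l n" and D: "D \<in> carrier_mat l m" and z: "cmod z \<ge> 1"
  shows "state_space A B C D \<in> carrier_mat l m" "regm z (state_space A B C D)"
    "ev z (state_space A B C D) = map_mat of_real C * ev z (resolvent A) * map_mat of_real B + map_mat of_real D"
proof -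
  note r = resolvent[OF A z]
  have ss: "state_space A B C D = map_mat const C * resolvent A * map_mat const B + map_mat const D"
    by (simp add: state_space_def resolvent_def)
  show "state_space A B C D \<in> carrier_mat l m" unfolding ss using B C D r by auto
  note 1 = ev_mult[OF ev_map_const(1)[of z C] r(2)]
  note 2 = ev_mult[OF 1(1) ev_map_const(1)[of z B]]
  note 3 = ev_add[OF 2(1) ev_map_const(1)[of z D]]
  show "regm z (state_space A B C D)" unfolding ss
    by (rule 3(1)) (use B C D r in auto)
  have "ev z (state_space A B C D) = ev z (map_mat const C * resolvent A * map_mat const B) + ev z (map_mat const D)"
    unfolding ss by (rule 3(2)) (use B C D r in auto)
  also have "ev z (map_mat const C * resolvent A * map_mat const B)
      = ev z (map_mat const C * resolvent A) * ev z (map_mat const B)"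
    by (rule 2(2)) (use B C D r in auto)
  also have "ev z (map_mat const C * resolvent A) = ev z (map_mat const C) * ev z (resolvent A)"
    by (rule 1(2)) (use B C D r in auto)
  finally show "ev z (state_space A B C D)
      = map_mat of_real C * ev z (resolvent A) * map_mat of_real B + map_mat of_real D"
    unfolding ev_map_const .
qed

section \<open>Decay of matrix powers and Markov parameters\<close>

text \<open>Entrywise decay is easier to hand on than \<open>stable\<close>: it passes at once to
  the transpose and to the block diagonal augmented matrix, where otherwise a spectral radius would
  have to be computed.\<close>

definition exp_decay :: "real mat \<Rightarrow> bool" where
  "exp_decay A \<longleftrightarrow> (\<exists>c r. c \<ge> 0 \<and> 0 < r \<and> r < 1 \<and>
     (\<forall>k. \<forall>i<dim_row A. \<forall>j<dim_row A. \<bar>(A ^\<^sub>m k) $$ (i,j)\<bar> \<le> c * r ^ k))"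

lemma smult_mat_pow:
  fixes A :: "'a :: comm_ring_1 mat"
  assumes "A \<in> carrier_mat n n"
  shows "(c \<cdot>\<^sub>m A) ^\<^sub>m k = c ^ k \<cdot>\<^sub>m (A ^\<^sub>m k)"
proof (induction k)
  case 0
  then show ?case using assms by (auto intro!: eq_matI)
next
  case (Suc k)
  have Ak: "A ^\<^sub>m k \<in> carrier_mat n n" using assms by simp
  have "(c \<cdot>\<^sub>m A) ^\<^sub>m Suc k = (c ^ k \<cdot>\<^sub>m (A ^\<^sub>m k)) * (c \<cdot>\<^sub>m A)" by (simp add: Suc)
  also have "\<dots> = c ^ k \<cdot>\<^sub>m (A ^\<^sub>m k * (c \<cdot>\<^sub>m A))"
    by (rule mult_smult_assoc_mat[OF Ak, of "c \<cdot>\<^sub>m A" n]) (use assms in simp)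
  also have "A ^\<^sub>m k * (c \<cdot>\<^sub>m A) = c \<cdot>\<^sub>m (A ^\<^sub>m k * A)" by (rule mult_smult_distrib[OF Ak assms])
  finally show ?case using Ak assms by (intro eq_matI) (auto simp: mult_ac)
qed

text \<open>Division by \<open>s\<close> brings the spectral radius below 1, and the powers of such
  a matrix are bounded.\<close>

lemma pow_mat_bound:
  fixes A :: "complex mat"
  assumes A: "A \<in> carrier_mat n n" and n: "n > 0" and s: "s > 0" "spectral_radius A < s"
  shows "\<exists>c. \<forall>k. \<forall>i<n. \<forall>j<n. norm ((A ^\<^sub>m k) $$ (i,j)) \<le> c * s ^ k"
proof -
  let ?B = "complex_of_real (1/s) \<cdot>\<^sub>m A"
  have cB: "?B \<in> carrier_mat n n" using A by simp
  have "spectral_radius ?B < 1"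
  proof -
    from spectral_radius_mem_max(1)[OF cB n] obtain k where
      k: "k \<in> spectrum ?B" "spectral_radius ?B = norm k" by auto
    then obtain v where v: "v \<in> carrier_vec n" "v \<noteq> 0\<^sub>v n" "?B *\<^sub>v v = k \<cdot>\<^sub>v v"
      using cB by (auto simp: spectrum_def eigenvalue_def eigenvector_def)
    have "A *\<^sub>v v = (of_real s * k) \<cdot>\<^sub>v v"
    proof -
      have "?B *\<^sub>v v = complex_of_real (1/s) \<cdot>\<^sub>v (A *\<^sub>v v)"
        using A v(1) by (intro eq_vecI) (auto simp: scalar_prod_def sum_distrib_left mult.assoc)
      then have "complex_of_real s \<cdot>\<^sub>v (complex_of_real (1/s) \<cdot>\<^sub>v (A *\<^sub>v v)) = of_real s \<cdot>\<^sub>v (k \<cdot>\<^sub>v v)"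
        using v(3) by simp
      then show ?thesis using s(1) by (simp add: smult_smult_assoc)
    qed
    then have "eigenvalue A (of_real s * k)"
      using v A unfolding eigenvalue_def eigenvector_def by auto
    then have "norm (of_real s * k) \<le> spectral_radius A"
      by (intro spectral_radius_mem_max(2)[OF A n]) (auto simp: spectrum_def)
    then have "s * norm k \<le> spectral_radius A" using s(1) by (simp add: norm_mult)
    also have "\<dots> < s * 1" using s(2) by simp
    finally show ?thesis using s(1) k(2) by simp
  qed
  from spectral_radius_jnf_norm_bound_less_1_upper_triangular[OF cB this] obtain c where
    c: "\<And>k. norm_bound (?B ^\<^sub>m k) c" by blast
  have "norm ((A ^\<^sub>m k) $$ (i,j)) \<le> c * s ^ k" if "i < n" "j < n" for k i j
  proof -
    have "?B ^\<^sub>m k \<in> carrier_mat n n" using cB by (rule pow_carrier_mat)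
    then have "norm ((?B ^\<^sub>m k) $$ (i,j)) \<le> c"
      using c[of k] that unfolding norm_bound_def by (metis carrier_matD)
    moreover have "norm ((?B ^\<^sub>m k) $$ (i,j)) = (1/s) ^ k * norm ((A ^\<^sub>m k) $$ (i,j))"
      unfolding smult_mat_pow[OF A] using that A s(1) by (simp add: norm_mult norm_power norm_divide)
    ultimately have "(1/s) ^ k * norm ((A ^\<^sub>m k) $$ (i,j)) \<le> c" by simp
    then show ?thesis using s(1) by (simp add: field_simps power_divide)
  qed
  then show ?thesis by blast
qed

lemma pow_mat_add:
  fixes A :: "'a :: semiring_1 mat"
  assumes "A \<in> carrier_mat n n"
  shows "A ^\<^sub>m (i + j) = A ^\<^sub>m i * A ^\<^sub>m j"
proof (induction j)
  case 0
  then show ?case using assms by simp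
next
  case (Suc j)
  then show ?case
    using assoc_mult_mat[OF pow_carrier_mat[OF assms] pow_carrier_mat[OF assms] assms, of i j] by simp
qed

lemma pow_mat_1:
  fixes A :: "'a :: semiring_1 mat"
  assumes "A \<in> carrier_mat n n"
  shows "A ^\<^sub>m 1 = A"
  using assms by simp

lemma pow_mat_commute:
  fixes A :: "'a :: semiring_1 mat"
  assumes "A \<in> carrier_mat n n"
  shows "A * A ^\<^sub>m k = A ^\<^sub>m k * A"
  using pow_mat_add[OF assms, of 1 k] pow_mat_add[OF assms, of k 1]
  unfolding pow_mat_1[OF assms] by (simp add: add.commute)

lemma stable_exp_decay:
  assumes A: "A \<in> carrier_mat n n" and st: "stable A"
  shows "exp_decay A"
proof (cases "n = 0")
  case True
  then show ?thesis using A unfolding exp_decay_def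
    by (intro exI[of _ 0] exI[of _ "1/2"]) auto
next
  case False
  let ?A = "map_mat complex_of_real A"
  have cA: "?A \<in> carrier_mat n n" using A by simp
  have sr: "spectral_radius ?A < 1" using st A False by (auto simp: stable_def)
  define s where "s = max (1/2) ((1 + spectral_radius ?A) / 2)"
  have s: "0 < s" "s < 1" "spectral_radius ?A < s" using sr by (simp_all add: s_def less_max_iff_disj)
  obtain c where c: "\<And>k i j. i < n \<Longrightarrow> j < n \<Longrightarrow> norm ((?A ^\<^sub>m k) $$ (i,j)) \<le> c * s ^ k"
    using pow_mat_bound[OF cA _ s(1,3)] False by auto
  have "\<bar>(A ^\<^sub>m k) $$ (i,j)\<bar> \<le> \<bar>c\<bar> * s ^ k" if "i < n" "j < n" for k i j
  proof -
    have "?A ^\<^sub>m k = map_mat complex_of_real (A ^\<^sub>m k)"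
      using of_real_hom.mat_hom_pow[OF A, where ?'a = complex] by simp
    then have "\<bar>(A ^\<^sub>m k) $$ (i,j)\<bar> \<le> c * s ^ k" using c[OF that, of k] that A by simp
    also have "\<dots> \<le> \<bar>c\<bar> * s ^ k" using s(1) by (intro mult_right_mono) auto
    finally show ?thesis .
  qed
  then show ?thesis using A s unfolding exp_decay_def
    by (intro exI[of _ "\<bar>c\<bar>"] exI[of _ s]) auto
qed

lemma exp_decay_markov:
  assumes A: "A \<in> carrier_mat n n" and d: "exp_decay A"
    and B: "B \<in> carrier_mat n m" and C: "C \<in> carrier_mat l n"
  shows "\<exists>c r. c \<ge> 0 \<and> 0 < r \<and> r < 1 \<and>
    (\<forall>k. \<forall>a<l. \<forall>b<m. \<bar>(C * A ^\<^sub>m k * B) $$ (a,b)\<bar> \<le> c * r ^ k)"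
proof -
  obtain c r where c: "c \<ge> 0" "0 < r" "r < 1"
    "\<And>k i j. i < n \<Longrightarrow> j < n \<Longrightarrow> \<bar>(A ^\<^sub>m k) $$ (i,j)\<bar> \<le> c * r ^ k"
    using d A unfolding exp_decay_def by auto
  define E where "E = (\<Sum>a<l. \<Sum>i<n. \<bar>C $$ (a,i)\<bar>) * (\<Sum>j<n. \<Sum>b<m. \<bar>B $$ (j,b)\<bar>)"
  have "\<bar>(C * A ^\<^sub>m k * B) $$ (a,b)\<bar> \<le> (c * E) * r ^ k" if ab: "a < l" "b < m" for k a b
  proof -
    have Ak: "A ^\<^sub>m k \<in> carrier_mat n n" using A by simp
    have "(C * A ^\<^sub>m k * B) $$ (a,b) = (\<Sum>j<n. (\<Sum>i<n. C $$ (a,i) * (A ^\<^sub>m k) $$ (i,j)) * B $$ (j,b))"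
      using ab carrier_matD[OF Ak] carrier_matD[OF B] carrier_matD[OF C]
      by (simp add: times_index del: index_mult_mat(1) assoc_mult_mat)
    also have "\<bar>\<dots>\<bar> \<le> (\<Sum>j<n. (\<Sum>i<n. \<bar>C $$ (a,i)\<bar> * (c * r ^ k)) * \<bar>B $$ (j,b)\<bar>)"
    proof (intro order_trans[OF sum_abs] sum_mono)
      fix j assume j: "j \<in> {..<n}"
      have "\<bar>\<Sum>i<n. C $$ (a,i) * (A ^\<^sub>m k) $$ (i,j)\<bar> \<le> (\<Sum>i<n. \<bar>C $$ (a,i)\<bar> * (c * r ^ k))"
        using j by (intro order_trans[OF sum_abs] sum_mono) (auto simp: abs_mult intro!: mult_left_mono c)
      then show "\<bar>(\<Sum>i<n. C $$ (a,i) * (A ^\<^sub>m k) $$ (i,j)) * B $$ (j,b)\<bar>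
          \<le> (\<Sum>i<n. \<bar>C $$ (a,i)\<bar> * (c * r ^ k)) * \<bar>B $$ (j,b)\<bar>"
        by (simp only: abs_mult) (intro mult_right_mono, auto)
    qed
    also have "\<dots> = c * r ^ k * ((\<Sum>i<n. \<bar>C $$ (a,i)\<bar>) * (\<Sum>j<n. \<bar>B $$ (j,b)\<bar>))"
      unfolding sum_distrib_left[symmetric] sum_distrib_right[symmetric] by (simp only: mult_ac)
    also have "\<dots> \<le> c * r ^ k * E"
    proof (intro mult_left_mono)
      have 1: "(\<Sum>i<n. \<bar>C $$ (a,i)\<bar>) \<le> (\<Sum>a<l. \<Sum>i<n. \<bar>C $$ (a,i)\<bar>)"
        using ab by (intro member_le_sum) (auto intro: sum_nonneg)
      have 2: "(\<Sum>j<n. \<bar>B $$ (j,b)\<bar>) \<le> (\<Sum>j<n. \<Sum>b<m. \<bar>B $$ (j,b)\<bar>)"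
        using ab by (intro sum_mono member_le_sum) auto
      show "(\<Sum>i<n. \<bar>C $$ (a,i)\<bar>) * (\<Sum>j<n. \<bar>B $$ (j,b)\<bar>) \<le> E"
        unfolding E_def by (intro mult_mono 1 2 sum_nonneg) auto
    qed (use c in auto)
    finally show ?thesis by (simp add: mult_ac)
  qed
  moreover have "c * E \<ge> 0" using c(1) unfolding E_def by (intro mult_nonneg_nonneg sum_nonneg) auto
  ultimately show ?thesis using c by (intro exI[of _ "c * E"] exI[of _ r]) auto
qed

text \<open>The resolvent \<open>W\<close> satisfies \<open>z W = I + A W\<close>. Iteration gives a
  telescoping sum with remainder \<open>C A^K W B / z^K\<close>, which tends to 0 by the decay of
  the powers of \<open>A\<close>, on the circle itself as well.\<close>

lemma markov_sums:
  assumes A: "A \<in> carrier_mat n n" "stable A" and B: "B \<in> carrier_mat n m"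
    and C: "C \<in> carrier_mat l n" and z: "cmod z = 1" and ab: "a < l" "b < m"
  shows "(\<lambda>k. of_real ((C * A ^\<^sub>m k * B) $$ (a,b)) / z ^ Suc k) sums
    (map_mat of_real C * ev z (resolvent A) * map_mat of_real B) $$ (a,b)"
proof -
  have z': "cmod z \<ge> 1" "z \<noteq> 0" using z by auto
  define W where "W = ev z (resolvent A)"
  let ?A = "map_mat complex_of_real A" and ?B = "map_mat complex_of_real B"
  have cA: "?A \<in> carrier_mat n n" and cB: "?B \<in> carrier_mat n m" using A B by auto
  have W: "W \<in> carrier_mat n n" unfolding W_def by (rule ev_carrier[OF resolvent(1)[OF A z'(1)]])
  have eq: "z \<cdot>\<^sub>m W = 1\<^sub>m n + ?A * W"
  proof -
    have "(z \<cdot>\<^sub>m 1\<^sub>m n - ?A) * W = (z \<cdot>\<^sub>m 1\<^sub>m n) * W - ?A * W"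
      by (rule minus_mult_distrib_mat[OF _ cA W]) simp
    also have "(z \<cdot>\<^sub>m 1\<^sub>m n) * W = z \<cdot>\<^sub>m W"
      using mult_smult_assoc_mat[of "1\<^sub>m n" n n W n z] W by simp
    finally have "z \<cdot>\<^sub>m W - ?A * W = 1\<^sub>m n" using resolvent(3)[OF A z'(1)] unfolding W_def by simp
    then have "(z \<cdot>\<^sub>m W - ?A * W) + ?A * W = 1\<^sub>m n + ?A * W" by simp
    moreover have "(z \<cdot>\<^sub>m W - ?A * W) + ?A * W = z \<cdot>\<^sub>m W"
      using W cA by (intro eq_matI) auto
    ultimately show ?thesis by simp
  qed
  define X where "X k = map_mat complex_of_real (C * A ^\<^sub>m k)" for k
  define x where "x k = (X k * (W * ?B)) $$ (a,b)" for k
  define M where "M k = complex_of_real ((C * A ^\<^sub>m k * B) $$ (a,b))" for k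
  have CAk: "C * A ^\<^sub>m k \<in> carrier_mat l n" for k by (rule mult_carrier_mat[OF C pow_carrier_mat[OF A(1)]])
  then have X: "X k \<in> carrier_mat l n" for k unfolding X_def by simp
  have WB: "W * ?B \<in> carrier_mat n m" using W cB by simp
  have step: "z * x k = M k + x (Suc k)" for k
  proof -
    have Ak: "A ^\<^sub>m k \<in> carrier_mat n n" using A by simp
    have CA: "C * A ^\<^sub>m k \<in> carrier_mat l n" using C Ak by simp
    have "X k * ?A = map_mat complex_of_real (C * A ^\<^sub>m k * A)"
      unfolding X_def by (rule of_real_hom.mat_hom_mult[OF CA A(1), symmetric])
    also have "C * A ^\<^sub>m k * A = C * A ^\<^sub>m Suc k" using assoc_mult_mat[OF C Ak A(1)] by simp
    finally have XA: "X k * ?A = X (Suc k)" unfolding X_def .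
    have XB: "X k * ?B = map_mat complex_of_real (C * A ^\<^sub>m k * B)"
      unfolding X_def by (rule of_real_hom.mat_hom_mult[OF CA B, symmetric])
    have "z \<cdot>\<^sub>m (X k * (W * ?B)) = X k * ((z \<cdot>\<^sub>m W) * ?B)"
      using mult_smult_distrib[OF X WB, of k z] mult_smult_assoc_mat[OF W cB, of z] by simp
    also have "(z \<cdot>\<^sub>m W) * ?B = ?B + ?A * (W * ?B)"
      unfolding eq using add_mult_distrib_mat[of "1\<^sub>m n" n n "?A * W" ?B m] cA cB W
      by (simp add: assoc_mult_mat[OF cA W cB])
    also have "X k * (?B + ?A * (W * ?B)) = X k * ?B + X k * (?A * (W * ?B))"
      by (rule mult_add_distrib_mat[OF X cB]) (use cA WB in simp)
    also have "X k * (?A * (W * ?B)) = X (Suc k) * (W * ?B)"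
      using assoc_mult_mat[OF X cA WB, of k] XA by simp
    finally have "z \<cdot>\<^sub>m (X k * (W * ?B)) = map_mat complex_of_real (C * A ^\<^sub>m k * B) + X (Suc k) * (W * ?B)"
      unfolding XB .
    then have "(z \<cdot>\<^sub>m (X k * (W * ?B))) $$ (a,b)
        = (map_mat complex_of_real (C * A ^\<^sub>m k * B) + X (Suc k) * (W * ?B)) $$ (a,b)" by simp
    moreover have "dim_row (X k) = l" "dim_row (X (Suc k)) = l" "dim_col (W * ?B) = m"
      using X WB by auto
    ultimately show ?thesis
      using ab B C by (simp add: x_def M_def del: index_mult_mat(1) assoc_mult_mat)
  qed
  have part: "(\<Sum>k<K. M k / z ^ Suc k) = x 0 - x K / z ^ K" for K
  proof (induction K)
    case (Suc K)
    have "x (Suc K) = z * x K - M K" using step[of K] by simp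
    then show ?case using Suc z'(2) by (simp add: diff_divide_distrib)
  qed simp
  have x0: "x \<longlonglongrightarrow> 0"
  proof -
    obtain c r where c: "c \<ge> 0" "0 < r" "r < 1"
      "\<And>k i j. i < l \<Longrightarrow> j < n \<Longrightarrow> \<bar>(C * A ^\<^sub>m k * 1\<^sub>m n) $$ (i,j)\<bar> \<le> c * r ^ k"
      using exp_decay_markov[OF A(1) stable_exp_decay[OF A] one_carrier_mat C] by blast
    have bnd: "norm (x k) \<le> (c * (\<Sum>j<n. norm ((W * ?B) $$ (j,b)))) * r ^ k" for k
    proof -
      have CA: "C * A ^\<^sub>m k \<in> carrier_mat l n" by (rule CAk)
      have "x k = (\<Sum>j<n. X k $$ (a,j) * (W * ?B) $$ (j,b))"
        unfolding x_def using times_index[of a "X k" b "W * ?B"] ab carrier_matD[OF X] carrier_matD[OF WB] by simp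
      also have "norm \<dots> \<le> (\<Sum>j<n. (c * r ^ k) * norm ((W * ?B) $$ (j,b)))"
      proof (intro sum_norm_le)
        fix j assume j: "j \<in> {..<n}"
        have "norm (X k $$ (a,j)) \<le> c * r ^ k"
        proof -
          have "X k $$ (a,j) = of_real ((C * A ^\<^sub>m k) $$ (a,j))"
            unfolding X_def by (rule index_map_mat(1)) (use j ab carrier_matD[OF CA] in auto)
          then have "norm (X k $$ (a,j)) = \<bar>(C * A ^\<^sub>m k) $$ (a,j)\<bar>" by simp
          then show ?thesis using c(4)[of a j k] j ab unfolding right_mult_one_mat[OF CA] by simp
        qed
        then show "norm (X k $$ (a,j) * (W * ?B) $$ (j,b)) \<le> (c * r ^ k) * norm ((W * ?B) $$ (j,b))"
          unfolding norm_mult by (intro mult_right_mono) auto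
      qed
      finally show ?thesis by (simp add: sum_distrib_left mult_ac)
    qed
    have "(\<lambda>k. (c * (\<Sum>j<n. norm ((W * ?B) $$ (j,b)))) * r ^ k) \<longlonglongrightarrow> 0"
      using c by (intro tendsto_mult_right_zero LIMSEQ_realpow_zero) auto
    then show ?thesis by (rule Lim_null_comparison[OF always_eventually, rotated]) (use bnd in blast)
  qed
  have "(\<lambda>K. x K / z ^ K) \<longlonglongrightarrow> 0"
    by (intro Lim_null_comparison[OF always_eventually tendsto_norm_zero[OF x0]])
      (auto simp: norm_divide norm_power z)
  then have "(\<lambda>K. \<Sum>k<K. M k / z ^ Suc k) \<longlonglongrightarrow> x 0 - 0"
    unfolding part by (intro tendsto_diff tendsto_const)
  moreover have "x 0 = (map_mat of_real C * W * ?B) $$ (a,b)"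
  proof -
    have "X 0 = map_mat of_real C" using A(1) C by (simp add: X_def)
    then show ?thesis using assoc_mult_mat[of "map_mat of_real C" l n W n ?B m] C W cB
      by (simp add: x_def del: index_mult_mat(1) assoc_mult_mat)
  qed
  ultimately show ?thesis unfolding sums_def M_def W_def by simp
qed

text \<open>The series for the resolvent was established on the circle only, so the coefficients are
  compared through \<open>laurent_unique\<close> and not through the definition of
  \<open>impulse\<close>. Without a direct term the expansion starts at 1/z, which accounts for
  \<open>Suc k\<close>.\<close>

lemma impulse_realization:
  assumes F: "realization n A B C F" "F \<in> RH_inf l m" and st: "stable A" and ab: "a < l" "b < m"
  shows "impulse (F $$ (a,b)) (Suc k) = (C * A ^\<^sub>m k * B) $$ (a,b)"
proof -
  have dF: "F \<in> carrier_mat l m" by (rule RH_inf_carrier[OF F(2)])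
  have A: "A \<in> carrier_mat n n" and B: "B \<in> carrier_mat n m" and C: "C \<in> carrier_mat l n"
    and Fs: "F = state_space A B C (0\<^sub>m l m)" using F(1) dF by (auto simp: realization_def)
  define h where "h i = (case i of 0 \<Rightarrow> 0 | Suc k \<Rightarrow> (C * A ^\<^sub>m k * B) $$ (a,b))" for i
  obtain c r where c: "c \<ge> 0" "0 < r" "r < 1"
    "\<And>k i j. i < l \<Longrightarrow> j < m \<Longrightarrow> \<bar>(C * A ^\<^sub>m k * B) $$ (i,j)\<bar> \<le> c * r ^ k"
    using exp_decay_markov[OF A stable_exp_decay[OF A st] B C] by blast
  have hb: "\<bar>h i\<bar> \<le> (c / r) * r ^ i" for i
    using c ab by (cases i) (auto simp: h_def)
  have hs: "(\<lambda>i. of_real (h i) / z ^ i) sums rat_eval (F $$ (a,b)) z" if z: "cmod z = 1" for z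
  proof -
    have "ev z F $$ (a,b) = (map_mat of_real C * ev z (resolvent A) * map_mat of_real B) $$ (a,b)"
      unfolding Fs using state_space_regm(3)[OF A st B C zero_carrier_mat, of z] ab B C z by simp
    then have "(\<lambda>k. of_real (h (Suc k)) / z ^ Suc k) sums rat_eval (F $$ (a,b)) z"
      using markov_sums[OF A st B C z ab] dF ab by (simp add: h_def ev_index)
    then show ?thesis by (subst (asm) sums_Suc_iff) (simp add: h_def)
  qed
  have "rh (F $$ (a,b))" using F(2) ab by (simp add: RH_inf_iff)
  then have 1: "laurent (\<lambda>k. if k \<le> 0 then of_real (impulse (F $$ (a,b)) (nat (- k))) else 0) (rat_eval (F $$ (a,b)))"
    by (rule laurent_rh)
  have 2: "laurent (\<lambda>k. if k \<le> 0 then of_real (h (nat (- k))) else 0) (rat_eval (F $$ (a,b)))"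
    using hb c(2,3) hs by (rule laurent_causal)
  have "complex_of_real (impulse (F $$ (a,b)) (Suc k)) = of_real (h (Suc k))"
    using fun_cong[OF laurent_unique[OF 1 2], of "- int (Suc k)"] by (simp add: nat_add_distrib)
  then show ?thesis by (simp add: h_def)
qed

section \<open>Largest singular values\<close>

definition cip :: "complex vec \<Rightarrow> complex vec \<Rightarrow> complex" where
  "cip x y = (\<Sum>i<dim_vec y. cnj (x $ i) * y $ i)"

lemma cip_self: "cip x x = of_real (sq_norm x)"
  by (simp add: cip_def sq_norm_def complex_norm_square mult.commute del: of_real_power)

lemma sq_norm_nonneg: "sq_norm v \<ge> 0"
  by (simp add: sq_norm_def sum_nonneg)

lemma sq_norm_pos: "v \<in> carrier_vec n \<Longrightarrow> v \<noteq> 0\<^sub>v n \<Longrightarrow> sq_norm v > 0"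
proof (rule ccontr)
  assume v: "v \<in> carrier_vec n" "v \<noteq> 0\<^sub>v n" and "\<not> sq_norm v > 0"
  then have "sq_norm v = 0" using sq_norm_nonneg[of v] by linarith
  then have "\<forall>i<n. v $ i = 0" using v(1) unfolding sq_norm_def by (subst (asm) sum_nonneg_eq_0_iff) auto
  then have "v = 0\<^sub>v n" using v(1) by (intro eq_vecI) auto
  with v(2) show False by simp
qed

lemma cip_Cauchy: "dim_vec x = dim_vec y \<Longrightarrow> (norm (cip x y))\<^sup>2 \<le> sq_norm x * sq_norm y"
proof -
  assume d: "dim_vec x = dim_vec y"
  have "norm (cip x y) \<le> (\<Sum>i<dim_vec y. norm (x $ i) * norm (y $ i))"
    unfolding cip_def by (rule order_trans[OF norm_sum]) (simp add: norm_mult)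
  then have "(norm (cip x y))\<^sup>2 \<le> (\<Sum>i<dim_vec y. norm (x $ i) * norm (y $ i))\<^sup>2"
    by (intro power_mono) auto
  also have "\<dots> \<le> sq_norm x * sq_norm y"
    unfolding sq_norm_def d by (rule Cauchy_Schwarz_ineq_sum)
  finally show ?thesis .
qed

lemma mult_vec_index: "i < dim_row M \<Longrightarrow> dim_vec x = dim_col M \<Longrightarrow>
    (M *\<^sub>v x) $ i = (\<Sum>j<dim_col M. M $$ (i,j) * x $ j)"
  by (simp add: scalar_prod_def atLeast0LessThan)

lemma mat_adjoint_carrier: "(M :: complex mat) \<in> carrier_mat q p \<Longrightarrow> mat_adjoint M \<in> carrier_mat p q"
  by (simp add: mat_adjoint_altdef)

lemma adjoint_gram_carrier: "(M :: complex mat) \<in> carrier_mat q p \<Longrightarrow> mat_adjoint M * M \<in> carrier_mat p p"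
  by (rule mult_carrier_mat[OF mat_adjoint_carrier])

lemma cip_adjoint:
  assumes M: "M \<in> carrier_mat q p" and x: "x \<in> carrier_vec q" and y: "y \<in> carrier_vec p"
  shows "cip y (mat_adjoint M *\<^sub>v x) = cip (M *\<^sub>v y) x"
proof -
  have d: "dim_row (mat_adjoint M) = p" "dim_col (mat_adjoint M) = q" using M by (simp_all add: mat_adjoint_altdef)
  have "cip y (mat_adjoint M *\<^sub>v x) = (\<Sum>i<p. \<Sum>a<q. cnj (y $ i) * (cnj (M $$ (a,i)) * x $ a))"
    unfolding cip_def using M x by (simp add: d mult_vec_index sum_distrib_left mat_adjoint_altdef del: index_mult_mat_vec)
  also have "\<dots> = (\<Sum>a<q. \<Sum>i<p. cnj (y $ i) * (cnj (M $$ (a,i)) * x $ a))" by (rule sum.swap)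
  also have "\<dots> = cip (M *\<^sub>v y) x"
    unfolding cip_def using M x y
    by (simp add: mult_vec_index sum_distrib_right sum_distrib_left mult_ac del: index_mult_mat_vec)
  finally show ?thesis .
qed

lemma cip_gram:
  assumes M: "M \<in> carrier_mat q p" and u: "u \<in> carrier_vec p" and y: "y \<in> carrier_vec p"
  shows "cip y ((mat_adjoint M * M) *\<^sub>v u) = cip (M *\<^sub>v y) (M *\<^sub>v u)"
proof -
  have a: "mat_adjoint M \<in> carrier_mat p q" using M by (simp add: mat_adjoint_altdef)
  have "(mat_adjoint M * M) *\<^sub>v u = mat_adjoint M *\<^sub>v (M *\<^sub>v u)" by (rule assoc_mult_mat_vec[OF a M u])
  then show ?thesis using cip_adjoint[OF M _ y, of "M *\<^sub>v u"] M u by simp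
qed

text \<open>The spectral radius of the Gram matrix is attained at an eigenvalue, and for an
  eigenvector \<open>v\<close> this eigenvalue is the quotient of the squared lengths of
  \<open>M v\<close> and \<open>v\<close>.\<close>

lemma lsv_le:
  assumes M: "M \<in> carrier_mat q p" and p: "p \<ge> 1" and \<rho>: "\<rho> \<ge> 0"
    and b: "\<And>u. u \<in> carrier_vec p \<Longrightarrow> sq_norm (M *\<^sub>v u) \<le> \<rho>\<^sup>2 * sq_norm u"
  shows "largest_singular_value M \<le> \<rho>"
proof -
  let ?H = "mat_adjoint M * M"
  have H: "?H \<in> carrier_mat p p" by (rule adjoint_gram_carrier[OF M])
  from spectral_radius_mem_max(1)[OF H] p obtain k where
    k: "k \<in> spectrum ?H" "spectral_radius ?H = norm k" by auto
  then obtain v where v: "v \<in> carrier_vec p" "v \<noteq> 0\<^sub>v p" "?H *\<^sub>v v = k \<cdot>\<^sub>v v"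
    using H by (auto simp: spectrum_def eigenvalue_def eigenvector_def)
  have "k * of_real (sq_norm v) = cip v (k \<cdot>\<^sub>v v)"
    unfolding cip_self[symmetric] by (simp add: cip_def sum_distrib_left mult_ac)
  also have "\<dots> = of_real (sq_norm (M *\<^sub>v v))" using cip_gram[OF M v(1) v(1)] v(3) by (simp add: cip_self)
  finally have "norm (k * of_real (sq_norm v)) = norm (complex_of_real (sq_norm (M *\<^sub>v v)))" by simp
  then have "norm k * sq_norm v = sq_norm (M *\<^sub>v v)"
    by (simp only: norm_mult norm_of_real abs_of_nonneg[OF sq_norm_nonneg])
  also have "\<dots> \<le> \<rho>\<^sup>2 * sq_norm v" by (rule b[OF v(1)])
  finally have "norm k \<le> \<rho>\<^sup>2" using sq_norm_pos[OF v(1,2)] by simp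
  then show ?thesis unfolding largest_singular_value_def k(2) using \<rho> by (intro real_le_lsqrt) auto
qed

lemma power_bounded_imp_le_one:
  fixes x :: real
  assumes "x \<ge> 0" "\<And>j::nat. x ^ (2 ^ j) \<le> C"
  shows "x \<le> 1"
proof (rule ccontr)
  assume "\<not> x \<le> 1"
  then have x: "x > 1" by simp
  obtain n where n: "C < x ^ n" using real_arch_pow[OF x] by blast
  have "n \<le> 2 ^ n" by (simp add: less_imp_le)
  then have "x ^ n \<le> x ^ (2 ^ n)" using x by (intro power_increasing) auto
  with n assms(2)[of n] show False by linarith
qed

lemma cip_gram_pow:
  assumes M: "M \<in> carrier_mat q p" and x: "x \<in> carrier_vec p" and y: "y \<in> carrier_vec p"
  shows "cip ((mat_adjoint M * M) ^\<^sub>m k *\<^sub>v y) x = cip y ((mat_adjoint M * M) ^\<^sub>m k *\<^sub>v x)"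
  using x y
proof (induction k arbitrary: x y)
  case 0
  then show ?case using M by (simp add: mat_adjoint_altdef)
next
  case (Suc k)
  let ?H = "mat_adjoint M * M"
  have H: "?H \<in> carrier_mat p p" by (rule adjoint_gram_carrier[OF M])
  then have Hk: "?H ^\<^sub>m k \<in> carrier_mat p p" by simp
  have H1: "cip (?H *\<^sub>v a) b = cip a (?H *\<^sub>v b)" if "a \<in> carrier_vec p" "b \<in> carrier_vec p" for a b
  proof -
    have sym: "cip r s = cnj (cip s r)" if "dim_vec r = dim_vec s" for r s
      using that by (simp add: cip_def mult.commute)
    have "cip (?H *\<^sub>v a) b = cnj (cip b (?H *\<^sub>v a))" by (rule sym) (use that H in auto)
    also have "\<dots> = cnj (cip (M *\<^sub>v b) (M *\<^sub>v a))" using cip_gram[OF M that(1,2)] by simp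
    also have "\<dots> = cip (M *\<^sub>v a) (M *\<^sub>v b)" by (rule sym[symmetric]) simp
    also have "\<dots> = cip a (?H *\<^sub>v b)" using cip_gram[OF M that(2,1)] by simp
    finally show ?thesis .
  qed
  have Hx: "?H *\<^sub>v x \<in> carrier_vec p" "?H *\<^sub>v y \<in> carrier_vec p" "?H ^\<^sub>m k *\<^sub>v x \<in> carrier_vec p" using mult_mat_vec_carrier[OF H] mult_mat_vec_carrier[OF Hk] Suc.prems by blast+
  have e: "?H ^\<^sub>m Suc k *\<^sub>v a = ?H ^\<^sub>m k *\<^sub>v (?H *\<^sub>v a)" if "a \<in> carrier_vec p" for a
    using assoc_mult_mat_vec[OF Hk H that] by simp
  have e': "?H *\<^sub>v (?H ^\<^sub>m k *\<^sub>v a) = ?H ^\<^sub>m k *\<^sub>v (?H *\<^sub>v a)" if a: "a \<in> carrier_vec p" for a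
    using assoc_mult_mat_vec[OF H Hk a] assoc_mult_mat_vec[OF Hk H a] unfolding pow_mat_commute[OF H] by simp
  have "cip (?H ^\<^sub>m Suc k *\<^sub>v y) x = cip (?H *\<^sub>v y) (?H ^\<^sub>m k *\<^sub>v x)"
    unfolding e[OF Suc.prems(2)] by (rule Suc.IH[OF Suc.prems(1) Hx(2)])
  also have "\<dots> = cip y (?H *\<^sub>v (?H ^\<^sub>m k *\<^sub>v x))" by (rule H1[OF Suc.prems(2) Hx(3)])
  finally show ?case unfolding e'[OF Suc.prems(1)] e[OF Suc.prems(1)] .
qed

text \<open>Power iteration takes the place of diagonalisation. For the Gram matrix
  \<open>?H\<close>, Cauchy-Schwarz bounds the power \<open>2 ^ j\<close> of
  \<open>f 1 / f 0\<close> by \<open>f (2 ^ j) / f 0\<close>, and the latter is at most a constant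
  times \<open>(r^2) ^ (2 ^ j)\<close> for every \<open>r\<close> above the spectral radius. Hence
  \<open>f 1 \<le> r^2 * f 0\<close>, and \<open>r\<close> tends to the spectral radius.\<close>

lemma lsv_ge:
  assumes M: "M \<in> carrier_mat q p" and p: "p \<ge> 1" and u: "u \<in> carrier_vec p"
  shows "sq_norm (M *\<^sub>v u) \<le> (largest_singular_value M)\<^sup>2 * sq_norm u"
proof -
  let ?H = "mat_adjoint M * M"
  have H: "?H \<in> carrier_mat p p" by (rule adjoint_gram_carrier[OF M])
  have Hk: "?H ^\<^sub>m k \<in> carrier_mat p p" for k using H by simp
  have "spectral_radius ?H \<ge> 0"
    using spectral_radius_mem_max(1)[OF H] p by auto
  then have sr: "(largest_singular_value M)\<^sup>2 = spectral_radius ?H"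
    by (simp add: largest_singular_value_def)
  define f where "f k = sq_norm (?H ^\<^sub>m k *\<^sub>v u)" for k
  have f0: "f 0 = sq_norm u" using carrier_matD(1)[OF H] u by (simp add: f_def del: index_mult_mat(2))
  \<comment> \<open>Self-adjointness moves \<open>m\<close> of the factors across the inner product
    before Cauchy-Schwarz is applied.\<close>
  have f2: "(f m)\<^sup>2 \<le> f 0 * f (m + m)" for m
  proof -
    have "cip (?H ^\<^sub>m m *\<^sub>v u) (?H ^\<^sub>m m *\<^sub>v u) = cip u (?H ^\<^sub>m m *\<^sub>v (?H ^\<^sub>m m *\<^sub>v u))"
      by (rule cip_gram_pow[OF M mult_mat_vec_carrier[OF Hk u] u])
    also have "?H ^\<^sub>m m *\<^sub>v (?H ^\<^sub>m m *\<^sub>v u) = ?H ^\<^sub>m (m + m) *\<^sub>v u"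
      using assoc_mult_mat_vec[OF Hk Hk u] pow_mat_add[OF H] by metis
    finally have "of_real (f m) = cip u (?H ^\<^sub>m (m + m) *\<^sub>v u)" unfolding cip_self f_def .
    then have "(norm (complex_of_real (f m)))\<^sup>2 \<le> f 0 * f (m + m)"
      using cip_Cauchy[of u "?H ^\<^sub>m (m + m) *\<^sub>v u"] Hk[of "m + m"] u unfolding f0 f_def by auto
    then show ?thesis by simp
  qed
  have Mu: "(sq_norm (M *\<^sub>v u))\<^sup>2 \<le> f 0 * f 1"
  proof -
    have "of_real (sq_norm (M *\<^sub>v u)) = cip u (?H *\<^sub>v u)" using cip_gram[OF M u u] by (simp add: cip_self)
    then have "(norm (complex_of_real (sq_norm (M *\<^sub>v u))))\<^sup>2 \<le> f 0 * f 1"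
      using cip_Cauchy[of u "?H *\<^sub>v u"] H u unfolding f0 f_def pow_mat_1[OF H] by (auto)
    then show ?thesis by simp
  qed
  show ?thesis
  proof (cases "f 0 = 0")
    case True
    then show ?thesis using Mu f0 sq_norm_nonneg[of "M *\<^sub>v u"] by simp
  next
    case False
    then have f0p: "f 0 > 0" using f0 sq_norm_nonneg[of u] by simp
    have "sq_norm (M *\<^sub>v u) \<le> r * f 0" if r: "r > spectral_radius ?H" for r
    proof -
      have r0: "r > 0" using r \<open>spectral_radius ?H \<ge> 0\<close> by linarith
      obtain c where c: "\<And>k i j. i < p \<Longrightarrow> j < p \<Longrightarrow> norm ((?H ^\<^sub>m k) $$ (i,j)) \<le> c * r ^ k"
        using pow_mat_bound[OF H _ r0 r] p by auto
      define S where "S = (\<Sum>j<p. norm (u $ j))"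
      have fb: "f k \<le> (real p * (c * S)\<^sup>2) * (r\<^sup>2) ^ k" for k
      proof -
        have "norm ((?H ^\<^sub>m k *\<^sub>v u) $ i) \<le> (c * S) * r ^ k" if i: "i < p" for i
        proof -
          have "(?H ^\<^sub>m k *\<^sub>v u) $ i = (\<Sum>j<p. (?H ^\<^sub>m k) $$ (i,j) * u $ j)"
            using mult_vec_index[of i "?H ^\<^sub>m k" u] Hk[of k] u i by (metis carrier_matD carrier_vecD)
          also have "norm \<dots> \<le> (\<Sum>j<p. c * r ^ k * norm (u $ j))"
            using c[OF i] by (intro sum_norm_le) (auto simp: norm_mult intro!: mult_right_mono)
          finally show ?thesis by (simp add: S_def sum_distrib_left mult_ac)
        qed
        then have "(\<Sum>i<p. (norm ((?H ^\<^sub>m k *\<^sub>v u) $ i))\<^sup>2) \<le> (\<Sum>i<p. ((c * S) * r ^ k)\<^sup>2)"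
          by (intro sum_mono power_mono) (simp_all del: index_mult_mat_vec)
        then have "f k \<le> (\<Sum>i<p. ((c * S) * r ^ k)\<^sup>2)"
          unfolding f_def sq_norm_def carrier_vecD[OF mult_mat_vec_carrier[OF Hk u]] .
        also have "\<dots> = (real p * (c * S)\<^sup>2) * (r\<^sup>2) ^ k"
          by (simp add: power_mult_distrib power_mult[symmetric] mult.commute)
        finally show ?thesis .
      qed
      define g where "g k = f k / f 0" for k
      have g2: "g 1 ^ (2 ^ j) \<le> g (2 ^ j)" for j
      proof (induction j)
        case (Suc j)
        have gn: "g k \<ge> 0" for k unfolding g_def f_def using f0p by (simp add: sq_norm_nonneg)
        have "g 1 ^ (2 ^ Suc j) = (g 1 ^ (2 ^ j))\<^sup>2" by (simp add: power_mult[symmetric] mult.commute)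
        also have "\<dots> \<le> (g (2 ^ j))\<^sup>2" using Suc gn[of 1] by (intro power_mono) auto
        also have "\<dots> \<le> g (2 ^ Suc j)"
        proof -
          have "(g (2 ^ j))\<^sup>2 = (f (2 ^ j))\<^sup>2 / (f 0)\<^sup>2" by (simp add: g_def power_divide)
          also have "\<dots> \<le> f 0 * f (2 ^ j + 2 ^ j) / (f 0)\<^sup>2" by (intro divide_right_mono f2) simp
          also have "\<dots> = g (2 ^ Suc j)" using f0p by (simp add: g_def power2_eq_square mult_2)
          finally show ?thesis .
        qed
        finally show ?case .
      qed simp
      have "g 1 / r\<^sup>2 \<le> 1"
      proof (rule power_bounded_imp_le_one)
        show "g 1 / r\<^sup>2 \<ge> 0" unfolding g_def f_def using f0p by (simp add: sq_norm_nonneg)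
        fix j :: nat
        have "(g 1 / r\<^sup>2) ^ (2 ^ j) \<le> g (2 ^ j) / (r\<^sup>2) ^ (2 ^ j)"
          unfolding power_divide using g2 by (intro divide_right_mono) auto
        also have "\<dots> \<le> (real p * (c * S)\<^sup>2) / f 0"
          using fb[of "2 ^ j"] f0p r0 by (simp add: g_def field_simps)
        finally show "(g 1 / r\<^sup>2) ^ (2 ^ j) \<le> (real p * (c * S)\<^sup>2) / f 0" .
      qed
      then have "f 1 \<le> r\<^sup>2 * f 0" using r0 f0p by (simp add: g_def field_simps)
      then have "f 0 * f 1 \<le> f 0 * (r\<^sup>2 * f 0)" using f0p by (intro mult_left_mono) auto
      then have "(sq_norm (M *\<^sub>v u))\<^sup>2 \<le> (r * f 0)\<^sup>2" using Mu by (simp add: power2_eq_square mult_ac)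
      then show ?thesis by (rule power2_le_imp_le) (use r0 f0p in simp)
    qed
    then have "sq_norm (M *\<^sub>v u) / f 0 \<le> r" if "r > spectral_radius ?H" for r
      using that f0p by (simp add: divide_le_eq)
    then have "sq_norm (M *\<^sub>v u) / f 0 \<le> spectral_radius ?H" by (rule dense_ge)
    then show ?thesis unfolding sr using f0p f0 by (simp add: divide_le_eq)
  qed
qed

lemma lsv_nonneg:
  assumes "M \<in> carrier_mat q p" "p \<ge> 1"
  shows "largest_singular_value M \<ge> 0"
proof -
  have H: "mat_adjoint M * M \<in> carrier_mat p p" by (rule adjoint_gram_carrier[OF assms(1)])
  then show ?thesis using spectral_radius_mem_max(1)[OF H] assms(2)
    by (auto simp: largest_singular_value_def)
qed

lemma sq_norm_mult_iff_bdd_form: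
  assumes M: "M \<in> carrier_mat q p" and \<rho>: "\<rho> \<ge> 0"
  shows "(\<forall>u\<in>carrier_vec p. sq_norm (M *\<^sub>v u) \<le> \<rho>\<^sup>2 * sq_norm u) \<longleftrightarrow>
    bdd_form {..<q} {..<p} (\<lambda>a b. M $$ (a,b)) \<rho>"
proof -
  have e: "sq_norm (M *\<^sub>v u) = (\<Sum>a<q. (norm (\<Sum>b<p. M $$ (a,b) * u $ b))\<^sup>2)"
    "sq_norm u = (\<Sum>b<p. (norm (u $ b))\<^sup>2)" if "u \<in> carrier_vec p" for u
    using M that by (auto simp: sq_norm_def mult_vec_index simp del: index_mult_mat_vec)
  show ?thesis unfolding bdd_form_iff_quad[OF \<rho>]
  proof (intro iffI ballI allI)
    fix u :: "nat \<Rightarrow> complex"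
    assume "\<forall>u\<in>carrier_vec p. sq_norm (M *\<^sub>v u) \<le> \<rho>\<^sup>2 * sq_norm u"
    from bspec[OF this, of "vec p u"] show "(\<Sum>i<q. (norm (\<Sum>j<p. M $$ (i, j) * u j))\<^sup>2) \<le> \<rho>\<^sup>2 * (\<Sum>j<p. (norm (u j))\<^sup>2)"
      using e[of "vec p u"] by simp
  next
    fix u :: "complex vec"
    assume "\<forall>u. (\<Sum>i<q. (norm (\<Sum>j<p. M $$ (i, j) * u j))\<^sup>2) \<le> \<rho>\<^sup>2 * (\<Sum>j<p. (norm (u j))\<^sup>2)" "u \<in> carrier_vec p"
    then show "sq_norm (M *\<^sub>v u) \<le> \<rho>\<^sup>2 * sq_norm u" using e[of u] by simp
  qed
qed

lemma Linf_norm_le: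
  assumes F: "F \<in> carrier_mat q p" and p: "p \<ge> 1" and \<rho>: "\<rho> \<ge> 0"
    and b: "\<And>z u. cmod z = 1 \<Longrightarrow> u \<in> carrier_vec p \<Longrightarrow> sq_norm (ev z F *\<^sub>v u) \<le> \<rho>\<^sup>2 * sq_norm u"
  shows "Linf_norm F \<le> \<rho>"
  unfolding Linf_norm_def ev_def[symmetric]
proof (rule cSUP_least)
  show "sphere (0::complex) 1 \<noteq> {}" by (auto intro!: exI[of _ 1])
  show "largest_singular_value (ev z F) \<le> \<rho>" if "z \<in> sphere 0 1" for z
    using that by (intro lsv_le[OF ev_carrier[OF F] p \<rho> b]) auto
qed

lemma rat_eval_bounded:
  assumes "\<And>z. cmod z = 1 \<Longrightarrow> reg of_real z f"
  shows "\<exists>B. \<forall>z. cmod z = 1 \<longrightarrow> norm (rat_eval f z) \<le> B"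
proof -
  have "continuous_on (sphere 0 1) (\<lambda>z::complex. rat_eval f z)"
    unfolding rat_subst_def
    using assms by (intro continuous_intros) (auto simp: reg_def evp_def)
  then have "compact ((\<lambda>z. rat_eval f z) ` sphere 0 1)"
    by (intro compact_continuous_image compact_sphere)
  then obtain B where "\<And>x. x \<in> (\<lambda>z. rat_eval f z) ` sphere 0 1 \<Longrightarrow> norm x \<le> B"
    using compact_imp_bounded bounded_iff by metis
  then show ?thesis by (intro exI[of _ B]) auto
qed

text \<open>The supremum in \<open>Linf_norm\<close> can be used only for a bounded set of singular
  values; continuity of the entries on the compact circle provides the bound.\<close>

lemma ev_bounded:
  assumes F: "F \<in> carrier_mat q p" and r: "\<And>z. cmod z = 1 \<Longrightarrow> regm z F"
  shows "\<exists>B\<ge>0. \<forall>z. cmod z = 1 \<longrightarrow> bdd_form {..<q} {..<p} (\<lambda>a b. ev z F $$ (a,b)) B"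
proof -
  have "\<exists>B. \<forall>z. cmod z = 1 \<longrightarrow> norm (rat_eval (F $$ (a,b)) z) \<le> B" if "a < q" "b < p" for a b
    using that F r by (intro rat_eval_bounded) (auto simp: regm_def)
  then obtain B where B: "\<And>a b z. a < q \<Longrightarrow> b < p \<Longrightarrow> cmod z = 1 \<Longrightarrow> norm (rat_eval (F $$ (a,b)) z) \<le> B a b"
    by metis
  define E where "E = (\<Sum>a<q. \<Sum>b<p. \<bar>B a b\<bar>)"
  have E: "\<bar>B a b\<bar> \<le> E" if "a < q" "b < p" for a b
  proof -
    have "\<bar>B a b\<bar> \<le> (\<Sum>b<p. \<bar>B a b\<bar>)" using that by (intro member_le_sum) auto
    also have "\<dots> \<le> E" unfolding E_def using that by (intro member_le_sum) (auto intro: sum_nonneg)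
    finally show ?thesis .
  qed
  define G where "G = max (\<Sum>a<q. E\<^sup>2) (\<Sum>b<p. 1\<^sup>2)"
  have "bdd_form {..<q} {..<p} (\<lambda>a b. ev z F $$ (a,b)) G" if z: "cmod z = 1" for z
  proof (rule bdd_form_rank_one[of _ _ _ "\<lambda>_. E" "\<lambda>_. 1"])
    fix a b assume ab: "a \<in> {..<q}" "b \<in> {..<p}"
    then have "norm (rat_eval (F $$ (a,b)) z) \<le> E" using B[of a b z] E[of a b] z by fastforce
    then show "norm (ev z F $$ (a,b)) \<le> E * 1" using F ab by (simp add: ev_index)
  qed (simp_all add: G_def)
  moreover have "G \<ge> 0" by (simp add: G_def le_max_iff_disj)
  ultimately show ?thesis by blast
qed

lemma Linf_norm_ge:
  assumes F: "F \<in> carrier_mat q p" and p: "p \<ge> 1" and r: "\<And>z. cmod z = 1 \<Longrightarrow> regm z F"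
  shows "Linf_norm F \<ge> 0"
    and "\<And>z u. cmod z = 1 \<Longrightarrow> u \<in> carrier_vec p \<Longrightarrow> sq_norm (ev z F *\<^sub>v u) \<le> (Linf_norm F)\<^sup>2 * sq_norm u"
proof -
  obtain B where B: "B \<ge> 0" "\<And>z. cmod z = 1 \<Longrightarrow> bdd_form {..<q} {..<p} (\<lambda>a b. ev z F $$ (a,b)) B"
    using ev_bounded[OF F r] by blast
  have "bdd_above ((\<lambda>z. largest_singular_value (ev z F)) ` sphere 0 1)"
  proof (rule bdd_aboveI2)
    fix z :: complex assume "z \<in> sphere 0 1"
    then have "cmod z = 1" by simp
    from B(2)[OF this] sq_norm_mult_iff_bdd_form[OF ev_carrier[OF F] B(1), of z]
    show "largest_singular_value (ev z F) \<le> B" by (intro lsv_le[OF ev_carrier[OF F] p B(1)]) auto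
  qed
  then have le: "largest_singular_value (ev z F) \<le> Linf_norm F" if "cmod z = 1" for z
    unfolding Linf_norm_def ev_def[symmetric] using that by (intro cSUP_upper) auto
  have nn: "largest_singular_value (ev z F) \<ge> 0" for z by (rule lsv_nonneg[OF ev_carrier[OF F] p])
  show "Linf_norm F \<ge> 0" using le[of 1] nn[of 1] by simp
  fix z :: complex and u :: "complex vec" assume z: "cmod z = 1" and u: "u \<in> carrier_vec p"
  have "sq_norm (ev z F *\<^sub>v u) \<le> (largest_singular_value (ev z F))\<^sup>2 * sq_norm u"
    by (rule lsv_ge[OF ev_carrier[OF F] p u])
  also have "\<dots> \<le> (Linf_norm F)\<^sup>2 * sq_norm u"
    using le[OF z] nn by (intro mult_right_mono power_mono sq_norm_nonneg) auto
  finally show "sq_norm (ev z F *\<^sub>v u) \<le> (Linf_norm F)\<^sup>2 * sq_norm u" .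
qed

section \<open>The Hankel operator and its finite sections\<close>

definition markov_seq :: "tf \<Rightarrow> int \<Rightarrow> nat \<Rightarrow> nat \<Rightarrow> real" where
  "markov_seq F k a b = impulse (F $$ (a,b)) (nat k)"

text \<open>Decay in \<open>i + j\<close> is decay in \<open>i\<close> times decay in
  \<open>j\<close>, so all sections are dominated by rank-one matrices whose two factors have square
  sums bounded independently of the size.\<close>

lemma hankel_section_bounded:
  assumes h: "\<And>k a b. a < l \<Longrightarrow> b < m \<Longrightarrow> \<bar>h (int k + 1) a b\<bar> \<le> c * r ^ k"
    and c: "c \<ge> 0" "0 < r" "r < 1"
  shows "\<exists>\<rho>\<ge>0. \<forall>K. hankel_section l m h 1 \<rho> K"
proof -
  define \<rho> where "\<rho> = max (real l * c\<^sup>2 / (1 - r\<^sup>2)) (real m / (1 - r\<^sup>2))"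
  have r2: "r\<^sup>2 < 1" "0 \<le> r\<^sup>2" using c by (auto simp: power_less_one_iff)
  have g: "(\<Sum>i<K. (r ^ i)\<^sup>2) \<le> 1 / (1 - r\<^sup>2)" for K
  proof -
    have "(\<Sum>i<K. (r ^ i)\<^sup>2) = (\<Sum>i<K. (r\<^sup>2) ^ i)" by (simp add: power_mult[symmetric] mult.commute)
    also have "\<dots> = (1 - (r\<^sup>2) ^ K) / (1 - r\<^sup>2)" using r2 by (simp add: sum_gp_strict)
    also have "\<dots> \<le> 1 / (1 - r\<^sup>2)" using r2 by (intro divide_right_mono) auto
    finally show ?thesis .
  qed
  have "hankel_section l m h 1 \<rho> K" for K
    unfolding hankel_section_def
  proof (rule bdd_form_rank_one[of _ _ _ "\<lambda>i. c * r ^ fst i" "\<lambda>j. r ^ fst j"])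
    fix i j :: "nat \<times> nat" assume ij: "i \<in> {..<K} \<times> {..<l}" "j \<in> {..<K} \<times> {..<m}"
    then have "\<bar>h (int (fst i + fst j) + 1) (snd i) (snd j)\<bar> \<le> c * r ^ (fst i + fst j)" by (intro h) auto
    then show "norm (h (int (fst i) + int (fst j) + 1) (snd i) (snd j)) \<le> c * r ^ fst i * r ^ fst j"
      by (simp add: power_add mult.assoc)
  next
    have "(\<Sum>i\<in>{..<K} \<times> {..<l}. (c * r ^ fst i)\<^sup>2) = (\<Sum>i<K. \<Sum>a<l. (c * r ^ i)\<^sup>2)"
      unfolding sum.cartesian_product by (simp add: case_prod_unfold)
    also have "\<dots> = real l * c\<^sup>2 * (\<Sum>i<K. (r ^ i)\<^sup>2)"
      by (simp add: power_mult_distrib sum_distrib_left mult_ac)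
    also have "\<dots> \<le> real l * c\<^sup>2 * (1 / (1 - r\<^sup>2))" by (intro mult_left_mono g) auto
    also have "\<dots> \<le> \<rho>" by (simp add: \<rho>_def)
    finally show "(\<Sum>i\<in>{..<K} \<times> {..<l}. (c * r ^ fst i)\<^sup>2) \<le> \<rho>" .
    have "(\<Sum>i\<in>{..<K} \<times> {..<m}. (r ^ fst i)\<^sup>2) = (\<Sum>i<K. \<Sum>a<m. (r ^ i)\<^sup>2)"
      unfolding sum.cartesian_product by (simp add: case_prod_unfold)
    also have "\<dots> = real m * (\<Sum>i<K. (r ^ i)\<^sup>2)"
      by (simp add: sum_distrib_left)
    also have "\<dots> \<le> real m * (1 / (1 - r\<^sup>2))" by (intro mult_left_mono g) auto
    also have "\<dots> \<le> \<rho>" by (simp add: \<rho>_def)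
    finally show "(\<Sum>j\<in>{..<K} \<times> {..<m}. (r ^ fst j)\<^sup>2) \<le> \<rho>" .
  qed
  moreover have "\<rho> \<ge> 0" unfolding \<rho>_def using r2 by (auto simp: le_max_iff_disj)
  ultimately show ?thesis by blast
qed

lemma RH_inf_decay:
  assumes F: "F \<in> RH_inf l m"
  shows "\<exists>c r. c \<ge> 0 \<and> 0 < r \<and> r < 1 \<and> (\<forall>k. \<forall>a<l. \<forall>b<m. \<bar>impulse (F $$ (a,b)) k\<bar> \<le> c * r ^ k)"
proof -
  have "\<exists>c r. 0 < r \<and> r < 1 \<and> (\<forall>k. \<bar>impulse (F $$ (a,b)) k\<bar> \<le> c * r ^ k)" if "a < l" "b < m" for a b
    using impulse_props(1) F that by (auto simp: RH_inf_iff)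
  then obtain c r where cr: "\<And>a b. a < l \<Longrightarrow> b < m \<Longrightarrow> 0 < r a b \<and> r a b < (1::real) \<and>
    (\<forall>k. \<bar>impulse (F $$ (a,b)) k\<bar> \<le> c a b * r a b ^ k)" by metis
  let ?I = "{..<l} \<times> {..<m}"
  define C where "C = (\<Sum>x\<in>?I. \<bar>c (fst x) (snd x)\<bar>)"
  \<comment> \<open>The inserted 1/2 keeps the maximum defined, and the ratio positive, when there
    are no entries.\<close>
  define R where "R = Max (insert (1/2) ((\<lambda>x. r (fst x) (snd x)) ` ?I))"
  have R: "R \<ge> 1/2" "\<And>a b. a < l \<Longrightarrow> b < m \<Longrightarrow> r a b \<le> R"
  proof -
    show "R \<ge> 1/2" unfolding R_def by (rule Max_ge) auto
    fix a b assume "a < l" "b < m"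
    then have "r a b \<in> (\<lambda>x. r (fst x) (snd x)) ` ?I" by (intro image_eqI[of _ _ "(a,b)"]) auto
    then show "r a b \<le> R" unfolding R_def by (intro Max_ge) auto
  qed
  have R1: "R < 1" unfolding R_def by (subst Max_less_iff) (use cr in auto)
  have "\<bar>impulse (F $$ (a,b)) k\<bar> \<le> C * R ^ k" if ab: "a < l" "b < m" for a b k
  proof -
    have "\<bar>impulse (F $$ (a,b)) k\<bar> \<le> c a b * r a b ^ k" using cr[OF ab] by blast
    also have "\<dots> \<le> C * R ^ k"
    proof (intro mult_mono power_mono)
      have "\<bar>c a b\<bar> \<le> C" unfolding C_def
        using member_le_sum[of "(a,b)" ?I "\<lambda>x. \<bar>c (fst x) (snd x)\<bar>"] ab by auto
      then show "c a b \<le> C" by linarith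
      then show "0 \<le> C" unfolding C_def by (simp add: sum_nonneg)
    qed (use R cr[OF ab] ab in \<open>auto intro: less_imp_le\<close>)
    finally show ?thesis .
  qed
  moreover have "C \<ge> 0" unfolding C_def by (simp add: sum_nonneg)
  ultimately show ?thesis using R(1) R1 by (intro exI[of _ C] exI[of _ R]) auto
qed

lemma RH_inf_hankel_section:
  assumes F: "F \<in> RH_inf l m"
  shows "\<exists>\<rho>\<ge>0. \<forall>K. hankel_section l m (markov_seq F) 1 \<rho> K"
proof -
  obtain c r where c: "c \<ge> 0" "0 < r" "r < 1"
    "\<And>k a b. a < l \<Longrightarrow> b < m \<Longrightarrow> \<bar>impulse (F $$ (a,b)) k\<bar> \<le> c * r ^ k"
    using RH_inf_decay[OF F] by blast
  show ?thesis
  proof (rule hankel_section_bounded[OF _ c(1-3)])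
    fix k a b assume ab: "a < l" "b < m"
    have "\<bar>markov_seq F (int k + 1) a b\<bar> \<le> c * r ^ Suc k"
      using c(4)[OF ab, of "Suc k"] by (simp add: markov_seq_def nat_add_distrib)
    also have "\<dots> \<le> c * r ^ k" using c(1-3) by (intro mult_left_mono power_decreasing) auto
    finally show "\<bar>markov_seq F (int k + 1) a b\<bar> \<le> c * r ^ k" .
  qed
qed

lemma hankel_section_quad:
  assumes \<rho>: "\<rho> \<ge> 0"
  shows "hankel_section l m h s \<rho> K \<longleftrightarrow>
    (\<forall>u. (\<Sum>i<K. \<Sum>a<l. (norm (\<Sum>j<K. \<Sum>b<m. h (int i + int j + s) a b * u j b))\<^sup>2)
      \<le> \<rho>\<^sup>2 * (\<Sum>j<K. \<Sum>b<m. (norm (u j b))\<^sup>2))"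
  unfolding hankel_section_def bdd_form_iff_quad[OF \<rho>]
proof (intro iffI allI)
  fix u :: "nat \<Rightarrow> nat \<Rightarrow> real"
  assume "\<forall>u. (\<Sum>i\<in>{..<K} \<times> {..<l}. (norm (\<Sum>j\<in>{..<K} \<times> {..<m}. h (int (fst i) + int (fst j) + s) (snd i) (snd j) * u j))\<^sup>2)
      \<le> \<rho>\<^sup>2 * (\<Sum>j\<in>{..<K} \<times> {..<m}. (norm (u j))\<^sup>2)"
  from spec[OF this, of "\<lambda>j. u (fst j) (snd j)"]
  show "(\<Sum>i<K. \<Sum>a<l. (norm (\<Sum>j<K. \<Sum>b<m. h (int i + int j + s) a b * u j b))\<^sup>2)
      \<le> \<rho>\<^sup>2 * (\<Sum>j<K. \<Sum>b<m. (norm (u j b))\<^sup>2)"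
    by (simp add: sum.cartesian_product case_prod_unfold)
next
  fix u :: "nat \<times> nat \<Rightarrow> real"
  assume "\<forall>u. (\<Sum>i<K. \<Sum>a<l. (norm (\<Sum>j<K. \<Sum>b<m. h (int i + int j + s) a b * u j b))\<^sup>2)
      \<le> \<rho>\<^sup>2 * (\<Sum>j<K. \<Sum>b<m. (norm (u j b))\<^sup>2)"
  from spec[OF this, of "\<lambda>j b. u (j,b)"]
  show "(\<Sum>i\<in>{..<K} \<times> {..<l}. (norm (\<Sum>j\<in>{..<K} \<times> {..<m}. h (int (fst i) + int (fst j) + s) (snd i) (snd j) * u j))\<^sup>2)
      \<le> \<rho>\<^sup>2 * (\<Sum>j\<in>{..<K} \<times> {..<m}. (norm (u j))\<^sup>2)"
    by (simp add: sum.cartesian_product case_prod_unfold)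
qed

lemma hankel_section_complex:
  assumes \<rho>: "\<rho> \<ge> 0" and h: "hankel_section l m h s \<rho> K"
  shows "(\<Sum>i<K. \<Sum>a<l. (norm (\<Sum>j<K. \<Sum>b<m. complex_of_real (h (int i + int j + s) a b) * u j b))\<^sup>2)
      \<le> \<rho>\<^sup>2 * (\<Sum>j<K. \<Sum>b<m. (norm (u j b))\<^sup>2)"
proof -
  note q = bdd_form_complex[OF h[unfolded hankel_section_def], unfolded bdd_form_iff_quad[OF \<rho>]]
  from spec[OF q, of "\<lambda>j. u (fst j) (snd j)"] show ?thesis
    by (simp add: sum.cartesian_product case_prod_unfold)
qed

text \<open>Inputs sit at the exponents \<open>int j + 1\<close> and outputs at
  \<open>- int i\<close>, so the coefficient that links them has index \<open>i + j + 1\<close>. The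
  terms of the convolution that meet inputs at exponents up to 0 vanish; this is the shift of the
  partial sums by \<open>Suc i\<close>.\<close>

lemma Hankel_limit:
  fixes g :: "int \<Rightarrow> complex vec"
  assumes F: "F \<in> RH_inf l m" and g: "g \<in> H2_perp m" and B: "\<And>k b. b < m \<Longrightarrow> norm (g k $ b) \<le> B"
    and a: "a < l"
  shows "(\<lambda>J. \<Sum>j<J. \<Sum>b<m. complex_of_real (markov_seq F (int i + int j + 1) a b) * g (int j + 1) $ b)
    \<longlonglongrightarrow> Hankel F g (- int i) $ a"
proof -
  have dF: "dim_row F = l" "dim_col F = m" using RH_inf_carrier[OF F] by auto
  have gd: "dim_vec (g k) = m" for k using g by (auto simp: H2_perp_def L2_def)
  have g0: "g k = 0\<^sub>v m" if "k \<le> 0" for k using g that by (auto simp: H2_perp_def)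
  define t where "t s = (\<Sum>b<m. complex_of_real (impulse (F $$ (a,b)) s) * g (- int i + int s) $ b)" for s
  obtain c r where c: "c \<ge> 0" "0 < r" "r < 1"
    "\<And>k a b. a < l \<Longrightarrow> b < m \<Longrightarrow> \<bar>impulse (F $$ (a,b)) k\<bar> \<le> c * r ^ k"
    using RH_inf_decay[OF F] by blast
  have "summable (\<lambda>s. norm (t s))"
  proof (rule summable_comparison_test'[of "\<lambda>s. (real m * (c * \<bar>B\<bar>)) * r ^ s" 0])
    show "summable (\<lambda>s. (real m * (c * \<bar>B\<bar>)) * r ^ s)" using c by (intro summable_mult summable_geometric) auto
    fix s :: nat
    have "norm (t s) \<le> (\<Sum>b<m. (c * r ^ s) * \<bar>B\<bar>)"
      unfolding t_def
    proof (rule sum_norm_le)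
      fix b assume b: "b \<in> {..<m}"
      have "norm (g (- int i + int s) $ b) \<le> \<bar>B\<bar>" using B[of b "- int i + int s"] b by fastforce
      then show "norm (complex_of_real (impulse (F $$ (a,b)) s) * g (- int i + int s) $ b) \<le> (c * r ^ s) * \<bar>B\<bar>"
        unfolding norm_mult using c(4)[OF a, of b s] c(1,2) b by (intro mult_mono) auto
    qed
    then show "norm (norm (t s)) \<le> (real m * (c * \<bar>B\<bar>)) * r ^ s" by (simp add: mult_ac)
  qed
  then have sm: "summable t" "t summable_on UNIV"
    by (auto intro: summable_norm_cancel norm_summable_imp_summable_on)
  have "Hankel F g (- int i) $ a = infsum t UNIV"
    using a unfolding Hankel_def proj_H2_def mult_L2_def t_def
    by (simp add: dF gd impulse_mat_def scalar_prod_def atLeast0LessThan)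
  moreover have "t sums infsum t UNIV" using sm(2) by (intro has_sum_imp_sums) simp
  ultimately have "(\<lambda>S. \<Sum>s<S. t s) \<longlonglongrightarrow> Hankel F g (- int i) $ a" by (simp add: sums_def)
  from LIMSEQ_ignore_initial_segment[OF this, of "Suc i"]
  have "(\<lambda>J. \<Sum>s<J + Suc i. t s) \<longlonglongrightarrow> Hankel F g (- int i) $ a" .
  moreover have "(\<Sum>s<J + Suc i. t s)
      = (\<Sum>j<J. \<Sum>b<m. complex_of_real (markov_seq F (int i + int j + 1) a b) * g (int j + 1) $ b)" for J
  proof (induction J)
    case 0
    have "t s = 0" if "s < Suc i" for s
      using that by (simp add: t_def g0)
    then show ?case by simp
  next
    case (Suc J)
    have "nat (int i + int J + 1) = J + Suc i" "- int i + int (J + Suc i) = int J + 1" by auto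
    then have "t (J + Suc i) = (\<Sum>b<m. complex_of_real (markov_seq F (int i + int J + 1) a b) * g (int J + 1) $ b)"
      unfolding t_def markov_seq_def by (simp only:)
    then show ?case using Suc by simp
  qed
  ultimately show ?thesis by simp
qed

lemma L2_sq_norm_le:
  fixes g :: "int \<Rightarrow> complex vec"
  assumes g: "g \<in> L2 m" "L2_norm g \<le> 1"
  shows "finite S \<Longrightarrow> (\<Sum>k\<in>S. sq_norm (g k)) \<le> 1" "b < m \<Longrightarrow> norm (g k $ b) \<le> 1"
proof -
  have nn: "sq_norm v \<ge> 0" for v by (simp add: sq_norm_def sum_nonneg)
  have sm: "(\<lambda>k. sq_norm (g k)) summable_on UNIV" using g(1) by (simp add: L2_def)
  have "infsum (\<lambda>k. sq_norm (g k)) UNIV \<le> 1" using g(2) by (simp add: L2_norm_def)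
  moreover have "(\<Sum>k\<in>S. sq_norm (g k)) \<le> infsum (\<lambda>k. sq_norm (g k)) UNIV" if "finite S" for S
    using that sm nn by (intro finite_sum_le_infsum) auto
  ultimately have fin: "(\<Sum>k\<in>S. sq_norm (g k)) \<le> 1" if "finite S" for S using that by (meson order_trans)
  then show "finite S \<Longrightarrow> (\<Sum>k\<in>S. sq_norm (g k)) \<le> 1" .
  assume b: "b < m"
  have "dim_vec (g k) = m" using g(1) by (auto simp: L2_def)
  then have "(norm (g k $ b))\<^sup>2 \<le> sq_norm (g k)"
    unfolding sq_norm_def using b by (intro member_le_sum) auto
  also have "\<dots> \<le> 1" using fin[of "{k}"] by simp
  finally show "norm (g k $ b) \<le> 1" by (simp add: power_le_one_iff abs_le_square_iff[of _ 1, simplified])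
qed

text \<open>For a fixed number \<open>K\<close> of output coefficients, inputs truncated to length
  \<open>J \<ge> K\<close> fall under the bound on sections. First \<open>J\<close> tends to
  infinity, then finite sets of output coefficients exhaust all of them.\<close>

lemma Hankel_bound:
  assumes F: "F \<in> RH_inf l m" and \<rho>: "\<rho> \<ge> 0" and sec: "\<And>K. hankel_section l m (markov_seq F) 1 \<rho> K"
    and g: "g \<in> H2_perp m" "L2_norm g \<le> 1"
  shows "(\<lambda>k. sq_norm (Hankel F g k)) summable_on UNIV" "L2_norm (Hankel F g) \<le> \<rho>"
proof -
  have nn: "sq_norm v \<ge> 0" for v by (simp add: sq_norm_def sum_nonneg)
  have dF: "dim_row F = l" "dim_col F = m" using RH_inf_carrier[OF F] by auto
  have gL: "g \<in> L2 m" using g(1) by (simp add: H2_perp_def)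
  have gd: "dim_vec (g k) = m" for k using gL by (auto simp: L2_def)
  have Hd: "dim_vec (Hankel F g k) = l" for k
    by (simp add: Hankel_def proj_H2_def mult_L2_def dF)
  define y where "y J i a = (\<Sum>j<J. \<Sum>b<m. complex_of_real (markov_seq F (int i + int j + 1) a b) * g (int j + 1) $ b)" for J i a
  have lim: "(\<lambda>J. y J i a) \<longlonglongrightarrow> Hankel F g (- int i) $ a" if "a < l" for i a
    unfolding y_def by (rule Hankel_limit[OF F g(1) L2_sq_norm_le(2)[OF gL g(2)] that])
  have part: "(\<Sum>i<K. sq_norm (Hankel F g (- int i))) \<le> \<rho>\<^sup>2" for K
  proof (rule LIMSEQ_le_const2)
    show "(\<lambda>J. \<Sum>i<K. \<Sum>a<l. (norm (y J i a))\<^sup>2) \<longlonglongrightarrow> (\<Sum>i<K. sq_norm (Hankel F g (- int i)))"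
      unfolding sq_norm_def Hd by (intro tendsto_sum tendsto_power tendsto_norm lim) auto
    have "(\<Sum>i<K. \<Sum>a<l. (norm (y J i a))\<^sup>2) \<le> \<rho>\<^sup>2" if J: "J \<ge> K" for J
    proof -
      have "(\<Sum>i<K. \<Sum>a<l. (norm (y J i a))\<^sup>2) \<le> (\<Sum>i<J. \<Sum>a<l. (norm (y J i a))\<^sup>2)"
        using J by (intro sum_mono2) (auto intro: sum_nonneg)
      also have "\<dots> \<le> \<rho>\<^sup>2 * (\<Sum>j<J. \<Sum>b<m. (norm (g (int j + 1) $ b))\<^sup>2)"
        unfolding y_def by (rule hankel_section_complex[OF \<rho> sec])
      also have "(\<Sum>j<J. \<Sum>b<m. (norm (g (int j + 1) $ b))\<^sup>2) = (\<Sum>k\<in>(\<lambda>j. int j + 1) ` {..<J}. sq_norm (g k))"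
        by (subst sum.reindex) (auto simp: inj_on_def sq_norm_def gd)
      also have "\<rho>\<^sup>2 * \<dots> \<le> \<rho>\<^sup>2 * 1" by (intro mult_left_mono L2_sq_norm_le(1)[OF gL g(2)]) auto
      finally show ?thesis by simp
    qed
    then show "\<exists>N. \<forall>J\<ge>N. (\<Sum>i<K. \<Sum>a<l. (norm (y J i a))\<^sup>2) \<le> \<rho>\<^sup>2" by blast
  qed
  have fin: "(\<Sum>k\<in>S. sq_norm (Hankel F g k)) \<le> \<rho>\<^sup>2" if S: "finite S" for S
  proof -
    define K where "K = Suc (Max (insert 0 ((\<lambda>k. nat \<bar>k\<bar>) ` S)))"
    have z: "sq_norm (Hankel F g k) = 0" if "k > 0" for k
      using that by (simp add: Hankel_def proj_H2_def sq_norm_def)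
    have "(\<Sum>k\<in>S. sq_norm (Hankel F g k)) = (\<Sum>k\<in>S \<inter> {..0}. sq_norm (Hankel F g k))"
      by (intro sum.mono_neutral_right S ballI z) auto
    also have "\<dots> \<le> (\<Sum>k\<in>(\<lambda>i. - int i) ` {..<K}. sq_norm (Hankel F g k))"
    proof (rule sum_mono2)
      show "S \<inter> {..0} \<subseteq> (\<lambda>i. - int i) ` {..<K}"
      proof
        fix k assume k: "k \<in> S \<inter> {..0}"
        then have "nat \<bar>k\<bar> \<le> Max (insert 0 ((\<lambda>k. nat \<bar>k\<bar>) ` S))"
          by (intro Max_ge finite.insertI finite_imageI S insertI2 imageI) simp
        then have "nat \<bar>k\<bar> < K" by (simp add: K_def)
        then show "k \<in> (\<lambda>i. - int i) ` {..<K}" using k by (intro image_eqI[of _ _ "nat \<bar>k\<bar>"]) auto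
      qed
    qed (auto simp: nn)
    also have "\<dots> = (\<Sum>i<K. sq_norm (Hankel F g (- int i)))" by (subst sum.reindex) (auto simp: inj_on_def)
    finally show ?thesis using part[of K] by linarith
  qed
  show sm: "(\<lambda>k. sq_norm (Hankel F g k)) summable_on UNIV"
    by (rule nonneg_bounded_partial_sums_imp_summable_on[of _ _ "\<rho>\<^sup>2"])
      (auto simp: nn fin eventually_finite_subsets_at_top intro!: exI[of _ "{}"])
  have "infsum (\<lambda>k. sq_norm (Hankel F g k)) UNIV \<le> \<rho>\<^sup>2"
    using sm fin by (intro infsum_le_finite_sums) auto
  then show "L2_norm (Hankel F g) \<le> \<rho>" unfolding L2_norm_def using \<rho> by (intro real_le_lsqrt) auto
qed

lemma zero_in_H2_perp: "(\<lambda>_. 0\<^sub>v m) \<in> H2_perp m" "L2_norm (\<lambda>_. 0\<^sub>v m) = 0"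
  by (auto simp: H2_perp_def L2_def L2_norm_def sq_norm_def)

text \<open>Finitely supported real inputs already reveal the norm of every section, so the Hankel
  norm itself serves as the uniform \<rho>. Conversely a uniform \<rho> bounds the supremum, and
  strictness is kept.\<close>

lemma Hankel_norm_less_one_iff:
  assumes F: "F \<in> RH_inf l m"
  shows "Hankel_norm F < 1 \<longleftrightarrow> (\<exists>\<rho>\<ge>0. \<rho> < 1 \<and> (\<forall>K. hankel_section l m (markov_seq F) 1 \<rho> K))"
proof
  have dF: "dim_row F = l" "dim_col F = m" using RH_inf_carrier[OF F] by auto
  let ?G = "{g \<in> H2_perp m. L2_norm g \<le> 1}"
  have ne: "?G \<noteq> {}" using zero_in_H2_perp by force
  have nn: "sq_norm v \<ge> 0" for v by (simp add: sq_norm_def sum_nonneg)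
  {
    assume "\<exists>\<rho>\<ge>0. \<rho> < 1 \<and> (\<forall>K. hankel_section l m (markov_seq F) 1 \<rho> K)"
    then obtain \<rho> where \<rho>: "\<rho> \<ge> 0" "\<rho> < 1" "\<And>K. hankel_section l m (markov_seq F) 1 \<rho> K" by blast
    have "Hankel_norm F \<le> \<rho>" unfolding Hankel_norm_def dF
      by (rule cSUP_least[OF ne]) (use Hankel_bound(2)[OF F \<rho>(1,3)] in auto)
    then show "Hankel_norm F < 1" using \<rho> by simp
  }
  assume less: "Hankel_norm F < 1"
  \<comment> \<open>A preliminary bound obtained from decay. It ensures that the supremum in
    \<open>Hankel_norm\<close> is over a bounded set and that the output energies are
    summable.\<close>
  obtain \<rho>0 where \<rho>0: "\<rho>0 \<ge> 0" "\<And>K. hankel_section l m (markov_seq F) 1 \<rho>0 K"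
    using RH_inf_hankel_section[OF F] by blast
  define \<rho> where "\<rho> = Hankel_norm F"
  have "bdd_above ((\<lambda>g. L2_norm (Hankel F g)) ` ?G)"
    by (rule bdd_aboveI2[of _ _ \<rho>0]) (use Hankel_bound(2)[OF F \<rho>0] in auto)
  then have up: "L2_norm (Hankel F g) \<le> \<rho>" if "g \<in> H2_perp m" "L2_norm g \<le> 1" for g
    unfolding \<rho>_def Hankel_norm_def dF using that by (intro cSUP_upper) auto
  have L2nn: "L2_norm g \<ge> 0" for g unfolding L2_norm_def by (simp add: infsum_nonneg nn)
  have \<rho>: "\<rho> \<ge> 0" using order_trans[OF L2nn up[OF zero_in_H2_perp(1)]] zero_in_H2_perp(2)[of m] by simp
  have "hankel_section l m (markov_seq F) 1 \<rho> K" for K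
    unfolding hankel_section_quad[OF \<rho>]
  proof
    fix u :: "nat \<Rightarrow> nat \<Rightarrow> real"
    define U where "U = (\<Sum>j<K. \<Sum>b<m. (norm (u j b))\<^sup>2)"
    have U0: "U \<ge> 0" unfolding U_def by (intro sum_nonneg) auto
    let ?y = "\<lambda>v i a. \<Sum>j<K. \<Sum>b<m. markov_seq F (int i + int j + 1) a b * v j b"
    show "(\<Sum>i<K. \<Sum>a<l. (norm (?y u i a))\<^sup>2) \<le> \<rho>\<^sup>2 * (\<Sum>j<K. \<Sum>b<m. (norm (u j b))\<^sup>2)"
    proof (cases "U = 0")
      case True
      then have "\<forall>j<K. \<forall>b<m. u j b = 0"
        unfolding U_def by (simp add: sum_nonneg_eq_0_iff sum_nonneg)
      then show ?thesis by simp
    next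
      case False
      with U0 have U: "U > 0" by simp
      define v where "v j b = u j b / sqrt U" for j b
      define g where "g k = (if 1 \<le> k \<and> k \<le> int K then vec m (\<lambda>b. complex_of_real (v (nat (k - 1)) b)) else 0\<^sub>v m)" for k
      have sq0: "sq_norm (g k) = 0" if "k \<notin> (\<lambda>j. int j + 1) ` {..<K}" for k
      proof -
        have "k \<in> (\<lambda>j. int j + 1) ` {..<K}" if "1 \<le> k" "k \<le> int K"
          using that by (intro image_eqI[of _ _ "nat (k - 1)"]) auto
        then have "\<not> (1 \<le> k \<and> k \<le> int K)" using that by blast
        then show ?thesis by (auto simp: g_def sq_norm_def)
      qed
      have gj: "g (int j + 1) = vec m (\<lambda>b. complex_of_real (v j b))" if "j < K" for j
        using that by (simp add: g_def)
      have hs: "((\<lambda>k. sq_norm (g k)) has_sum (\<Sum>k\<in>(\<lambda>j. int j + 1) ` {..<K}. sq_norm (g k))) UNIV"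
        by (rule has_sum_finite_neutralI) (use sq0 in auto)
      have "(\<Sum>k\<in>(\<lambda>j. int j + 1) ` {..<K}. sq_norm (g k)) = (\<Sum>j<K. \<Sum>b<m. (v j b)\<^sup>2)"
        by (subst sum.reindex) (auto simp: inj_on_def sq_norm_def gj)
      also have "\<dots> = (\<Sum>j<K. \<Sum>b<m. (u j b)\<^sup>2) / U"
        unfolding v_def power_divide real_sqrt_pow2[OF U0] by (simp only: sum_divide_distrib)
      also have "\<dots> = U / U" by (simp add: U_def)
      finally have hs1: "((\<lambda>k. sq_norm (g k)) has_sum 1) UNIV" using hs U by simp
      have gH: "g \<in> H2_perp m"
        using hs1 by (auto simp: H2_perp_def L2_def g_def has_sum_imp_summable)
      have gn: "L2_norm g \<le> 1" using infsumI[OF hs1] by (simp add: L2_norm_def)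
      have gL: "g \<in> L2 m" using gH by (simp add: H2_perp_def)
      have Hd: "dim_vec (Hankel F g k) = l" for k
        by (simp add: Hankel_def proj_H2_def mult_L2_def dF)
      have Hv: "Hankel F g (- int i) $ a = of_real (?y v i a)" if a: "a < l" for i a
      proof (rule LIMSEQ_unique)
        let ?s = "\<lambda>J. \<Sum>j<J. \<Sum>b<m. complex_of_real (markov_seq F (int i + int j + 1) a b) * g (int j + 1) $ b"
        show "?s \<longlonglongrightarrow> Hankel F g (- int i) $ a"
          by (rule Hankel_limit[OF F gH L2_sq_norm_le(2)[OF gL gn] a])
        have "?s J = of_real (?y v i a)" if "J \<ge> K" for J
        proof -
          have "?s J = (\<Sum>j<K. \<Sum>b<m. complex_of_real (markov_seq F (int i + int j + 1) a b) * g (int j + 1) $ b)"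
            using that by (intro sum.mono_neutral_right) (auto simp: g_def)
          also have "\<dots> = of_real (?y v i a)" by (simp add: gj)
          finally show ?thesis .
        qed
        then show "?s \<longlonglongrightarrow> of_real (?y v i a)"
          by (intro tendsto_eventually) (auto simp: eventually_sequentially)
      qed
      have "(\<Sum>i<K. \<Sum>a<l. (?y v i a)\<^sup>2) = (\<Sum>k\<in>(\<lambda>i. - int i) ` {..<K}. sq_norm (Hankel F g k))"
        by (subst sum.reindex) (auto simp: inj_on_def sq_norm_def Hd Hv simp del: of_real_sum of_real_mult)
      also have "\<dots> \<le> infsum (\<lambda>k. sq_norm (Hankel F g k)) UNIV"
        using Hankel_bound(1)[OF F \<rho>0 gH gn] nn by (intro finite_sum_le_infsum) auto
      also have "\<dots> = (L2_norm (Hankel F g))\<^sup>2" unfolding L2_norm_def by (simp add: infsum_nonneg nn)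
      also have "\<dots> \<le> \<rho>\<^sup>2" using up[OF gH gn] L2nn by (intro power_mono) auto
      finally have 1: "(\<Sum>i<K. \<Sum>a<l. (?y v i a)\<^sup>2) \<le> \<rho>\<^sup>2" .
      have yv: "?y v i a = ?y u i a / sqrt U" for i a
        by (simp only: v_def times_divide_eq_right sum_divide_distrib)
      have "(\<Sum>i<K. \<Sum>a<l. (?y v i a)\<^sup>2) = (\<Sum>i<K. \<Sum>a<l. (?y u i a)\<^sup>2) / U"
        unfolding yv power_divide real_sqrt_pow2[OF U0] by (simp only: sum_divide_distrib)
      with 1 U have "(\<Sum>i<K. \<Sum>a<l. (?y u i a)\<^sup>2) \<le> \<rho>\<^sup>2 * U" by (simp add: divide_le_eq)
      then show ?thesis by (simp add: U_def)
    qed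
  qed
  then show "\<exists>\<rho>\<ge>0. \<rho> < 1 \<and> (\<forall>K. hankel_section l m (markov_seq F) 1 \<rho> K)"
    using \<rho> less unfolding \<rho>_def by blast
qed

section \<open>Nehari's theorem for stable rational matrices\<close>

lemma rat_eval_inverse_zvar:
  assumes "z \<noteq> 0"
  shows "reg of_real z (inverse zvar)" "rat_eval (inverse zvar) z = inverse z"
  using creg_inverse[OF creg_zvar(1)[of z]] assms by (simp_all add: creg_zvar)

lemma rat_eval_fir:
  assumes z: "z \<noteq> 0" and ij: "i < m" "j < p"
  shows "rat_eval (fir m p N V $$ (i,j)) z = (\<Sum>k<N. of_real (V k $$ (i,j)) * inverse z ^ k)"
proof -
  have r: "reg of_real z (inverse zvar ^ k)" "rat_eval (inverse zvar ^ k) z = inverse z ^ k" for k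
    using creg_power[OF rat_eval_inverse_zvar(1)[OF z]] by (simp_all add: rat_eval_inverse_zvar(2)[OF z])
  have r2: "reg of_real z (inverse zvar ^ k * const c)"
    "rat_eval (inverse zvar ^ k * const c) z = inverse z ^ k * of_real c" for k c
    using creg_mult[OF r(1) creg_const(1)] by (simp_all add: r creg_const)
  have "fir m p N V $$ (i,j) = (\<Sum>k<N. inverse zvar ^ k * const (V k $$ (i,j)))"
    using ij by (simp add: fir_def)
  moreover have "rat_eval (\<Sum>k<N. inverse zvar ^ k * const (V k $$ (i,j))) z
      = (\<Sum>k<N. rat_eval (inverse zvar ^ k * const (V k $$ (i,j))) z)"
    by (rule creg_sum[THEN conjunct2]) (rule r2)
  ultimately show ?thesis by (simp add: r2 mult.commute)
qed

text \<open>Summation along diagonals: the diagonal at distance \<open>k\<close> has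
  \<open>n - k\<close> entries, and the main diagonal occurs in both sums. After division by
  \<open>n\<close> the weights are those of Fejer.\<close>

lemma toeplitz_sum:
  fixes f :: "int \<Rightarrow> complex"
  shows "(\<Sum>i<n. \<Sum>j<n. f (int i - int j))
    = (\<Sum>k<n. of_nat (n - k) * f (- int k)) + (\<Sum>k<n. of_nat (n - k) * f (int k)) - of_nat n * f 0"
proof (induction n)
  case (Suc n)
  have a: "(\<Sum>k<Suc n. of_nat (Suc n - k) * g k) = (\<Sum>k<n. of_nat (n - k) * g k) + (\<Sum>k<Suc n. g k)"
    for g :: "nat \<Rightarrow> complex"
  proof -
    have "(\<Sum>k<n. of_nat (Suc n - k) * g k) = (\<Sum>k<n. of_nat (n - k) * g k + g k)"
      by (intro sum.cong) (auto simp: Suc_diff_le algebra_simps)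
    then show ?thesis by (simp add: sum.distrib)
  qed
  have b: "(\<Sum>j<n. f (int n - int j)) + f 0 = (\<Sum>k<Suc n. f (int k))"
  proof -
    have "(\<Sum>k<Suc n. f (int k)) = (\<Sum>k<Suc n. f (int (Suc n - Suc k)))"
      by (rule sum.nat_diff_reindex[symmetric])
    also have "\<dots> = (\<Sum>k<Suc n. f (int n - int k))" by (intro sum.cong) (auto simp: of_nat_diff)
    finally show ?thesis by simp
  qed
  have c: "(\<Sum>j<n. f (int j - int n)) + f 0 = (\<Sum>k<Suc n. f (- int k))"
  proof -
    have "(\<Sum>k<Suc n. f (- int k)) = (\<Sum>k<Suc n. f (- int (Suc n - Suc k)))"
      by (rule sum.nat_diff_reindex[symmetric, where g = "\<lambda>k. f (- int k)"])
    also have "\<dots> = (\<Sum>k<Suc n. f (int k - int n))" by (intro sum.cong) (auto simp: of_nat_diff)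
    finally show ?thesis by simp
  qed
  have "(\<Sum>i<Suc n. \<Sum>j<Suc n. f (int i - int j))
      = (\<Sum>i<n. \<Sum>j<n. f (int i - int j)) + (\<Sum>i<n. f (int i - int n)) + ((\<Sum>j<n. f (int n - int j)) + f 0)"
    by (simp add: sum.distrib)
  also have "\<dots> = (\<Sum>k<Suc n. of_nat (Suc n - k) * f (- int k))
      + (\<Sum>k<Suc n. of_nat (Suc n - k) * f (int k)) - of_nat (Suc n) * f 0"
    unfolding a Suc b c[symmetric] by (simp add: algebra_simps)
  finally show ?case .
qed simp

text \<open>The Fejer mean of the symbol of a Toeplitz contraction is a contraction at every point of the
  circle: it is the compression of the Toeplitz matrix to the vector \<open>(1, z, \<dots>, z\<^bsup>n-1\<^esup>)\<close>.\<close>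

lemma fejer_bdd_form:
  assumes h: "hankel_section l m h (1 - int n) \<rho> n" and n: "n > 0" and z: "cmod z = 1"
  shows "bdd_form {..<l} {..<m}
    (\<lambda>a b. (\<Sum>i<n. \<Sum>j<n. of_real (h (int i - int j) a b) * z powi (int i - int j)) / of_nat n) \<rho>"
  unfolding bdd_form_def
proof (intro allI)
  fix x y :: "nat \<Rightarrow> complex"
  have z0: "z \<noteq> 0" using z by auto
  let ?I = "{..<n} \<times> {..<l}" and ?J = "{..<n} \<times> {..<m}"
  define s where "s = 1 - int n"
  \<comment> \<open>The exponents of \<open>z\<close> in the two test vectors add up to the Hankel
    index. Since \<open>z\<close> is unimodular, the squared lengths are \<open>n\<close> times
    those of \<open>x\<close> and \<open>y\<close>.\<close>
  let ?w = "\<lambda>p. x (snd p) * z powi (int (fst p))"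
  let ?u = "\<lambda>q. y (snd q) * z powi (int (fst q) + s)"
  define T where "T = (\<Sum>p\<in>?I. \<Sum>q\<in>?J. ?w p * complex_of_real (h (int (fst p) + int (fst q) + s) (snd p) (snd q)) * ?u q)"
  \<comment> \<open>Reversing the block columns turns the Hankel index at offset
    \<open>1 - n\<close> into the Toeplitz index \<open>i - j\<close>.\<close>
  have flip: "(\<Sum>j<n. g (int i + int j + s)) = (\<Sum>j<n. g (int i - int j))" for g :: "int \<Rightarrow> complex" and i
  proof -
    have "(\<Sum>j<n. g (int i + int j + s)) = (\<Sum>j<n. g (int i + int (n - Suc j) + s))"
      by (rule sum.nat_diff_reindex[symmetric, where g = "\<lambda>j. g (int i + int j + s)"])
    also have "\<dots> = (\<Sum>j<n. g (int i - int j))"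
      by (intro sum.cong) (auto simp: s_def of_nat_diff algebra_simps)
    finally show ?thesis .
  qed
  let ?\<sigma> = "\<lambda>a b. (\<Sum>i<n. \<Sum>j<n. complex_of_real (h (int i - int j) a b) * z powi (int i - int j))"
  have "T = (\<Sum>i<n. \<Sum>a<l. \<Sum>j<n. \<Sum>b<m. x a * (of_real (h (int i + int j + s) a b) * z powi (int i + int j + s)) * y b)"
    unfolding T_def using z0 by (simp add: sum.cartesian_product' power_int_add mult_ac)
  also have "\<dots> = (\<Sum>a<l. \<Sum>i<n. \<Sum>j<n. \<Sum>b<m. x a * (of_real (h (int i + int j + s) a b) * z powi (int i + int j + s)) * y b)"
    by (rule sum.swap)
  also have "\<dots> = (\<Sum>a<l. \<Sum>b<m. x a * ?\<sigma> a b * y b)"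
  proof (rule sum.cong[OF refl])
    fix a
    have "(\<Sum>i<n. \<Sum>j<n. \<Sum>b<m. x a * (of_real (h (int i + int j + s) a b) * z powi (int i + int j + s)) * y b)
        = (\<Sum>b<m. \<Sum>i<n. \<Sum>j<n. x a * (of_real (h (int i + int j + s) a b) * z powi (int i + int j + s)) * y b)"
    proof -
      have "(\<Sum>i<n. \<Sum>j<n. \<Sum>b<m. x a * (of_real (h (int i + int j + s) a b) * z powi (int i + int j + s)) * y b)
          = (\<Sum>i<n. \<Sum>b<m. \<Sum>j<n. x a * (of_real (h (int i + int j + s) a b) * z powi (int i + int j + s)) * y b)"
        by (intro sum.cong refl sum.swap)
      also have "\<dots> = (\<Sum>b<m. \<Sum>i<n. \<Sum>j<n. x a * (of_real (h (int i + int j + s) a b) * z powi (int i + int j + s)) * y b)"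
        by (rule sum.swap)
      finally show ?thesis .
    qed
    also have "\<dots> = (\<Sum>b<m. x a * ?\<sigma> a b * y b)"
      unfolding flip[of "\<lambda>k. x a * (of_real (h k a _) * z powi k) * y _"]
      by (simp add: sum_distrib_left sum_distrib_right)
    finally show "(\<Sum>i<n. \<Sum>j<n. \<Sum>b<m. x a * (of_real (h (int i + int j + s) a b) * z powi (int i + int j + s)) * y b)
        = (\<Sum>b<m. x a * ?\<sigma> a b * y b)" .
  qed
  finally have T: "T = (\<Sum>a<l. \<Sum>b<m. x a * ?\<sigma> a b * y b)" .
  have "2 * norm T \<le> \<rho> * ((\<Sum>p\<in>?I. (norm (?w p))\<^sup>2) + (\<Sum>q\<in>?J. (norm (?u q))\<^sup>2))"
    unfolding T_def using bdd_formD[OF bdd_form_complex[OF h[unfolded hankel_section_def, folded s_def]], of ?w ?u] .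
  also have "(\<Sum>p\<in>?I. (norm (?w p))\<^sup>2) = of_nat n * (\<Sum>a<l. (norm (x a))\<^sup>2)"
    using z by (simp add: norm_mult norm_power norm_power_int sum.cartesian_product')
  also have "(\<Sum>q\<in>?J. (norm (?u q))\<^sup>2) = of_nat n * (\<Sum>b<m. (norm (y b))\<^sup>2)"
    using z by (simp add: norm_mult norm_power norm_power_int sum.cartesian_product')
  finally have 1: "2 * norm T \<le> of_nat n * (\<rho> * ((\<Sum>a<l. (norm (x a))\<^sup>2) + (\<Sum>b<m. (norm (y b))\<^sup>2)))"
    by (simp add: algebra_simps)
  have "(\<Sum>a<l. \<Sum>b<m. x a * (?\<sigma> a b / of_nat n) * y b) = T / of_nat n"
  proof -
    have "(\<Sum>a<l. \<Sum>b<m. x a * (g a b / c) * y b) = (\<Sum>a<l. \<Sum>b<m. x a * g a b * y b) / c" for g c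
      by (simp add: sum_divide_distrib)
    then show ?thesis unfolding T .
  qed
  then have "2 * norm (\<Sum>a<l. \<Sum>b<m. x a * (?\<sigma> a b / of_nat n) * y b) = 2 * norm T / of_nat n"
    by (simp add: norm_divide)
  also have "\<dots> \<le> \<rho> * ((\<Sum>a<l. (norm (x a))\<^sup>2) + (\<Sum>b<m. (norm (y b))\<^sup>2))"
    using 1 n by (simp add: divide_le_eq mult.commute)
  finally show "2 * norm (\<Sum>a<l. \<Sum>b<m. x a * (?\<sigma> a b / of_nat n) * y b)
      \<le> \<rho> * ((\<Sum>a<l. (norm (x a))\<^sup>2) + (\<Sum>b<m. (norm (y b))\<^sup>2))" .
qed

text \<open>An extension is needed only up to the slack \<open>1 - \<rho>\<close>, so a single
  section of large size \<open>n\<close> is extended, down to the Toeplitz offset. Its Fejer mean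
  has norm at most \<rho> on the circle, and its coefficients at positive powers are those of
  \<open>F\<close> damped by the Fejer weights; restoring them costs an error of order 1/n.\<close>

lemma nehari_sufficient:
  assumes F: "F \<in> RH_inf l m" and \<rho>: "\<rho> \<ge> 0" "\<rho> < 1"
    and sec: "\<And>K. hankel_section l m (markov_seq F) 1 \<rho> K"
  shows "\<exists>S\<in>RH_inf m l. \<exists>\<rho>'\<ge>0. \<rho>' < 1 \<and>
    (\<forall>z. cmod z = 1 \<longrightarrow> bdd_form {..<m} {..<l} (\<lambda>b a. ev z (para_conj F + S) $$ (b,a)) \<rho>')"
proof -
  obtain c r where c: "c \<ge> 0" "0 < r" "r < 1"
    "\<And>k a b. a < l \<Longrightarrow> b < m \<Longrightarrow> \<bar>impulse (F $$ (a,b)) k\<bar> \<le> c * r ^ k"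
    using RH_inf_decay[OF F] by blast
  have sm: "summable (\<lambda>k. c * (of_nat (Suc k) * r ^ k))"
    using c geometric_deriv_sums[of r] by (intro summable_mult) (auto simp: sums_iff)
  \<comment> \<open>\<open>E\<close> will bound \<open>n\<close> times the error in each entry: the
    defect of the Fejer weight at \<open>k\<close> is at most \<open>(k + 1) / n\<close>, also for
    \<open>k \<ge> n\<close>, where the weight is 0.\<close>
  define E where "E = (\<Sum>k. c * (of_nat (Suc k) * r ^ k))"
  have E: "(\<lambda>k. c * (of_nat (Suc k) * r ^ k)) sums E" unfolding E_def using sm by (rule summable_sums)
  have E0: "E \<ge> 0" unfolding E_def using c by (intro suminf_nonneg[OF sm]) auto
  \<comment> \<open>An \<open>l\<close> by \<open>m\<close> matrix with entries of modulus at most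
    \<open>e\<close> has norm at most \<open>d * e\<close>.\<close>
  define d where "d = real (max l m)"
  obtain n :: nat where n: "n > 0" "d * E / real n < 1 - \<rho>"
  proof -
    obtain n :: nat where "d * E / (1 - \<rho>) < real n" using reals_Archimedean2 by blast
    then have "d * E / (1 - \<rho>) < real (Suc n)" by simp
    then have "d * E / real (Suc n) < 1 - \<rho>" using \<rho> by (simp add: field_simps)
    then show ?thesis using that[of "Suc n"] by simp
  qed
  from hankel_section_extend[OF sec n(1), where t = n] obtain h where
    h: "\<And>k. k \<ge> 1 \<Longrightarrow> h k = markov_seq F k" "hankel_section l m h (1 - int n) \<rho> n" by blast
  \<comment> \<open>The stable half of the Fejer mean of \<open>h\<close>; the anti-stable half differs from \<open>F\<close> by at most \<open>E / n\<close>
    per entry.\<close>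
  define V where "V k = mat m l (\<lambda>(b,a). real (n - k) / real n * h (- int k) a b
      - (if k = 0 then impulse (F $$ (a,b)) 0 else 0))" for k
  define S where "S = fir m l n V"
  have S: "S \<in> RH_inf m l" unfolding S_def by (rule RH_inf_fir)
  have dF: "F \<in> carrier_mat l m" by (rule RH_inf_carrier[OF F])
  have "bdd_form {..<m} {..<l} (\<lambda>b a. ev z (para_conj F + S) $$ (b,a)) (\<rho> + d * E / real n)" if z: "cmod z = 1" for z
  proof -
    have z0: "z \<noteq> 0" using z by auto
    define \<sigma> where "\<sigma> a b = (\<Sum>i<n. \<Sum>j<n. complex_of_real (h (int i - int j) a b) * z powi (int i - int j)) / of_nat n" for a b
    define err where "err a b = ev z (para_conj F + S) $$ (b,a) - \<sigma> a b" for a b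
    have err: "norm (err a b) \<le> E / real n" if ab: "a < l" "b < m" for a b
    proof -
      define f where "f = F $$ (a,b)"
      have f: "rh f" using F ab by (simp add: f_def RH_inf_iff)
      define W where "W k = of_nat (n - k) / complex_of_nat n" for k
      have ei: "ev z (para_conj F + S) $$ (b,a) = rat_eval (rsub f) z + rat_eval (S $$ (b,a)) z"
      proof -
        have "ev z (para_conj F + S) = ev z (para_conj F) + ev z S"
          by (rule ev_add(2)[OF ev_para_conj(1)[OF RH_inf_regm[OF F] z] RH_inf_regm[OF S]])
            (use z dF RH_inf_carrier[OF S] in auto)
        then show ?thesis using ab dF RH_inf_carrier[OF S] by (simp add: ev_index f_def)
      qed
      have iz: "cmod (inverse z) \<ge> 1" using z by (simp add: norm_inverse)
      have fs: "(\<lambda>k. of_real (impulse f k) * z ^ k) sums rat_eval (rsub f) z"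
        using impulse_props(2)[OF f iz] rat_eval_rsub(2)[OF z0 rh_reg[OF f iz]]
        by (simp add: power_inverse divide_inverse)
      have Sv: "rat_eval (S $$ (b,a)) z = (\<Sum>k<n. W k * (of_real (h (- int k) a b) * z powi (- int k))) - of_real (impulse f 0)"
      proof -
        have "rat_eval (S $$ (b,a)) z = (\<Sum>k<n. of_real (V k $$ (b,a)) * inverse z ^ k)"
          unfolding S_def by (rule rat_eval_fir[OF z0 ab(2,1)])
        also have "\<dots> = (\<Sum>k<n. W k * (of_real (h (- int k) a b) * z powi (- int k))
            - (if k = 0 then of_real (impulse f 0) else 0))"
          using ab by (intro sum.cong refl)
            (simp add: V_def W_def f_def power_int_minus power_inverse algebra_simps)
        also have "\<dots> = (\<Sum>k<n. W k * (of_real (h (- int k) a b) * z powi (- int k))) - of_real (impulse f 0)"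
          using n(1) by (simp add: sum_subtractf)
        finally show ?thesis .
      qed
      have \<sigma>: "\<sigma> a b = (\<Sum>k<n. W k * (of_real (h (- int k) a b) * z powi (- int k)))
          + (\<Sum>k<n. W k * (of_real (h (int k) a b) * z ^ k)) - of_real (h 0 a b)"
        unfolding \<sigma>_def toeplitz_sum[of "\<lambda>k. of_real (h k a b) * z powi k"] W_def using n(1)
        by (simp add: sum_divide_distrib add_divide_distrib diff_divide_distrib del: of_nat_diff)
      \<comment> \<open>Index 0 is treated apart because \<open>h 0\<close> comes from Parrott's
        lemma and may differ from the constant term of \<open>F\<close>. From index 1 on the
        coefficients agree.\<close>
      have split: "(\<Sum>k<n. W k * (of_real (h (int k) a b) * z ^ k)) - of_real (h 0 a b)
          = (\<Sum>k<n. W k * (of_real (impulse f k) * z ^ k)) - of_real (impulse f 0)"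
      proof -
        obtain n' where n': "n = Suc n'" using n(1) by (cases n) auto
        have "W 0 = 1" using n(1) by (simp add: W_def)
        moreover have "h (int (Suc k)) a b = impulse f (Suc k)" for k
          using h(1)[of "int (Suc k)"] by (simp add: markov_seq_def f_def nat_add_distrib)
        ultimately show ?thesis unfolding n' sum.lessThan_Suc_shift by simp
      qed
      have e1: "err a b = rat_eval (rsub f) z - (\<Sum>k<n. W k * (of_real (impulse f k) * z ^ k))"
        unfolding err_def ei Sv \<sigma> using split by (simp add: algebra_simps)
      have e2: "(\<lambda>k. if k < n then W k * (of_real (impulse f k) * z ^ k) else 0) sums
          (\<Sum>k<n. W k * (of_real (impulse f k) * z ^ k))"
        using sums_If_finite_set[of "{..<n}" "\<lambda>k. W k * (of_real (impulse f k) * z ^ k)"] by simp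
      have err_sums: "(\<lambda>k. of_real (impulse f k) * z ^ k
          - (if k < n then W k * (of_real (impulse f k) * z ^ k) else 0)) sums err a b"
        unfolding e1 by (rule sums_diff[OF fs e2])
      have bound: "norm (of_real (impulse f k) * z ^ k
          - (if k < n then W k * (of_real (impulse f k) * z ^ k) else 0)) \<le> c * (of_nat (Suc k) * r ^ k) / real n" for k
      proof -
        define v where "v = (if k < n then 1 - W k else 1)"
        have "norm v \<le> real (Suc k) / real n"
        proof (cases "k < n")
          case True
          have "v = complex_of_real (real k / real n)"
            using True n(1) by (simp add: v_def W_def of_nat_diff field_simps)
          then have "norm v = real k / real n" by (simp only: norm_of_real) simp
          then show ?thesis by (simp add: divide_right_mono)
        next
          case False
          then show ?thesis using n(1) by (simp add: v_def)
        qed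
        moreover have "\<bar>impulse f k\<bar> \<le> c * r ^ k" unfolding f_def by (rule c(4)[OF ab])
        ultimately have "norm v * \<bar>impulse f k\<bar> \<le> real (Suc k) / real n * (c * r ^ k)"
          by (intro mult_mono) auto
        moreover have "of_real (impulse f k) * z ^ k
          - (if k < n then W k * (of_real (impulse f k) * z ^ k) else 0) = v * (of_real (impulse f k) * z ^ k)"
          by (simp add: v_def algebra_simps)
        ultimately show ?thesis using z by (simp add: norm_mult norm_power mult_ac)
      qed
      show ?thesis by (rule norm_sums_le[OF err_sums sums_divide[OF E] bound])
    qed
    have "bdd_form {..<l} {..<m} err (d * E / real n)"
    proof (rule bdd_form_rank_one[of _ _ _ "\<lambda>_. sqrt (E / real n)" "\<lambda>_. sqrt (E / real n)"])
      show "norm (err a b) \<le> sqrt (E / real n) * sqrt (E / real n)" if "a \<in> {..<l}" "b \<in> {..<m}" for a b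
        using err that E0 by simp
      have e: "E / real n \<ge> 0" using E0 by simp
      have le: "real l * (E / real n) \<le> d * (E / real n)" "real m * (E / real n) \<le> d * (E / real n)"
        using e by (intro mult_right_mono; simp add: d_def)+
      then show "(\<Sum>i<l. (sqrt (E / real n))\<^sup>2) \<le> d * E / real n" "(\<Sum>i<m. (sqrt (E / real n))\<^sup>2) \<le> d * E / real n"
        unfolding real_sqrt_pow2[OF e] sum_constant card_lessThan by simp_all
    qed
    moreover have "bdd_form {..<l} {..<m} \<sigma> \<rho>"
      unfolding \<sigma>_def by (rule fejer_bdd_form[OF h(2) n(1) z])
    ultimately have "bdd_form {..<l} {..<m} (\<lambda>a b. \<sigma> a b + err a b) (\<rho> + d * E / real n)"
      by (intro bdd_form_add)
    then have "bdd_form {..<l} {..<m} (\<lambda>a b. ev z (para_conj F + S) $$ (b,a)) (\<rho> + d * E / real n)"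
      by (simp add: err_def)
    then show ?thesis by (rule bdd_form_swap)
  qed
  moreover have "\<rho> + d * E / real n \<ge> 0" using \<rho> E0 by (auto simp: d_def)
  moreover have "\<rho> + d * E / real n < 1" using n(2) by simp
  ultimately show ?thesis using S by blast
qed

text \<open>The Hankel form at \<open>w\<close> and \<open>u\<close> is the average over the circle
  of the form of \<open>para_conj F + S\<close> at two trigonometric polynomials with coefficients
  \<open>w\<close> and \<open>u\<close>. Their exponents \<open>- i\<close> and
  \<open>- j - 1\<close> select the coefficients at \<open>i + j + 1 \<ge> 1\<close>, where the
  stable \<open>S\<close> has none. Pointwise contractivity and Parseval's identity give the
  bound.\<close>

lemma nehari_necessary:
  assumes F: "F \<in> RH_inf l m" and S: "S \<in> RH_inf m l" and \<rho>: "\<rho> \<ge> 0"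
    and b: "\<And>z. cmod z = 1 \<Longrightarrow> bdd_form {..<m} {..<l} (\<lambda>b a. ev z (para_conj F + S) $$ (b,a)) \<rho>"
  shows "hankel_section l m (markov_seq F) 1 \<rho> K"
  unfolding hankel_section_def bdd_form_def
proof (intro allI)
  fix w u :: "nat \<times> nat \<Rightarrow> real"
  let ?I = "{..<K} \<times> {..<l}" and ?J = "{..<K} \<times> {..<m}"
  have dF: "F \<in> carrier_mat l m" and dS: "S \<in> carrier_mat m l" using F S by (auto simp: RH_inf_carrier)
  define e where "e a b z = ev z (para_conj F + S) $$ (b,a)" for a b z
  define c where "c a b k = (if k \<ge> 0 then complex_of_real (impulse (F $$ (a,b)) (nat k)) else 0)
    + (if k \<le> 0 then of_real (impulse (S $$ (b,a)) (nat (- k))) else 0)" for a b k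
  have le: "laurent (c a b) (e a b)" if ab: "a < l" "b < m" for a b
  proof -
    have "rh (F $$ (a,b))" "rh (S $$ (b,a))" using F S ab by (auto simp: RH_inf_iff)
    from laurent_add[OF laurent_rsub[OF this(1)] laurent_rh[OF this(2)]]
    have L0: "laurent (c a b) (\<lambda>z. rat_eval (rsub (F $$ (a,b))) z + rat_eval (S $$ (b,a)) z)"
      by (simp add: c_def[abs_def])
    have ec: "rat_eval (rsub (F $$ (a,b))) z + rat_eval (S $$ (b,a)) z = e a b z" if z: "cmod z = 1" for z
    proof -
      have "ev z (para_conj F + S) = ev z (para_conj F) + ev z S"
        by (rule ev_add(2)[OF ev_para_conj(1)[OF RH_inf_regm[OF F] z] RH_inf_regm[OF S]])
          (use z dF dS in auto)
      then show ?thesis using ab dF dS by (simp add: ev_index e_def)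
    qed
    show ?thesis by (rule laurent_cong[OF L0 refl ec])
  qed
  define \<phi> where "\<phi> z = (\<Sum>p\<in>?I. \<Sum>q\<in>?J. of_real (w p * u q) *
    (z powi (- (int (fst p) + int (fst q) + 1)) * e (snd p) (snd q) z))" for z
  \<comment> \<open>The squared length of the trigonometric polynomial with coefficients
    \<open>v\<close>, expanded into a Laurent polynomial so that its mean can be read off.\<close>
  define \<psi> where "\<psi> N v z = (\<Sum>a<N. \<Sum>i<K. \<Sum>j<K. complex_of_real (v (i,a) * v (j,a)) * z powi (int j - int i))"
    for N :: nat and v :: "nat \<times> nat \<Rightarrow> real" and z
  have "laurent (\<lambda>k. \<Sum>p\<in>?I. \<Sum>q\<in>?J. of_real (w p * u q) * c (snd p) (snd q) (k - (- (int (fst p) + int (fst q) + 1)))) \<phi>"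
    unfolding \<phi>_def[abs_def]
    by (intro laurent_sum laurent_cmult laurent_shift le) auto
  from circle_mean_laurent[OF this, unfolded diff_0 minus_minus]
  have m\<phi>: "circle_mean \<phi> \<longlonglongrightarrow>
      of_real (\<Sum>p\<in>?I. \<Sum>q\<in>?J. w p * markov_seq F (int (fst p) + int (fst q) + 1) (snd p) (snd q) * u q)"
    by (simp add: c_def markov_seq_def mult_ac)
  have m\<psi>: "circle_mean (\<psi> N v) \<longlonglongrightarrow> of_real (\<Sum>p\<in>{..<K} \<times> {..<N}. (v p)\<^sup>2)" for N v
  proof -
    have "laurent (\<lambda>k. \<Sum>a<N. \<Sum>i<K. \<Sum>j<K. if k = int j - int i then complex_of_real (v (i,a) * v (j,a)) else 0) (\<psi> N v)"
      unfolding \<psi>_def[abs_def] by (intro laurent_sum laurent_powi)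
    from circle_mean_laurent[OF this]
    have "circle_mean (\<psi> N v) \<longlonglongrightarrow> (\<Sum>a<N. \<Sum>i<K. \<Sum>j<K. if j = i then complex_of_real (v (i,a) * v (j,a)) else 0)"
      by (simp add: eq_commute[of "0::int"])
    also have "(\<Sum>a<N. \<Sum>i<K. \<Sum>j<K. if j = i then complex_of_real (v (i,a) * v (j,a)) else 0)
        = of_real (\<Sum>a<N. \<Sum>i<K. (v (i,a))\<^sup>2)" by (simp add: power2_eq_square)
    also have "(\<Sum>a<N. \<Sum>i<K. (v (i,a))\<^sup>2) = (\<Sum>p\<in>{..<K} \<times> {..<N}. (v p)\<^sup>2)"
      by (subst sum.swap) (simp add: sum.cartesian_product')
    finally show ?thesis .
  qed
  have pw: "norm (2 * \<phi> z) \<le> Re (of_real \<rho> * (\<psi> l w z + \<psi> m u z))" if z: "cmod z = 1" for z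
  proof -
    have z0: "z \<noteq> 0" using z by auto
    have cz: "cnj z = inverse z"
      using z complex_norm_square[of z] by (intro inverse_unique[symmetric]) simp
    define X where "X i a = complex_of_real (w (i,a)) * z powi (- int i)" for i a
    define Y where "Y j b = complex_of_real (u (j,b)) * z powi (- int j - 1)" for j b
    define x where "x a = (\<Sum>i<K. X i a)" for a
    define y where "y b = (\<Sum>j<K. Y j b)" for b
    have "\<phi> z = (\<Sum>i<K. \<Sum>a<l. \<Sum>j<K. \<Sum>b<m. X i a * e a b z * Y j b)"
    proof -
      have "z powi (- (int i + int j + 1)) = z powi (- int i) * z powi (- int j - 1)" for i j
      proof -
        have "- (int i + int j + 1) = (- int i) + (- int j - 1)" by simp
        then show ?thesis by (simp only: power_int_add[OF disjI1[OF z0]])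
      qed
      then show ?thesis unfolding \<phi>_def X_def Y_def
        by (simp add: sum.cartesian_product' mult_ac)
    qed
    also have "\<dots> = (\<Sum>i<K. \<Sum>a<l. \<Sum>b<m. X i a * e a b z * y b)"
      unfolding y_def sum_distrib_left by (intro sum.cong refl sum.swap)
    also have "\<dots> = (\<Sum>a<l. \<Sum>i<K. \<Sum>b<m. X i a * e a b z * y b)" by (rule sum.swap)
    also have "\<dots> = (\<Sum>a<l. \<Sum>b<m. x a * e a b z * y b)"
      unfolding x_def sum_distrib_right by (intro sum.cong refl sum.swap)
    finally have \<phi>: "\<phi> z = (\<Sum>a<l. \<Sum>b<m. x a * e a b z * y b)" .
    have xn: "of_real (\<Sum>a<N. (norm (\<Sum>i<K. complex_of_real (v (i,a)) * z powi (- int i - s)))\<^sup>2) = \<psi> N v z" for N v s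
    proof -
      have "complex_of_real ((norm (\<Sum>i<K. complex_of_real (v (i,a)) * z powi (- int i - s)))\<^sup>2)
          = (\<Sum>i<K. \<Sum>j<K. complex_of_real (v (i,a) * v (j,a)) * z powi (int j - int i))" for a
      proof -
        have "z powi (- int i - s) * cnj (z powi (- int j - s)) = z powi (int j - int i)" for i j
        proof -
          have "cnj (z powi (- int j - s)) = z powi (int j + s)"
            by (simp add: complex_cnj_power_int cz power_int_inverse add.commute flip: power_int_minus)
          then show ?thesis using z0 by (simp flip: power_int_add)
        qed
        then have pp: "complex_of_real (v (i,a)) * z powi (- int i - s) * cnj (complex_of_real (v (j,a)) * z powi (- int j - s))
            = complex_of_real (v (i,a) * v (j,a)) * z powi (int j - int i)" for i j
          by (simp add: mult_ac)
        show ?thesis unfolding complex_norm_square cnj_sum sum_product pp ..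
      qed
      then show ?thesis unfolding \<psi>_def of_real_sum by simp
    qed
    have xn': "of_real (\<Sum>a<l. (norm (x a))\<^sup>2) = \<psi> l w z" using xn[of w 0 l] by (simp add: x_def X_def)
    have yn': "of_real (\<Sum>b<m. (norm (y b))\<^sup>2) = \<psi> m u z" using xn[of u 1 m] by (simp add: y_def Y_def)
    have "2 * norm (\<phi> z) \<le> \<rho> * ((\<Sum>a<l. (norm (x a))\<^sup>2) + (\<Sum>b<m. (norm (y b))\<^sup>2))"
      unfolding \<phi> e_def by (rule bdd_formD[OF bdd_form_swap[OF b[OF z]]])
    also have "\<dots> = Re (of_real \<rho> * (\<psi> l w z + \<psi> m u z))"
      unfolding xn'[symmetric] yn'[symmetric] by (simp del: of_real_sum)
    finally show ?thesis by (simp add: norm_mult)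
  qed
  have lim: "(\<lambda>M. circle_mean (\<lambda>z. 2 * \<phi> z) M) \<longlonglongrightarrow>
      2 * of_real (\<Sum>p\<in>?I. \<Sum>q\<in>?J. w p * markov_seq F (int (fst p) + int (fst q) + 1) (snd p) (snd q) * u q)"
    unfolding circle_mean_cmult by (intro tendsto_mult tendsto_const m\<phi>)
  have lim2: "(\<lambda>M. circle_mean (\<lambda>z. of_real \<rho> * (\<psi> l w z + \<psi> m u z)) M) \<longlonglongrightarrow>
      of_real \<rho> * (of_real (\<Sum>p\<in>?I. (w p)\<^sup>2) + of_real (\<Sum>q\<in>?J. (u q)\<^sup>2))"
    unfolding circle_mean_cmult circle_mean_add by (intro tendsto_mult tendsto_add tendsto_const m\<psi>)
  have "norm (2 * complex_of_real (\<Sum>p\<in>?I. \<Sum>q\<in>?J. w p * markov_seq F (int (fst p) + int (fst q) + 1) (snd p) (snd q) * u q))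
      \<le> Re (of_real \<rho> * (complex_of_real (\<Sum>p\<in>?I. (w p)\<^sup>2) + of_real (\<Sum>q\<in>?J. (u q)\<^sup>2)))"
    by (rule LIMSEQ_le[OF tendsto_norm[OF lim] tendsto_Re[OF lim2]])
      (intro exI[of _ 0] allI impI circle_mean_norm_le pw)
  then show "2 * norm (\<Sum>p\<in>?I. \<Sum>q\<in>?J. w p * markov_seq F (int (fst p) + int (fst q) + 1) (snd p) (snd q) * u q)
      \<le> \<rho> * ((\<Sum>p\<in>?I. (norm (w p))\<^sup>2) + (\<Sum>q\<in>?J. (norm (u q))\<^sup>2))"
    by (simp add: norm_mult del: of_real_sum of_real_mult)
qed

theorem nehari:
  assumes F: "F \<in> RH_inf l m"
  shows "Hankel_norm F < 1 \<longleftrightarrow> (\<exists>S\<in>RH_inf m l. \<exists>\<rho>\<ge>0. \<rho> < 1 \<and>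
    (\<forall>z. cmod z = 1 \<longrightarrow> bdd_form {..<m} {..<l} (\<lambda>b a. ev z (para_conj F + S) $$ (b,a)) \<rho>))"
  unfolding Hankel_norm_less_one_iff[OF F]
  using nehari_sufficient[OF F] nehari_necessary[OF F] by blast

section \<open>Matrix inequalities as dissipation inequalities\<close>

lemma sq_vec_nonneg: "(v :: real vec) \<bullet> v \<ge> 0"
  by (simp add: scalar_prod_def sum_nonneg)

lemma sq_vec_sum: "(v :: real vec) \<bullet> v = (\<Sum>i<dim_vec v. (v $ i)\<^sup>2)"
  by (simp add: scalar_prod_def atLeast0LessThan power2_eq_square)

lemma adjoint_scalar_prod:
  fixes A :: "real mat"
  assumes "A \<in> carrier_mat m n" "x \<in> carrier_vec n" "y \<in> carrier_vec m"
  shows "x \<bullet> (transpose_mat A *\<^sub>v y) = (A *\<^sub>v x) \<bullet> y"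
  using transpose_vec_mult_scalar[OF assms] assms
  by (metis comm_scalar_prod mult_mat_vec_carrier transpose_carrier_mat)

lemma sym_scalar_prod:
  fixes P :: "real mat"
  assumes "P \<in> carrier_mat n n" "transpose_mat P = P" "x \<in> carrier_vec n" "y \<in> carrier_vec n"
  shows "x \<bullet> (P *\<^sub>v y) = y \<bullet> (P *\<^sub>v x)"
  using adjoint_scalar_prod[OF assms(1,3,4)] assms
  by (metis comm_scalar_prod mult_mat_vec_carrier)

lemma transpose_eqI:
  fixes P :: "real mat"
  assumes P: "P \<in> carrier_mat n n"
    and sym: "\<And>x y. x \<in> carrier_vec n \<Longrightarrow> y \<in> carrier_vec n \<Longrightarrow> x \<bullet> (P *\<^sub>v y) = y \<bullet> (P *\<^sub>v x)"
  shows "transpose_mat P = P"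
proof (rule eq_matI)
  fix i j assume "i < dim_row P" "j < dim_col P"
  then have ij: "i < n" "j < n" using P by auto
  have e: "unit_vec n a \<bullet> (P *\<^sub>v unit_vec n b) = P $$ (a,b)" if "a < n" "b < n" for a b
  proof -
    have "P *\<^sub>v unit_vec n b \<in> carrier_vec n" using P by simp
    then have "unit_vec n a \<bullet> (P *\<^sub>v unit_vec n b) = (P *\<^sub>v unit_vec n b) $ a"
      using that by (simp add: scalar_prod_left_unit del: index_mult_mat_vec)
    also have "\<dots> = P $$ (a,b)" using that P by simp
    finally show ?thesis .
  qed
  show "transpose_mat P $$ (i,j) = P $$ (i,j)"
    using sym[of "unit_vec n j" "unit_vec n i"] e[OF ij] e[OF ij(2,1)] ij P by simp
qed (use P in auto)

lemma uminus_mult_mat_vec_real: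
  fixes M :: "real mat"
  assumes "M \<in> carrier_mat n m" "v \<in> carrier_vec m"
  shows "(- M) *\<^sub>v v = - (M *\<^sub>v v)"
  using assms by (intro eq_vecI) (auto simp: scalar_prod_def sum_negf)

lemma scalar_prod_uminus_r:
  fixes v w :: "real vec"
  assumes "dim_vec v = dim_vec w"
  shows "v \<bullet> (- w) = - (v \<bullet> w)"
  using assms by (simp add: scalar_prod_def sum_negf)

lemma psd_uminus_iff:
  fixes M :: "real mat"
  assumes M: "M \<in> carrier_mat n n"
  shows "psd (- M) \<longleftrightarrow> (\<forall>v\<in>carrier_vec n. \<forall>w\<in>carrier_vec n. v \<bullet> (M *\<^sub>v w) = w \<bullet> (M *\<^sub>v v)) \<and>
    (\<forall>v\<in>carrier_vec n. v \<bullet> (M *\<^sub>v v) \<le> 0)"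
proof -
  have q: "v \<bullet> ((- M) *\<^sub>v w) = - (v \<bullet> (M *\<^sub>v w))" if "v \<in> carrier_vec n" "w \<in> carrier_vec n" for v w
    unfolding uminus_mult_mat_vec_real[OF M that(2)]
    by (rule scalar_prod_uminus_r) (use that M in simp)
  have mM: "- M \<in> carrier_mat n n" using M by simp
  have dim: "square_mat (- M)" "dim_row (- M) = n" using M by auto
  show ?thesis unfolding psd_def dim(2)
    using sym_scalar_prod[OF mM] transpose_eqI[OF mM] dim(1) q by (metis neg_0_le_iff_le neg_equal_iff_equal)
qed

lemma psd_bilinear:
  assumes "psd P" "P \<in> carrier_mat n n" "x \<in> carrier_vec n" "y \<in> carrier_vec n"
  shows "x \<bullet> (P *\<^sub>v y) = y \<bullet> (P *\<^sub>v x)" "x \<bullet> (P *\<^sub>v x) \<ge> 0"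
  using assms sym_scalar_prod[of P n x y] unfolding psd_def by auto

lemma append_columns_mult_vec:
  fixes A :: "real mat"
  assumes A: "A \<in> carrier_mat n p" and B: "B \<in> carrier_mat n q" and a: "a \<in> carrier_vec p" and b: "b \<in> carrier_vec q"
  shows "A @\<^sub>c B \<in> carrier_mat n (p + q)" "(A @\<^sub>c B) *\<^sub>v (a @\<^sub>v b) = A *\<^sub>v a + B *\<^sub>v b"
proof -
  have d: "dim_col A = p" "dim_col B = q" using A B by auto
  show "A @\<^sub>c B \<in> carrier_mat n (p + q)" unfolding append_columns_def d
    using four_block_carrier_mat[OF A, of "0\<^sub>m 0 q" 0 q] by simp
  have "(A @\<^sub>c B) *\<^sub>v (a @\<^sub>v b) = (A *\<^sub>v a + B *\<^sub>v b) @\<^sub>v (0\<^sub>m 0 p *\<^sub>v a + 0\<^sub>m 0 q *\<^sub>v b)"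
    unfolding append_columns_def d by (rule four_block_mat_mult_vec[OF A B _ _ a b]) auto
  also have "\<dots> = A *\<^sub>v a + B *\<^sub>v b"
    by (intro eq_vecI) auto
  finally show "(A @\<^sub>c B) *\<^sub>v (a @\<^sub>v b) = A *\<^sub>v a + B *\<^sub>v b" .
qed

text \<open>The content of \<open>LMI\<close> with the auxiliary vectors eliminated:
  \<open>P\<close> is a storage function for the input energy, and \<open>lam * Q\<close> is one for
  the output energy. A positive \<open>lam\<close> permits division by it; the value 0 allowed in
  \<open>LMI\<close> is handled by raising \<open>lam\<close>.\<close>

definition dissipative :: "real mat \<Rightarrow> real mat \<Rightarrow> real mat \<Rightarrow> nat \<Rightarrow> nat \<Rightarrow> real mat \<Rightarrow> real mat \<Rightarrow> real \<Rightarrow> bool" where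
  "dissipative A B C n m P Q lam \<longleftrightarrow>
    P \<in> carrier_mat n n \<and> Q \<in> carrier_mat n n \<and> psd P \<and> psd Q \<and> 0 < lam \<and> lam < 1 \<and>
    (\<forall>x\<in>carrier_vec n. \<forall>u\<in>carrier_vec m. (A *\<^sub>v x + B *\<^sub>v u) \<bullet> (P *\<^sub>v (A *\<^sub>v x + B *\<^sub>v u)) \<le> x \<bullet> (P *\<^sub>v x) + u \<bullet> u) \<and>
    (\<forall>x\<in>carrier_vec n. lam * ((A *\<^sub>v x) \<bullet> (Q *\<^sub>v (A *\<^sub>v x))) + (C *\<^sub>v x) \<bullet> (C *\<^sub>v x) \<le> lam * (x \<bullet> (Q *\<^sub>v x))) \<and>
    (\<forall>x\<in>carrier_vec n. x \<bullet> (Q *\<^sub>v x) \<le> x \<bullet> (P *\<^sub>v x))"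

lemma ball_append_vec:
  "(\<forall>v\<in>carrier_vec (n + m). R v) \<longleftrightarrow> (\<forall>x\<in>carrier_vec n. \<forall>y\<in>carrier_vec m. R (x @\<^sub>v y))"
  by (metis append_carrier_vec vec_first_carrier vec_first_last_append vec_last_carrier)

context
  fixes A B C :: "real mat" and n m l :: nat
  assumes A: "A \<in> carrier_mat n n" and B: "B \<in> carrier_mat n m" and C: "C \<in> carrier_mat l n"
begin

text \<open>The second component \<open>y\<close> stays a free variable and no Schur complement is
  taken, since \<open>lam\<close> may be 0 at this point.\<close>

lemma output_block:
  assumes Q: "Q \<in> carrier_mat n n" "psd Q"
  shows "psd (- four_block_mat (transpose_mat A * Q * A - Q) (transpose_mat C) C (- (lam \<cdot>\<^sub>m 1\<^sub>m l))) \<longleftrightarrow>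
    (\<forall>x\<in>carrier_vec n. \<forall>y\<in>carrier_vec l.
      (A *\<^sub>v x) \<bullet> (Q *\<^sub>v (A *\<^sub>v x)) - x \<bullet> (Q *\<^sub>v x) + 2 * (y \<bullet> (C *\<^sub>v x)) - lam * (y \<bullet> y) \<le> 0)"
proof -
  let ?X = "transpose_mat A * Q * A - Q" and ?L = "- (lam \<cdot>\<^sub>m 1\<^sub>m l) :: real mat"
  let ?M = "four_block_mat ?X (transpose_mat C) C ?L"
  have X: "?X \<in> carrier_mat n n" and Ct: "transpose_mat C \<in> carrier_mat n l" and L: "?L \<in> carrier_mat l l"
    using A Q C by (auto intro: minus_carrier_mat)
  have M: "?M \<in> carrier_mat (n + l) (n + l)" by (rule four_block_carrier_mat[OF X L])
  have form: "(x @\<^sub>v y) \<bullet> (?M *\<^sub>v (x' @\<^sub>v y')) = (A *\<^sub>v x) \<bullet> (Q *\<^sub>v (A *\<^sub>v x')) - x \<bullet> (Q *\<^sub>v x')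
      + (C *\<^sub>v x) \<bullet> y' + y \<bullet> (C *\<^sub>v x') - lam * (y \<bullet> y')"
    if x: "x \<in> carrier_vec n" "x' \<in> carrier_vec n" and y: "y \<in> carrier_vec l" "y' \<in> carrier_vec l" for x x' y y'
  proof -
    have Ax: "A *\<^sub>v x \<in> carrier_vec n" "A *\<^sub>v x' \<in> carrier_vec n" using A x by auto
    have X': "?X *\<^sub>v x' = transpose_mat A *\<^sub>v (Q *\<^sub>v (A *\<^sub>v x')) - Q *\<^sub>v x'"
    proof -
      have AQ: "transpose_mat A * Q \<in> carrier_mat n n" using A Q by simp
      have "?X *\<^sub>v x' = (transpose_mat A * Q * A) *\<^sub>v x' - Q *\<^sub>v x'"
        by (rule minus_mult_distrib_mat_vec[OF _ Q(1) x(2)]) (use A Q in simp)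
      also have "(transpose_mat A * Q * A) *\<^sub>v x' = (transpose_mat A * Q) *\<^sub>v (A *\<^sub>v x')"
        by (rule assoc_mult_mat_vec[OF AQ A x(2)])
      also have "\<dots> = transpose_mat A *\<^sub>v (Q *\<^sub>v (A *\<^sub>v x'))"
        by (rule assoc_mult_mat_vec[OF _ Q(1) Ax(2)]) (use A in simp)
      finally show ?thesis .
    qed
    have L': "?L *\<^sub>v y' = (- lam) \<cdot>\<^sub>v y'"
    proof (rule eq_vecI)
      fix i assume "i < dim_vec ((- lam) \<cdot>\<^sub>v y')"
      then have i: "i < l" using y by simp
      have "(?L *\<^sub>v y') $ i = (\<Sum>k<l. ?L $$ (i,k) * y' $ k)"
        using mult_vec_index[of i ?L y'] y i by simp
      also have "\<dots> = (\<Sum>k<l. if k = i then - lam * y' $ k else 0)"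
        using i by (intro sum.cong) auto
      also have "\<dots> = ((- lam) \<cdot>\<^sub>v y') $ i" using i y by simp
      finally show "(?L *\<^sub>v y') $ i = ((- lam) \<cdot>\<^sub>v y') $ i" .
    qed (use y in simp)
    have c: "?X *\<^sub>v x' \<in> carrier_vec n" "transpose_mat C *\<^sub>v y' \<in> carrier_vec n" "C *\<^sub>v x' \<in> carrier_vec l" "?L *\<^sub>v y' \<in> carrier_vec l"
      using mult_mat_vec_carrier[OF X x(2)] mult_mat_vec_carrier[OF Ct y(2)] mult_mat_vec_carrier[OF C x(2)]
        mult_mat_vec_carrier[OF L y(2)] by blast+
    have "(x @\<^sub>v y) \<bullet> (?M *\<^sub>v (x' @\<^sub>v y')) = x \<bullet> (?X *\<^sub>v x' + transpose_mat C *\<^sub>v y') + y \<bullet> (C *\<^sub>v x' + ?L *\<^sub>v y')"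
      unfolding four_block_mat_mult_vec[OF X Ct C L x(2) y(2)]
      by (rule scalar_prod_append[OF x(1) y(1)]) (use c in auto)
    also have "\<dots> = x \<bullet> (?X *\<^sub>v x') + x \<bullet> (transpose_mat C *\<^sub>v y') + (y \<bullet> (C *\<^sub>v x') + y \<bullet> (?L *\<^sub>v y'))"
      using scalar_prod_add_distrib[OF x(1) c(1,2)] scalar_prod_add_distrib[OF y(1) c(3,4)] by simp
    also have "x \<bullet> (?X *\<^sub>v x') = (A *\<^sub>v x) \<bullet> (Q *\<^sub>v (A *\<^sub>v x')) - x \<bullet> (Q *\<^sub>v x')"
    proof -
      have q: "Q *\<^sub>v (A *\<^sub>v x') \<in> carrier_vec n" "Q *\<^sub>v x' \<in> carrier_vec n" using Q Ax x by auto
      have "x \<bullet> (?X *\<^sub>v x') = x \<bullet> (transpose_mat A *\<^sub>v (Q *\<^sub>v (A *\<^sub>v x'))) - x \<bullet> (Q *\<^sub>v x')"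
        unfolding X' by (rule scalar_prod_minus_distrib[OF x(1) _ q(2)]) (use A q in simp)
      then show ?thesis using adjoint_scalar_prod[OF A x(1) q(1)] by simp
    qed
    also have "x \<bullet> (transpose_mat C *\<^sub>v y') = (C *\<^sub>v x) \<bullet> y'" by (rule adjoint_scalar_prod[OF C x(1) y(2)])
    also have "y \<bullet> (?L *\<^sub>v y') = - lam * (y \<bullet> y')" unfolding L' using y by simp
    finally show ?thesis by simp
  qed
  have cc: "(C *\<^sub>v x) \<bullet> y = y \<bullet> (C *\<^sub>v x)" if "x \<in> carrier_vec n" "y \<in> carrier_vec l" for x y
    by (rule comm_scalar_prod[OF mult_mat_vec_carrier[OF C that(1)] that(2)])
  have sym: "(x @\<^sub>v y) \<bullet> (?M *\<^sub>v (x' @\<^sub>v y')) = (x' @\<^sub>v y') \<bullet> (?M *\<^sub>v (x @\<^sub>v y))"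
    if x: "x \<in> carrier_vec n" "x' \<in> carrier_vec n" and y: "y \<in> carrier_vec l" "y' \<in> carrier_vec l" for x x' y y'
  proof -
    have Ax: "A *\<^sub>v x \<in> carrier_vec n" "A *\<^sub>v x' \<in> carrier_vec n" using A x by auto
    show ?thesis
      unfolding form[OF x y] form[OF x(2,1) y(2,1)]
      using psd_bilinear(1)[OF Q(2,1) Ax] psd_bilinear(1)[OF Q(2,1) x] cc[OF x(1) y(2)] cc[OF x(2) y(1)]
        comm_scalar_prod[OF y, THEN arg_cong[where f = "(*) lam"]] by linarith
  qed
  have q: "(x @\<^sub>v y) \<bullet> (?M *\<^sub>v (x @\<^sub>v y))
      = (A *\<^sub>v x) \<bullet> (Q *\<^sub>v (A *\<^sub>v x)) - x \<bullet> (Q *\<^sub>v x) + 2 * (y \<bullet> (C *\<^sub>v x)) - lam * (y \<bullet> y)"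
    if "x \<in> carrier_vec n" "y \<in> carrier_vec l" for x y
    using form[OF that(1,1) that(2,2)] cc[OF that] by linarith
  show ?thesis unfolding psd_uminus_iff[OF M] ball_append_vec
  proof (intro iffI conjI ballI, goal_cases)
    case (1 x y)
    then show ?case using q[OF 1(2,3)] by (metis (no_types, lifting))
  next
    case (2 x y x' y')
    then show ?case by (intro sym)
  next
    case (3 x y)
    then show ?case using q[OF 3(2,3)] by (metis (no_types, lifting))
  qed
qed

text \<open>All three components stay free: \<open>P\<close> may be singular, so that it cannot be
  inverted for a Schur complement.\<close>

lemma input_block:
  assumes P: "P \<in> carrier_mat n n" "psd P"
  shows "psd (- ((- P @\<^sub>c P * B @\<^sub>c P * A) @\<^sub>r
              (transpose_mat B * P @\<^sub>c - 1\<^sub>m m @\<^sub>c 0\<^sub>m m n) @\<^sub>r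
              (transpose_mat A * P @\<^sub>c 0\<^sub>m n m @\<^sub>c - P))) \<longleftrightarrow>
    (\<forall>w\<in>carrier_vec n. \<forall>u\<in>carrier_vec m. \<forall>x\<in>carrier_vec n.
      - (w \<bullet> (P *\<^sub>v w)) + 2 * (w \<bullet> (P *\<^sub>v (A *\<^sub>v x + B *\<^sub>v u))) - u \<bullet> u - x \<bullet> (P *\<^sub>v x) \<le> 0)"
proof -
  let ?R1 = "- P @\<^sub>c P * B @\<^sub>c P * A"
  let ?R2 = "transpose_mat B * P @\<^sub>c - 1\<^sub>m m @\<^sub>c 0\<^sub>m m n"
  let ?R3 = "transpose_mat A * P @\<^sub>c 0\<^sub>m n m @\<^sub>c - P"
  let ?M = "?R1 @\<^sub>r ?R2 @\<^sub>r ?R3"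
  have cP: "- P \<in> carrier_mat n n" "P * B \<in> carrier_mat n m" "P * A \<in> carrier_mat n n"
    "transpose_mat B * P \<in> carrier_mat m n" "transpose_mat A * P \<in> carrier_mat n n"
    "- 1\<^sub>m m \<in> carrier_mat m m" using A B P by auto
  have R1: "?R1 \<in> carrier_mat n (n + (m + n))"
    and R2: "?R2 \<in> carrier_mat m (n + (m + n))" and R3: "?R3 \<in> carrier_mat n (n + (m + n))"
    using cP by (auto intro!: append_columns_mult_vec(1)[OF _ _ zero_carrier_vec zero_carrier_vec])
  have R23: "?R2 @\<^sub>r ?R3 \<in> carrier_mat (m + n) (n + (m + n))" by (rule carrier_append_rows[OF R2 R3])
  have M: "?M \<in> carrier_mat (n + (m + n)) (n + (m + n))" by (rule carrier_append_rows[OF R1 R23])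
  have form: "(w @\<^sub>v (u @\<^sub>v x)) \<bullet> (?M *\<^sub>v (w' @\<^sub>v (u' @\<^sub>v x')))
      = - (w \<bullet> (P *\<^sub>v w')) + w \<bullet> (P *\<^sub>v (A *\<^sub>v x' + B *\<^sub>v u')) + (A *\<^sub>v x + B *\<^sub>v u) \<bullet> (P *\<^sub>v w')
        - u \<bullet> u' - x \<bullet> (P *\<^sub>v x')"
    if w: "w \<in> carrier_vec n" "w' \<in> carrier_vec n" and u: "u \<in> carrier_vec m" "u' \<in> carrier_vec m"
      and x: "x \<in> carrier_vec n" "x' \<in> carrier_vec n" for w w' u u' x x'
  proof -
    have ux: "u' @\<^sub>v x' \<in> carrier_vec (m + n)" using u x by simp
    have v: "w' @\<^sub>v (u' @\<^sub>v x') \<in> carrier_vec (n + (m + n))" using w ux by simp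
    have Pw: "P *\<^sub>v w' \<in> carrier_vec n" "P *\<^sub>v x' \<in> carrier_vec n" "P *\<^sub>v w \<in> carrier_vec n" using P w x by auto
    have Ax: "A *\<^sub>v x' \<in> carrier_vec n" "A *\<^sub>v x \<in> carrier_vec n" "B *\<^sub>v u' \<in> carrier_vec n" "B *\<^sub>v u \<in> carrier_vec n"
      using A B x u by auto
    have PAx: "P *\<^sub>v (A *\<^sub>v x') \<in> carrier_vec n" "P *\<^sub>v (B *\<^sub>v u') \<in> carrier_vec n" using P Ax by auto
    have r1: "?R1 *\<^sub>v (w' @\<^sub>v (u' @\<^sub>v x')) = - (P *\<^sub>v w') + (P *\<^sub>v (B *\<^sub>v u') + P *\<^sub>v (A *\<^sub>v x'))"
      using append_columns_mult_vec(2)[OF cP(1) append_columns_mult_vec(1)[OF cP(2,3) u(2) x(2)] w(2) ux]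
        append_columns_mult_vec(2)[OF cP(2,3) u(2) x(2)] uminus_mult_mat_vec_real[OF P(1) w(2)]
        assoc_mult_mat_vec[OF P(1) B u(2)] assoc_mult_mat_vec[OF P(1) A x(2)] by simp
    have r2: "?R2 *\<^sub>v (w' @\<^sub>v (u' @\<^sub>v x')) = transpose_mat B *\<^sub>v (P *\<^sub>v w') - u'"
    proof -
      have "(- 1\<^sub>m m) *\<^sub>v u' + 0\<^sub>m m n *\<^sub>v x' = - u'"
      proof -
        have "0\<^sub>m m n *\<^sub>v x' = (0\<^sub>v m :: real vec)" using x by (intro eq_vecI) auto
        then show ?thesis using uminus_mult_mat_vec_real[of "1\<^sub>m m" m m u'] u by simp
      qed
      then show ?thesis
        using append_columns_mult_vec(2)[OF cP(4) append_columns_mult_vec(1)[OF cP(6) zero_carrier_mat u(2) x(2)] w(2) ux]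
          append_columns_mult_vec(2)[OF cP(6) zero_carrier_mat u(2) x(2)]
          assoc_mult_mat_vec[OF _ P(1) w(2), of "transpose_mat B" m] B u
          minus_add_uminus_vec[of "transpose_mat B *\<^sub>v (P *\<^sub>v w')" m u'] Pw(1)
        by simp
    qed
    have r3: "?R3 *\<^sub>v (w' @\<^sub>v (u' @\<^sub>v x')) = transpose_mat A *\<^sub>v (P *\<^sub>v w') - P *\<^sub>v x'"
    proof -
      have "0\<^sub>m n m *\<^sub>v u' + (- P) *\<^sub>v x' = - (P *\<^sub>v x')"
      proof -
        have "0\<^sub>m n m *\<^sub>v u' = (0\<^sub>v n :: real vec)" using u by (intro eq_vecI) auto
        then show ?thesis using uminus_mult_mat_vec_real[OF P(1) x(2)] Pw(2) by simp
      qed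
      then show ?thesis
        using append_columns_mult_vec(2)[OF cP(5) append_columns_mult_vec(1)[OF zero_carrier_mat cP(1) u(2) x(2)] w(2) ux]
          append_columns_mult_vec(2)[OF zero_carrier_mat cP(1) u(2) x(2)]
          assoc_mult_mat_vec[OF _ P(1) w(2), of "transpose_mat A" n] A Pw
          minus_add_uminus_vec[of "transpose_mat A *\<^sub>v (P *\<^sub>v w')" n "P *\<^sub>v x'"]
        by simp
    qed
    have "(w @\<^sub>v (u @\<^sub>v x)) \<bullet> (?M *\<^sub>v (w' @\<^sub>v (u' @\<^sub>v x')))
       = w \<bullet> (?R1 *\<^sub>v (w' @\<^sub>v (u' @\<^sub>v x'))) + (u \<bullet> (?R2 *\<^sub>v (w' @\<^sub>v (u' @\<^sub>v x'))) + x \<bullet> (?R3 *\<^sub>v (w' @\<^sub>v (u' @\<^sub>v x'))))"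
    proof -
      have "?M *\<^sub>v (w' @\<^sub>v (u' @\<^sub>v x')) = (?R1 *\<^sub>v (w' @\<^sub>v (u' @\<^sub>v x'))) @\<^sub>v
          ((?R2 *\<^sub>v (w' @\<^sub>v (u' @\<^sub>v x'))) @\<^sub>v (?R3 *\<^sub>v (w' @\<^sub>v (u' @\<^sub>v x'))))"
        unfolding mat_mult_append[OF R1 R23 v] mat_mult_append[OF R2 R3 v] ..
      moreover note c = mult_mat_vec_carrier[OF R1 v] mult_mat_vec_carrier[OF R2 v] mult_mat_vec_carrier[OF R3 v]
      ultimately show ?thesis
        using scalar_prod_append[OF w(1) _ c(1), of "u @\<^sub>v x" "m + n"] scalar_prod_append[OF u(1) x(1) c(2,3)]
          append_carrier_vec[OF u(1) x(1)] append_carrier_vec[OF c(2,3)] by metis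
    qed
    also have "w \<bullet> (?R1 *\<^sub>v (w' @\<^sub>v (u' @\<^sub>v x'))) = - (w \<bullet> (P *\<^sub>v w')) + w \<bullet> (P *\<^sub>v (A *\<^sub>v x' + B *\<^sub>v u'))"
    proof -
      have "P *\<^sub>v (A *\<^sub>v x' + B *\<^sub>v u') = P *\<^sub>v (B *\<^sub>v u') + P *\<^sub>v (A *\<^sub>v x')"
        using mult_add_distrib_mat_vec[OF P(1) Ax(1,3)] comm_add_vec[OF PAx] by simp
      then show ?thesis unfolding r1
        using scalar_prod_add_distrib[OF w(1), of "- (P *\<^sub>v w')" "P *\<^sub>v (B *\<^sub>v u') + P *\<^sub>v (A *\<^sub>v x')"] Pw PAx w
          scalar_prod_uminus_r[of w "P *\<^sub>v w'"] carrier_vecD[OF w(1)] carrier_vecD[OF Pw(1)] by simp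
    qed
    also have "u \<bullet> (?R2 *\<^sub>v (w' @\<^sub>v (u' @\<^sub>v x'))) = (B *\<^sub>v u) \<bullet> (P *\<^sub>v w') - u \<bullet> u'"
      unfolding r2 using scalar_prod_minus_distrib[OF u(1) _ u(2), of "transpose_mat B *\<^sub>v (P *\<^sub>v w')"]
        adjoint_scalar_prod[OF B u(1) Pw(1)] B Pw by simp
    also have "x \<bullet> (?R3 *\<^sub>v (w' @\<^sub>v (u' @\<^sub>v x'))) = (A *\<^sub>v x) \<bullet> (P *\<^sub>v w') - x \<bullet> (P *\<^sub>v x')"
      unfolding r3 using scalar_prod_minus_distrib[OF x(1) _ Pw(2), of "transpose_mat A *\<^sub>v (P *\<^sub>v w')"]
        adjoint_scalar_prod[OF A x(1) Pw(1)] A Pw by simp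
    finally show ?thesis using add_scalar_prod_distrib[OF Ax(2,4) Pw(1)] by simp
  qed
  have cc: "(A *\<^sub>v x + B *\<^sub>v u) \<bullet> (P *\<^sub>v w) = w \<bullet> (P *\<^sub>v (A *\<^sub>v x + B *\<^sub>v u))"
    if "w \<in> carrier_vec n" "u \<in> carrier_vec m" "x \<in> carrier_vec n" for w u x
    by (rule psd_bilinear(1)[OF P(2,1) _ that(1)]) (use A B that in simp)
  have sym: "(w @\<^sub>v (u @\<^sub>v x)) \<bullet> (?M *\<^sub>v (w' @\<^sub>v (u' @\<^sub>v x'))) = (w' @\<^sub>v (u' @\<^sub>v x')) \<bullet> (?M *\<^sub>v (w @\<^sub>v (u @\<^sub>v x)))"
    if w: "w \<in> carrier_vec n" "w' \<in> carrier_vec n" and u: "u \<in> carrier_vec m" "u' \<in> carrier_vec m"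
      and x: "x \<in> carrier_vec n" "x' \<in> carrier_vec n" for w w' u u' x x'
    unfolding form[OF w u x] form[OF w(2,1) u(2,1) x(2,1)]
    using cc[OF w(1) u(2) x(2)] cc[OF w(2) u(1) x(1)] psd_bilinear(1)[OF P(2,1) w] psd_bilinear(1)[OF P(2,1) x]
      comm_scalar_prod[OF u] by linarith
  have q: "(w @\<^sub>v (u @\<^sub>v x)) \<bullet> (?M *\<^sub>v (w @\<^sub>v (u @\<^sub>v x)))
      = - (w \<bullet> (P *\<^sub>v w)) + 2 * (w \<bullet> (P *\<^sub>v (A *\<^sub>v x + B *\<^sub>v u))) - u \<bullet> u - x \<bullet> (P *\<^sub>v x)"
    if "w \<in> carrier_vec n" "u \<in> carrier_vec m" "x \<in> carrier_vec n" for w u x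
    using form[OF that(1,1) that(2,2) that(3,3)] cc[OF that] by linarith
  show ?thesis unfolding psd_uminus_iff[OF M] ball_append_vec
  proof (intro iffI conjI ballI, goal_cases)
    case (1 w u x)
    then show ?case using q[OF 1(2-4)] by (metis (no_types, lifting))
  next
    case (2 w u x w' u' x')
    then show ?case by (intro sym)
  next
    case (3 w u x)
    then show ?case using q[OF 3(2-4)] by (metis (no_types, lifting))
  qed
qed

lemma psd_diff_iff:
  fixes P Q :: "real mat"
  assumes P: "P \<in> carrier_mat n n" "psd P" and Q: "Q \<in> carrier_mat n n" "psd Q"
  shows "psd (P - Q) \<longleftrightarrow> (\<forall>x\<in>carrier_vec n. x \<bullet> (Q *\<^sub>v x) \<le> x \<bullet> (P *\<^sub>v x))"
proof -
  have PQ: "P - Q \<in> carrier_mat n n" using Q by (rule_tac minus_carrier_mat)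
  have q: "x \<bullet> ((P - Q) *\<^sub>v y) = x \<bullet> (P *\<^sub>v y) - x \<bullet> (Q *\<^sub>v y)" if "x \<in> carrier_vec n" "y \<in> carrier_vec n" for x y
    unfolding minus_mult_distrib_mat_vec[OF P(1) Q(1) that(2)]
    by (rule scalar_prod_minus_distrib[OF that(1)]) (use P Q that in auto)
  have "transpose_mat (P - Q) = P - Q"
    by (rule transpose_eqI[OF PQ]) (simp add: q psd_bilinear(1)[OF P(2,1)] psd_bilinear(1)[OF Q(2,1)])
  moreover have "square_mat (P - Q)" "dim_row (P - Q) = n" using Q by auto
  ultimately show ?thesis unfolding psd_def using q by auto
qed

lemma LMI_imp_dissipative:
  assumes "LMI A B C P Q lam"
  shows "\<exists>lam'. dissipative A B C n m P Q lam'"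
proof -
  have d: "dim_row A = n" "dim_col B = m" "dim_row C = l" using A B C by auto
  note L = assms[unfolded LMI_def Let_def d]
  have P: "P \<in> carrier_mat n n" "psd P" and Q: "Q \<in> carrier_mat n n" "psd Q" and lam: "lam \<ge> 0" "lam < 1"
    using L by auto
  have in_b: "\<forall>w\<in>carrier_vec n. \<forall>u\<in>carrier_vec m. \<forall>x\<in>carrier_vec n.
      - (w \<bullet> (P *\<^sub>v w)) + 2 * (w \<bullet> (P *\<^sub>v (A *\<^sub>v x + B *\<^sub>v u))) - u \<bullet> u - x \<bullet> (P *\<^sub>v x) \<le> 0"
    using L input_block[OF P] by blast
  have out_b: "\<forall>x\<in>carrier_vec n. \<forall>y\<in>carrier_vec l.
      (A *\<^sub>v x) \<bullet> (Q *\<^sub>v (A *\<^sub>v x)) - x \<bullet> (Q *\<^sub>v x) + 2 * (y \<bullet> (C *\<^sub>v x)) - lam * (y \<bullet> y) \<le> 0"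
    using L output_block[OF Q] by blast
  \<comment> \<open>Half the distance to 1 makes the multiplier positive and still less than
    1.\<close>
  define lam' where "lam' = (1 + lam) / 2"
  have lam': "0 < lam'" "lam' < 1" "lam \<le> lam'" using lam by (auto simp: lam'_def)
  \<comment> \<open>The choice \<open>w = A x + B u\<close> maximises the form in
    \<open>w\<close>.\<close>
  have "(A *\<^sub>v x + B *\<^sub>v u) \<bullet> (P *\<^sub>v (A *\<^sub>v x + B *\<^sub>v u)) \<le> x \<bullet> (P *\<^sub>v x) + u \<bullet> u"
    if "x \<in> carrier_vec n" "u \<in> carrier_vec m" for x u
    using in_b[rule_format, of "A *\<^sub>v x + B *\<^sub>v u" u x] that A B by auto
  moreover have "lam' * ((A *\<^sub>v x) \<bullet> (Q *\<^sub>v (A *\<^sub>v x))) + (C *\<^sub>v x) \<bullet> (C *\<^sub>v x) \<le> lam' * (x \<bullet> (Q *\<^sub>v x))"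
    if x: "x \<in> carrier_vec n" for x
  proof -
    let ?s = "(C *\<^sub>v x) \<bullet> (C *\<^sub>v x)"
    have Cx: "C *\<^sub>v x \<in> carrier_vec l" using C x by simp
    have s: "?s \<ge> 0" by (rule sq_vec_nonneg)
    \<comment> \<open>The maximiser in \<open>y\<close> of the form with \<open>lam'\<close> in
      place of \<open>lam\<close>.\<close>
    let ?y = "(1 / lam') \<cdot>\<^sub>v (C *\<^sub>v x)"
    have "?y \<bullet> (C *\<^sub>v x) = ?s / lam'" "?y \<bullet> ?y = ?s / lam'\<^sup>2"
      using Cx by (simp_all add: power2_eq_square)
    then have "(A *\<^sub>v x) \<bullet> (Q *\<^sub>v (A *\<^sub>v x)) - x \<bullet> (Q *\<^sub>v x) + 2 * (?s / lam') - lam * (?s / lam'\<^sup>2) \<le> 0"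
      using out_b[rule_format, OF x, of ?y] Cx by (simp add: power2_eq_square)
    moreover have "lam * (?s / lam'\<^sup>2) \<le> ?s / lam'"
    proof -
      have "lam * (?s / lam'\<^sup>2) \<le> lam' * (?s / lam'\<^sup>2)" using lam' s by (intro mult_right_mono) auto
      also have "\<dots> = ?s / lam'" using lam'(1) by (simp add: power2_eq_square)
      finally show ?thesis .
    qed
    ultimately have "(A *\<^sub>v x) \<bullet> (Q *\<^sub>v (A *\<^sub>v x)) + ?s / lam' \<le> x \<bullet> (Q *\<^sub>v x)" by linarith
    then have "lam' * ((A *\<^sub>v x) \<bullet> (Q *\<^sub>v (A *\<^sub>v x)) + ?s / lam') \<le> lam' * (x \<bullet> (Q *\<^sub>v x))"
      using lam' by (intro mult_left_mono) auto
    then show ?thesis using lam'(1) by (simp add: distrib_left)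
  qed
  moreover have "\<forall>x\<in>carrier_vec n. x \<bullet> (Q *\<^sub>v x) \<le> x \<bullet> (P *\<^sub>v x)" using L psd_diff_iff[OF P Q] by blast
  ultimately show ?thesis using P Q lam' unfolding dissipative_def by blast
qed

text \<open>Both blocks are recovered by completing a square: in the weight \<open>P\<close> around
  \<open>w = A x + B u\<close>, and in \<open>y\<close> around the quotient of \<open>C x\<close> by
  \<open>lam\<close>.\<close>

lemma dissipative_imp_LMI:
  assumes D: "dissipative A B C n m P Q lam"
  shows "LMI A B C P Q lam"
proof -
  have d: "dim_row A = n" "dim_col B = m" "dim_row C = l" using A B C by auto
  have P: "P \<in> carrier_mat n n" "psd P" and Q: "Q \<in> carrier_mat n n" "psd Q" and lam: "lam > 0" "lam < 1"
    using D by (auto simp: dissipative_def)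
  have 1: "- (w \<bullet> (P *\<^sub>v w)) + 2 * (w \<bullet> (P *\<^sub>v (A *\<^sub>v x + B *\<^sub>v u))) - u \<bullet> u - x \<bullet> (P *\<^sub>v x) \<le> 0"
    if w: "w \<in> carrier_vec n" and u: "u \<in> carrier_vec m" and x: "x \<in> carrier_vec n" for w u x
  proof -
    let ?v = "A *\<^sub>v x + B *\<^sub>v u"
    have v: "?v \<in> carrier_vec n" using A B u x by simp
    have Pv: "P *\<^sub>v ?v \<in> carrier_vec n" "P *\<^sub>v w \<in> carrier_vec n" using P v w by auto
    have "0 \<le> (w - ?v) \<bullet> (P *\<^sub>v (w - ?v))" by (rule psd_bilinear(2)[OF P(2,1)]) (use w v in auto)
    also have "P *\<^sub>v (w - ?v) = P *\<^sub>v w - P *\<^sub>v ?v" by (rule mult_minus_distrib_mat_vec[OF P(1) w v])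
    also have "(w - ?v) \<bullet> (P *\<^sub>v w - P *\<^sub>v ?v) = w \<bullet> (P *\<^sub>v w) - w \<bullet> (P *\<^sub>v ?v) - (?v \<bullet> (P *\<^sub>v w) - ?v \<bullet> (P *\<^sub>v ?v))"
      using minus_scalar_prod_distrib[OF w v, of "P *\<^sub>v w - P *\<^sub>v ?v"] scalar_prod_minus_distrib[OF w Pv(2,1)]
        scalar_prod_minus_distrib[OF v Pv(2,1)] Pv by simp
    also have "?v \<bullet> (P *\<^sub>v w) = w \<bullet> (P *\<^sub>v ?v)" by (rule psd_bilinear(1)[OF P(2,1) v w])
    finally have "- (w \<bullet> (P *\<^sub>v w)) + 2 * (w \<bullet> (P *\<^sub>v ?v)) \<le> ?v \<bullet> (P *\<^sub>v ?v)" by simp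
    moreover have "?v \<bullet> (P *\<^sub>v ?v) \<le> x \<bullet> (P *\<^sub>v x) + u \<bullet> u" using D u x unfolding dissipative_def by blast
    ultimately show ?thesis by linarith
  qed
  have 2: "(A *\<^sub>v x) \<bullet> (Q *\<^sub>v (A *\<^sub>v x)) - x \<bullet> (Q *\<^sub>v x) + 2 * (y \<bullet> (C *\<^sub>v x)) - lam * (y \<bullet> y) \<le> 0"
    if x: "x \<in> carrier_vec n" and y: "y \<in> carrier_vec l" for x y
  proof -
    have "lam * ((A *\<^sub>v x) \<bullet> (Q *\<^sub>v (A *\<^sub>v x))) + (C *\<^sub>v x) \<bullet> (C *\<^sub>v x) \<le> lam * (x \<bullet> (Q *\<^sub>v x))"
      using D x unfolding dissipative_def by blast
    moreover have "2 * lam * (y \<bullet> (C *\<^sub>v x)) \<le> lam\<^sup>2 * (y \<bullet> y) + (C *\<^sub>v x) \<bullet> (C *\<^sub>v x)"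
    proof -
      have "dim_vec y = l" "dim_vec (C *\<^sub>v x) = l" using y C by auto
      then have "y \<bullet> (C *\<^sub>v x) = (\<Sum>i<l. y $ i * (C *\<^sub>v x) $ i)" "y \<bullet> y = (\<Sum>i<l. (y $ i)\<^sup>2)"
        "(C *\<^sub>v x) \<bullet> (C *\<^sub>v x) = (\<Sum>i<l. ((C *\<^sub>v x) $ i)\<^sup>2)"
        by (auto simp: sq_vec_sum scalar_prod_def atLeast0LessThan simp del: index_mult_mat_vec)
      moreover have "(\<Sum>i<l. 2 * (lam * y $ i) * (C *\<^sub>v x) $ i) \<le> (\<Sum>i<l. (lam * y $ i)\<^sup>2 + ((C *\<^sub>v x) $ i)\<^sup>2)"
        by (intro sum_mono sum_squares_bound)
      ultimately show ?thesis
        by (simp add: sum_distrib_left sum.distrib power_mult_distrib mult_ac del: index_mult_mat_vec)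
    qed
    ultimately have "lam * ((A *\<^sub>v x) \<bullet> (Q *\<^sub>v (A *\<^sub>v x)) - x \<bullet> (Q *\<^sub>v x) + 2 * (y \<bullet> (C *\<^sub>v x)) - lam * (y \<bullet> y)) \<le> 0"
      by (simp add: algebra_simps power2_eq_square)
    then show ?thesis using lam(1) by (simp add: mult_le_0_iff)
  qed
  have 3: "psd (P - Q)" using psd_diff_iff[OF P Q] D unfolding dissipative_def by blast
  have "psd (- ((- P @\<^sub>c P * B @\<^sub>c P * A) @\<^sub>r
              (transpose_mat B * P @\<^sub>c - 1\<^sub>m m @\<^sub>c 0\<^sub>m m n) @\<^sub>r
              (transpose_mat A * P @\<^sub>c 0\<^sub>m n m @\<^sub>c - P)))" using input_block[OF P] 1 by blast
  moreover have "psd (- four_block_mat (transpose_mat A * Q * A - Q) (transpose_mat C) C (- (lam \<cdot>\<^sub>m 1\<^sub>m l)))"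
    using output_block[OF Q] 2 by blast
  ultimately show ?thesis unfolding LMI_def Let_def d using P Q lam 3 by simp
qed

end

section \<open>Dissipation inequalities and finite Hankel sections\<close>

text \<open>The state reached from rest when inputs are numbered backwards in time:
  \<open>u 0\<close> acts last, and the state is the sum of the vectors \<open>A^j B u j\<close>.
  With this numbering, past inputs are mapped to future outputs by a Hankel matrix without reversal
  of indices.\<close>

primrec reach :: "real mat \<Rightarrow> real mat \<Rightarrow> nat \<Rightarrow> (nat \<Rightarrow> real vec) \<Rightarrow> real vec" where
  "reach A B 0 u = 0\<^sub>v (dim_row A)"
| "reach A B (Suc K) u = B *\<^sub>v u 0 + A *\<^sub>v reach A B K (\<lambda>j. u (Suc j))"

text \<open>The shift by one aligns the index with \<open>markov_seq\<close>, in which index 0 is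
  the direct term.\<close>

definition markov :: "real mat \<Rightarrow> real mat \<Rightarrow> real mat \<Rightarrow> int \<Rightarrow> nat \<Rightarrow> nat \<Rightarrow> real" where
  "markov A B C k a b = (C * A ^\<^sub>m nat (k - 1) * B) $$ (a,b)"

lemma reach_carrier:
  assumes "A \<in> carrier_mat n n" "B \<in> carrier_mat n m" "\<And>j. u j \<in> carrier_vec m"
  shows "reach A B K u \<in> carrier_vec n"
  using assms(3)
proof (induction K arbitrary: u)
  case (Suc K)
  then show ?case using mult_mat_vec_carrier[OF assms(2)] mult_mat_vec_carrier[OF assms(1)] by auto
qed (use assms in auto)

lemma pow_mult_vec_Suc:
  fixes A :: "real mat"
  assumes A: "A \<in> carrier_mat n n" and x: "x \<in> carrier_vec n"
  shows "A ^\<^sub>m Suc k *\<^sub>v x = A *\<^sub>v (A ^\<^sub>m k *\<^sub>v x)" "A ^\<^sub>m Suc k *\<^sub>v x = A ^\<^sub>m k *\<^sub>v (A *\<^sub>v x)"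
proof -
  have Ak: "A ^\<^sub>m k \<in> carrier_mat n n" using A by simp
  show "A ^\<^sub>m Suc k *\<^sub>v x = A ^\<^sub>m k *\<^sub>v (A *\<^sub>v x)" using assoc_mult_mat_vec[OF Ak A x] by simp
  show "A ^\<^sub>m Suc k *\<^sub>v x = A *\<^sub>v (A ^\<^sub>m k *\<^sub>v x)"
    using assoc_mult_mat_vec[OF A Ak x] pow_mat_commute[OF A, of k] by simp
qed

lemma reach_output:
  assumes A: "A \<in> carrier_mat n n" and B: "B \<in> carrier_mat n m" and C: "C \<in> carrier_mat l n"
    and u: "\<And>j. u j \<in> carrier_vec m" and a: "a < l"
  shows "((C * A ^\<^sub>m i) *\<^sub>v reach A B K u) $ a = (\<Sum>j<K. \<Sum>b<m. markov A B C (int i + int j + 1) a b * u j $ b)"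
  using u
proof (induction K arbitrary: u i)
  case 0
  have "C * A ^\<^sub>m i \<in> carrier_mat l n" by (rule mult_carrier_mat[OF C pow_carrier_mat[OF A]])
  then have "((C * A ^\<^sub>m i) *\<^sub>v 0\<^sub>v n) $ a = 0" using a by (simp add: mult_vec_index del: index_mult_mat_vec index_mult_mat)
  then show ?case using A by simp
next
  case (Suc K)
  let ?r = "reach A B K (\<lambda>j. u (Suc j))"
  have CA: "C * A ^\<^sub>m i \<in> carrier_mat l n" by (rule mult_carrier_mat[OF C pow_carrier_mat[OF A]])
  have CAB: "C * A ^\<^sub>m i * B \<in> carrier_mat l m" by (rule mult_carrier_mat[OF CA B])
  have r: "?r \<in> carrier_vec n" by (rule reach_carrier[OF A B Suc.prems])
  have c: "B *\<^sub>v u 0 \<in> carrier_vec n" "A *\<^sub>v ?r \<in> carrier_vec n"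
    by (rule mult_mat_vec_carrier[OF B Suc.prems], rule mult_mat_vec_carrier[OF A r])
  have "(C * A ^\<^sub>m i) *\<^sub>v reach A B (Suc K) u = (C * A ^\<^sub>m i) *\<^sub>v (B *\<^sub>v u 0) + (C * A ^\<^sub>m i) *\<^sub>v (A *\<^sub>v ?r)"
    unfolding reach.simps by (rule mult_add_distrib_mat_vec[OF CA c])
  also have "(C * A ^\<^sub>m i) *\<^sub>v (B *\<^sub>v u 0) = (C * A ^\<^sub>m i * B) *\<^sub>v u 0"
    by (rule assoc_mult_mat_vec[OF CA B Suc.prems, symmetric])
  also have "(C * A ^\<^sub>m i) *\<^sub>v (A *\<^sub>v ?r) = (C * A ^\<^sub>m i * A) *\<^sub>v ?r"
    by (rule assoc_mult_mat_vec[OF CA A r, symmetric])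
  also have "C * A ^\<^sub>m i * A = C * A ^\<^sub>m Suc i"
    using assoc_mult_mat[OF C pow_carrier_mat[OF A] A] by simp
  finally have eq: "(C * A ^\<^sub>m i) *\<^sub>v reach A B (Suc K) u = (C * A ^\<^sub>m i * B) *\<^sub>v u 0 + (C * A ^\<^sub>m Suc i) *\<^sub>v ?r" .
  have CA': "C * A ^\<^sub>m Suc i \<in> carrier_mat l n" by (rule mult_carrier_mat[OF C pow_carrier_mat[OF A]])
  have "((C * A ^\<^sub>m i) *\<^sub>v reach A B (Suc K) u) $ a = ((C * A ^\<^sub>m i * B) *\<^sub>v u 0) $ a + ((C * A ^\<^sub>m Suc i) *\<^sub>v ?r) $ a"
    unfolding eq by (rule index_add_vec(1)) (use mult_mat_vec_carrier[OF CA' r] a in \<open>simp only: carrier_vecD\<close>)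
  also have "((C * A ^\<^sub>m i * B) *\<^sub>v u 0) $ a = (\<Sum>b<m. markov A B C (int i + int 0 + 1) a b * u 0 $ b)"
    using mult_vec_index[of a "C * A ^\<^sub>m i * B" "u 0"] carrier_matD[OF CAB] a carrier_vecD[OF Suc.prems]
    by (simp only: markov_def) simp
  also have "((C * A ^\<^sub>m Suc i) *\<^sub>v ?r) $ a = (\<Sum>j<K. \<Sum>b<m. markov A B C (int i + int (Suc j) + 1) a b * u (Suc j) $ b)"
    using Suc.IH[of "\<lambda>j. u (Suc j)" "Suc i"] Suc.prems by (simp only: of_nat_Suc) (simp add: algebra_simps)
  finally show ?case by (simp only: sum.lessThan_Suc_shift o_def)
qed

text \<open>A section applied to the stacked past inputs gives the stacked future outputs of the
  state they reach. Contractivity thus compares output energy after time 0 with input energy before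
  it.\<close>

lemma hankel_section_reach:
  assumes A: "A \<in> carrier_mat n n" and B: "B \<in> carrier_mat n m" and C: "C \<in> carrier_mat l n" and \<rho>: "\<rho> \<ge> 0"
  shows "hankel_section l m (markov A B C) 1 \<rho> K \<longleftrightarrow>
    (\<forall>u. (\<forall>j. u j \<in> carrier_vec m) \<longrightarrow>
      (\<Sum>i<K. ((C * A ^\<^sub>m i) *\<^sub>v reach A B K u) \<bullet> ((C * A ^\<^sub>m i) *\<^sub>v reach A B K u)) \<le> \<rho>\<^sup>2 * (\<Sum>j<K. u j \<bullet> u j))"
proof -
  have e: "(\<Sum>i<K. ((C * A ^\<^sub>m i) *\<^sub>v reach A B K u) \<bullet> ((C * A ^\<^sub>m i) *\<^sub>v reach A B K u))
      = (\<Sum>i<K. \<Sum>a<l. (norm (\<Sum>j<K. \<Sum>b<m. markov A B C (int i + int j + 1) a b * u j $ b))\<^sup>2)"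
    "(\<Sum>j<K. u j \<bullet> u j) = (\<Sum>j<K. \<Sum>b<m. (norm (u j $ b))\<^sup>2)"
    if u: "\<And>j. u j \<in> carrier_vec m" for u :: "nat \<Rightarrow> real vec"
  proof -
    have d: "dim_vec ((C * A ^\<^sub>m i) *\<^sub>v reach A B K u) = l" for i using C by simp
    show "(\<Sum>i<K. ((C * A ^\<^sub>m i) *\<^sub>v reach A B K u) \<bullet> ((C * A ^\<^sub>m i) *\<^sub>v reach A B K u))
      = (\<Sum>i<K. \<Sum>a<l. (norm (\<Sum>j<K. \<Sum>b<m. markov A B C (int i + int j + 1) a b * u j $ b))\<^sup>2)"
    proof (intro sum.cong refl)
      fix i
      show "((C * A ^\<^sub>m i) *\<^sub>v reach A B K u) \<bullet> ((C * A ^\<^sub>m i) *\<^sub>v reach A B K u)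
          = (\<Sum>a<l. (norm (\<Sum>j<K. \<Sum>b<m. markov A B C (int i + int j + 1) a b * u j $ b))\<^sup>2)"
        unfolding sq_vec_sum d real_norm_def power2_abs
        by (intro sum.cong refl) (simp only: lessThan_iff reach_output[OF A B C u])
    qed
    show "(\<Sum>j<K. u j \<bullet> u j) = (\<Sum>j<K. \<Sum>b<m. (norm (u j $ b))\<^sup>2)"
      unfolding sq_vec_sum using carrier_vecD[OF u] by simp
  qed
  show ?thesis unfolding hankel_section_quad[OF \<rho>]
  proof (intro iffI allI impI)
    fix u :: "nat \<Rightarrow> real vec"
    assume h: "\<forall>u. (\<Sum>i<K. \<Sum>a<l. (norm (\<Sum>j<K. \<Sum>b<m. markov A B C (int i + int j + 1) a b * u j b))\<^sup>2)
      \<le> \<rho>\<^sup>2 * (\<Sum>j<K. \<Sum>b<m. (norm (u j b))\<^sup>2)" and u: "\<forall>j. u j \<in> carrier_vec m"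
    show "(\<Sum>i<K. ((C * A ^\<^sub>m i) *\<^sub>v reach A B K u) \<bullet> ((C * A ^\<^sub>m i) *\<^sub>v reach A B K u)) \<le> \<rho>\<^sup>2 * (\<Sum>j<K. u j \<bullet> u j)"
      unfolding e[of u, OF u[rule_format]] by (rule h[rule_format, of "\<lambda>j b. u j $ b"])
  next
    fix u :: "nat \<Rightarrow> nat \<Rightarrow> real"
    assume h: "\<forall>u. (\<forall>j. u j \<in> carrier_vec m) \<longrightarrow>
      (\<Sum>i<K. ((C * A ^\<^sub>m i) *\<^sub>v reach A B K u) \<bullet> ((C * A ^\<^sub>m i) *\<^sub>v reach A B K u)) \<le> \<rho>\<^sup>2 * (\<Sum>j<K. u j \<bullet> u j)"
    have v: "vec m (u j) \<in> carrier_vec m" for j by simp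
    have "(\<Sum>i<K. \<Sum>a<l. (norm (\<Sum>j<K. \<Sum>b<m. markov A B C (int i + int j + 1) a b * vec m (u j) $ b))\<^sup>2)
        \<le> \<rho>\<^sup>2 * (\<Sum>j<K. \<Sum>b<m. (norm (vec m (u j) $ b))\<^sup>2)"
      using h[rule_format, of "\<lambda>j. vec m (u j)", OF v] unfolding e[of "\<lambda>j. vec m (u j)", OF v] .
    then show "(\<Sum>i<K. \<Sum>a<l. (norm (\<Sum>j<K. \<Sum>b<m. markov A B C (int i + int j + 1) a b * u j b))\<^sup>2)
      \<le> \<rho>\<^sup>2 * (\<Sum>j<K. \<Sum>b<m. (norm (u j b))\<^sup>2)" by simp
  qed
qed

text \<open>Energy balance along a trajectory: the \<open>P\<close> energy of the reached state is
  at most the past input energy, the future output energy is at most \<open>lam\<close> times the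
  \<open>Q\<close> energy, and the order between \<open>Q\<close> and \<open>P\<close> joins the
  two. Energies are squared norms, hence the square root of \<open>lam\<close>.\<close>

lemma dissipative_imp_section:
  assumes A: "A \<in> carrier_mat n n" and B: "B \<in> carrier_mat n m" and C: "C \<in> carrier_mat l n"
    and D: "dissipative A B C n m P Q lam"
  shows "hankel_section l m (markov A B C) 1 (sqrt lam) K"
proof -
  have P: "P \<in> carrier_mat n n" "psd P" and Q: "Q \<in> carrier_mat n n" "psd Q" and lam: "lam > 0" "lam < 1"
    using D by (auto simp: dissipative_def)
  have inp: "reach A B K u \<bullet> (P *\<^sub>v reach A B K u) \<le> (\<Sum>j<K. u j \<bullet> u j)" if "\<And>j. u j \<in> carrier_vec m" for K u
    using that
  proof (induction K arbitrary: u)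
    case 0
    have "P *\<^sub>v 0\<^sub>v n \<in> carrier_vec n" using P by simp
    then show ?case using A by simp
  next
    case (Suc K)
    let ?r = "reach A B K (\<lambda>j. u (Suc j))"
    have r: "?r \<in> carrier_vec n" by (rule reach_carrier[OF A B Suc.prems])
    have c: "B *\<^sub>v u 0 \<in> carrier_vec n" "A *\<^sub>v ?r \<in> carrier_vec n"
      by (rule mult_mat_vec_carrier[OF B Suc.prems], rule mult_mat_vec_carrier[OF A r])
    have "reach A B (Suc K) u = A *\<^sub>v ?r + B *\<^sub>v u 0" unfolding reach.simps by (rule comm_add_vec[OF c])
    then have "reach A B (Suc K) u \<bullet> (P *\<^sub>v reach A B (Suc K) u) \<le> ?r \<bullet> (P *\<^sub>v ?r) + u 0 \<bullet> u 0"
      using D r Suc.prems[of 0] unfolding dissipative_def by (simp only:)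
    also have "\<dots> \<le> (\<Sum>j<K. u (Suc j) \<bullet> u (Suc j)) + u 0 \<bullet> u 0"
      using Suc.IH[of "\<lambda>j. u (Suc j)"] Suc.prems by simp
    finally show ?case by (simp only: sum.lessThan_Suc_shift add.commute)
  qed
  have out: "(\<Sum>i<K. ((C * A ^\<^sub>m i) *\<^sub>v x) \<bullet> ((C * A ^\<^sub>m i) *\<^sub>v x))
      + lam * ((A ^\<^sub>m K *\<^sub>v x) \<bullet> (Q *\<^sub>v (A ^\<^sub>m K *\<^sub>v x))) \<le> lam * (x \<bullet> (Q *\<^sub>v x))" if x: "x \<in> carrier_vec n" for K x
  proof (induction K)
    case 0
    then show ?case using A x by simp
  next
    case (Suc K)
    let ?y = "A ^\<^sub>m K *\<^sub>v x"
    have y: "?y \<in> carrier_vec n" by (rule mult_mat_vec_carrier[OF pow_carrier_mat[OF A] x])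
    have e1: "(C * A ^\<^sub>m K) *\<^sub>v x = C *\<^sub>v ?y" by (rule assoc_mult_mat_vec[OF C pow_carrier_mat[OF A] x])
    have e2: "A ^\<^sub>m Suc K *\<^sub>v x = A *\<^sub>v ?y" by (rule pow_mult_vec_Suc(1)[OF A x])
    have "lam * ((A *\<^sub>v ?y) \<bullet> (Q *\<^sub>v (A *\<^sub>v ?y))) + (C *\<^sub>v ?y) \<bullet> (C *\<^sub>v ?y) \<le> lam * (?y \<bullet> (Q *\<^sub>v ?y))"
      using D y unfolding dissipative_def by blast
    then show ?case using Suc unfolding sum.lessThan_Suc e1 e2 by linarith
  qed
  have "sqrt lam \<ge> 0" using lam by simp
  show ?thesis unfolding hankel_section_reach[OF A B C \<open>sqrt lam \<ge> 0\<close>]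
  proof (intro allI impI)
    fix u :: "nat \<Rightarrow> real vec" assume u: "\<forall>j. u j \<in> carrier_vec m"
    let ?x = "reach A B K u"
    have x: "?x \<in> carrier_vec n" using reach_carrier[OF A B] u by blast
    have "(A ^\<^sub>m K *\<^sub>v ?x) \<bullet> (Q *\<^sub>v (A ^\<^sub>m K *\<^sub>v ?x)) \<ge> 0"
      using mult_mat_vec_carrier[OF pow_carrier_mat[OF A] x] psd_bilinear(2)[OF Q(2,1)] by blast
    then have "lam * ((A ^\<^sub>m K *\<^sub>v ?x) \<bullet> (Q *\<^sub>v (A ^\<^sub>m K *\<^sub>v ?x))) \<ge> 0" using lam by simp
    then have "(\<Sum>i<K. ((C * A ^\<^sub>m i) *\<^sub>v ?x) \<bullet> ((C * A ^\<^sub>m i) *\<^sub>v ?x)) \<le> lam * (?x \<bullet> (Q *\<^sub>v ?x))"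
      using out[OF x, of K] by linarith
    also have "\<dots> \<le> lam * (?x \<bullet> (P *\<^sub>v ?x))"
      using D x lam unfolding dissipative_def by (intro mult_left_mono) auto
    also have "\<dots> \<le> lam * (\<Sum>j<K. u j \<bullet> u j)" using inp[of u K] u lam by (intro mult_left_mono) auto
    also have "lam = (sqrt lam)\<^sup>2" using lam by simp
    finally show "(\<Sum>i<K. ((C * A ^\<^sub>m i) *\<^sub>v ?x) \<bullet> ((C * A ^\<^sub>m i) *\<^sub>v ?x)) \<le> (sqrt lam)\<^sup>2 * (\<Sum>j<K. u j \<bullet> u j)" .
  qed
qed

section \<open>Finite-horizon Gramians\<close>

text \<open>The sum over \<open>k < K\<close> of \<open>A^k D\<close> times the transpose of
  \<open>A^k\<close>. With a finite horizon no series occurs, and the defect in the Lyapunov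
  equation is one explicit term.\<close>

primrec gram :: "real mat \<Rightarrow> real mat \<Rightarrow> nat \<Rightarrow> real mat" where
  "gram A D 0 = 0\<^sub>m (dim_row A) (dim_row A)"
| "gram A D (Suc k) = D + A * gram A D k * transpose_mat A"

text \<open>The second summand is a fictitious input that drives every state with weight \<epsilon>;
  it makes the Gramian bounded below by \<epsilon> for any positive horizon.\<close>

definition input_weight :: "real mat \<Rightarrow> real \<Rightarrow> real mat" where
  "input_weight B \<epsilon> = B * transpose_mat B + \<epsilon> \<cdot>\<^sub>m 1\<^sub>m (dim_row B)"

lemma transpose_pow:
  fixes A :: "real mat"
  assumes A: "A \<in> carrier_mat n n"
  shows "transpose_mat A ^\<^sub>m k = transpose_mat (A ^\<^sub>m k)"
proof (induction k)
  case (Suc k)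
  have "transpose_mat (A ^\<^sub>m Suc k) = transpose_mat A * transpose_mat (A ^\<^sub>m k)"
    using transpose_mult[OF pow_carrier_mat[OF A] A, of k] by simp
  also have "\<dots> = transpose_mat A * transpose_mat A ^\<^sub>m k" using Suc by simp
  also have "\<dots> = transpose_mat A ^\<^sub>m k * transpose_mat A" by (rule pow_mat_commute) (use A in simp)
  finally show ?case by simp
qed (use A in simp)

lemma exp_decay_transpose:
  assumes A: "A \<in> carrier_mat n n" and d: "exp_decay A"
  shows "exp_decay (transpose_mat A)"
proof -
  have d1: "dim_row A = n" "dim_row (transpose_mat A) = n" using A by auto
  have e: "(transpose_mat A ^\<^sub>m k) $$ (i,j) = (A ^\<^sub>m k) $$ (j,i)" if "i < n" "j < n" for i j k
    unfolding transpose_pow[OF A] using that carrier_matD[OF pow_carrier_mat[OF A, of k]] by simp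
  show ?thesis using d unfolding exp_decay_def d1 by (metis e)
qed

text \<open>Separates the part of a state due to true inputs from the part due to fictitious ones;
  the constant of the first can be kept as close to 1 as desired.\<close>

lemma young:
  fixes v w :: "real vec"
  assumes "v \<in> carrier_vec n" "w \<in> carrier_vec n" "\<delta> > 0"
  shows "(v + w) \<bullet> (v + w) \<le> (1 + \<delta>) * (v \<bullet> v) + (1 + 1/\<delta>) * (w \<bullet> w)"
proof -
  have "(a + b)\<^sup>2 \<le> (1 + \<delta>) * a\<^sup>2 + (1 + 1/\<delta>) * b\<^sup>2" for a b :: real
  proof -
    have "2 * (sqrt \<delta> * a) * (b / sqrt \<delta>) \<le> (sqrt \<delta> * a)\<^sup>2 + (b / sqrt \<delta>)\<^sup>2" by (rule sum_squares_bound)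
    then have "2 * a * b \<le> \<delta> * a\<^sup>2 + b\<^sup>2 / \<delta>" using assms(3) by (simp add: power_mult_distrib power_divide)
    then show ?thesis by (simp add: power2_sum algebra_simps)
  qed
  then have "(\<Sum>i<n. (v $ i + w $ i)\<^sup>2) \<le> (\<Sum>i<n. (1 + \<delta>) * (v $ i)\<^sup>2 + (1 + 1/\<delta>) * (w $ i)\<^sup>2)"
    by (intro sum_mono)
  also have "\<dots> = (1 + \<delta>) * (\<Sum>i<n. (v $ i)\<^sup>2) + (1 + 1/\<delta>) * (\<Sum>i<n. (w $ i)\<^sup>2)"
    by (simp add: sum.distrib sum_distrib_left)
  finally show ?thesis unfolding sq_vec_sum using carrier_vecD[OF assms(1)] carrier_vecD[OF assms(2)] by simp
qed

lemma decay_small: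
  assumes A: "A \<in> carrier_mat n n" and d: "exp_decay A" and M: "M \<in> carrier_mat l n" and \<eta>: "\<eta> > 0"
  shows "\<forall>\<^sub>F K in sequentially. \<forall>x\<in>carrier_vec n. (M *\<^sub>v (A ^\<^sub>m K *\<^sub>v x)) \<bullet> (M *\<^sub>v (A ^\<^sub>m K *\<^sub>v x)) \<le> \<eta> * (x \<bullet> x)"
proof -
  obtain c r where c: "c \<ge> 0" "0 < r" "r < 1"
    "\<And>k a b. a < l \<Longrightarrow> b < n \<Longrightarrow> \<bar>(M * A ^\<^sub>m k * 1\<^sub>m n) $$ (a,b)\<bar> \<le> c * r ^ k"
    using exp_decay_markov[OF A d one_carrier_mat M] by blast
  have bd: "(M *\<^sub>v (A ^\<^sub>m K *\<^sub>v x)) \<bullet> (M *\<^sub>v (A ^\<^sub>m K *\<^sub>v x)) \<le> (real l * (real n * (c * r ^ K)\<^sup>2)) * (x \<bullet> x)"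
    if x: "x \<in> carrier_vec n" for K x
  proof -
    have MA: "M * A ^\<^sub>m K \<in> carrier_mat l n" by (rule mult_carrier_mat[OF M pow_carrier_mat[OF A]])
    let ?y = "(M * A ^\<^sub>m K) *\<^sub>v x"
    have "?y = M *\<^sub>v (A ^\<^sub>m K *\<^sub>v x)" by (rule assoc_mult_mat_vec[OF M pow_carrier_mat[OF A] x])
    moreover have "(?y $ a)\<^sup>2 \<le> (real n * (c * r ^ K)\<^sup>2) * (x \<bullet> x)" if a: "a < l" for a
    proof -
      have "?y $ a = (\<Sum>b<n. (M * A ^\<^sub>m K) $$ (a,b) * x $ b)"
        using mult_vec_index[of a "M * A ^\<^sub>m K" x] carrier_matD[OF MA] carrier_vecD[OF x] a by (simp only:)
      then have "(?y $ a)\<^sup>2 \<le> (\<Sum>b<n. ((M * A ^\<^sub>m K) $$ (a,b))\<^sup>2) * (\<Sum>b<n. (x $ b)\<^sup>2)"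
        by (simp only: Cauchy_Schwarz_ineq_sum)
      also have "\<dots> \<le> (\<Sum>b<n. (c * r ^ K)\<^sup>2) * (\<Sum>b<n. (x $ b)\<^sup>2)"
      proof (intro mult_right_mono sum_mono sum_nonneg)
        fix b assume "b \<in> {..<n}"
        then have "\<bar>(M * A ^\<^sub>m K) $$ (a,b)\<bar> \<le> c * r ^ K"
          using c(4)[OF a, of b K] unfolding right_mult_one_mat[OF MA] by simp
        then have "\<bar>(M * A ^\<^sub>m K) $$ (a,b)\<bar>\<^sup>2 \<le> (c * r ^ K)\<^sup>2" by (rule power_mono) simp
        then show "((M * A ^\<^sub>m K) $$ (a,b))\<^sup>2 \<le> (c * r ^ K)\<^sup>2" by (simp only: power2_abs)
      qed simp
      finally show ?thesis unfolding sq_vec_sum using carrier_vecD[OF x] by simp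
    qed
    then have "(\<Sum>a<l. (?y $ a)\<^sup>2) \<le> (\<Sum>a<l. (real n * (c * r ^ K)\<^sup>2) * (x \<bullet> x))" by (intro sum_mono) simp
    moreover have "dim_vec ?y = l" using mult_mat_vec_carrier[OF MA x] by (rule carrier_vecD)
    ultimately show ?thesis unfolding sq_vec_sum[of "M *\<^sub>v (A ^\<^sub>m K *\<^sub>v x)"] by (simp add: mult.assoc)
  qed
  have "(\<lambda>K. real l * (real n * (c * r ^ K)\<^sup>2)) \<longlonglongrightarrow> real l * (real n * (c * 0)\<^sup>2)"
    using c by (intro tendsto_intros LIMSEQ_realpow_zero) auto
  then have "\<forall>\<^sub>F K in sequentially. real l * (real n * (c * r ^ K)\<^sup>2) < \<eta>"
    by (rule order_tendstoD(2)) (use \<eta> in simp)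
  then show ?thesis
  proof eventually_elim
    case (elim K)
    show ?case
    proof
      fix x :: "real vec" assume x: "x \<in> carrier_vec n"
      have "(real l * (real n * (c * r ^ K)\<^sup>2)) * (x \<bullet> x) \<le> \<eta> * (x \<bullet> x)"
        using elim by (intro mult_right_mono sq_vec_nonneg) simp
      then show "(M *\<^sub>v (A ^\<^sub>m K *\<^sub>v x)) \<bullet> (M *\<^sub>v (A ^\<^sub>m K *\<^sub>v x)) \<le> \<eta> * (x \<bullet> x)" using bd[OF x, of K] by linarith
    qed
  qed
qed

context
  fixes A B :: "real mat" and n m :: nat and \<epsilon> :: real
  assumes A: "A \<in> carrier_mat n n" and B: "B \<in> carrier_mat n m" and eps: "\<epsilon> > 0"
begin

abbreviation (input) "gram_w \<equiv> gram A (input_weight B \<epsilon>)"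
abbreviation (input) "adj_pow k y \<equiv> transpose_mat A ^\<^sub>m k *\<^sub>v y"
abbreviation (input) "energy y \<equiv> (transpose_mat B *\<^sub>v y) \<bullet> (transpose_mat B *\<^sub>v y) + \<epsilon> * (y \<bullet> y)"

lemma At: "transpose_mat A \<in> carrier_mat n n" using A by simp

lemma Bt: "transpose_mat B \<in> carrier_mat m n" using B by simp

lemma weight_carrier: "input_weight B \<epsilon> \<in> carrier_mat n n"
  using B by (simp add: input_weight_def)

lemma weight_mult:
  assumes y: "y \<in> carrier_vec n"
  shows "input_weight B \<epsilon> *\<^sub>v y = B *\<^sub>v (transpose_mat B *\<^sub>v y) + \<epsilon> \<cdot>\<^sub>v y"
proof -
  have BB: "B * transpose_mat B \<in> carrier_mat n n" by (rule mult_carrier_mat[OF B Bt])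
  have d: "dim_row B = n" using B by simp
  have "input_weight B \<epsilon> *\<^sub>v y = (B * transpose_mat B) *\<^sub>v y + (\<epsilon> \<cdot>\<^sub>m 1\<^sub>m n) *\<^sub>v y"
    unfolding input_weight_def d by (rule add_mult_distrib_mat_vec[OF BB _ y]) simp
  also have "(B * transpose_mat B) *\<^sub>v y = B *\<^sub>v (transpose_mat B *\<^sub>v y)" by (rule assoc_mult_mat_vec[OF B Bt y])
  also have "(\<epsilon> \<cdot>\<^sub>m 1\<^sub>m n) *\<^sub>v y = \<epsilon> \<cdot>\<^sub>v y"
  proof (rule eq_vecI)
    fix i assume "i < dim_vec (\<epsilon> \<cdot>\<^sub>v y)"
    then have i: "i < n" using y by simp
    have "((\<epsilon> \<cdot>\<^sub>m 1\<^sub>m n) *\<^sub>v y) $ i = (\<Sum>k<n. (\<epsilon> \<cdot>\<^sub>m 1\<^sub>m n) $$ (i,k) * y $ k)"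
      using mult_vec_index[of i "\<epsilon> \<cdot>\<^sub>m 1\<^sub>m n" y] y i by simp
    also have "\<dots> = (\<Sum>k<n. if k = i then \<epsilon> * y $ k else 0)" using i by (intro sum.cong) auto
    also have "\<dots> = (\<epsilon> \<cdot>\<^sub>v y) $ i" using i y by simp
    finally show "((\<epsilon> \<cdot>\<^sub>m 1\<^sub>m n) *\<^sub>v y) $ i = (\<epsilon> \<cdot>\<^sub>v y) $ i" .
  qed (use y in simp)
  finally show ?thesis .
qed

lemma weight_form:
  assumes p: "p \<in> carrier_vec n" and q: "q \<in> carrier_vec n"
  shows "p \<bullet> (input_weight B \<epsilon> *\<^sub>v q) = (transpose_mat B *\<^sub>v p) \<bullet> (transpose_mat B *\<^sub>v q) + \<epsilon> * (p \<bullet> q)"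
proof -
  have Bq: "transpose_mat B *\<^sub>v q \<in> carrier_vec m" by (rule mult_mat_vec_carrier[OF Bt q])
  have "p \<bullet> (input_weight B \<epsilon> *\<^sub>v q) = p \<bullet> (B *\<^sub>v (transpose_mat B *\<^sub>v q)) + p \<bullet> (\<epsilon> \<cdot>\<^sub>v q)"
    unfolding weight_mult[OF q]
    by (rule scalar_prod_add_distrib[OF p mult_mat_vec_carrier[OF B Bq]]) (use q in simp)
  also have "p \<bullet> (B *\<^sub>v (transpose_mat B *\<^sub>v q)) = (transpose_mat B *\<^sub>v p) \<bullet> (transpose_mat B *\<^sub>v q)"
    using adjoint_scalar_prod[OF Bt p Bq] by simp
  finally show ?thesis using p q by simp
qed

lemma gram_carrier: "gram_w K \<in> carrier_mat n n"
proof (induction K)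
  case (Suc K)
  then show ?case using weight_carrier mult_carrier_mat[OF mult_carrier_mat[OF A Suc] At] by simp
qed (use A in simp)

lemma gram_mult_Suc:
  assumes q: "q \<in> carrier_vec n"
  shows "gram_w (Suc K) *\<^sub>v q = input_weight B \<epsilon> *\<^sub>v q + A *\<^sub>v (gram_w K *\<^sub>v (transpose_mat A *\<^sub>v q))"
proof -
  have AG: "A * gram_w K \<in> carrier_mat n n" by (rule mult_carrier_mat[OF A gram_carrier])
  have Aq: "transpose_mat A *\<^sub>v q \<in> carrier_vec n" by (rule mult_mat_vec_carrier[OF At q])
  have "gram_w (Suc K) *\<^sub>v q = input_weight B \<epsilon> *\<^sub>v q + (A * gram_w K * transpose_mat A) *\<^sub>v q"
    unfolding gram.simps
    by (rule add_mult_distrib_mat_vec[OF weight_carrier mult_carrier_mat[OF AG At] q])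
  also have "(A * gram_w K * transpose_mat A) *\<^sub>v q = (A * gram_w K) *\<^sub>v (transpose_mat A *\<^sub>v q)"
    by (rule assoc_mult_mat_vec[OF AG At q])
  also have "\<dots> = A *\<^sub>v (gram_w K *\<^sub>v (transpose_mat A *\<^sub>v q))" by (rule assoc_mult_mat_vec[OF A gram_carrier Aq])
  finally show ?thesis .
qed

lemma gram_form:
  assumes "p \<in> carrier_vec n" "q \<in> carrier_vec n"
  shows "p \<bullet> (gram_w K *\<^sub>v q) = (\<Sum>k<K. (adj_pow k p) \<bullet> (input_weight B \<epsilon> *\<^sub>v adj_pow k q))"
  using assms
proof (induction K arbitrary: p q)
  case 0
  have "0\<^sub>m n n *\<^sub>v q = 0\<^sub>v n" using 0 by (intro eq_vecI) auto
  then show ?case using A 0 by simp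
next
  case (Suc K)
  have Ap: "transpose_mat A *\<^sub>v p \<in> carrier_vec n" and Aq: "transpose_mat A *\<^sub>v q \<in> carrier_vec n"
    using mult_mat_vec_carrier[OF At] Suc.prems by blast+
  have GA: "gram_w K *\<^sub>v (transpose_mat A *\<^sub>v q) \<in> carrier_vec n" by (rule mult_mat_vec_carrier[OF gram_carrier Aq])
  have "p \<bullet> (gram_w (Suc K) *\<^sub>v q) = p \<bullet> (input_weight B \<epsilon> *\<^sub>v q) + p \<bullet> (A *\<^sub>v (gram_w K *\<^sub>v (transpose_mat A *\<^sub>v q)))"
    unfolding gram_mult_Suc[OF Suc.prems(2)]
    by (rule scalar_prod_add_distrib[OF Suc.prems(1) mult_mat_vec_carrier[OF weight_carrier Suc.prems(2)]
          mult_mat_vec_carrier[OF A GA]])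
  also have "p \<bullet> (A *\<^sub>v (gram_w K *\<^sub>v (transpose_mat A *\<^sub>v q))) = (transpose_mat A *\<^sub>v p) \<bullet> (gram_w K *\<^sub>v (transpose_mat A *\<^sub>v q))"
    using adjoint_scalar_prod[OF At Suc.prems(1) GA] by simp
  also have "\<dots> = (\<Sum>k<K. (adj_pow (Suc k) p) \<bullet> (input_weight B \<epsilon> *\<^sub>v adj_pow (Suc k) q))"
    unfolding Suc.IH[OF Ap Aq] pow_mult_vec_Suc(2)[OF At Suc.prems(1)] pow_mult_vec_Suc(2)[OF At Suc.prems(2)] ..
  finally show ?case unfolding sum.lessThan_Suc_shift using At Suc.prems by simp
qed

lemma v_carrier: "y \<in> carrier_vec n \<Longrightarrow> adj_pow k y \<in> carrier_vec n"
  by (rule mult_mat_vec_carrier[OF pow_carrier_mat[OF At]])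

lemma gram_energy:
  assumes "p \<in> carrier_vec n"
  shows "p \<bullet> (gram_w K *\<^sub>v p) = (\<Sum>k<K. energy (adj_pow k p))"
  unfolding gram_form[OF assms assms] by (intro sum.cong refl weight_form v_carrier assms)

lemma energy_nonneg: "energy y \<ge> 0"
  using eps by (intro add_nonneg_nonneg sq_vec_nonneg mult_nonneg_nonneg) auto

lemma gram_sym:
  assumes "p \<in> carrier_vec n" "q \<in> carrier_vec n"
  shows "p \<bullet> (gram_w K *\<^sub>v q) = q \<bullet> (gram_w K *\<^sub>v p)"
  unfolding gram_form[OF assms] gram_form[OF assms(2,1)]
proof (intro sum.cong refl)
  fix k
  note c = v_carrier[OF assms(1), of k] v_carrier[OF assms(2), of k]
  show "(adj_pow k p) \<bullet> (input_weight B \<epsilon> *\<^sub>v adj_pow k q) = (adj_pow k q) \<bullet> (input_weight B \<epsilon> *\<^sub>v adj_pow k p)"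
    unfolding weight_form[OF c] weight_form[OF c(2,1)]
    using comm_scalar_prod[OF c] comm_scalar_prod[OF mult_mat_vec_carrier[OF Bt c(1)] mult_mat_vec_carrier[OF Bt c(2)]] by simp
qed

lemma gram_psd: "psd (gram_w K)"
proof -
  have "transpose_mat (gram_w K) = gram_w K" by (rule transpose_eqI[OF gram_carrier gram_sym])
  moreover have "dim_row (gram_w K) = n" "square_mat (gram_w K)" using gram_carrier[of K] by auto
  moreover have "p \<bullet> (gram_w K *\<^sub>v p) \<ge> 0" if "p \<in> carrier_vec n" for p
    unfolding gram_energy[OF that] by (intro sum_nonneg energy_nonneg)
  ultimately show ?thesis unfolding psd_def by simp
qed

text \<open>The finite Gramian misses the Lyapunov equation by the energy at step \<open>K\<close>.
  The hypothesis bounds this energy by \<open>\<epsilon> * (y \<bullet> y)\<close>, which is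
  precisely the share of the fictitious input in the term for \<open>k = 0\<close>.\<close>

lemma gram_lyapunov:
  assumes small: "\<And>y. y \<in> carrier_vec n \<Longrightarrow> energy (adj_pow K y) \<le> \<epsilon> * (y \<bullet> y)" and y: "y \<in> carrier_vec n"
  shows "(transpose_mat A *\<^sub>v y) \<bullet> (gram_w K *\<^sub>v (transpose_mat A *\<^sub>v y)) + (transpose_mat B *\<^sub>v y) \<bullet> (transpose_mat B *\<^sub>v y)
    \<le> y \<bullet> (gram_w K *\<^sub>v y)"
proof -
  have Ay: "transpose_mat A *\<^sub>v y \<in> carrier_vec n" by (rule mult_mat_vec_carrier[OF At y])
  have y0: "adj_pow 0 y = y" using At y by simp
  have "(transpose_mat A *\<^sub>v y) \<bullet> (gram_w K *\<^sub>v (transpose_mat A *\<^sub>v y)) = (\<Sum>k<K. energy (adj_pow (Suc k) y))"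
    unfolding gram_energy[OF Ay] pow_mult_vec_Suc(2)[OF At y] ..
  moreover have "(\<Sum>k<Suc K. energy (adj_pow k y)) = energy (adj_pow 0 y) + (\<Sum>k<K. energy (adj_pow (Suc k) y))"
    by (rule sum.lessThan_Suc_shift)
  moreover have "(\<Sum>k<Suc K. energy (adj_pow k y)) = (\<Sum>k<K. energy (adj_pow k y)) + energy (adj_pow K y)"
    by (rule sum.lessThan_Suc)
  ultimately show ?thesis using small[OF y] unfolding gram_energy[OF y] y0 by linarith
qed

text \<open>A Gramian is a reachability map times its adjoint. So \<open>gram_w K\<close> applied to
  \<open>y\<close> is a state reached by inputs computed from \<open>y\<close>, plus \<epsilon>
  times a state reached through the fictitious input; this ties the inverse of the Gramian to input
  energies.\<close>

lemma gram_reach: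
  assumes "y \<in> carrier_vec n"
  shows "gram_w K *\<^sub>v y = reach A B K (\<lambda>k. transpose_mat B *\<^sub>v adj_pow k y) + \<epsilon> \<cdot>\<^sub>v reach A (1\<^sub>m n) K (\<lambda>k. adj_pow k y)"
  using assms
proof (induction K arbitrary: y)
  case 0
  have "0\<^sub>m n n *\<^sub>v y = 0\<^sub>v n" using 0 by (intro eq_vecI) auto
  moreover have "\<epsilon> \<cdot>\<^sub>v 0\<^sub>v n = (0\<^sub>v n :: real vec)" by (intro eq_vecI) auto
  ultimately show ?case using A by simp
next
  case (Suc K)
  let ?z = "transpose_mat A *\<^sub>v y"
  have z: "?z \<in> carrier_vec n" by (rule mult_mat_vec_carrier[OF At Suc.prems])
  let ?r = "reach A B K (\<lambda>k. transpose_mat B *\<^sub>v adj_pow k ?z)" and ?s = "reach A (1\<^sub>m n) K (\<lambda>k. adj_pow k ?z)"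
  have r: "?r \<in> carrier_vec n" by (rule reach_carrier[OF A B mult_mat_vec_carrier[OF Bt v_carrier[OF z]]])
  have s: "?s \<in> carrier_vec n" by (rule reach_carrier[OF A one_carrier_mat v_carrier[OF z]])
  have c: "A *\<^sub>v ?r \<in> carrier_vec n" "A *\<^sub>v ?s \<in> carrier_vec n" "B *\<^sub>v (transpose_mat B *\<^sub>v y) \<in> carrier_vec n"
    using mult_mat_vec_carrier[OF A r] mult_mat_vec_carrier[OF A s]
      mult_mat_vec_carrier[OF B mult_mat_vec_carrier[OF Bt Suc.prems]] by blast+
  have "A *\<^sub>v (?r + \<epsilon> \<cdot>\<^sub>v ?s) = A *\<^sub>v ?r + A *\<^sub>v (\<epsilon> \<cdot>\<^sub>v ?s)"
    by (rule mult_add_distrib_mat_vec[OF A r]) (use s in simp)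
  also have "A *\<^sub>v (\<epsilon> \<cdot>\<^sub>v ?s) = \<epsilon> \<cdot>\<^sub>v (A *\<^sub>v ?s)" by (rule mult_mat_vec[OF A s])
  finally have Ars: "A *\<^sub>v (?r + \<epsilon> \<cdot>\<^sub>v ?s) = A *\<^sub>v ?r + \<epsilon> \<cdot>\<^sub>v (A *\<^sub>v ?s)" .
  have y0: "adj_pow 0 y = y" using At Suc.prems by simp
  have R: "reach A B (Suc K) (\<lambda>k. transpose_mat B *\<^sub>v adj_pow k y) = B *\<^sub>v (transpose_mat B *\<^sub>v y) + A *\<^sub>v ?r"
    unfolding reach.simps y0 pow_mult_vec_Suc(2)[OF At Suc.prems] ..
  have S: "reach A (1\<^sub>m n) (Suc K) (\<lambda>k. adj_pow k y) = y + A *\<^sub>v ?s"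
    unfolding reach.simps y0 pow_mult_vec_Suc(2)[OF At Suc.prems] using Suc.prems by simp
  have "gram_w (Suc K) *\<^sub>v y = (B *\<^sub>v (transpose_mat B *\<^sub>v y) + \<epsilon> \<cdot>\<^sub>v y) + (A *\<^sub>v ?r + \<epsilon> \<cdot>\<^sub>v (A *\<^sub>v ?s))"
    unfolding gram_mult_Suc[OF Suc.prems] weight_mult[OF Suc.prems] Suc.IH[OF z] Ars ..
  also have "\<dots> = (B *\<^sub>v (transpose_mat B *\<^sub>v y) + A *\<^sub>v ?r) + \<epsilon> \<cdot>\<^sub>v (y + A *\<^sub>v ?s)"
  proof -
    have gen: "(a + \<epsilon> \<cdot>\<^sub>v b) + (c + \<epsilon> \<cdot>\<^sub>v d) = (a + c) + \<epsilon> \<cdot>\<^sub>v (b + d)"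
      if "a \<in> carrier_vec n" "b \<in> carrier_vec n" "c \<in> carrier_vec n" "d \<in> carrier_vec n" for a b c d
      using that by (intro eq_vecI) (auto simp: algebra_simps)
    show ?thesis by (rule gen[OF c(3) Suc.prems c(1,2)])
  qed
  finally show ?case unfolding R S .
qed

end

lemma pos_def_inverse:
  fixes S :: "real mat"
  assumes S: "S \<in> carrier_mat n n" and pos: "\<And>p. p \<in> carrier_vec n \<Longrightarrow> \<epsilon> * (p \<bullet> p) \<le> p \<bullet> (S *\<^sub>v p)" and e: "\<epsilon> > 0"
  obtains P where "P \<in> carrier_mat n n" "P * S = 1\<^sub>m n" "S * P = 1\<^sub>m n"
proof -
  have "det S \<noteq> 0"
  proof
    assume "det S = 0"
    then obtain p where p: "p \<in> carrier_vec n" "p \<noteq> 0\<^sub>v n" "S *\<^sub>v p = 0\<^sub>v n"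
      using det_0_iff_vec_prod_zero[OF S] by auto
    then have "\<epsilon> * (p \<bullet> p) \<le> 0" using pos[OF p(1)] by simp
    then have "p \<bullet> p \<le> 0" using e by (simp add: mult_le_0_iff)
    then have "(\<Sum>i<n. (p $ i)\<^sup>2) = 0"
      using sq_vec_nonneg[of p] carrier_vecD[OF p(1)] by (simp add: sq_vec_sum)
    then have "\<forall>i<n. p $ i = 0" by (subst (asm) sum_nonneg_eq_0_iff) auto
    then have "p = 0\<^sub>v n" using p(1) by (intro eq_vecI) auto
    with p(2) show False by simp
  qed
  from det_non_zero_imp_unit[OF S this, of undefined] obtain P where
    "P \<in> carrier_mat n n" "P * S = 1\<^sub>m n" "S * P = 1\<^sub>m n"
    unfolding Units_def ring_mat_def by auto
  then show ?thesis by (rule that)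
qed

text \<open>\<open>P\<close> is the inverse of the perturbed controllability Gramian
  \<open>S\<close>, and \<open>lam * Q\<close> is the perturbed observability Gramian
  \<open>H\<close>. Both dissipation inequalities hold by construction; contractivity of the
  sections enters in the comparison of \<open>Q\<close> with \<open>P\<close>. For that,
  \<open>x = S y\<close> is split into the part \<xi> reached by true inputs and \<epsilon> times
  the part \<eta> reached by fictitious ones.\<close>

lemma section_imp_dissipative:
  assumes A: "A \<in> carrier_mat n n" and B: "B \<in> carrier_mat n m" and C: "C \<in> carrier_mat l n"
    and dec: "exp_decay A" and \<rho>: "\<rho> \<ge> 0" "\<rho> < 1"
    and sec: "\<And>K. hankel_section l m (markov A B C) 1 \<rho> K"
  shows "\<exists>P Q lam. dissipative A B C n m P Q lam"
proof -
  have one: "1\<^sub>m n \<in> carrier_mat n n" by simp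
  have ex: "\<exists>c\<ge>0. \<forall>K. hankel_section l' m' (markov A B' C') 1 c K"
    if B': "B' \<in> carrier_mat n m'" and C': "C' \<in> carrier_mat l' n" for B' C' m' l'
  proof -
    obtain c r where c: "c \<ge> 0" "0 < r" "r < 1"
      "\<And>k a b. a < l' \<Longrightarrow> b < m' \<Longrightarrow> \<bar>(C' * A ^\<^sub>m k * B') $$ (a,b)\<bar> \<le> c * r ^ k"
      using exp_decay_markov[OF A dec B' C'] by blast
    show ?thesis by (rule hankel_section_bounded[OF _ c(1-3)]) (use c(4) in \<open>simp add: markov_def\<close>)
  qed
  \<comment> \<open>Crude bounds, uniform in the horizon, for the systems with fictitious input
    (\<open>c1\<close>), with fictitious output (\<open>c2\<close>) and with both
    (\<open>c3\<close>).\<close>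
  obtain c1 where c1: "c1 \<ge> 0" "\<And>K. hankel_section l n (markov A (1\<^sub>m n) C) 1 c1 K" using ex[OF one C] by blast
  obtain c2 where c2: "c2 \<ge> 0" "\<And>K. hankel_section n m (markov A B (1\<^sub>m n)) 1 c2 K" using ex[OF B one] by blast
  obtain c3 where c3: "c3 \<ge> 0" "\<And>K. hankel_section n n (markov A (1\<^sub>m n) (1\<^sub>m n)) 1 c3 K" using ex[OF one one] by blast
  have \<rho>2: "\<rho>\<^sup>2 < 1" "\<rho>\<^sup>2 \<ge> 0" using \<rho> by (auto simp: power_less_one_iff)
  \<comment> \<open>\<open>lam\<close> is the midpoint between the square of \<rho> and 1. Half of
    that gain is \<delta>, spent on Young's inequality; the other half covers the fictitious output
    driven by true inputs.\<close>
  define \<delta> where "\<delta> = (1 - \<rho>\<^sup>2) / 4"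
  define lam where "lam = (1 + \<rho>\<^sup>2) / 2"
  define k2 where "k2 = (1 + 1/\<delta>) * c1\<^sup>2 + 2 * c3\<^sup>2 + 1"
  define \<epsilon> where "\<epsilon> = min 1 (min (\<delta> / (2 * c2\<^sup>2 + 1)) ((1/2) / k2))"
  have \<delta>: "\<delta> > 0" using \<rho>2 by (simp add: \<delta>_def)
  have "lam \<ge> 1/2" using \<rho>2 unfolding lam_def by simp
  moreover have "lam < 1" using \<rho>2 unfolding lam_def by simp
  ultimately have lam: "0 < lam" "lam < 1" "lam \<ge> 1/2" by simp_all
  have k2: "k2 > 0"
    unfolding k2_def using \<delta> by (intro add_nonneg_pos add_nonneg_nonneg mult_nonneg_nonneg) auto
  have c2p: "2 * c2\<^sup>2 + 1 > 0" by (intro add_nonneg_pos) auto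
  have eps: "\<epsilon> > 0" "\<epsilon> \<le> 1" using \<delta> k2 c2p by (auto simp: \<epsilon>_def)
  have e1: "(1 + \<delta>) * \<rho>\<^sup>2 + 2 * \<epsilon> * c2\<^sup>2 \<le> lam"
  proof -
    have "\<epsilon> \<le> \<delta> / (2 * c2\<^sup>2 + 1)" by (simp add: \<epsilon>_def)
    then have "\<epsilon> * (2 * c2\<^sup>2 + 1) \<le> \<delta>" using c2p by (simp add: le_divide_eq)
    then have "2 * \<epsilon> * c2\<^sup>2 \<le> \<delta>" using eps by (simp add: algebra_simps)
    moreover have "\<delta> * \<rho>\<^sup>2 \<le> \<delta> * 1" using \<rho>2 \<delta> by (intro mult_left_mono) auto
    ultimately show ?thesis by (simp add: distrib_right lam_def \<delta>_def field_simps)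
  qed
  \<comment> \<open>The fictitious inputs add only \<open>\<epsilon> * W\<close> to the
    \<open>P\<close> energy, but their effect on the outputs is of second order in \<epsilon>, so a
    small \<epsilon> suffices. Division by \<epsilon> leaves a bound by 1/2, which is at most
    \<open>lam\<close>.\<close>
  have e2: "(1 + 1/\<delta>) * \<epsilon>\<^sup>2 * c1\<^sup>2 + 2 * \<epsilon> ^ 3 * c3\<^sup>2 \<le> lam * \<epsilon>"
  proof -
    have "\<epsilon> \<le> (1/2) / k2" by (simp add: \<epsilon>_def)
    then have "\<epsilon> * k2 \<le> 1/2" using k2 by (simp add: le_divide_eq)
    moreover have "(1 + 1/\<delta>) * \<epsilon> * c1\<^sup>2 + 2 * \<epsilon>\<^sup>2 * c3\<^sup>2 \<le> \<epsilon> * k2"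
    proof -
      have "\<epsilon>\<^sup>2 \<le> \<epsilon>" using eps by (simp add: power2_eq_square mult_le_cancel_left1)
      then have "2 * \<epsilon>\<^sup>2 * c3\<^sup>2 \<le> 2 * \<epsilon> * c3\<^sup>2" by (intro mult_right_mono) auto
      then show ?thesis using eps by (simp add: k2_def algebra_simps)
    qed
    ultimately have "(1 + 1/\<delta>) * \<epsilon> * c1\<^sup>2 + 2 * \<epsilon>\<^sup>2 * c3\<^sup>2 \<le> lam" using lam by linarith
    then have "\<epsilon> * ((1 + 1/\<delta>) * \<epsilon> * c1\<^sup>2 + 2 * \<epsilon>\<^sup>2 * c3\<^sup>2) \<le> \<epsilon> * lam" using eps by (intro mult_left_mono) auto
    then show ?thesis by (simp add: power2_eq_square power3_eq_cube algebra_simps)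
  qed
  have At: "transpose_mat A \<in> carrier_mat n n" and Bt: "transpose_mat B \<in> carrier_mat m n"
    and Ct: "transpose_mat C \<in> carrier_mat n l" using A B C by auto
  have decT: "exp_decay (transpose_mat A)" by (rule exp_decay_transpose[OF A dec])
  have "\<forall>\<^sub>F K in sequentially. (\<forall>x\<in>carrier_vec n. (transpose_mat B *\<^sub>v (transpose_mat A ^\<^sub>m K *\<^sub>v x)) \<bullet> (transpose_mat B *\<^sub>v (transpose_mat A ^\<^sub>m K *\<^sub>v x)) \<le> (\<epsilon>/2) * (x \<bullet> x))
    \<and> (\<forall>x\<in>carrier_vec n. (1\<^sub>m n *\<^sub>v (transpose_mat A ^\<^sub>m K *\<^sub>v x)) \<bullet> (1\<^sub>m n *\<^sub>v (transpose_mat A ^\<^sub>m K *\<^sub>v x)) \<le> (1/2) * (x \<bullet> x))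
    \<and> (\<forall>x\<in>carrier_vec n. (C *\<^sub>v (A ^\<^sub>m K *\<^sub>v x)) \<bullet> (C *\<^sub>v (A ^\<^sub>m K *\<^sub>v x)) \<le> (\<epsilon>/2) * (x \<bullet> x))
    \<and> (\<forall>x\<in>carrier_vec n. (1\<^sub>m n *\<^sub>v (A ^\<^sub>m K *\<^sub>v x)) \<bullet> (1\<^sub>m n *\<^sub>v (A ^\<^sub>m K *\<^sub>v x)) \<le> (1/2) * (x \<bullet> x))
    \<and> K > 0"
    using eps by (intro eventually_conj decay_small[OF At decT Bt] decay_small[OF At decT one]
      decay_small[OF A dec C] decay_small[OF A dec one] eventually_gt_at_top) auto
  from eventually_happens'[OF sequentially_bot this] obtain K where K:
    "\<And>x. x \<in> carrier_vec n \<Longrightarrow> (transpose_mat B *\<^sub>v (transpose_mat A ^\<^sub>m K *\<^sub>v x)) \<bullet> (transpose_mat B *\<^sub>v (transpose_mat A ^\<^sub>m K *\<^sub>v x)) \<le> (\<epsilon>/2) * (x \<bullet> x)"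
    "\<And>x. x \<in> carrier_vec n \<Longrightarrow> (1\<^sub>m n *\<^sub>v (transpose_mat A ^\<^sub>m K *\<^sub>v x)) \<bullet> (1\<^sub>m n *\<^sub>v (transpose_mat A ^\<^sub>m K *\<^sub>v x)) \<le> (1/2) * (x \<bullet> x)"
    "\<And>x. x \<in> carrier_vec n \<Longrightarrow> (C *\<^sub>v (A ^\<^sub>m K *\<^sub>v x)) \<bullet> (C *\<^sub>v (A ^\<^sub>m K *\<^sub>v x)) \<le> (\<epsilon>/2) * (x \<bullet> x)"
    "\<And>x. x \<in> carrier_vec n \<Longrightarrow> (1\<^sub>m n *\<^sub>v (A ^\<^sub>m K *\<^sub>v x)) \<bullet> (1\<^sub>m n *\<^sub>v (A ^\<^sub>m K *\<^sub>v x)) \<le> (1/2) * (x \<bullet> x)" "K > 0"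
    by blast
  \<comment> \<open>Finite-horizon Gramians with an extra input (output) of weight \<open>\<epsilon>\<close>: they are invertible, and for
    \<open>K\<close> large the discarded tail is dominated by the \<open>\<epsilon>\<close>-term, so the Lyapunov inequalities hold exactly.\<close>
  define S where "S = gram A (input_weight B \<epsilon>) K"
  define H where "H = gram (transpose_mat A) (input_weight (transpose_mat C) \<epsilon>) K"
  note ctxS = A B eps(1) and ctxH = At Ct eps(1)
  have S: "S \<in> carrier_mat n n" "psd S" unfolding S_def by (rule gram_carrier[OF ctxS], rule gram_psd[OF ctxS])
  have H: "H \<in> carrier_mat n n" "psd H" unfolding H_def by (rule gram_carrier[OF ctxH], rule gram_psd[OF ctxH])
  have smallS: "(transpose_mat B *\<^sub>v (transpose_mat A ^\<^sub>m K *\<^sub>v y)) \<bullet> (transpose_mat B *\<^sub>v (transpose_mat A ^\<^sub>m K *\<^sub>v y))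
      + \<epsilon> * ((transpose_mat A ^\<^sub>m K *\<^sub>v y) \<bullet> (transpose_mat A ^\<^sub>m K *\<^sub>v y)) \<le> \<epsilon> * (y \<bullet> y)"
    if y: "y \<in> carrier_vec n" for y
  proof -
    have "1\<^sub>m n *\<^sub>v (transpose_mat A ^\<^sub>m K *\<^sub>v y) = transpose_mat A ^\<^sub>m K *\<^sub>v y"
      using mult_mat_vec_carrier[OF pow_carrier_mat[OF At] y] by (rule one_mult_mat_vec)
    with K(2)[OF y] have "(transpose_mat A ^\<^sub>m K *\<^sub>v y) \<bullet> (transpose_mat A ^\<^sub>m K *\<^sub>v y) \<le> (1/2) * (y \<bullet> y)" by simp
    then have "\<epsilon> * ((transpose_mat A ^\<^sub>m K *\<^sub>v y) \<bullet> (transpose_mat A ^\<^sub>m K *\<^sub>v y)) \<le> \<epsilon> * ((1/2) * (y \<bullet> y))"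
      using eps by (intro mult_left_mono) auto
    then show ?thesis using K(1)[OF y] by (simp add: algebra_simps)
  qed
  have smallH: "(C *\<^sub>v (A ^\<^sub>m K *\<^sub>v y)) \<bullet> (C *\<^sub>v (A ^\<^sub>m K *\<^sub>v y))
      + \<epsilon> * ((A ^\<^sub>m K *\<^sub>v y) \<bullet> (A ^\<^sub>m K *\<^sub>v y)) \<le> \<epsilon> * (y \<bullet> y)"
    if y: "y \<in> carrier_vec n" for y
  proof -
    have "1\<^sub>m n *\<^sub>v (A ^\<^sub>m K *\<^sub>v y) = A ^\<^sub>m K *\<^sub>v y"
      using mult_mat_vec_carrier[OF pow_carrier_mat[OF A] y] by (rule one_mult_mat_vec)
    with K(4)[OF y] have "(A ^\<^sub>m K *\<^sub>v y) \<bullet> (A ^\<^sub>m K *\<^sub>v y) \<le> (1/2) * (y \<bullet> y)" by simp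
    then have "\<epsilon> * ((A ^\<^sub>m K *\<^sub>v y) \<bullet> (A ^\<^sub>m K *\<^sub>v y)) \<le> \<epsilon> * ((1/2) * (y \<bullet> y))"
      using eps by (intro mult_left_mono) auto
    then show ?thesis using K(3)[OF y] by (simp add: algebra_simps)
  qed
  have lyapS: "(transpose_mat A *\<^sub>v y) \<bullet> (S *\<^sub>v (transpose_mat A *\<^sub>v y)) + (transpose_mat B *\<^sub>v y) \<bullet> (transpose_mat B *\<^sub>v y) \<le> y \<bullet> (S *\<^sub>v y)"
    if "y \<in> carrier_vec n" for y
    unfolding S_def using smallS that by (rule gram_lyapunov[OF ctxS])
  have lyapH: "(A *\<^sub>v y) \<bullet> (H *\<^sub>v (A *\<^sub>v y)) + (C *\<^sub>v y) \<bullet> (C *\<^sub>v y) \<le> y \<bullet> (H *\<^sub>v y)"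
    if y: "y \<in> carrier_vec n" for y
    unfolding H_def using gram_lyapunov[OF ctxH, of K y] smallH y by simp
  have energyS: "y \<bullet> (S *\<^sub>v y) = (\<Sum>k<K. (transpose_mat B *\<^sub>v (transpose_mat A ^\<^sub>m k *\<^sub>v y)) \<bullet> (transpose_mat B *\<^sub>v (transpose_mat A ^\<^sub>m k *\<^sub>v y))
      + \<epsilon> * ((transpose_mat A ^\<^sub>m k *\<^sub>v y) \<bullet> (transpose_mat A ^\<^sub>m k *\<^sub>v y)))" if "y \<in> carrier_vec n" for y
    unfolding S_def using that by (rule gram_energy[OF ctxS])
  have energyH: "y \<bullet> (H *\<^sub>v y) = (\<Sum>k<K. (C *\<^sub>v (A ^\<^sub>m k *\<^sub>v y)) \<bullet> (C *\<^sub>v (A ^\<^sub>m k *\<^sub>v y))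
      + \<epsilon> * ((A ^\<^sub>m k *\<^sub>v y) \<bullet> (A ^\<^sub>m k *\<^sub>v y)))" if "y \<in> carrier_vec n" for y
    unfolding H_def using gram_energy[OF ctxH that] by simp
  have pos: "\<epsilon> * (p \<bullet> p) \<le> p \<bullet> (S *\<^sub>v p)" if p: "p \<in> carrier_vec n" for p
  proof -
    obtain K' where K': "K = Suc K'" using K(5) by (cases K) auto
    have p0: "transpose_mat A ^\<^sub>m 0 *\<^sub>v p = p" using At p by simp
    have "\<epsilon> * (p \<bullet> p) \<le> (transpose_mat B *\<^sub>v p) \<bullet> (transpose_mat B *\<^sub>v p) + \<epsilon> * (p \<bullet> p)" by (simp add: sq_vec_nonneg)
    also have "\<dots> \<le> p \<bullet> (S *\<^sub>v p)"
      unfolding energyS[OF p] K' sum.lessThan_Suc_shift p0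
      using eps by (simp add: sum_nonneg add_nonneg_nonneg sq_vec_nonneg)
    finally show ?thesis .
  qed
  obtain P where P: "P \<in> carrier_mat n n" "P * S = 1\<^sub>m n" "S * P = 1\<^sub>m n"
    using pos_def_inverse[OF S(1) pos eps(1)] by blast
  have SP: "S *\<^sub>v (P *\<^sub>v x) = x" "P *\<^sub>v (S *\<^sub>v x) = x" if "x \<in> carrier_vec n" for x
    using assoc_mult_mat_vec[OF S(1) P(1) that] assoc_mult_mat_vec[OF P(1) S(1) that] that by (simp_all add: P)
  have Pc: "P *\<^sub>v x \<in> carrier_vec n" if "x \<in> carrier_vec n" for x by (rule mult_mat_vec_carrier[OF P(1) that])
  have Sc: "S *\<^sub>v x \<in> carrier_vec n" if "x \<in> carrier_vec n" for x by (rule mult_mat_vec_carrier[OF S(1) that])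
  have symS: "x \<bullet> (S *\<^sub>v y) = y \<bullet> (S *\<^sub>v x)" if "x \<in> carrier_vec n" "y \<in> carrier_vec n" for x y
    by (rule psd_bilinear(1)[OF S(2,1) that])
  have PS: "x \<bullet> (P *\<^sub>v y) = (P *\<^sub>v x) \<bullet> (S *\<^sub>v (P *\<^sub>v y))" if x: "x \<in> carrier_vec n" and y: "y \<in> carrier_vec n" for x y
    using symS[OF Pc[OF x] Pc[OF y]] SP(1)[OF x] comm_scalar_prod[OF x Pc[OF y]] by simp
  have symP: "transpose_mat P = P"
    by (rule transpose_eqI[OF P(1)]) (simp add: PS symS[OF Pc Pc])
  have psdP: "psd P"
    using P(1) symP PS psd_bilinear(2)[OF S(2,1) Pc Pc] unfolding psd_def by auto
  define Q where "Q = (1/lam) \<cdot>\<^sub>m H"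
  have Q: "Q \<in> carrier_mat n n" using H by (simp add: Q_def)
  have Qm: "x \<bullet> (Q *\<^sub>v y) = (x \<bullet> (H *\<^sub>v y)) / lam" if x: "x \<in> carrier_vec n" and y: "y \<in> carrier_vec n" for x y
  proof -
    have "Q *\<^sub>v y = (1/lam) \<cdot>\<^sub>v (H *\<^sub>v y)"
      unfolding Q_def using H(1) y by (intro eq_vecI) (auto simp: scalar_prod_def sum_distrib_left mult.assoc)
    then show ?thesis using mult_mat_vec_carrier[OF H(1) y] x by simp
  qed
  have psdQ: "psd Q"
  proof -
    have "transpose_mat Q = Q"
      by (rule transpose_eqI[OF Q]) (simp add: Qm psd_bilinear(1)[OF H(2,1)])
    then show ?thesis using Q Qm psd_bilinear(2)[OF H(2,1)] lam unfolding psd_def by auto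
  qed
  \<comment> \<open>The Lyapunov inequality for \<open>S\<close> is dualised. With
    \<open>y = P w\<close>, the energy of \<open>w\<close> equals
    \<open>x \<bullet> a + u \<bullet> b\<close>. Cauchy-Schwarz in the weight \<open>S\<close> for
    the first product and in the plain metric for the second gives twice the energy on the left, and
    one copy is absorbed by the Lyapunov inequality.\<close>
  have dissP: "(A *\<^sub>v x + B *\<^sub>v u) \<bullet> (P *\<^sub>v (A *\<^sub>v x + B *\<^sub>v u)) \<le> x \<bullet> (P *\<^sub>v x) + u \<bullet> u"
    if x: "x \<in> carrier_vec n" and u: "u \<in> carrier_vec m" for x u
  proof -
    define w where "w = A *\<^sub>v x + B *\<^sub>v u"
    have Ax: "A *\<^sub>v x \<in> carrier_vec n" "B *\<^sub>v u \<in> carrier_vec n"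
      by (rule mult_mat_vec_carrier[OF A x], rule mult_mat_vec_carrier[OF B u])
    have w: "w \<in> carrier_vec n" using Ax by (simp add: w_def)
    define y where "y = P *\<^sub>v w"
    have y: "y \<in> carrier_vec n" unfolding y_def by (rule Pc[OF w])
    define a where "a = transpose_mat A *\<^sub>v y"
    define b where "b = transpose_mat B *\<^sub>v y"
    have a: "a \<in> carrier_vec n" unfolding a_def by (rule mult_mat_vec_carrier[OF At y])
    have b: "b \<in> carrier_vec m" unfolding b_def by (rule mult_mat_vec_carrier[OF Bt y])
    have 1: "w \<bullet> (P *\<^sub>v w) = x \<bullet> a + u \<bullet> b"
      using add_scalar_prod_distrib[OF Ax y] adjoint_scalar_prod[OF A x y] adjoint_scalar_prod[OF B u y]
      unfolding a_def b_def y_def[symmetric] by (simp only: w_def)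
    have 2: "w \<bullet> (P *\<^sub>v w) = y \<bullet> (S *\<^sub>v y)" unfolding y_def by (rule PS[OF w w])
    have 3: "a \<bullet> (S *\<^sub>v a) + b \<bullet> b \<le> y \<bullet> (S *\<^sub>v y)" unfolding a_def b_def by (rule lyapS[OF y])
    have 4: "2 * (x \<bullet> a) \<le> a \<bullet> (S *\<^sub>v a) + x \<bullet> (P *\<^sub>v x)"
    proof -
      let ?p = "P *\<^sub>v x"
      note p = Pc[OF x]
      have "0 \<le> (a - ?p) \<bullet> (S *\<^sub>v (a - ?p))" by (rule psd_bilinear(2)[OF S(2,1)]) (use a p in auto)
      also have "S *\<^sub>v (a - ?p) = S *\<^sub>v a - x"
        using mult_minus_distrib_mat_vec[OF S(1) a p] SP(1)[OF x] by simp
      also have "(a - ?p) \<bullet> (S *\<^sub>v a - x) = a \<bullet> (S *\<^sub>v a) - a \<bullet> x - (?p \<bullet> (S *\<^sub>v a) - ?p \<bullet> x)"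
        using minus_scalar_prod_distrib[OF a p, of "S *\<^sub>v a - x"] scalar_prod_minus_distrib[OF a Sc[OF a] x]
          scalar_prod_minus_distrib[OF p Sc[OF a] x] Sc[OF a] x by simp
      also have "?p \<bullet> (S *\<^sub>v a) = a \<bullet> x" using symS[OF p a] SP(1)[OF x] by simp
      finally show ?thesis using comm_scalar_prod[OF a x] comm_scalar_prod[OF p x] by linarith
    qed
    have 5: "2 * (u \<bullet> b) \<le> u \<bullet> u + b \<bullet> b"
    proof -
      have "2 * (\<Sum>i<m. u $ i * b $ i) \<le> (\<Sum>i<m. (u $ i)\<^sup>2 + (b $ i)\<^sup>2)"
        unfolding sum_distrib_left mult.assoc[symmetric] by (intro sum_mono sum_squares_bound)
      then show ?thesis unfolding sq_vec_sum using carrier_vecD[OF u] carrier_vecD[OF b]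
        by (simp add: scalar_prod_def atLeast0LessThan sum.distrib)
    qed
    show ?thesis unfolding w_def[symmetric] using 1 2 3 4 5 by linarith
  qed
  have dissQ: "lam * ((A *\<^sub>v x) \<bullet> (Q *\<^sub>v (A *\<^sub>v x))) + (C *\<^sub>v x) \<bullet> (C *\<^sub>v x) \<le> lam * (x \<bullet> (Q *\<^sub>v x))"
    if x: "x \<in> carrier_vec n" for x
    unfolding Qm[OF x x] Qm[OF mult_mat_vec_carrier[OF A x] mult_mat_vec_carrier[OF A x]]
    using lyapH[OF x] lam(1) by simp
  have QP: "x \<bullet> (Q *\<^sub>v x) \<le> x \<bullet> (P *\<^sub>v x)" if x: "x \<in> carrier_vec n" for x
  proof -
    define y where "y = P *\<^sub>v x"
    have y: "y \<in> carrier_vec n" unfolding y_def by (rule Pc[OF x])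
    define v where "v k = transpose_mat A ^\<^sub>m k *\<^sub>v y" for k
    define u where "u k = transpose_mat B *\<^sub>v v k" for k
    have v: "v k \<in> carrier_vec n" for k
      unfolding v_def by (rule mult_mat_vec_carrier[OF pow_carrier_mat[OF At] y])
    have u: "u k \<in> carrier_vec m" for k unfolding u_def by (rule mult_mat_vec_carrier[OF Bt v])
    define U where "U = (\<Sum>k<K. u k \<bullet> u k)"
    define W where "W = (\<Sum>k<K. v k \<bullet> v k)"
    have UW: "U \<ge> 0" "W \<ge> 0" unfolding U_def W_def by (intro sum_nonneg sq_vec_nonneg)+
    \<comment> \<open>The \<open>P\<close> energy of \<open>x\<close> is the total weighted energy
      of the true and fictitious inputs that produce it.\<close>
    have xP: "x \<bullet> (P *\<^sub>v x) = U + \<epsilon> * W"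
      using PS[OF x x] energyS[OF y]
      by (simp add: U_def W_def u_def v_def y_def[symmetric] sum.distrib sum_distrib_left)
    define \<xi> where "\<xi> = reach A B K u"
    define \<eta> where "\<eta> = reach A (1\<^sub>m n) K v"
    have \<xi>: "\<xi> \<in> carrier_vec n" unfolding \<xi>_def by (rule reach_carrier[OF A B u])
    have \<eta>: "\<eta> \<in> carrier_vec n" unfolding \<eta>_def by (rule reach_carrier[OF A one v])
    have xe: "x = \<xi> + \<epsilon> \<cdot>\<^sub>v \<eta>"
      using gram_reach[OF ctxS y, of K] SP(1)[OF x]
      unfolding S_def[symmetric] \<xi>_def \<eta>_def u_def v_def y_def by simp
    have b1: "(\<Sum>i<K. ((C * A ^\<^sub>m i) *\<^sub>v \<xi>) \<bullet> ((C * A ^\<^sub>m i) *\<^sub>v \<xi>)) \<le> \<rho>\<^sup>2 * U"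
      using sec[of K] u unfolding hankel_section_reach[OF A B C \<rho>(1)] \<xi>_def U_def by blast
    have b2: "(\<Sum>i<K. ((C * A ^\<^sub>m i) *\<^sub>v \<eta>) \<bullet> ((C * A ^\<^sub>m i) *\<^sub>v \<eta>)) \<le> c1\<^sup>2 * W"
      using c1(2)[of K] v unfolding hankel_section_reach[OF A one C c1(1)] \<eta>_def W_def by blast
    have b3: "(\<Sum>i<K. ((1\<^sub>m n * A ^\<^sub>m i) *\<^sub>v \<xi>) \<bullet> ((1\<^sub>m n * A ^\<^sub>m i) *\<^sub>v \<xi>)) \<le> c2\<^sup>2 * U"
      using c2(2)[of K] u unfolding hankel_section_reach[OF A B one c2(1)] \<xi>_def U_def by blast
    have b4: "(\<Sum>i<K. ((1\<^sub>m n * A ^\<^sub>m i) *\<^sub>v \<eta>) \<bullet> ((1\<^sub>m n * A ^\<^sub>m i) *\<^sub>v \<eta>)) \<le> c3\<^sup>2 * W"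
      using c3(2)[of K] v unfolding hankel_section_reach[OF A one one c3(1)] \<eta>_def W_def by blast
    have yg: "(M *\<^sub>v x) \<bullet> (M *\<^sub>v x) \<le> (1 + d) * ((M *\<^sub>v \<xi>) \<bullet> (M *\<^sub>v \<xi>)) + (1 + 1/d) * \<epsilon>\<^sup>2 * ((M *\<^sub>v \<eta>) \<bullet> (M *\<^sub>v \<eta>))"
      if M: "M \<in> carrier_mat k n" and d: "d > 0" for M k d
    proof -
      have c: "M *\<^sub>v \<xi> \<in> carrier_vec k" "M *\<^sub>v \<eta> \<in> carrier_vec k"
        by (rule mult_mat_vec_carrier[OF M \<xi>], rule mult_mat_vec_carrier[OF M \<eta>])
      have "M *\<^sub>v x = M *\<^sub>v \<xi> + M *\<^sub>v (\<epsilon> \<cdot>\<^sub>v \<eta>)" unfolding xe by (rule mult_add_distrib_mat_vec[OF M \<xi>]) (use \<eta> in simp)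
      also have "M *\<^sub>v (\<epsilon> \<cdot>\<^sub>v \<eta>) = \<epsilon> \<cdot>\<^sub>v (M *\<^sub>v \<eta>)" by (rule mult_mat_vec[OF M \<eta>])
      finally have e: "M *\<^sub>v x = M *\<^sub>v \<xi> + \<epsilon> \<cdot>\<^sub>v (M *\<^sub>v \<eta>)" .
      have "(\<epsilon> \<cdot>\<^sub>v (M *\<^sub>v \<eta>)) \<bullet> (\<epsilon> \<cdot>\<^sub>v (M *\<^sub>v \<eta>)) = \<epsilon>\<^sup>2 * ((M *\<^sub>v \<eta>) \<bullet> (M *\<^sub>v \<eta>))"
        using c(2) by (simp add: power2_eq_square)
      then show ?thesis unfolding e using young[OF c(1) _ d, of "\<epsilon> \<cdot>\<^sub>v (M *\<^sub>v \<eta>)"] c(2) by (simp add: mult.assoc power2_eq_square)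
    qed
    have pc: "A ^\<^sub>m k \<in> carrier_mat n n" for k by (rule pow_carrier_mat[OF A])
    have CA: "C *\<^sub>v (A ^\<^sub>m k *\<^sub>v z) = (C * A ^\<^sub>m k) *\<^sub>v z" "A ^\<^sub>m k *\<^sub>v z = (1\<^sub>m n * A ^\<^sub>m k) *\<^sub>v z"
      if "z \<in> carrier_vec n" for k z
      using assoc_mult_mat_vec[OF C pc that] left_mult_one_mat[OF pc] by simp_all
    have "x \<bullet> (H *\<^sub>v x) = (\<Sum>k<K. ((C * A ^\<^sub>m k) *\<^sub>v x) \<bullet> ((C * A ^\<^sub>m k) *\<^sub>v x))
        + \<epsilon> * (\<Sum>k<K. ((1\<^sub>m n * A ^\<^sub>m k) *\<^sub>v x) \<bullet> ((1\<^sub>m n * A ^\<^sub>m k) *\<^sub>v x))"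
      unfolding energyH[OF x] CA(1)[OF x] sum.distrib sum_distrib_left left_mult_one_mat[OF pc] ..
    \<comment> \<open>Young's inequality is used with parameter \<delta> for the true outputs, where
      the constant must stay near the square of \<rho>, and with parameter 1 for the fictitious
      outputs, which already carry a factor \<epsilon>.\<close>
    also have "\<dots> \<le> ((1 + \<delta>) * (\<rho>\<^sup>2 * U) + (1 + 1/\<delta>) * \<epsilon>\<^sup>2 * (c1\<^sup>2 * W))
        + \<epsilon> * ((1 + 1) * (c2\<^sup>2 * U) + (1 + 1/1) * \<epsilon>\<^sup>2 * (c3\<^sup>2 * W))"
    proof (rule add_mono)
      have "(\<Sum>k<K. ((C * A ^\<^sub>m k) *\<^sub>v x) \<bullet> ((C * A ^\<^sub>m k) *\<^sub>v x))
        \<le> (\<Sum>k<K. (1 + \<delta>) * (((C * A ^\<^sub>m k) *\<^sub>v \<xi>) \<bullet> ((C * A ^\<^sub>m k) *\<^sub>v \<xi>))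
            + (1 + 1/\<delta>) * \<epsilon>\<^sup>2 * (((C * A ^\<^sub>m k) *\<^sub>v \<eta>) \<bullet> ((C * A ^\<^sub>m k) *\<^sub>v \<eta>)))"
        by (rule sum_mono, rule yg[OF mult_carrier_mat[OF C pc] \<delta>])
      also have "\<dots> \<le> (1 + \<delta>) * (\<rho>\<^sup>2 * U) + (1 + 1/\<delta>) * \<epsilon>\<^sup>2 * (c1\<^sup>2 * W)"
        unfolding sum.distrib sum_distrib_left[symmetric]
        using \<delta> by (intro add_mono mult_left_mono b1 b2) auto
      finally show "(\<Sum>k<K. ((C * A ^\<^sub>m k) *\<^sub>v x) \<bullet> ((C * A ^\<^sub>m k) *\<^sub>v x))
        \<le> (1 + \<delta>) * (\<rho>\<^sup>2 * U) + (1 + 1/\<delta>) * \<epsilon>\<^sup>2 * (c1\<^sup>2 * W)" .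
      have "(\<Sum>k<K. ((1\<^sub>m n * A ^\<^sub>m k) *\<^sub>v x) \<bullet> ((1\<^sub>m n * A ^\<^sub>m k) *\<^sub>v x))
        \<le> (\<Sum>k<K. (1 + 1) * (((1\<^sub>m n * A ^\<^sub>m k) *\<^sub>v \<xi>) \<bullet> ((1\<^sub>m n * A ^\<^sub>m k) *\<^sub>v \<xi>))
            + (1 + 1/1) * \<epsilon>\<^sup>2 * (((1\<^sub>m n * A ^\<^sub>m k) *\<^sub>v \<eta>) \<bullet> ((1\<^sub>m n * A ^\<^sub>m k) *\<^sub>v \<eta>)))"
        by (rule sum_mono, rule yg[OF mult_carrier_mat[OF one pc]]) simp
      also have "\<dots> \<le> (1 + 1) * (c2\<^sup>2 * U) + (1 + 1/1) * \<epsilon>\<^sup>2 * (c3\<^sup>2 * W)"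
        unfolding sum.distrib sum_distrib_left[symmetric]
        by (intro add_mono mult_left_mono b3 b4) auto
      finally show "\<epsilon> * (\<Sum>k<K. ((1\<^sub>m n * A ^\<^sub>m k) *\<^sub>v x) \<bullet> ((1\<^sub>m n * A ^\<^sub>m k) *\<^sub>v x))
        \<le> \<epsilon> * ((1 + 1) * (c2\<^sup>2 * U) + (1 + 1/1) * \<epsilon>\<^sup>2 * (c3\<^sup>2 * W))"
        using eps by (intro mult_left_mono) auto
    qed
    also have "\<dots> = ((1 + \<delta>) * \<rho>\<^sup>2 + 2 * \<epsilon> * c2\<^sup>2) * U + ((1 + 1/\<delta>) * \<epsilon>\<^sup>2 * c1\<^sup>2 + 2 * \<epsilon> ^ 3 * c3\<^sup>2) * W"
      by (simp add: power2_eq_square power3_eq_cube algebra_simps)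
    also have "\<dots> \<le> lam * U + (lam * \<epsilon>) * W"
      by (intro add_mono mult_right_mono e1 e2 UW)
    also have "\<dots> = lam * (x \<bullet> (P *\<^sub>v x))" unfolding xP by (simp add: algebra_simps)
    finally have "x \<bullet> (H *\<^sub>v x) \<le> lam * (x \<bullet> (P *\<^sub>v x))" .
    then show ?thesis unfolding Qm[OF x x] using lam(1) by (simp add: divide_le_eq mult.commute)
  qed
  have "dissipative A B C n m P Q lam"
    unfolding dissipative_def using P(1) Q psdP psdQ lam dissP dissQ QP by blast
  then show ?thesis by blast
qed

lemma LMI_feasible_iff:
  assumes A: "A \<in> carrier_mat n n" and B: "B \<in> carrier_mat n m" and C: "C \<in> carrier_mat l n" and dec: "exp_decay A"
  shows "(\<exists>P Q lam. LMI A B C P Q lam) \<longleftrightarrow> (\<exists>\<rho>\<ge>0. \<rho> < 1 \<and> (\<forall>K. hankel_section l m (markov A B C) 1 \<rho> K))"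
proof
  assume "\<exists>P Q lam. LMI A B C P Q lam"
  then obtain P Q lam where D: "dissipative A B C n m P Q lam" using LMI_imp_dissipative[OF A B C] by blast
  then have "0 < lam" "lam < 1" by (auto simp: dissipative_def)
  then have "sqrt lam \<ge> 0" "sqrt lam < 1" by auto
  then show "\<exists>\<rho>\<ge>0. \<rho> < 1 \<and> (\<forall>K. hankel_section l m (markov A B C) 1 \<rho> K)"
    using dissipative_imp_section[OF A B C D] by blast
next
  assume "\<exists>\<rho>\<ge>0. \<rho> < 1 \<and> (\<forall>K. hankel_section l m (markov A B C) 1 \<rho> K)"
  then show "\<exists>P Q lam. LMI A B C P Q lam"
    using section_imp_dissipative[OF A B C dec] dissipative_imp_LMI[OF A B C] by blast
qed

section \<open>The augmented realization\<close>

text \<open>Comparison of the coefficients at the power \<open>k + 1\<close> of z: the stable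
  functions \<open>f2\<close> and \<open>g2\<close> have none there, and the factor
  \<open>zvar ^ N\<close> lifts the coefficients of \<open>g\<close> of index below \<open>N\<close>
  to positive powers, in reverse order.\<close>

lemma antistable_part_shift:
  assumes rh: "rh f1" "rh f2" "rh g1" "rh g2" "rh g"
    and eq: "rsub f1 + f2 = rsub g1 + g2 - zvar ^ N * g"
  shows "impulse f1 (Suc k) = impulse g1 (Suc k) - (if k < N then impulse g (N - 1 - k) else 0)"
proof -
  define L where "L z = rat_eval (rsub f1) z + rat_eval f2 z" for z
  define M where "M z = rat_eval (rsub g1) z + rat_eval g2 z - z powi int N * rat_eval g z" for z
  have LM: "L z = M z" if z: "cmod z = 1" for z
  proof -
    have z0: "z \<noteq> 0" and iz: "cmod (inverse z) \<ge> 1" using z by (auto simp: norm_inverse)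
    have r: "reg of_real z (rsub f1)" "reg of_real z (rsub g1)" "reg of_real z f2" "reg of_real z g2" "reg of_real z g"
      using rat_eval_rsub(1)[OF z0] rh_reg[OF _ iz] rh_reg[of _ z] rh z by auto
    have zN: "reg of_real z (zvar ^ N)" "rat_eval (zvar ^ N) z = z ^ N"
      using creg_power[OF creg_zvar(1)] by (simp_all add: creg_zvar)
    show ?thesis
      using arg_cong[OF eq, of "\<lambda>f. rat_eval f z"] r zN
      by (simp add: L_def M_def creg_add creg_diff creg_mult)
  qed
  have L1: "laurent (\<lambda>k. (if k \<ge> 0 then of_real (impulse f1 (nat k)) else 0) + (if k \<le> 0 then of_real (impulse f2 (nat (- k))) else 0)) L"
    unfolding L_def[abs_def] by (intro laurent_add laurent_rsub laurent_rh rh)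
  have "laurent (\<lambda>k. (if k \<ge> 0 then of_real (impulse g1 (nat k)) else 0) + (if k \<le> 0 then of_real (impulse g2 (nat (- k))) else 0)
      - (if k - int N \<le> 0 then of_real (impulse g (nat (- (k - int N)))) else 0)) M"
    unfolding M_def[abs_def] by (intro laurent_diff laurent_add laurent_rsub laurent_rh laurent_shift[of "\<lambda>k. if k \<le> 0 then of_real (impulse g (nat (- k))) else 0"] rh)
  then have L2: "laurent (\<lambda>k. (if k \<ge> 0 then of_real (impulse g1 (nat k)) else 0) + (if k \<le> 0 then of_real (impulse g2 (nat (- k))) else 0)
      - (if k - int N \<le> 0 then of_real (impulse g (nat (- (k - int N)))) else 0)) L"
    by (rule laurent_cong) (auto simp: LM)
  have "nat (int (Suc k)) = Suc k" "\<not> int (Suc k) \<le> 0" "int (Suc k) \<ge> 0" by simp_all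
  with fun_cong[OF laurent_unique[OF L1 L2], of "int (Suc k)"]
  have e: "complex_of_real (impulse f1 (Suc k)) = of_real (impulse g1 (Suc k))
      - (if int (Suc k) - int N \<le> 0 then of_real (impulse g (nat (- (int (Suc k) - int N)))) else 0)"
    by (simp only: if_True if_False add_0_right)
  show ?thesis
  proof (cases "k < N")
    case True
    then have "nat (- (int (Suc k) - int N)) = N - 1 - k" "int (Suc k) - int N \<le> 0" by auto
    then have "complex_of_real (impulse f1 (Suc k)) = of_real (impulse g1 (Suc k) - impulse g (N - 1 - k))"
      using e by simp
    then show ?thesis using True by (simp only: of_real_eq_iff) simp
  next
    case False
    then have "complex_of_real (impulse f1 (Suc k)) = of_real (impulse g1 (Suc k))" using e by simp
    then show ?thesis using False by (simp only: of_real_eq_iff) simp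
  qed
qed

lemma Aq_carrier: "Aq N p \<in> carrier_mat (N * p) (N * p)"
  and Bq_carrier: "Bq N p \<in> carrier_mat (N * p) p"
  by (simp_all add: Aq_def Bq_def)

lemma Aq_pow_index:
  assumes "i < N * p" "j < N * p"
  shows "(Aq N p ^\<^sub>m k) $$ (i,j) = (if i = j + k * p then 1 else 0)"
  using assms
proof (induction k arbitrary: i j)
  case 0
  then show ?case using Aq_carrier[of N p] by auto
next
  case (Suc k)
  have "(Aq N p ^\<^sub>m Suc k) $$ (i,j) = (\<Sum>l<N * p. (Aq N p ^\<^sub>m k) $$ (i,l) * Aq N p $$ (l,j))"
    using times_index[of i "Aq N p ^\<^sub>m k" j "Aq N p"] Suc.prems carrier_matD[OF pow_carrier_mat[OF Aq_carrier[of N p], of k]]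
      carrier_matD[OF Aq_carrier[of N p]] by simp
  also have "\<dots> = (\<Sum>l<N * p. if l = j + p then (if i = l + k * p then 1 else 0) else 0)"
  proof (intro sum.cong refl)
    fix l assume "l \<in> {..<N * p}"
    then have l: "l < N * p" by simp
    have "Aq N p $$ (l,j) = (if l = j + p then 1 else 0)" using l Suc.prems by (simp add: Aq_def)
    then show "(Aq N p ^\<^sub>m k) $$ (i,l) * Aq N p $$ (l,j) = (if l = j + p then (if i = l + k * p then 1 else 0) else 0)"
      using Suc.IH[OF Suc.prems(1) l] by simp
  qed
  also have "\<dots> = (if j + p < N * p then (if i = j + p + k * p then 1 else 0) else 0)" by simp
  also have "\<dots> = (if i = j + Suc k * p then 1 else 0)" using Suc.prems by auto
  finally show ?case .
qed

lemma Aq_pow_Bq_index: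
  assumes "i < N * p" "b < p"
  shows "(Aq N p ^\<^sub>m k * Bq N p) $$ (i,b) = (if i = b + k * p then 1 else 0)"
proof -
  have bN: "b < N * p" using assms by (cases N) auto
  have "(Aq N p ^\<^sub>m k * Bq N p) $$ (i,b) = (\<Sum>l<N * p. (Aq N p ^\<^sub>m k) $$ (i,l) * Bq N p $$ (l,b))"
    using times_index[of i "Aq N p ^\<^sub>m k" b "Bq N p"] assms carrier_matD[OF pow_carrier_mat[OF Aq_carrier[of N p], of k]]
      carrier_matD[OF Bq_carrier[of N p]] by simp
  also have "\<dots> = (\<Sum>l<N * p. if l = b then (if i = l + k * p then 1 else 0) else 0)"
    using assms by (intro sum.cong) (auto simp: Aq_pow_index Bq_def)
  also have "\<dots> = (if i = b + k * p then 1 else 0)" using bN by simp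
  finally show ?thesis .
qed

text \<open>The shift register moves the input down one block per step. After \<open>k\<close> steps
  it occupies block \<open>k\<close>, where \<open>Cq\<close> stores the coefficient of index
  \<open>N - 1 - k\<close>; after \<open>N\<close> steps it has left the register.\<close>

lemma Cq_markov:
  assumes G: "G \<in> carrier_mat p m" and ab: "a < m" "b < p"
  shows "(Cq N G * (Aq N p ^\<^sub>m k * Bq N p)) $$ (a,b) = (if k < N then impulse (G $$ (b,a)) (N - 1 - k) else 0)"
proof -
  have d: "dim_row G = p" "dim_col G = m" using G by auto
  have C: "Cq N G \<in> carrier_mat m (N * p)" by (simp add: Cq_def d)
  have AB: "Aq N p ^\<^sub>m k * Bq N p \<in> carrier_mat (N * p) p"
    by (rule mult_carrier_mat[OF pow_carrier_mat[OF Aq_carrier] Bq_carrier])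
  have iff: "b + k * p < N * p \<longleftrightarrow> k < N"
  proof
    assume "b + k * p < N * p"
    then have "k * p < N * p" by linarith
    then show "k < N" by simp
  next
    assume "k < N"
    then have "Suc k * p \<le> N * p" by (intro mult_right_mono) auto
    then show "b + k * p < N * p" using ab by simp
  qed
  have "(Cq N G * (Aq N p ^\<^sub>m k * Bq N p)) $$ (a,b) = (\<Sum>i<N * p. Cq N G $$ (a,i) * (Aq N p ^\<^sub>m k * Bq N p) $$ (i,b))"
    using times_index[of a "Cq N G" b "Aq N p ^\<^sub>m k * Bq N p"] ab carrier_matD[OF C] carrier_matD[OF AB] by (simp only:)
  also have "\<dots> = (\<Sum>i<N * p. if i = b + k * p then Cq N G $$ (a,i) else 0)"
    using ab by (intro sum.cong) (auto simp: Aq_pow_Bq_index simp del: index_mult_mat)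
  also have "\<dots> = (if k < N then Cq N G $$ (a, b + k * p) else 0)" using iff by simp
  also have "\<dots> = (if k < N then impulse (G $$ (b,a)) (N - 1 - k) else 0)"
  proof (cases "k < N")
    case True
    have "(b + k * p) div p = k" "(b + k * p) mod p = b" using ab by auto
    then show ?thesis using True iff ab by (simp add: Cq_def d impulse_mat_def)
  qed simp
  finally show ?thesis .
qed

context
  fixes Ar Br Cr Cc :: "real mat" and r p1 p2 N :: nat
  assumes Ar: "Ar \<in> carrier_mat r r" and Br: "Br \<in> carrier_mat r p2" and Cr: "Cr \<in> carrier_mat p1 r"
    and Cc: "Cc \<in> carrier_mat p1 (N * p2)"
begin

abbreviation (input) "A_aug \<equiv> four_block_mat Ar (0\<^sub>m r (N * p2)) (0\<^sub>m (N * p2) r) (Aq N p2)"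

lemma augmented_carrier:
  "A_aug \<in> carrier_mat (r + N * p2) (r + N * p2)" "Br @\<^sub>r Bq N p2 \<in> carrier_mat (r + N * p2) p2"
  "Cr @\<^sub>c Cc \<in> carrier_mat p1 (r + N * p2)"
proof -
  show "A_aug \<in> carrier_mat (r + N * p2) (r + N * p2)" by (rule four_block_carrier_mat[OF Ar Aq_carrier])
  show "Br @\<^sub>r Bq N p2 \<in> carrier_mat (r + N * p2) p2" by (rule carrier_append_rows[OF Br Bq_carrier])
  show "Cr @\<^sub>c Cc \<in> carrier_mat p1 (r + N * p2)"
    by (rule append_columns_mult_vec(1)[OF Cr Cc zero_carrier_vec zero_carrier_vec])
qed

text \<open>The powers are block diagonal, and the shift is nilpotent: its powers vanish from
  exponent \<open>N\<close> on, so any rate of decay is admissible for it.\<close>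

lemma augmented_exp_decay:
  assumes "exp_decay Ar"
  shows "exp_decay A_aug"
proof -
  obtain c s where c: "c \<ge> 0" "0 < s" "s < 1" "\<And>k i j. i < r \<Longrightarrow> j < r \<Longrightarrow> \<bar>(Ar ^\<^sub>m k) $$ (i,j)\<bar> \<le> c * s ^ k"
    using assms Ar unfolding exp_decay_def by auto
  \<comment> \<open>The second alternative absorbs the entries 1 in the powers of the shift, because
    \<open>1 \<le> (1/s) ^ N * s ^ k\<close> for \<open>k < N\<close>.\<close>
  define c' where "c' = max c ((1/s) ^ N)"
  have c': "c' \<ge> c" "c' \<ge> (1/s) ^ N" "c' \<ge> 0" using c by (auto simp: c'_def)
  have "\<bar>(A_aug ^\<^sub>m k) $$ (i,j)\<bar> \<le> c' * s ^ k" if ij: "i < r + N * p2" "j < r + N * p2" for k i j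
  proof -
    have Ark: "Ar ^\<^sub>m k \<in> carrier_mat r r" by (rule pow_carrier_mat[OF Ar])
    have Aqk: "Aq N p2 ^\<^sub>m k \<in> carrier_mat (N * p2) (N * p2)" by (rule pow_carrier_mat[OF Aq_carrier])
    have e: "(A_aug ^\<^sub>m k) $$ (i,j) = (if i < r then if j < r then (Ar ^\<^sub>m k) $$ (i,j) else 0
        else if j < r then 0 else (Aq N p2 ^\<^sub>m k) $$ (i - r, j - r))"
      unfolding pow_four_block_mat[OF Ar Aq_carrier] using ij carrier_matD[OF Ark] carrier_matD[OF Aqk]
      by (subst index_mat_four_block(1)) auto
    have pos: "c' * s ^ k \<ge> 0" using c' c by simp
    show ?thesis
    proof (cases "i < r \<and> j < r")
      case True
      have "c * s ^ k \<le> c' * s ^ k" using c c' by (intro mult_right_mono) auto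
      then show ?thesis using c(4)[of i j k] True e by auto
    next
      case False
      have q: "\<bar>(Aq N p2 ^\<^sub>m k) $$ (i - r, j - r)\<bar> \<le> c' * s ^ k" if "i \<ge> r" "j \<ge> r"
      proof (cases "k < N")
        case True
        have "1 \<le> (1/s) ^ N * s ^ k"
        proof -
          have "(1/s) ^ k * s ^ k \<le> (1/s) ^ N * s ^ k"
            using True c by (intro mult_right_mono power_increasing) auto
          moreover have "(1/s) ^ k * s ^ k = 1" using c by (simp add: power_one_over)
          ultimately show ?thesis by simp
        qed
        also have "\<dots> \<le> c' * s ^ k" using c c' by (intro mult_right_mono) auto
        finally have "1 \<le> c' * s ^ k" .
        then show ?thesis using ij that by (auto simp: Aq_pow_index)
      next
        case False
        then have "N * p2 \<le> k * p2" by (intro mult_right_mono) auto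
        then have "i - r \<noteq> (j - r) + k * p2" using ij that by linarith
        then show ?thesis using ij that pos by (auto simp: Aq_pow_index)
      qed
      show ?thesis using False e pos q by auto
    qed
  qed
  then show ?thesis unfolding exp_decay_def using c' c carrier_matD(1)[OF augmented_carrier(1)] by metis
qed

lemma augmented_markov:
  assumes ab: "a < p1" "b < p2"
  shows "((Cr @\<^sub>c Cc) * A_aug ^\<^sub>m k * (Br @\<^sub>r Bq N p2)) $$ (a,b)
    = (Cr * Ar ^\<^sub>m k * Br) $$ (a,b) + (Cc * (Aq N p2 ^\<^sub>m k * Bq N p2)) $$ (a,b)"
proof -
  have Ark: "Ar ^\<^sub>m k \<in> carrier_mat r r" by (rule pow_carrier_mat[OF Ar])
  have Aqk: "Aq N p2 ^\<^sub>m k \<in> carrier_mat (N * p2) (N * p2)" by (rule pow_carrier_mat[OF Aq_carrier])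
  have AB: "Ar ^\<^sub>m k * Br \<in> carrier_mat r p2" "Aq N p2 ^\<^sub>m k * Bq N p2 \<in> carrier_mat (N * p2) p2"
    by (rule mult_carrier_mat[OF Ark Br], rule mult_carrier_mat[OF Aqk Bq_carrier])
  have v: "(A_aug ^\<^sub>m k * (Br @\<^sub>r Bq N p2)) = (Ar ^\<^sub>m k * Br) @\<^sub>r (Aq N p2 ^\<^sub>m k * Bq N p2)"
  proof -
    have d: "dim_row Br = r" "dim_col Br = p2" "dim_row (Bq N p2) = N * p2" "dim_col (Bq N p2) = p2"
      "dim_row (Ar ^\<^sub>m k * Br) = r" "dim_col (Ar ^\<^sub>m k * Br) = p2"
      "dim_row (Aq N p2 ^\<^sub>m k * Bq N p2) = N * p2"
      using carrier_matD[OF Br] carrier_matD[OF Bq_carrier[of N p2]] carrier_matD[OF AB(1)] carrier_matD[OF AB(2)] by auto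
    have z: "Ar ^\<^sub>m k * Br + 0\<^sub>m r (N * p2) * Bq N p2 = Ar ^\<^sub>m k * Br"
      "0\<^sub>m (N * p2) r * Br + Aq N p2 ^\<^sub>m k * Bq N p2 = Aq N p2 ^\<^sub>m k * Bq N p2"
      using AB Br Bq_carrier[of N p2] by (simp_all add: left_mult_zero_mat[OF Br] left_mult_zero_mat[OF Bq_carrier])
    have z0: "Ar ^\<^sub>m k * 0\<^sub>m r 0 + 0\<^sub>m r (N * p2) * 0\<^sub>m (N * p2) 0 = 0\<^sub>m r 0"
      "0\<^sub>m (N * p2) r * 0\<^sub>m r 0 + Aq N p2 ^\<^sub>m k * 0\<^sub>m (N * p2) 0 = 0\<^sub>m (N * p2) 0"
      by (intro eq_matI; use carrier_matD[OF Ark] carrier_matD[OF Aqk] in simp)+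
    show ?thesis
      unfolding append_rows_def d pow_four_block_mat[OF Ar Aq_carrier]
      using mult_four_block_mat[OF Ark zero_carrier_mat zero_carrier_mat Aqk Br zero_carrier_mat Bq_carrier zero_carrier_mat, of 0]
      unfolding z z0 by simp
  qed
  have Ap: "A_aug ^\<^sub>m k \<in> carrier_mat (r + N * p2) (r + N * p2)" by (rule pow_carrier_mat[OF augmented_carrier(1)])
  have "(Cr @\<^sub>c Cc) * A_aug ^\<^sub>m k * (Br @\<^sub>r Bq N p2) = (Cr @\<^sub>c Cc) * (A_aug ^\<^sub>m k * (Br @\<^sub>r Bq N p2))"
    by (rule assoc_mult_mat[OF augmented_carrier(3) Ap augmented_carrier(2)])
  also have "\<dots> = (Cr @\<^sub>c Cc) * ((Ar ^\<^sub>m k * Br) @\<^sub>r (Aq N p2 ^\<^sub>m k * Bq N p2))" unfolding v ..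
  finally have e: "(Cr @\<^sub>c Cc) * A_aug ^\<^sub>m k * (Br @\<^sub>r Bq N p2) = \<dots>" .
  let ?X = "(Ar ^\<^sub>m k * Br) @\<^sub>r (Aq N p2 ^\<^sub>m k * Bq N p2)"
  have X: "?X \<in> carrier_mat (r + N * p2) p2" by (rule carrier_append_rows[OF AB])
  have Ci: "(Cr @\<^sub>c Cc) $$ (a,j) = (if j < r then Cr $$ (a,j) else Cc $$ (a, j - r))" if "j < r + N * p2" for j
    using that ab Cr Cc by (simp add: append_columns_def)
  have Xi: "?X $$ (j,b) = (if j < r then (Ar ^\<^sub>m k * Br) $$ (j,b) else (Aq N p2 ^\<^sub>m k * Bq N p2) $$ (j - r, b))" if "j < r + N * p2" for j
  proof -
    have "?X $$ (j,b) = (if j < dim_row (Ar ^\<^sub>m k * Br) then if b < dim_col (Ar ^\<^sub>m k * Br) then (Ar ^\<^sub>m k * Br) $$ (j,b) else 0\<^sub>m (dim_row (Ar ^\<^sub>m k * Br)) 0 $$ (j, b - dim_col (Ar ^\<^sub>m k * Br))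
        else if b < dim_col (Ar ^\<^sub>m k * Br) then (Aq N p2 ^\<^sub>m k * Bq N p2) $$ (j - dim_row (Ar ^\<^sub>m k * Br), b) else 0\<^sub>m (dim_row (Aq N p2 ^\<^sub>m k * Bq N p2)) 0 $$ (j - dim_row (Ar ^\<^sub>m k * Br), b - dim_col (Ar ^\<^sub>m k * Br)))"
      unfolding append_rows_def by (rule index_mat_four_block(1))
        (use that ab carrier_matD[OF AB(1)] carrier_matD[OF AB(2)] in auto)
    then show ?thesis using ab unfolding carrier_matD[OF AB(1)] by simp
  qed
  have "((Cr @\<^sub>c Cc) * ?X) $$ (a,b) = (\<Sum>j<r + N * p2. (Cr @\<^sub>c Cc) $$ (a,j) * ?X $$ (j,b))"
    using times_index[of a "Cr @\<^sub>c Cc" b ?X] ab carrier_matD[OF augmented_carrier(3)] carrier_matD[OF X] by (simp only:)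
  also have "\<dots> = (\<Sum>j<r. Cr $$ (a,j) * (Ar ^\<^sub>m k * Br) $$ (j,b)) + (\<Sum>j<N * p2. Cc $$ (a,j) * (Aq N p2 ^\<^sub>m k * Bq N p2) $$ (j,b))"
  proof -
    have split: "(\<Sum>j<r + M. f j) = (\<Sum>j<r. f j) + (\<Sum>j<M. f (r + j))" for f :: "nat \<Rightarrow> real" and M
      by (induction M) (auto simp: add.assoc)
    show ?thesis unfolding split by (intro arg_cong2[of _ _ _ _ "(+)"] sum.cong refl) (simp_all only: Ci Xi lessThan_iff, auto)
  qed
  also have "(\<Sum>j<r. Cr $$ (a,j) * (Ar ^\<^sub>m k * Br) $$ (j,b)) = (Cr * (Ar ^\<^sub>m k * Br)) $$ (a,b)"
    using times_index[of a Cr b "Ar ^\<^sub>m k * Br"] ab carrier_matD[OF Cr] carrier_matD[OF AB(1)] by (simp only:)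
  also have "Cr * (Ar ^\<^sub>m k * Br) = Cr * Ar ^\<^sub>m k * Br" by (rule assoc_mult_mat[OF Cr Ark Br, symmetric])
  also have "(\<Sum>j<N * p2. Cc $$ (a,j) * (Aq N p2 ^\<^sub>m k * Bq N p2) $$ (j,b)) = (Cc * (Aq N p2 ^\<^sub>m k * Bq N p2)) $$ (a,b)"
    using times_index[of a Cc b "Aq N p2 ^\<^sub>m k * Bq N p2"] ab carrier_matD[OF Cc] carrier_matD[OF AB(2)] by (simp only:)
  finally show ?thesis unfolding e .
qed

end

section \<open>Reduction to a Nehari problem\<close>

lemma para_conj_add:
  assumes "dim_row A = dim_row B" "dim_col A = dim_col B"
  shows "para_conj (A + B) = para_conj A + para_conj B"
  using assms by (intro eq_matI) (auto simp: rsub_simps)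

lemma mat_diff_add:
  fixes A B C :: "'a :: ab_group_add mat"
  assumes "A \<in> carrier_mat m p" "B \<in> carrier_mat m p" "C \<in> carrier_mat m p"
  shows "A - B - C = A - (B + C)"
  using assms by (intro eq_matI) auto

lemma smult_mat_diff_add:
  fixes A B C :: "'a :: comm_ring_1 mat"
  assumes "A \<in> carrier_mat m p" "B \<in> carrier_mat m p" "C \<in> carrier_mat m p"
  shows "c \<cdot>\<^sub>m A - c \<cdot>\<^sub>m B - c \<cdot>\<^sub>m C = c \<cdot>\<^sub>m (A - (B + C))"
  using assms by (intro eq_matI) (auto simp: algebra_simps)

lemma RH_inf_inverse_zvar_smult: "F \<in> RH_inf m p \<Longrightarrow> inverse zvar ^ N \<cdot>\<^sub>m F \<in> RH_inf m p"
  unfolding RH_inf_iff by (auto intro!: rh_mult rh_power rh_inverse_zvar)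

lemma mat_add_diff_assoc:
  fixes A B C :: "'a :: ab_group_add mat"
  assumes "A \<in> carrier_mat m p" "B \<in> carrier_mat m p" "C \<in> carrier_mat m p"
  shows "A + B - C = A + (B - C)"
  using assms by (intro eq_matI) auto

lemma smult_mat_mult_vec:
  fixes A :: "'a :: comm_ring_1 mat"
  assumes "A \<in> carrier_mat m p" "u \<in> carrier_vec p"
  shows "(c \<cdot>\<^sub>m A) *\<^sub>v u = c \<cdot>\<^sub>v (A *\<^sub>v u)"
  using assms by (intro eq_vecI) (auto simp: scalar_prod_def sum_distrib_left mult.assoc intro!: sum.cong)

lemma para_conj_zero: "para_conj (0\<^sub>m m p) = 0\<^sub>m p m"
  by (intro eq_matI) (auto simp: rsub_simps)

lemma mat_diff_split:
  fixes A B C :: "'a :: ab_group_add mat"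
  assumes "A \<in> carrier_mat m p" "B \<in> carrier_mat m p" "C \<in> carrier_mat m p"
  shows "A - C = B - C + (A - B)"
  using assms by (intro eq_matI) auto

lemma cip_add: "dim_vec y = dim_vec z \<Longrightarrow> cip x (y + z) = cip x y + cip x z"
  by (simp add: cip_def algebra_simps sum.distrib)

lemma gram_sum_sq_norm:
  assumes A: "A \<in> carrier_mat l p" and B: "B \<in> carrier_mat m p" and C: "C \<in> carrier_mat k p"
    and r: "regm z A" "regm z B" "regm z C" and z: "cmod z = 1" and u: "u \<in> carrier_vec p"
    and eq: "para_conj A * A = para_conj B * B + para_conj C * C"
  shows "sq_norm (ev z A *\<^sub>v u) = sq_norm (ev z B *\<^sub>v u) + sq_norm (ev z C *\<^sub>v u)"
proof -
  have g: "ev z (para_conj X * X) = mat_adjoint (ev z X) * ev z X" "regm z (para_conj X * X)"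
    "ev z (para_conj X * X) \<in> carrier_mat p p"
    "cip u (ev z (para_conj X * X) *\<^sub>v u) = of_real (sq_norm (ev z X *\<^sub>v u))"
    if X: "X \<in> carrier_mat j p" "regm z X" for X j
  proof -
    note pc = ev_para_conj[OF X(2) z]
    show e: "ev z (para_conj X * X) = mat_adjoint (ev z X) * ev z X" and "regm z (para_conj X * X)"
      using ev_mult[OF pc(1) X(2)] X(1) pc(2) by simp_all
    show "ev z (para_conj X * X) \<in> carrier_mat p p"
      by (rule ev_carrier[OF mult_carrier_mat[OF para_conj_carrier[OF X(1)] X(1)]])
    show "cip u (ev z (para_conj X * X) *\<^sub>v u) = of_real (sq_norm (ev z X *\<^sub>v u))"
      unfolding e cip_gram[OF ev_carrier[OF X(1)] u u] by (rule cip_self)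
  qed
  have d: "dim_row (para_conj B * B) = dim_row (para_conj C * C)" "dim_col (para_conj B * B) = dim_col (para_conj C * C)"
    using B C by auto
  have "ev z (para_conj A * A) = ev z (para_conj B * B) + ev z (para_conj C * C)"
    unfolding eq by (rule ev_add(2)[OF g(2)[OF B r(2)] g(2)[OF C r(3)] d])
  then have "ev z (para_conj A * A) *\<^sub>v u = ev z (para_conj B * B) *\<^sub>v u + ev z (para_conj C * C) *\<^sub>v u"
    using add_mult_distrib_mat_vec[OF g(3)[OF B r(2)] g(3)[OF C r(3)] u] by simp
  then have "cip u (ev z (para_conj A * A) *\<^sub>v u)
      = cip u (ev z (para_conj B * B) *\<^sub>v u) + cip u (ev z (para_conj C * C) *\<^sub>v u)"
    using cip_add[of "ev z (para_conj B * B) *\<^sub>v u" "ev z (para_conj C * C) *\<^sub>v u" u]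
      carrier_matD(1)[OF g(3)[OF B r(2)]] carrier_matD(1)[OF g(3)[OF C r(3)]] by simp
  then have "complex_of_real (sq_norm (ev z A *\<^sub>v u)) = of_real (sq_norm (ev z B *\<^sub>v u) + sq_norm (ev z C *\<^sub>v u))"
    unfolding g(4)[OF A r(1)] g(4)[OF B r(2)] g(4)[OF C r(3)] by simp
  then show ?thesis by (simp only: of_real_eq_iff)
qed

text \<open>\<open>M\<close> equals \<open>Ui * K + Y\<close>, where \<open>Ui\<close> is isometric
  and \<open>para_conj Ui * Y\<close> vanishes, since \<open>Y\<close> is what remains of
  \<open>T1\<close> after projection onto the range of \<open>Ui\<close>. The mixed terms therefore
  drop out, already as rational matrices.\<close>

lemma pythagoras:
  assumes Ui: "Ui \<in> carrier_mat q p2" and Uo: "Uo \<in> carrier_mat p2 p2"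
    and T1: "T1 \<in> carrier_mat q p1" and X: "X \<in> carrier_mat p2 p1"
    and iso: "para_conj Ui * Ui = 1\<^sub>m p2"
  defines "M \<equiv> T1 - Ui * Uo * X" and "K \<equiv> para_conj Ui * T1 - Uo * X"
    and "Y \<equiv> (1\<^sub>m q - Ui * para_conj Ui) * T1"
  shows "para_conj M * M = para_conj K * K + para_conj Y * Y"
proof -
  let ?V = "para_conj Ui"
  note V = para_conj_carrier[OF Ui]
  note VT = mult_carrier_mat[OF V T1] and UX = mult_carrier_mat[OF Uo X]
  have K: "K \<in> carrier_mat p2 p1" unfolding K_def using UX by (rule minus_carrier_mat)
  have UV: "Ui * ?V \<in> carrier_mat q q" by (rule mult_carrier_mat[OF Ui V])
  have Yd: "Y = T1 - Ui * (?V * T1)"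
    unfolding Y_def minus_mult_distrib_mat[OF one_carrier_mat UV T1] left_mult_one_mat[OF T1]
      assoc_mult_mat[OF Ui V T1] ..
  have UVT: "Ui * (?V * T1) \<in> carrier_mat q p1" by (rule mult_carrier_mat[OF Ui VT])
  have Y: "Y \<in> carrier_mat q p1" unfolding Yd using UVT by (rule minus_carrier_mat)
  have UUX: "Ui * (Uo * X) \<in> carrier_mat q p1" by (rule mult_carrier_mat[OF Ui UX])
  have Md: "M = T1 - Ui * (Uo * X)" unfolding M_def assoc_mult_mat[OF Ui Uo X] ..
  have UK: "Ui * K = Ui * (?V * T1) - Ui * (Uo * X)"
    unfolding K_def by (rule mult_minus_distrib_mat[OF Ui VT UX])
  have UKc: "Ui * K \<in> carrier_mat q p1" by (rule mult_carrier_mat[OF Ui K])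
  have M: "M = Ui * K + Y"
    unfolding Md UK Yd by (rule mat_diff_split[OF T1 UVT UUX])
  have VU: "?V * (Ui * Z) = Z" if "Z \<in> carrier_mat p2 p1" for Z
    using assoc_mult_mat[OF V Ui that] iso left_mult_one_mat[OF that] by simp
  have VY: "?V * Y = 0\<^sub>m p2 p1"
    unfolding Yd mult_minus_distrib_mat[OF V T1 UVT] VU[OF VT] by (rule minus_r_inv_mat[OF VT])
  have VM: "?V * M = K"
    unfolding M mult_add_distrib_mat[OF V UKc Y] VU[OF K] VY using K by simp
  have "para_conj (?V * Y) = para_conj Y * Ui"
    using para_conj_mult[of ?V Y] V Y Ui by (simp add: para_conj_para_conj)
  then have YU: "para_conj Y * Ui = 0\<^sub>m p1 p2"
    unfolding VY using para_conj_zero[of p2 p1] by simp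
  note Yc = para_conj_carrier[OF Y] and Kc = para_conj_carrier[OF K]
  have "para_conj M = para_conj K * ?V + para_conj Y"
    unfolding M using para_conj_add[of "Ui * K" Y] para_conj_mult[of Ui K] Ui K Y by simp
  then have "para_conj M * M = para_conj K * ?V * M + para_conj Y * M"
    using add_mult_distrib_mat[OF mult_carrier_mat[OF Kc V] Yc, of M p1] UKc Y M by simp
  also have "para_conj K * ?V * M = para_conj K * K"
    using assoc_mult_mat[OF Kc V, of M p1] VM UKc Y M by simp
  also have "para_conj Y * M = para_conj Y * Y"
  proof -
    have "para_conj Y * M = para_conj Y * Ui * K + para_conj Y * Y"
      unfolding M mult_add_distrib_mat[OF Yc UKc Y] assoc_mult_mat[OF Yc Ui K] ..
    then show ?thesis using left_mult_zero_mat[OF K, of p1] mult_carrier_mat[OF Yc Y] unfolding YU by simp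
  qed
  finally show ?thesis .
qed

lemma sq_norm_smult: "sq_norm (c \<cdot>\<^sub>v v) = (cmod c)\<^sup>2 * sq_norm v"
  by (simp add: sq_norm_def norm_mult power_mult_distrib sum_distrib_left)

lemma ev_zvar_pow_smult:
  assumes "regm z F"
  shows "regm z (zvar ^ N \<cdot>\<^sub>m F)" "ev z (zvar ^ N \<cdot>\<^sub>m F) = z ^ N \<cdot>\<^sub>m ev z F"
proof -
  have zN: "reg of_real z (zvar ^ N)" "rat_eval (zvar ^ N) z = z ^ N"
    using creg_power[OF creg_zvar(1)] by (simp_all add: creg_zvar)
  show "regm z (zvar ^ N \<cdot>\<^sub>m F)" "ev z (zvar ^ N \<cdot>\<^sub>m F) = z ^ N \<cdot>\<^sub>m ev z F"
    using ev_smult[OF zN(1) assms] zN(2) by simp_all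
qed

section \<open>From the model error to a Nehari problem\<close>

context
  fixes q p1 p2 N :: nat and \<gamma> :: real and T1 T2 Ui Uo Y Yo R :: tf
  assumes p1: "p1 \<ge> 1"
    and T1: "T1 \<in> carrier_mat q p1" "\<And>z. cmod z = 1 \<Longrightarrow> regm z T1"
    and T2: "T2 = Ui * Uo"
    and Ui: "Ui \<in> RH_inf q p2" "para_conj Ui * Ui = 1\<^sub>m p2"
    and Uo: "Uo \<in> RH_inf_units p2"
    and Y: "Y = (1\<^sub>m q - Ui * para_conj Ui) * T1"
    and \<gamma>: "\<gamma> > Linf_norm Y"
    and Yo: "Yo \<in> RH_inf_units p1"
      "para_conj Yo * Yo = const (\<gamma>\<^sup>2) \<cdot>\<^sub>m 1\<^sub>m p1 - para_conj Y * Y"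
    and R: "R = para_conj Ui * T1 * minv Yo"
begin

abbreviation (input) "model_error V D \<equiv> T1 - T2 * V - inverse zvar ^ N \<cdot>\<^sub>m (T2 * D)"
text \<open>What is left of the model error once \<open>Ui\<close> is stripped, the delay by
  \<open>N\<close> is undone and the metric is changed by \<open>Yo\<close>: the matrix
  \<open>Rhat V\<close> minus a stable term that \<open>D\<close> makes arbitrary.\<close>

abbreviation (input) "reduced_error V D \<equiv> zvar ^ N \<cdot>\<^sub>m R - Uo * (zvar ^ N \<cdot>\<^sub>m V) * minv Yo - Uo * D * minv Yo"

lemmas Ui_car = RH_inf_carrier[OF Ui(1)]
lemmas Uo_units = RH_inf_units[OF Uo]
lemmas Yo_units = RH_inf_units[OF Yo(1)]

lemma regm_Ui: "cmod z = 1 \<Longrightarrow> regm z Ui" and regm_Uo: "cmod z = 1 \<Longrightarrow> regm z Uo"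
  and regm_Yo: "cmod z = 1 \<Longrightarrow> regm z Yo" and regm_minv_Yo: "cmod z = 1 \<Longrightarrow> regm z (minv Yo)"
  using RH_inf_regm[OF Ui(1)] RH_inf_regm[OF Uo_units(1)] RH_inf_regm[OF Yo_units(1)] RH_inf_regm[OF Yo_units(2)]
  by simp_all

lemma Y_carrier: "Y \<in> carrier_mat q p1" and regm_Y: "cmod z = 1 \<Longrightarrow> regm z Y"
proof -
  have c: "1\<^sub>m q - Ui * para_conj Ui \<in> carrier_mat q q"
    by (rule minus_carrier_mat[OF mult_carrier_mat[OF Ui_car para_conj_carrier[OF Ui_car]]])
  show "Y \<in> carrier_mat q p1" unfolding Y by (rule mult_carrier_mat[OF c T1(1)])
  assume z: "cmod z = 1"
  have "regm z (Ui * para_conj Ui)"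
    using ev_mult(1)[OF regm_Ui[OF z] ev_para_conj(1)[OF regm_Ui[OF z] z]] by simp
  then have "regm z (1\<^sub>m q - Ui * para_conj Ui)"
    using Ui_car by (intro ev_diff(1) ev_one(1)) auto
  then show "regm z Y"
    unfolding Y using ev_mult(1)[OF _ T1(2)[OF z]] carrier_matD[OF c] carrier_matD[OF T1(1)] by simp
qed

lemma \<gamma>_pos: "\<gamma> > 0"
  using \<gamma> Linf_norm_ge(1)[OF Y_carrier p1 regm_Y] by linarith

text \<open>By Pythagoras the squared length is that of \<open>K\<close> plus that of
  \<open>Y\<close>. The spectral factor expresses the \<open>Y\<close> part through \<gamma> and
  \<open>Yo\<close>, and \<open>reduced_error V D * Yo\<close> is \<open>zvar ^ N\<close> times
  \<open>K\<close>, with a scalar factor of modulus 1 on the circle. Since this is an identity, it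
  serves both directions of the reduction.\<close>

lemma model_error_sq_norm:
  assumes V: "V \<in> RH_inf p2 p1" and D: "D \<in> RH_inf p2 p1" and z: "cmod z = 1" and u: "u \<in> carrier_vec p1"
  shows "sq_norm (ev z (model_error V D) *\<^sub>v u)
    = sq_norm (ev z (reduced_error V D) *\<^sub>v (ev z Yo *\<^sub>v u)) + \<gamma>\<^sup>2 * sq_norm u - sq_norm (ev z Yo *\<^sub>v u)"
proof -
  note Vc = RH_inf_carrier[OF V] and Dc = RH_inf_carrier[OF D]
  note UoC = Uo_units(5) and YoC = Yo_units(5) and iYoC = Yo_units(6)
  let ?c = "inverse zvar ^ N :: real poly fract"
  define X where "X = V + ?c \<cdot>\<^sub>m D"
  have cD: "?c \<cdot>\<^sub>m D \<in> carrier_mat p2 p1" using Dc by simp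
  have Xc: "X \<in> carrier_mat p2 p1" unfolding X_def using cD by simp
  have T2c: "T2 \<in> carrier_mat q p2" unfolding T2 by (rule mult_carrier_mat[OF Ui_car UoC])
  define K where "K = para_conj Ui * T1 - Uo * X"
  have Kc: "K \<in> carrier_mat p2 p1" unfolding K_def by (rule minus_carrier_mat[OF mult_carrier_mat[OF UoC Xc]])
  have z0: "z \<noteq> 0" and z1: "cmod z \<ge> 1" using z by auto
  have M: "model_error V D = T1 - Ui * Uo * X"
  proof -
    have "T2 * X = T2 * V + ?c \<cdot>\<^sub>m (T2 * D)"
      unfolding X_def mult_add_distrib_mat[OF T2c Vc cD] mult_smult_distrib[OF T2c Dc] ..
    then show ?thesis
      using mat_diff_add[OF T1(1) mult_carrier_mat[OF T2c Vc], of "?c \<cdot>\<^sub>m (T2 * D)"] mult_carrier_mat[OF T2c Dc]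
      unfolding T2[symmetric] by simp
  qed
  have rX: "regm z X"
  proof -
    have "?c \<cdot>\<^sub>m D \<in> RH_inf p2 p1" by (rule RH_inf_inverse_zvar_smult[OF D])
    then show ?thesis unfolding X_def by (intro RH_inf_regm[OF RH_inf_add[OF V] z1])
  qed
  have rK: "regm z K"
  proof -
    have "regm z (para_conj Ui * T1)" "regm z (Uo * X)"
      using ev_mult(1)[OF ev_para_conj(1)[OF regm_Ui[OF z] z] T1(2)[OF z]] ev_mult(1)[OF regm_Uo[OF z] rX]
        carrier_matD[OF Ui_car] carrier_matD[OF T1(1)] carrier_matD[OF UoC] carrier_matD[OF Xc] by simp_all
    then show ?thesis unfolding K_def
      using ev_diff(1) carrier_matD[OF Ui_car] carrier_matD[OF T1(1)] carrier_matD[OF UoC] carrier_matD[OF Xc] by simp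
  qed
  have Mc: "model_error V D \<in> carrier_mat q p1"
    unfolding M by (rule minus_carrier_mat[OF mult_carrier_mat[OF mult_carrier_mat[OF Ui_car UoC] Xc]])
  have rM: "regm z (model_error V D)"
  proof -
    have "regm z (Ui * Uo)" using ev_mult(1)[OF regm_Ui[OF z] regm_Uo[OF z]] Ui_car UoC by simp
    then have "regm z (Ui * Uo * X)" using ev_mult(1)[OF _ rX] UoC Xc by simp
    then show ?thesis unfolding M using ev_diff(1)[OF T1(2)[OF z]] T1(1) Ui_car Xc by simp
  qed
  have pyth: "para_conj (model_error V D) * model_error V D = para_conj K * K + para_conj Y * Y"
    unfolding M K_def Y by (rule pythagoras[OF Ui_car UoC T1(1) Xc Ui(2)])
  have E: "reduced_error V D * Yo = zvar ^ N \<cdot>\<^sub>m K"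
  proof -
    let ?Z = "zvar ^ N :: real poly fract"
    note VT = mult_carrier_mat[OF para_conj_carrier[OF Ui_car] T1(1)]
    note UV = mult_carrier_mat[OF UoC Vc] and UD = mult_carrier_mat[OF UoC Dc]
    note cc = mult_carrier_mat[OF _ iYoC] 
    have r: "F * minv Yo * Yo = F" if "F \<in> carrier_mat p2 p1" for F
      using assoc_mult_mat[OF that iYoC YoC] Yo_units(4) right_mult_one_mat[OF that] by simp
    have s: "?Z \<cdot>\<^sub>m F \<in> carrier_mat p2 p1" if "F \<in> carrier_mat p2 p1" for F using that by simp
    have Rc: "R \<in> carrier_mat p2 p1" unfolding R by (rule cc[OF VT])
    have e2: "Uo * (?Z \<cdot>\<^sub>m V) = ?Z \<cdot>\<^sub>m (Uo * V)" by (rule mult_smult_distrib[OF UoC Vc])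
    have "reduced_error V D * Yo = ?Z \<cdot>\<^sub>m R * Yo - Uo * (?Z \<cdot>\<^sub>m V) * minv Yo * Yo - Uo * D * minv Yo * Yo"
      unfolding e2 using minus_mult_distrib_mat[OF minus_carrier_mat[OF cc[OF s[OF UV]]] cc[OF UD] YoC, of "?Z \<cdot>\<^sub>m R"]
        minus_mult_distrib_mat[OF s[OF Rc] cc[OF s[OF UV]] YoC] by simp
    also have "?Z \<cdot>\<^sub>m R * Yo = ?Z \<cdot>\<^sub>m (para_conj Ui * T1)"
      using mult_smult_assoc_mat[OF Rc YoC, of ?Z] r[OF VT] R by simp
    also have "Uo * (?Z \<cdot>\<^sub>m V) * minv Yo * Yo = ?Z \<cdot>\<^sub>m (Uo * V)" unfolding e2 by (rule r[OF s[OF UV]])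
    also have "Uo * D * minv Yo * Yo = ?Z \<cdot>\<^sub>m (?c \<cdot>\<^sub>m (Uo * D))"
      unfolding r[OF UD] using UD zvar_nz by (intro eq_matI) (auto simp del: index_mult_mat(1) simp: power_inverse)
    also have "?Z \<cdot>\<^sub>m (para_conj Ui * T1) - ?Z \<cdot>\<^sub>m (Uo * V) - ?Z \<cdot>\<^sub>m (?c \<cdot>\<^sub>m (Uo * D)) = ?Z \<cdot>\<^sub>m K"
    proof -
      have "Uo * X = Uo * V + ?c \<cdot>\<^sub>m (Uo * D)"
        unfolding X_def mult_add_distrib_mat[OF UoC Vc cD] mult_smult_distrib[OF UoC Dc] ..
      then show ?thesis unfolding K_def using smult_mat_diff_add[OF VT UV, of "?c \<cdot>\<^sub>m (Uo * D)" ?Z] UD by simp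
    qed
    finally show ?thesis .
  qed
  have Ec: "reduced_error V D \<in> carrier_mat p2 p1"
    by (rule minus_carrier_mat[OF mult_carrier_mat[OF mult_carrier_mat[OF UoC Dc] iYoC]])
  have rE: "regm z (reduced_error V D)"
  proof -
    have i: "reduced_error V D = (zvar ^ N \<cdot>\<^sub>m K) * minv Yo"
      unfolding E[symmetric] using assoc_mult_mat[OF Ec YoC iYoC] Yo_units(3) right_mult_one_mat[OF Ec] by simp
    show ?thesis unfolding i
      using ev_mult(1)[OF ev_zvar_pow_smult(1)[OF rK, of N] regm_minv_Yo[OF z]] carrier_matD[OF Kc] carrier_matD[OF iYoC] by simp
  qed
  have uc: "ev z Yo *\<^sub>v u \<in> carrier_vec p1" by (rule mult_mat_vec_carrier[OF ev_carrier[OF YoC] u])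
  have "ev z (reduced_error V D) *\<^sub>v (ev z Yo *\<^sub>v u) = ev z (reduced_error V D * Yo) *\<^sub>v u"
    using ev_mult(2)[OF rE regm_Yo[OF z]] carrier_matD[OF Ec] carrier_matD[OF YoC]
      assoc_mult_mat_vec[OF ev_carrier[OF Ec] ev_carrier[OF YoC] u] by simp
  also have "\<dots> = z ^ N \<cdot>\<^sub>v (ev z K *\<^sub>v u)"
    unfolding E ev_zvar_pow_smult(2)[OF rK] by (rule smult_mat_mult_vec[OF ev_carrier[OF Kc] u])
  finally have nE: "sq_norm (ev z (reduced_error V D) *\<^sub>v (ev z Yo *\<^sub>v u)) = sq_norm (ev z K *\<^sub>v u)"
    using z by (simp add: sq_norm_smult norm_power)
  have nM: "sq_norm (ev z (model_error V D) *\<^sub>v u) = sq_norm (ev z K *\<^sub>v u) + sq_norm (ev z Y *\<^sub>v u)"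
    by (rule gram_sum_sq_norm[OF Mc Kc Y_carrier rM rK regm_Y[OF z] z u pyth])
  \<comment> \<open>Writing \<gamma> as a scalar matrix turns the spectral factorisation into a sum
    of two Gram matrices, to which \<open>gram_sum_sq_norm\<close> applies.\<close>
  define I where "I = const \<gamma> \<cdot>\<^sub>m 1\<^sub>m p1"
  have Ic: "I \<in> carrier_mat p1 p1" by (simp add: I_def)
  have eI: "regm z I" "ev z I = of_real \<gamma> \<cdot>\<^sub>m 1\<^sub>m p1"
    unfolding I_def using ev_smult[OF creg_const(1) ev_one(1)] by (simp_all add: creg_const ev_one)
  have "para_conj I * I = const (\<gamma>\<^sup>2) \<cdot>\<^sub>m 1\<^sub>m p1"
  proof -
    have "para_conj I = I" unfolding I_def by (simp add: para_conj_smult para_conj_one rsub_simps)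
    then show ?thesis unfolding I_def
      by (simp add: mult_smult_assoc_mat[OF one_carrier_mat smult_carrier_mat[OF one_carrier_mat]]
          left_mult_one_mat[OF smult_carrier_mat[OF one_carrier_mat]] const_simps power2_eq_square)
        (intro eq_matI; simp)
  qed
  also have "\<dots> = para_conj Yo * Yo + para_conj Y * Y"
    unfolding Yo(2) using mult_carrier_mat[OF para_conj_carrier[OF Y_carrier] Y_carrier]
    by (intro eq_matI) (auto simp del: index_mult_mat(1))
  finally have "para_conj I * I = para_conj Yo * Yo + para_conj Y * Y" .
  then have "sq_norm (ev z I *\<^sub>v u) = sq_norm (ev z Yo *\<^sub>v u) + sq_norm (ev z Y *\<^sub>v u)"
    by (rule gram_sum_sq_norm[OF Ic YoC Y_carrier eI(1) regm_Yo[OF z] regm_Y[OF z] z u])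
  moreover have "ev z I *\<^sub>v u = of_real \<gamma> \<cdot>\<^sub>v u"
    unfolding eI(2) using u by (intro eq_vecI) (auto simp: row_smult)
  ultimately show ?thesis unfolding nM nE by (simp add: sq_norm_smult)
qed

text \<open>As \<open>Uo\<close> and \<open>Yo\<close> are units,
  \<open>Uo * D * minv Yo = F2 - S\<close> matches stable \<open>D\<close> with stable
  \<open>S\<close>. Strict inequality at each point would not suffice: the gap must be uniform on
  the circle, and norm bounds for \<open>Yo\<close> and its inverse carry it from one side to the
  other.\<close>

lemma nehari_distance:
  assumes V: "V \<in> RH_inf p2 p1" and F: "F \<in> RH_inf p1 p2" and F2: "F2 \<in> RH_inf p2 p1"
    and dec: "zvar ^ N \<cdot>\<^sub>m R - Uo * (zvar ^ N \<cdot>\<^sub>m V) * minv Yo = para_conj F + F2"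
  shows "Hankel_norm F < 1 \<longleftrightarrow> (\<exists>D\<in>RH_inf p2 p1. Linf_norm (model_error V D) < \<gamma>)"
proof
  note Uo' = Uo_units and Yo' = Yo_units
  have Mc: "model_error V D \<in> carrier_mat q p1" if "D \<in> RH_inf p2 p1" for D
    using that Ui_car RH_inf_carrier[OF that] unfolding T2 by auto
  have F': "para_conj F \<in> carrier_mat p2 p1" by (rule para_conj_carrier[OF RH_inf_carrier[OF F]])
  {
    assume "Hankel_norm F < 1"
    then obtain S \<rho> where S: "S \<in> RH_inf p2 p1" and \<rho>: "\<rho> \<ge> 0" "\<rho> < 1"
      and b: "\<And>z. cmod z = 1 \<Longrightarrow> bdd_form {..<p2} {..<p1} (\<lambda>b a. ev z (para_conj F + S) $$ (b,a)) \<rho>"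
      unfolding nehari[OF F] by blast
    define D where "D = minv Uo * (F2 - S) * Yo"
    have D: "D \<in> RH_inf p2 p1" unfolding D_def
      by (rule RH_inf_mult[OF RH_inf_mult[OF Uo'(2) RH_inf_diff[OF F2 S]] Yo'(1)])
    have FS: "F2 - S \<in> carrier_mat p2 p1" by (rule RH_inf_carrier[OF RH_inf_diff[OF F2 S]])
    have "Uo * D = Uo * (minv Uo * ((F2 - S) * Yo))"
      unfolding D_def using assoc_mult_mat[OF Uo'(6) FS Yo'(5)] by simp
    also have "\<dots> = (F2 - S) * Yo"
      using assoc_mult_mat[OF Uo'(5,6) mult_carrier_mat[OF FS Yo'(5)]] Uo'(3)
        left_mult_one_mat[OF mult_carrier_mat[OF FS Yo'(5)]] by simp
    finally have "Uo * D * minv Yo = F2 - S"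
      using assoc_mult_mat[OF FS Yo'(5,6)] Yo'(3) right_mult_one_mat[OF FS] by simp
    then have E: "reduced_error V D = para_conj F + S"
      unfolding dec using F' RH_inf_carrier[OF S] RH_inf_carrier[OF F2] by (intro eq_matI) auto
    obtain B0 where B0: "B0 \<ge> 0" "\<And>z. cmod z = 1 \<Longrightarrow> bdd_form {..<p1} {..<p1} (\<lambda>a b. ev z (minv Yo) $$ (a,b)) B0"
      using ev_bounded[OF Yo'(6) regm_minv_Yo] by blast
    define B where "B = B0 + 1"
    have B: "B > 0" using B0 by (simp add: B_def)
    \<comment> \<open>The identity for the model error loses at least \<open>(1 - \<rho>^2)\<close>
      times the squared length of \<open>w\<close>, and that length is bounded below through the
      bound \<open>B\<close> on the inverse of \<open>Yo\<close>. The maximum with 0 keeps the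
      radicand nonnegative.\<close>
    define \<kappa> where "\<kappa> = sqrt (max 0 (\<gamma>\<^sup>2 - (1 - \<rho>\<^sup>2) / B\<^sup>2))"
    have \<rho>2: "\<rho>\<^sup>2 < 1" using \<rho> by (simp add: power_less_one_iff)
    have \<kappa>: "\<kappa> \<ge> 0" "\<kappa>\<^sup>2 \<ge> \<gamma>\<^sup>2 - (1 - \<rho>\<^sup>2) / B\<^sup>2" by (simp_all add: \<kappa>_def)
    have "\<kappa> < \<gamma>"
    proof -
      have "(1 - \<rho>\<^sup>2) / B\<^sup>2 > 0" using \<rho>2 B by simp
      then have "max 0 (\<gamma>\<^sup>2 - (1 - \<rho>\<^sup>2) / B\<^sup>2) < \<gamma>\<^sup>2" using \<gamma>_pos by simp
      then show ?thesis unfolding \<kappa>_def using \<gamma>_pos by (intro real_less_lsqrt) auto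
    qed
    moreover have "Linf_norm (model_error V D) \<le> \<kappa>"
    proof (rule Linf_norm_le[OF Mc[OF D] p1 \<kappa>(1)])
      fix z :: complex and u :: "complex vec" assume z: "cmod z = 1" and u: "u \<in> carrier_vec p1"
      define w where "w = ev z Yo *\<^sub>v u"
      have w: "w \<in> carrier_vec p1" unfolding w_def by (rule mult_mat_vec_carrier[OF ev_carrier[OF Yo'(5)] u])
      have "ev z (minv Yo) *\<^sub>v w = ev z (minv Yo * Yo) *\<^sub>v u"
        using ev_mult(2)[OF regm_minv_Yo[OF z] regm_Yo[OF z]] carrier_matD[OF Yo'(5)] carrier_matD[OF Yo'(6)]
          assoc_mult_mat_vec[OF ev_carrier[OF Yo'(6)] ev_carrier[OF Yo'(5)] u] by (simp add: w_def)
      then have uw: "ev z (minv Yo) *\<^sub>v w = u" unfolding Yo'(4) using u by (simp add: ev_one)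
      have "sq_norm u \<le> B0\<^sup>2 * sq_norm w"
        using B0(2)[OF z] w uw unfolding sq_norm_mult_iff_bdd_form[OF ev_carrier[OF Yo'(6)] B0(1), symmetric] by metis
      also have "\<dots> \<le> B\<^sup>2 * sq_norm w" unfolding B_def
        using B0 by (intro mult_right_mono power_mono sq_norm_nonneg) auto
      finally have 1: "sq_norm u / B\<^sup>2 \<le> sq_norm w" using B by (simp add: divide_le_eq mult.commute)
      have c: "ev z (para_conj F + S) \<in> carrier_mat p2 p1"
        using F' RH_inf_carrier[OF S] by (intro ev_carrier) simp
      have 2: "sq_norm (ev z (reduced_error V D) *\<^sub>v w) \<le> \<rho>\<^sup>2 * sq_norm w"
        using b[OF z] w unfolding E sq_norm_mult_iff_bdd_form[OF c \<rho>(1), symmetric] by blast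
      have "(1 - \<rho>\<^sup>2) * (sq_norm u / B\<^sup>2) \<le> (1 - \<rho>\<^sup>2) * sq_norm w"
        using 1 \<rho>2 by (intro mult_left_mono) auto
      then have "sq_norm (ev z (model_error V D) *\<^sub>v u) \<le> (\<gamma>\<^sup>2 - (1 - \<rho>\<^sup>2) / B\<^sup>2) * sq_norm u"
        using model_error_sq_norm[OF V D z u] 2 unfolding w_def[symmetric] by (simp add: algebra_simps)
      also have "\<dots> \<le> \<kappa>\<^sup>2 * sq_norm u" using \<kappa> by (intro mult_right_mono sq_norm_nonneg)
      finally show "sq_norm (ev z (model_error V D) *\<^sub>v u) \<le> \<kappa>\<^sup>2 * sq_norm u" .
    qed
    ultimately show "\<exists>D\<in>RH_inf p2 p1. Linf_norm (model_error V D) < \<gamma>" using D by force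
  next
    assume "\<exists>D\<in>RH_inf p2 p1. Linf_norm (model_error V D) < \<gamma>"
    then obtain D where D: "D \<in> RH_inf p2 p1" and lt: "Linf_norm (model_error V D) < \<gamma>" by blast
    define \<kappa> where "\<kappa> = Linf_norm (model_error V D)"
    have rM: "regm z (model_error V D)" if z: "cmod z = 1" for z
    proof -
      have T2c: "T2 \<in> RH_inf q p2" unfolding T2 by (rule RH_inf_mult[OF Ui(1) Uo'(1)])
      have "inverse zvar ^ N \<cdot>\<^sub>m (T2 * D) \<in> RH_inf q p1"
        by (rule RH_inf_inverse_zvar_smult[OF RH_inf_mult[OF T2c D]])
      then have "regm z (inverse zvar ^ N \<cdot>\<^sub>m (T2 * D))" "regm z (T2 * V)"
        using RH_inf_regm RH_inf_mult[OF T2c V] z by auto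
      then show ?thesis using T1(2)[OF z] T1(1) RH_inf_carrier[OF T2c] RH_inf_carrier[OF V] RH_inf_carrier[OF D]
        by (intro ev_diff(1)) auto
    qed
    have \<kappa>: "\<kappa> \<ge> 0" "\<kappa> < \<gamma>" unfolding \<kappa>_def using Linf_norm_ge(1)[OF Mc[OF D] p1 rM] lt by auto
    have \<kappa>2: "\<kappa>\<^sup>2 < \<gamma>\<^sup>2" using \<kappa> by (intro power_strict_mono) auto
    obtain B0 where B0: "B0 \<ge> 0" "\<And>z. cmod z = 1 \<Longrightarrow> bdd_form {..<p1} {..<p1} (\<lambda>a b. ev z Yo $$ (a,b)) B0"
      using ev_bounded[OF Yo'(5) regm_Yo] by blast
    define B where "B = B0 + 1"
    have B: "B > 0" using B0 by (simp add: B_def)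
    \<comment> \<open>The same computation in reverse: the gap between \<kappa> and \<gamma> is
      measured in \<open>u\<close>, and \<open>B\<close>, now a bound on \<open>Yo\<close>,
      transfers it to \<open>w\<close>.\<close>
    define \<rho> where "\<rho> = sqrt (max 0 (1 - (\<gamma>\<^sup>2 - \<kappa>\<^sup>2) / B\<^sup>2))"
    have \<rho>: "\<rho> \<ge> 0" "\<rho>\<^sup>2 \<ge> 1 - (\<gamma>\<^sup>2 - \<kappa>\<^sup>2) / B\<^sup>2" by (simp_all add: \<rho>_def)
    have "(\<gamma>\<^sup>2 - \<kappa>\<^sup>2) / B\<^sup>2 > 0" using \<kappa>2 B by simp
    then have \<rho>1: "\<rho> < 1" unfolding \<rho>_def by simp
    define S where "S = F2 - Uo * D * minv Yo"
    have UD: "Uo * D * minv Yo \<in> RH_inf p2 p1" by (rule RH_inf_mult[OF RH_inf_mult[OF Uo'(1) D] Yo'(2)])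
    have S: "S \<in> RH_inf p2 p1" unfolding S_def by (rule RH_inf_diff[OF F2 UD])
    have E: "reduced_error V D = para_conj F + S"
      unfolding dec S_def by (rule mat_add_diff_assoc[OF F' RH_inf_carrier[OF F2] RH_inf_carrier[OF UD]])
    have "bdd_form {..<p2} {..<p1} (\<lambda>b a. ev z (para_conj F + S) $$ (b,a)) \<rho>" if z: "cmod z = 1" for z
    proof -
      have c: "ev z (para_conj F + S) \<in> carrier_mat p2 p1"
        using F' RH_inf_carrier[OF S] by (intro ev_carrier) simp
      show ?thesis unfolding sq_norm_mult_iff_bdd_form[OF c \<rho>(1), symmetric]
      proof
        fix w :: "complex vec" assume w: "w \<in> carrier_vec p1"
        define u where "u = ev z (minv Yo) *\<^sub>v w"
        have u: "u \<in> carrier_vec p1" unfolding u_def by (rule mult_mat_vec_carrier[OF ev_carrier[OF Yo'(6)] w])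
        have "ev z Yo *\<^sub>v u = ev z (Yo * minv Yo) *\<^sub>v w"
          using ev_mult(2)[OF regm_Yo[OF z] regm_minv_Yo[OF z]] carrier_matD[OF Yo'(5)] carrier_matD[OF Yo'(6)]
            assoc_mult_mat_vec[OF ev_carrier[OF Yo'(5)] ev_carrier[OF Yo'(6)] w] by (simp add: u_def)
        then have uw: "ev z Yo *\<^sub>v u = w" unfolding Yo'(3) using w by (simp add: ev_one)
        have "sq_norm w \<le> B0\<^sup>2 * sq_norm u"
          using B0(2)[OF z] u uw unfolding sq_norm_mult_iff_bdd_form[OF ev_carrier[OF Yo'(5)] B0(1), symmetric] by metis
        also have "\<dots> \<le> B\<^sup>2 * sq_norm u" unfolding B_def
          using B0 by (intro mult_right_mono power_mono sq_norm_nonneg) auto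
        finally have 1: "sq_norm w / B\<^sup>2 \<le> sq_norm u" using B by (simp add: divide_le_eq mult.commute)
        have 2: "sq_norm (ev z (model_error V D) *\<^sub>v u) \<le> \<kappa>\<^sup>2 * sq_norm u"
          unfolding \<kappa>_def by (rule Linf_norm_ge(2)[OF Mc[OF D] p1 rM z u])
        have "(\<gamma>\<^sup>2 - \<kappa>\<^sup>2) * (sq_norm w / B\<^sup>2) \<le> (\<gamma>\<^sup>2 - \<kappa>\<^sup>2) * sq_norm u"
          using 1 \<kappa>2 by (intro mult_left_mono) auto
        then have "sq_norm (ev z (para_conj F + S) *\<^sub>v w) \<le> (1 - (\<gamma>\<^sup>2 - \<kappa>\<^sup>2) / B\<^sup>2) * sq_norm w"
          using model_error_sq_norm[OF V D z u] 2 unfolding uw E by (simp add: algebra_simps diff_divide_distrib)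
        also have "\<dots> \<le> \<rho>\<^sup>2 * sq_norm w" using \<rho> by (intro mult_right_mono sq_norm_nonneg)
        finally show "sq_norm (ev z (para_conj F + S) *\<^sub>v w) \<le> \<rho>\<^sup>2 * sq_norm w" .
      qed
    qed
    then show "Hankel_norm F < 1" unfolding nehari[OF F] using S \<rho>(1) \<rho>1 by blast
  }
qed

end

section \<open>The Hankel norm in terms of the augmented realization\<close>

text \<open>Both sides have been reduced to uniform contractivity of finite sections, which depend
  on the Markov parameters alone. Those of \<open>F1\<close> and of the augmented triple agree at
  every positive index.\<close>

lemma Hankel_norm_iff_LMI:
  assumes p: "R1 \<in> RH_inf p1 p2" "R2 \<in> RH_inf p2 p1" "F1 \<in> RH_inf p1 p2" "F2 \<in> RH_inf p2 p1" "G \<in> RH_inf p2 p1"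
    and eq: "para_conj F1 + F2 = para_conj R1 + R2 - zvar ^ N \<cdot>\<^sub>m G"
    and real: "realization r Ar Br Cr R1" "stable Ar"
  shows "Hankel_norm F1 < 1 \<longleftrightarrow>
    (\<exists>P Q lam. LMI (four_block_mat Ar (0\<^sub>m r (N * p2)) (0\<^sub>m (N * p2) r) (Aq N p2)) (Br @\<^sub>r Bq N p2) (Cr @\<^sub>c - Cq N G) P Q lam)"
    (is "_ \<longleftrightarrow> (\<exists>P Q lam. LMI ?A ?B ?C P Q lam)")
proof -
  note c = p[THEN RH_inf_carrier]
  have Ar: "Ar \<in> carrier_mat r r" and Br: "Br \<in> carrier_mat r p2" and Cr: "Cr \<in> carrier_mat p1 r"
    using real(1) c(1) by (auto simp: realization_def)
  have CqG: "Cq N G \<in> carrier_mat p1 (N * p2)" using c(5) by (simp add: Cq_def)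
  have Cc: "- Cq N G \<in> carrier_mat p1 (N * p2)" using CqG by simp
  have m: "markov_seq F1 (int k + 1) a b = markov ?A ?B ?C (int k + 1) a b" if ab: "a < p1" "b < p2" for k a b
  proof -
    have ba: "(para_conj F1 + F2) $$ (b,a) = (para_conj R1 + R2 - zvar ^ N \<cdot>\<^sub>m G) $$ (b,a)" unfolding eq ..
    have "rsub (F1 $$ (a,b)) + F2 $$ (b,a) = rsub (R1 $$ (a,b)) + R2 $$ (b,a) - zvar ^ N * G $$ (b,a)"
      using ba ab c by (simp add: para_conj_carrier)
    then have "impulse (F1 $$ (a,b)) (Suc k)
        = impulse (R1 $$ (a,b)) (Suc k) - (if k < N then impulse (G $$ (b,a)) (N - 1 - k) else 0)"
      by (intro antistable_part_shift) (use p ab in \<open>auto simp: RH_inf_iff\<close>)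
    also have "impulse (R1 $$ (a,b)) (Suc k) = (Cr * Ar ^\<^sub>m k * Br) $$ (a,b)"
      by (rule impulse_realization[OF real(1) p(1) real(2) ab])
    also have "(if k < N then impulse (G $$ (b,a)) (N - 1 - k) else 0) = (Cq N G * (Aq N p2 ^\<^sub>m k * Bq N p2)) $$ (a,b)"
      by (rule Cq_markov[OF c(5) ab, symmetric])
    also have "\<dots> = - ((- Cq N G * (Aq N p2 ^\<^sub>m k * Bq N p2)) $$ (a,b))"
    proof -
      have X: "Aq N p2 ^\<^sub>m k * Bq N p2 \<in> carrier_mat (N * p2) p2"
        by (rule mult_carrier_mat[OF pow_carrier_mat[OF Aq_carrier] Bq_carrier])
      have "- Cq N G * (Aq N p2 ^\<^sub>m k * Bq N p2) = - (Cq N G * (Aq N p2 ^\<^sub>m k * Bq N p2))"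
        using carrier_matD[OF X] carrier_matD[OF CqG] by (intro uminus_mult_left_mat) simp
      then show ?thesis
        using carrier_matD[OF mult_carrier_mat[OF CqG X]] ab by (simp only: index_uminus_mat minus_minus)
    qed
    finally show ?thesis
      using augmented_markov[OF Ar Br Cr Cc ab, of k] by (simp add: markov_seq_def markov_def nat_add_distrib)
  qed
  have "hankel_section p1 p2 (markov_seq F1) 1 \<rho> K \<longleftrightarrow> hankel_section p1 p2 (markov ?A ?B ?C) 1 \<rho> K" for \<rho> K
    unfolding hankel_section_def
  proof (rule bdd_form_cong)
    fix i j :: "nat \<times> nat" assume "i \<in> {..<K} \<times> {..<p1}" "j \<in> {..<K} \<times> {..<p2}"
    then show "markov_seq F1 (int (fst i) + int (fst j) + 1) (snd i) (snd j)
      = markov ?A ?B ?C (int (fst i) + int (fst j) + 1) (snd i) (snd j)"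
      using m[of "snd i" "snd j" "fst i + fst j"] by auto
  qed
  then have "hankel_section p1 p2 (markov_seq F1) 1 = hankel_section p1 p2 (markov ?A ?B ?C) 1" by (intro ext)
  then show ?thesis
    unfolding Hankel_norm_less_one_iff[OF p(3)]
      LMI_feasible_iff[OF augmented_carrier[OF Ar Br Cr Cc] augmented_exp_decay[OF Ar Br Cr Cc stable_exp_decay[OF Ar real(2)]]]
    by simp
qed

lemma Cq_affine:
  assumes "G \<in> RH_inf m p" "H \<in> RH_inf m p"
  shows "Cq N (const (1 - t) \<cdot>\<^sub>m G + const t \<cdot>\<^sub>m H) = (1 - t) \<cdot>\<^sub>m Cq N G + t \<cdot>\<^sub>m Cq N H"
proof -
  note c = RH_inf_carrier[OF assms(1)] RH_inf_carrier[OF assms(2)]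
  have i: "impulse (const (1 - t) * G $$ (a,b) + const t * H $$ (a,b)) k
      = (1 - t) * impulse (G $$ (a,b)) k + t * impulse (H $$ (a,b)) k" if "a < m" "b < p" for a b k
  proof -
    have r: "rh (G $$ (a,b))" "rh (H $$ (a,b))" using assms that by (auto simp: RH_inf_iff)
    show ?thesis using r by (simp add: impulse_add impulse_cmult rh_mult rh_const)
  qed
  show ?thesis
  proof (rule eq_matI)
    fix a j assume "a < dim_row ((1 - t) \<cdot>\<^sub>m Cq N G + t \<cdot>\<^sub>m Cq N H)" "j < dim_col ((1 - t) \<cdot>\<^sub>m Cq N G + t \<cdot>\<^sub>m Cq N H)"
    then have aj: "a < p" "j < N * m" using c by (auto simp: Cq_def)
    then have "m > 0" by (cases m) auto
    then have "j mod m < m" by simp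
    then show "Cq N (const (1 - t) \<cdot>\<^sub>m G + const t \<cdot>\<^sub>m H) $$ (a,j) = ((1 - t) \<cdot>\<^sub>m Cq N G + t \<cdot>\<^sub>m Cq N H) $$ (a,j)"
      using aj c i[of "j mod m" a] by (simp add: Cq_def impulse_mat_def)
  qed (use c in \<open>auto simp: Cq_def\<close>)
qed

lemma fir_affine:
  assumes "\<And>i. i < N \<Longrightarrow> V i \<in> carrier_mat m p" "\<And>i. i < N \<Longrightarrow> W i \<in> carrier_mat m p"
  shows "fir m p N (\<lambda>i. (1 - t) \<cdot>\<^sub>m V i + t \<cdot>\<^sub>m W i) = const (1 - t) \<cdot>\<^sub>m fir m p N V + const t \<cdot>\<^sub>m fir m p N W"
proof (rule eq_matI)
  fix a b assume "a < dim_row (const (1 - t) \<cdot>\<^sub>m fir m p N V + const t \<cdot>\<^sub>m fir m p N W)"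
    "b < dim_col (const (1 - t) \<cdot>\<^sub>m fir m p N V + const t \<cdot>\<^sub>m fir m p N W)"
  then have ab: "a < m" "b < p" by (auto simp: fir_def)
  have "(\<Sum>i<N. inverse zvar ^ i * const (((1 - t) \<cdot>\<^sub>m V i + t \<cdot>\<^sub>m W i) $$ (a,b)))
      = (\<Sum>i<N. const (1 - t) * (inverse zvar ^ i * const (V i $$ (a,b))) + const t * (inverse zvar ^ i * const (W i $$ (a,b))))"
  proof (rule sum.cong[OF refl])
    fix i assume "i \<in> {..<N}"
    then have "V i \<in> carrier_mat m p" "W i \<in> carrier_mat m p" using assms by auto
    then have "((1 - t) \<cdot>\<^sub>m V i + t \<cdot>\<^sub>m W i) $$ (a,b) = (1 - t) * V i $$ (a,b) + t * W i $$ (a,b)" using ab by simp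
    then show "inverse zvar ^ i * const (((1 - t) \<cdot>\<^sub>m V i + t \<cdot>\<^sub>m W i) $$ (a,b))
      = const (1 - t) * (inverse zvar ^ i * const (V i $$ (a,b))) + const t * (inverse zvar ^ i * const (W i $$ (a,b)))"
      by (simp only: const_simps(3,4)) (simp add: algebra_simps)
  qed
  then show "fir m p N (\<lambda>i. (1 - t) \<cdot>\<^sub>m V i + t \<cdot>\<^sub>m W i) $$ (a,b)
    = (const (1 - t) \<cdot>\<^sub>m fir m p N V + const t \<cdot>\<^sub>m fir m p N W) $$ (a,b)"
    using ab by (simp add: fir_def sum.distrib sum_distrib_left)
qed (auto simp: fir_def)

lemma append_columns_affine:
  fixes A B B' :: "real mat"
  assumes A: "A \<in> carrier_mat l n" and B: "B \<in> carrier_mat l m" and B': "B' \<in> carrier_mat l m"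
  shows "A @\<^sub>c - ((1 - t) \<cdot>\<^sub>m B + t \<cdot>\<^sub>m B') = (1 - t) \<cdot>\<^sub>m (A @\<^sub>c - B) + t \<cdot>\<^sub>m (A @\<^sub>c - B')"
  using assms by (intro eq_matI) (auto simp: append_columns_def algebra_simps)

lemma smult_mult_affine:
  fixes U V W Z :: "'a :: field mat"
  assumes U: "U \<in> carrier_mat m n" and V: "V \<in> carrier_mat n p" "W \<in> carrier_mat n p" and Z: "Z \<in> carrier_mat p k"
  shows "U * (c \<cdot>\<^sub>m V + d \<cdot>\<^sub>m W) * Z = c \<cdot>\<^sub>m (U * V * Z) + d \<cdot>\<^sub>m (U * W * Z)"
proof -
  have s: "c \<cdot>\<^sub>m V \<in> carrier_mat n p" "d \<cdot>\<^sub>m W \<in> carrier_mat n p" using V by auto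
  have t: "U * V \<in> carrier_mat m p" "U * W \<in> carrier_mat m p" using U V by auto
  then have t': "c \<cdot>\<^sub>m (U * V) \<in> carrier_mat m p" "d \<cdot>\<^sub>m (U * W) \<in> carrier_mat m p" by auto
  show ?thesis
    unfolding mult_add_distrib_mat[OF U s] mult_smult_distrib[OF U V(1)] mult_smult_distrib[OF U V(2)]
      add_mult_distrib_mat[OF t' Z] mult_smult_assoc_mat[OF t(1) Z] mult_smult_assoc_mat[OF t(2) Z] ..
qed

theorem mainTheorem3:
  fixes N n q p1 p2 r :: nat
    and A B1 B2 C1 D12 Ar Br Cr AR BR :: "real mat"
    and T1 T2 Ui Uo Y Yo R R1 R2 :: tf
    and Ys :: "nat \<Rightarrow> real mat set"
    and YY :: "tf set"
    and Rhat Rhat1 Rhat2 G :: "tf \<Rightarrow> tf"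
    and CR :: "tf \<Rightarrow> real mat"
    and \<gamma> \<alpha> :: real
  assumes sizes: "N \<ge> 1" "p1 \<ge> 1" "p2 \<ge> 1"
    and A: "A \<in> carrier_mat n n" "stable A"
    and B1: "B1 \<in> carrier_mat n p1" and B2: "B2 \<in> carrier_mat n p2"
    and C1: "C1 \<in> carrier_mat q n"
    and D12: "D12 \<in> carrier_mat q p2" "pos_def (transpose_mat D12 * D12)"
      "transpose_mat C1 * D12 = 0\<^sub>m n p2"
    and T1: "T1 = state_space A B1 C1 (0\<^sub>m q p1)"
    and T2: "T2 = state_space A B2 C1 D12"
    and T2_factor: "T2 = Ui * Uo"
    and Ui: "Ui \<in> RH_inf q p2" "para_conj Ui * Ui = 1\<^sub>m p2"
    and Uo: "Uo \<in> RH_inf_units p2"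
    and Y: "Y = (1\<^sub>m q - Ui * para_conj Ui) * T1"
    and \<gamma>: "\<gamma> > Linf_norm Y"
    and Yo: "Yo \<in> RH_inf_units p1"
      "para_conj Yo * Yo = const (\<gamma>\<^sup>2) \<cdot>\<^sub>m 1\<^sub>m p1 - para_conj Y * Y"
    and R: "R = para_conj Ui * T1 * minv Yo"
    and Ys: "\<forall>i<N. mat_subspace p2 p1 (Ys i)"
    and YY: "YY = fir_set p2 p1 N Ys"
    and Rhat: "\<forall>V. Rhat V = zvar ^ N \<cdot>\<^sub>m R - Uo * (zvar ^ N \<cdot>\<^sub>m V) * minv Yo"
    and R1: "antistable_stable_decomp p2 p1 (zvar ^ N \<cdot>\<^sub>m R) R1 R2"
    and Rhat1: "\<forall>V\<in>YY. antistable_stable_decomp p2 p1 (Rhat V) (Rhat1 V) (Rhat2 V)"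
    and G: "\<forall>V. G V = Uo * V * minv Yo"
    and Ar: "minimal_realization r Ar Br Cr R1" "stable Ar"
    and AR: "AR = four_block_mat Ar (0\<^sub>m r (N * p2)) (0\<^sub>m (N * p2) r) (Aq N p2)"
    and BR: "BR = Br @\<^sub>r Bq N p2"
    and CR: "\<forall>V. CR V = Cr @\<^sub>c - Cq N (G V)"
    and \<alpha>: "\<alpha> = Inf {Linf_norm (T1 - T2 * V - inverse zvar ^ N \<cdot>\<^sub>m (T2 * D)) | D V.
      D \<in> RH_inf p2 p1 \<and> V \<in> YY}"
  shows "affine_in_coeffs p2 p1 N (\<lambda>V. CR (fir p2 p1 N V)) \<and>
    ((\<exists>V\<in>YY. \<exists>P Q lam. LMI AR BR (CR V) P Q lam) \<longleftrightarrow> (\<exists>V\<in>YY. Hankel_norm (Rhat1 V) < 1)) \<and>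
    ((\<exists>V\<in>YY. Hankel_norm (Rhat1 V) < 1) \<longleftrightarrow> \<alpha> < \<gamma>) \<and>
    (\<forall>V\<in>YY. \<forall>P Q lam. LMI AR BR (CR V) P Q lam \<longrightarrow> Hankel_norm (Rhat1 V) < 1)"
proof -
  note Uo' = RH_inf_units[OF Uo] and Yo' = RH_inf_units[OF Yo(1)]
  note Uic = RH_inf_carrier[OF Ui(1)]
  have R1c: "R1 \<in> RH_inf p1 p2" "R2 \<in> RH_inf p2 p1" and R12: "zvar ^ N \<cdot>\<^sub>m R = para_conj R1 + R2"
    using R1 by (auto simp: antistable_stable_decomp_def)
  have Rhat12: "Rhat1 V \<in> RH_inf p1 p2" "Rhat2 V \<in> RH_inf p2 p1" "Rhat V = para_conj (Rhat1 V) + Rhat2 V" if "V \<in> YY" for V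
    using Rhat1 that by (auto simp: antistable_stable_decomp_def)
  have YYc: "V \<in> RH_inf p2 p1" if "V \<in> YY" for V
    using that unfolding YY fir_set_def by (auto intro: RH_inf_fir)
  have GRH: "G V \<in> RH_inf p2 p1" if "V \<in> RH_inf p2 p1" for V
    using G RH_inf_mult[OF RH_inf_mult[OF Uo'(1) that] Yo'(2)] by simp
  have real: "realization r Ar Br Cr R1" using Ar(1) by (simp add: minimal_realization_def)
  have Crc: "Cr \<in> carrier_mat p1 r" using real RH_inf_carrier[OF R1c(1)] by (auto simp: realization_def)
  \<comment> \<open>The equivalence is proved for each \<open>V\<close> separately, which also
    yields the last claim, about every \<open>V\<close> in a solution.\<close>
  have LMI_iff: "Hankel_norm (Rhat1 V) < 1 \<longleftrightarrow> (\<exists>P Q lam. LMI AR BR (CR V) P Q lam)" if V: "V \<in> YY" for V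
  proof -
    have "Uo * (zvar ^ N \<cdot>\<^sub>m V) * minv Yo = zvar ^ N \<cdot>\<^sub>m G V"
      using G mult_smult_distrib[OF Uo'(5) RH_inf_carrier[OF YYc[OF V]]]
        mult_smult_assoc_mat[OF mult_carrier_mat[OF Uo'(5) RH_inf_carrier[OF YYc[OF V]]] Yo'(6)] by simp
    then have "para_conj (Rhat1 V) + Rhat2 V = para_conj R1 + R2 - zvar ^ N \<cdot>\<^sub>m G V"
      using Rhat12(3)[OF V] Rhat R12 by simp
    from Hankel_norm_iff_LMI[OF R1c Rhat12(1,2)[OF V] GRH[OF YYc[OF V]] this real Ar(2)]
    show ?thesis unfolding AR BR using CR by simp
  qed
  have T1c: "T1 \<in> carrier_mat q p1" "\<And>z. cmod z = 1 \<Longrightarrow> regm z T1"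
    using state_space_regm[OF A B1 C1 zero_carrier_mat, of 1] state_space_regm[OF A B1 C1 zero_carrier_mat]
    unfolding T1 by auto
  have nehari_iff: "Hankel_norm (Rhat1 V) < 1 \<longleftrightarrow>
      (\<exists>D\<in>RH_inf p2 p1. Linf_norm (T1 - T2 * V - inverse zvar ^ N \<cdot>\<^sub>m (T2 * D)) < \<gamma>)" if V: "V \<in> YY" for V
    using nehari_distance[OF sizes(2) T1c T2_factor Ui Uo Y \<gamma> Yo R YYc[OF V] Rhat12(1,2)[OF V]]
      Rhat12(3)[OF V] Rhat by simp
  let ?S = "{Linf_norm (T1 - T2 * V - inverse zvar ^ N \<cdot>\<^sub>m (T2 * D)) | D V. D \<in> RH_inf p2 p1 \<and> V \<in> YY}"
  have T2RH: "T2 \<in> RH_inf q p2" unfolding T2_factor by (rule RH_inf_mult[OF Ui(1) Uo'(1)])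
  \<comment> \<open>A real infimum is meaningful only for a nonempty set that is bounded below. Then
    \<open>\<alpha> < \<gamma>\<close> says that some error norm lies below \<gamma>, whether or not
    the infimum is attained.\<close>
  have "bdd_below ?S"
  proof (rule bdd_belowI)
    fix x assume "x \<in> ?S"
    then obtain D V where D: "D \<in> RH_inf p2 p1" and V: "V \<in> RH_inf p2 p1"
      and x: "x = Linf_norm (T1 - T2 * V - inverse zvar ^ N \<cdot>\<^sub>m (T2 * D))" using YYc by auto
    have TV: "T2 * V \<in> RH_inf q p1" "inverse zvar ^ N \<cdot>\<^sub>m (T2 * D) \<in> RH_inf q p1"
      using RH_inf_mult[OF T2RH V] RH_inf_inverse_zvar_smult[OF RH_inf_mult[OF T2RH D]] by auto
    note TVc = TV[THEN RH_inf_carrier]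
    have M: "T1 - T2 * V - inverse zvar ^ N \<cdot>\<^sub>m (T2 * D) \<in> carrier_mat q p1" by (rule minus_carrier_mat[OF TVc(2)])
    have "regm z (T1 - T2 * V - inverse zvar ^ N \<cdot>\<^sub>m (T2 * D))" if z: "cmod z = 1" for z
      using T1c TVc TV[THEN RH_inf_regm, of z] z RH_inf_carrier[OF T2RH] by (intro ev_diff(1)) (auto dest!: carrier_matD)
    then show "0 \<le> x" unfolding x by (rule Linf_norm_ge(1)[OF M sizes(2)])
  qed
  moreover have "?S \<noteq> {}"
  proof -
    have "fir p2 p1 N (\<lambda>i. 0\<^sub>m p2 p1) \<in> YY" using Ys unfolding YY fir_set_def by (auto simp: mat_subspace_def)
    then show ?thesis using RH_inf_fir[of p2 p1 N "\<lambda>i. 0\<^sub>m p2 p1"] by blast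
  qed
  ultimately have "\<alpha> < \<gamma> \<longleftrightarrow> (\<exists>x\<in>?S. x < \<gamma>)" unfolding \<alpha> by (intro cInf_less_iff)
  then have \<alpha>_iff: "\<alpha> < \<gamma> \<longleftrightarrow> (\<exists>V\<in>YY. Hankel_norm (Rhat1 V) < 1)" using nehari_iff by auto
  \<comment> \<open>The block \<open>Cr\<close> is the same for every \<open>V\<close>, which makes
    \<open>CR\<close> affine and not linear; it is reproduced because the weights
    \<open>1 - t\<close> and \<open>t\<close> add up to 1.\<close>
  have "affine_in_coeffs p2 p1 N (\<lambda>V. CR (fir p2 p1 N V))"
    unfolding affine_in_coeffs_def
  proof (intro allI impI)
    fix V W :: "nat \<Rightarrow> real mat" and t :: real
    assume VW: "\<forall>i<N. V i \<in> carrier_mat p2 p1 \<and> W i \<in> carrier_mat p2 p1"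
    let ?V = "fir p2 p1 N V" and ?W = "fir p2 p1 N W"
    have "fir p2 p1 N (\<lambda>i. (1 - t) \<cdot>\<^sub>m V i + t \<cdot>\<^sub>m W i) = const (1 - t) \<cdot>\<^sub>m ?V + const t \<cdot>\<^sub>m ?W"
      using VW by (intro fir_affine) auto
    then have "G (fir p2 p1 N (\<lambda>i. (1 - t) \<cdot>\<^sub>m V i + t \<cdot>\<^sub>m W i)) = const (1 - t) \<cdot>\<^sub>m G ?V + const t \<cdot>\<^sub>m G ?W"
      using G smult_mult_affine[OF Uo'(5) RH_inf_carrier[OF RH_inf_fir] RH_inf_carrier[OF RH_inf_fir] Yo'(6)] by simp
    then have "Cq N (G (fir p2 p1 N (\<lambda>i. (1 - t) \<cdot>\<^sub>m V i + t \<cdot>\<^sub>m W i))) = (1 - t) \<cdot>\<^sub>m Cq N (G ?V) + t \<cdot>\<^sub>m Cq N (G ?W)"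
      using Cq_affine[OF GRH[OF RH_inf_fir] GRH[OF RH_inf_fir]] by simp
    moreover have "Cq N (G ?V) \<in> carrier_mat p1 (N * p2)" "Cq N (G ?W) \<in> carrier_mat p1 (N * p2)"
      using carrier_matD[OF RH_inf_carrier[OF GRH[OF RH_inf_fir]]] by (simp_all add: Cq_def)
    ultimately show "CR (fir p2 p1 N (\<lambda>i. (1 - t) \<cdot>\<^sub>m V i + t \<cdot>\<^sub>m W i)) = (1 - t) \<cdot>\<^sub>m CR ?V + t \<cdot>\<^sub>m CR ?W"
      using append_columns_affine[OF Crc] CR by simp
  qed
  then show ?thesis using LMI_iff \<alpha>_iff by blast
qed

end
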